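(* Let $\mathcal{H}$ be an admissible affine hyperplane arrangement in $E$, let $K$ be an admissible group and let $L$ be a flat. The stratum $X=X(\mathcal{H},K,L)$ is normal in codimension $1$ if and only if the following two conditions hold: (i) $X$ is unibranch in codimension $1$; (ii) $\mathcal{W}_{\mathcal{H}^L}\leq\iota_L(\Gamma_{\mathcal{H},K,L})$.
   Context: $E$ is a finite-dimensional Euclidean affine space with direction vector space $V$, and $E_{\mathbb{C}}=E+iV$ is its complexification. $\mathcal{H}$ is a (possibly infinite) set of affine hyperplanes of $E$, and $\mathcal{W}_{\mathcal{H}}$ is the group generated by the orthogonal reflections in the elements of $\mathcal{H}$. $\mathcal{H}$ is admissible if $\mathcal{W}_{\mathcal{H}}$, with the discrete topology, acts properly on $E$ and preserves $\mathcal{H}$. The closure $\overline{\mathcal{A}}$ of a fixed connected component $\mathcal{A}$ of $E\setminus\bigcup_{H\in\mathcal{H}}H$ is a fundamental domain for $\mathcal{W}_{\mathcal{H}}$. For an affine subspace $A$, $V(A)$ is its direction, and $V_{\mathcal{H}}=\bigcap_{H\in\mathcal{H}}V(H)$. $K$ is a subgroup of the group of isometries of $E$ stabilising $\mathcal{A}$; it is admissible if its action is pulled back from $E/V_{\mathcal{H}}$, i.e. for some $p\in E$ every $k\in K$ preserves $E^{ess}=p+V_{\mathcal{H}}^{\perp}$ and satisfies $k(x+v)=kx+v$ for all $x\in E$, $v\in V_{\mathcal{H}}$ (so $K$ is finite). Put $\mathcal{W}_{\mathcal{H},K}=K\ltimes\mathcal{W}_{\mathcal{H}}$; it acts on $E_{\mathbb{C}}$.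 A flat is a nonempty intersection of elements of $\mathcal{H}$ ($E$ included); $L_{\mathbb{C}}=L+iV(L)$. The stratum $X(\mathcal{H},K,L):=\mathcal{W}_{\mathcal{H},K}L_{\mathbb{C}}/\mathcal{W}_{\mathcal{H},K}$ is a closed (reduced) analytic subvariety of $E_{\mathbb{C}}/\mathcal{W}_{\mathcal{H},K}$, whose functions are the $\mathcal{W}_{\mathcal{H},K}$-invariant analytic functions on $\mathcal{W}_{\mathcal{H},K}L_{\mathbb{C}}$ (it carries a structure of affine algebraic variety). A variety is normal (resp. unibranch) in codimension $1$ if its non-normality (resp. non-unibranchedness) locus has codimension greater than $1$. $\mathcal{H}^L=\{H\cap L: H\in\mathcal{H},\ \emptyset\neq H\cap L\neq L\}$ is the induced arrangement on $L$, and $\mathcal{W}_{\mathcal{H}^L}$ is the group of isometries of $L$ generated by the orthogonal reflections of $L$ in the elements of $\mathcal{H}^L$. $\Gamma_{\mathcal{H},K,L}$ is the setwise stabiliser of $L$ in $\mathcal{W}_{\mathcal{H},K}$ and $\iota_L\colon\Gamma_{\mathcal{H},K,L}\to\mathrm{Aut}(L)$ is restriction to $L$. *)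

theory Defs
  imports "HOL-Analysis.Analysis" "HOL-Algebra.Algebra"
begin

section \<open>Affine spaces, reflections and arrangements\<close>

text \<open>
  The Euclidean affine space \<open>E\<close> is a nonempty affine subset of a type of class
  \<^class>\<open>euclidean_space\<close>; this includes the case that \<open>E\<close> is a point.
  Transformations of an affine space \<open>A\<close> are extensional functions on \<open>A\<close>, that is, elements
  of the group \<^term>\<open>BijGroup A\<close>. In this way the transformation groups of \<open>E\<close> and those
  of a flat \<open>L\<close> are treated alike, and restriction to \<open>L\<close> is \<^term>\<open>\<lambda>g. restrict g L\<close>.
\<close>

definition direction :: "'a::euclidean_space set \<Rightarrow> 'a set"
  where "direction A = {x - y |x y. x \<in> A \<and> y \<in> A}"

definition hyperplane_in :: "'a::euclidean_space set \<Rightarrow> 'a set \<Rightarrow> bool"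
  where "hyperplane_in A H \<longleftrightarrow>
    affine H \<and> H \<noteq> {} \<and> H \<subseteq> A \<and> aff_dim H = aff_dim A - 1"

definition reflection :: "'a::euclidean_space set \<Rightarrow> 'a set \<Rightarrow> 'a \<Rightarrow> 'a"
  where "reflection A H = (\<lambda>x\<in>A. 2 *\<^sub>R closest_point H x - x)"

definition reflection_group :: "'a::euclidean_space set \<Rightarrow> 'a set set \<Rightarrow> ('a \<Rightarrow> 'a) set"
  where "reflection_group A \<H> = generate (BijGroup A) (reflection A ` \<H>)"

definition acts_properly :: "('a::euclidean_space \<Rightarrow> 'a) set \<Rightarrow> 'a set \<Rightarrow> bool"
  where "acts_properly G A \<longleftrightarrow>
    proper_map (prod_topology (discrete_topology G) (top_of_set A))
      (prod_topology (top_of_set A) (top_of_set A)) (\<lambda>(g, x). (g x, x))"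

definition admissible_arrangement :: "'a::euclidean_space set \<Rightarrow> 'a set set \<Rightarrow> bool"
  where "admissible_arrangement E \<H> \<longleftrightarrow>
    (\<forall>H\<in>\<H>. hyperplane_in E H) \<and>
    acts_properly (reflection_group E \<H>) E \<and>
    (\<forall>g\<in>reflection_group E \<H>. \<forall>H\<in>\<H>. g ` H \<in> \<H>)"

definition common_direction :: "'a::euclidean_space set \<Rightarrow> 'a set set \<Rightarrow> 'a set"
  where "common_direction E \<H> = direction E \<inter> (\<Inter>H\<in>\<H>. direction H)"

definition admissible_group ::
    "'a::euclidean_space set \<Rightarrow> 'a set set \<Rightarrow> 'a set \<Rightarrow> ('a \<Rightarrow> 'a) set \<Rightarrow> bool"
  where "admissible_group E \<H> \<A> K \<longleftrightarrow>
    subgroup K (BijGroup E) \<and>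
    (\<forall>k\<in>K. \<forall>x\<in>E. \<forall>y\<in>E. dist (k x) (k y) = dist x y) \<and>
    (\<forall>k\<in>K. k ` \<A> = \<A>) \<and>
    (\<exists>p\<in>E. let Eess = (+) p ` (direction E \<inter> orthogonal_comp (common_direction E \<H>)) in
       \<forall>k\<in>K. k ` Eess = Eess \<and>
         (\<forall>x\<in>E. \<forall>v\<in>common_direction E \<H>. k (x + v) = k x + v))"

text \<open>
  An element of \<open>K\<close> that lies in the reflection group stabilises the chamber \<open>\<A>\<close> and is
  therefore trivial, and \<open>K\<close> normalises the reflection group. So the semidirect product is
  the internal one, that is, the group of all products in the group of bijections of \<open>E\<close>.
\<close>

definition extended_group ::
    "'a::euclidean_space set \<Rightarrow> 'a set set \<Rightarrow> ('a \<Rightarrow> 'a) set \<Rightarrow> ('a \<Rightarrow> 'a) set"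
  where "extended_group E \<H> K = K <#>\<^bsub>BijGroup E\<^esub> reflection_group E \<H>"

definition is_flat :: "'a::euclidean_space set \<Rightarrow> 'a set set \<Rightarrow> 'a set \<Rightarrow> bool"
  where "is_flat E \<H> L \<longleftrightarrow> L \<noteq> {} \<and> (\<exists>S\<subseteq>\<H>. L = E \<inter> \<Inter>S)"

definition induced_arrangement :: "'a::euclidean_space set set \<Rightarrow> 'a set \<Rightarrow> 'a set set"
  where "induced_arrangement \<H> L = {H \<inter> L |H. H \<in> \<H> \<and> H \<inter> L \<noteq> {} \<and> H \<inter> L \<noteq> L}"

definition flat_stabiliser ::
    "'a::euclidean_space set \<Rightarrow> 'a set set \<Rightarrow> ('a \<Rightarrow> 'a) set \<Rightarrow> 'a set \<Rightarrow> ('a \<Rightarrow> 'a) set"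
  where "flat_stabiliser E \<H> K L = {g \<in> extended_group E \<H> K. g ` L = L}"


section \<open>Complexification and analytic functions\<close>

text \<open>
  The pair \<open>(x, y)\<close> stands for \<open>x + iy\<close>. An affine map \<open>g\<close> of \<open>E\<close> acts on the
  complexification by \<open>x + iy \<mapsto> g x + i (dg) y\<close>, where \<open>(dg) y = g (x + y) - g x\<close>.
\<close>

definition complexify :: "'a::euclidean_space set \<Rightarrow> ('a \<times> 'a) set"
  where "complexify A = A \<times> direction A"

definition complex_act :: "('a::euclidean_space \<Rightarrow> 'a) \<Rightarrow> 'a \<times> 'a \<Rightarrow> 'a \<times> 'a"
  where "complex_act g = (\<lambda>(x, y). (g x, g (x + y) - g x))"

definition times_i :: "'a::euclidean_space \<times> 'a \<Rightarrow> 'a \<times> 'a"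
  where "times_i = (\<lambda>(x, y). (- y, x))"

definition complex_differentiable_at :: "('a::euclidean_space \<times> 'a \<Rightarrow> complex) \<Rightarrow> 'a \<times> 'a \<Rightarrow> bool"
  where "complex_differentiable_at f z \<longleftrightarrow>
    (\<exists>D. (f has_derivative D) (at z) \<and> (\<forall>v. D (times_i v) = \<i> * D v))"

text \<open>
  Analytic functions on a subset \<open>S\<close>, with its reduced structure: locally restrictions
  of holomorphic functions of the ambient space.
\<close>

definition analytic_fun_on :: "('a::euclidean_space \<times> 'a) set \<Rightarrow> ('a \<times> 'a \<Rightarrow> complex) \<Rightarrow> bool"
  where "analytic_fun_on S f \<longleftrightarrow>
    (\<forall>z\<in>S. \<exists>N F. open N \<and> z \<in> N \<and> (\<forall>w\<in>N. complex_differentiable_at F w) \<and>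
       (\<forall>w\<in>N \<inter> S. f w = F w))"


section \<open>Spaces with a sheaf of functions\<close>

record 'x function_space =
  top_of :: "'x topology"
  regular :: "'x set \<Rightarrow> ('x \<Rightarrow> complex) set"

text \<open>
  The germ of \<open>f\<close> at \<open>x\<close> is the set of all functions that agree with \<open>f\<close> near \<open>x\<close>.
\<close>

definition germ :: "'x function_space \<Rightarrow> 'x \<Rightarrow> ('x \<Rightarrow> complex) \<Rightarrow> ('x \<Rightarrow> complex) set"
  where "germ Y x f = {h. \<forall>\<^sub>F y in nhdsin (top_of Y) x. h y = f y}"

definition stalk :: "'x function_space \<Rightarrow> 'x \<Rightarrow> ('x \<Rightarrow> complex) set ring"
  where "stalk Y x =
    \<lparr>carrier = {germ Y x f |f U. openin (top_of Y) U \<and> x \<in> U \<and> f \<in> regular Y U},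
     mult = (\<lambda>a b. \<Union>f\<in>a. \<Union>g\<in>b. germ Y x (\<lambda>y. f y * g y)),
     one = germ Y x (\<lambda>_. 1),
     ring.zero = germ Y x (\<lambda>_. 0),
     ring.add = (\<lambda>a b. \<Union>f\<in>a. \<Union>g\<in>b. germ Y x (\<lambda>y. f y + g y))\<rparr>"


section \<open>Normal and unibranch local rings\<close>

definition frac_rel :: "('r, 'm) ring_scheme \<Rightarrow> (('r \<times> 'r) \<times> ('r \<times> 'r)) set"
  where "frac_rel R = {((a, b), (c, d)).
    a \<in> carrier R \<and> b \<in> carrier R - {\<zero>\<^bsub>R\<^esub>} \<and> c \<in> carrier R \<and> d \<in> carrier R - {\<zero>\<^bsub>R\<^esub>} \<and>
    a \<otimes>\<^bsub>R\<^esub> d = c \<otimes>\<^bsub>R\<^esub> b}"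

definition fraction :: "('r, 'm) ring_scheme \<Rightarrow> 'r \<Rightarrow> 'r \<Rightarrow> ('r \<times> 'r) set"
  where "fraction R a b = frac_rel R `` {(a, b)}"

definition fraction_field :: "('r, 'm) ring_scheme \<Rightarrow> ('r \<times> 'r) set ring"
  where "fraction_field R =
    \<lparr>carrier = {fraction R a b |a b. a \<in> carrier R \<and> b \<in> carrier R - {\<zero>\<^bsub>R\<^esub>}},
     mult = (\<lambda>x y. \<Union>(a, b)\<in>x. \<Union>(c, d)\<in>y. fraction R (a \<otimes>\<^bsub>R\<^esub> c) (b \<otimes>\<^bsub>R\<^esub> d)),
     one = fraction R \<one>\<^bsub>R\<^esub> \<one>\<^bsub>R\<^esub>,
     ring.zero = fraction R \<zero>\<^bsub>R\<^esub> \<one>\<^bsub>R\<^esub>,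
     ring.add = (\<lambda>x y. \<Union>(a, b)\<in>x. \<Union>(c, d)\<in>y.
       fraction R (a \<otimes>\<^bsub>R\<^esub> d \<oplus>\<^bsub>R\<^esub> c \<otimes>\<^bsub>R\<^esub> b) (b \<otimes>\<^bsub>R\<^esub> d))\<rparr>"

definition embedded :: "('r, 'm) ring_scheme \<Rightarrow> ('r \<times> 'r) set set"
  where "embedded R = (\<lambda>a. fraction R a \<one>\<^bsub>R\<^esub>) ` carrier R"

definition integral_closure :: "('r, 'm) ring_scheme \<Rightarrow> ('r \<times> 'r) set set"
  where "integral_closure R = {x \<in> carrier (fraction_field R).
    \<exists>p. polynomial\<^bsub>fraction_field R\<^esub> (embedded R) p \<and> p \<noteq> [] \<and>
      lead_coeff p = \<one>\<^bsub>fraction_field R\<^esub> \<and>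
      ring.eval (fraction_field R) p x = \<zero>\<^bsub>fraction_field R\<^esub>}"

definition integrally_closed_domain :: "('r, 'm) ring_scheme \<Rightarrow> bool"
  where "integrally_closed_domain R \<longleftrightarrow> domain R \<and> integral_closure R = embedded R"

text \<open>
  A local ring is unibranch if its reduction is a domain whose integral closure in the
  fraction field is a local ring. Rings of germs of functions are reduced.
\<close>

definition unibranch_ring :: "('r, 'm) ring_scheme \<Rightarrow> bool"
  where "unibranch_ring R \<longleftrightarrow> domain R \<and>
    (\<exists>!M. maximalideal M ((fraction_field R)\<lparr>carrier := integral_closure R\<rparr>))"

definition normal_at :: "'x function_space \<Rightarrow> 'x \<Rightarrow> bool"
  where "normal_at Y x \<longleftrightarrow> integrally_closed_domain (stalk Y x)"

definition unibranch_at :: "'x function_space \<Rightarrow> 'x \<Rightarrow> bool"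
  where "unibranch_at Y x \<longleftrightarrow> unibranch_ring (stalk Y x)"


section \<open>The stratum\<close>

definition orbit_of :: "('a::euclidean_space \<Rightarrow> 'a) set \<Rightarrow> 'a \<times> 'a \<Rightarrow> ('a \<times> 'a) set"
  where "orbit_of G z = (\<lambda>g. complex_act g z) ` G"

definition orbit_space ::
    "('a::euclidean_space \<Rightarrow> 'a) set \<Rightarrow> ('a \<times> 'a) set \<Rightarrow> ('a \<times> 'a) set function_space"
  where "orbit_space G S =
    \<lparr>top_of = topology (\<lambda>U. U \<subseteq> orbit_of G ` S \<and>
       openin (top_of_set S) {z \<in> S. orbit_of G z \<in> U}),
     regular = (\<lambda>U. {f. analytic_fun_on {z \<in> S. orbit_of G z \<in> U} (f \<circ> orbit_of G)})\<rparr>"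

lemma openin_orbit_space:
  "openin (top_of (orbit_space G S)) U \<longleftrightarrow>
    U \<subseteq> orbit_of G ` S \<and> openin (top_of_set S) {z \<in> S. orbit_of G z \<in> U}"
proof -
  define P where "P U \<longleftrightarrow> U \<subseteq> orbit_of G ` S \<and> openin (top_of_set S) {z \<in> S. orbit_of G z \<in> U}"
    for U
  have "istopology P"
    unfolding istopology_def
  proof (intro conjI allI impI)
    fix U V assume PU: "P U" and PV: "P V"
    have eq: "{z \<in> S. orbit_of G z \<in> U \<inter> V} =
        {z \<in> S. orbit_of G z \<in> U} \<inter> {z \<in> S. orbit_of G z \<in> V}" by blast
    show "P (U \<inter> V)"
      using PU PV unfolding P_def eq by (blast intro: openin_Int)
  next
    fix \<U> assume PU: "\<forall>U\<in>\<U>. P U"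
    have eq: "{z \<in> S. orbit_of G z \<in> \<Union>\<U>} = \<Union>((\<lambda>U. {z \<in> S. orbit_of G z \<in> U}) ` \<U>)"
      by blast
    have "openin (top_of_set S) (\<Union>((\<lambda>U. {z \<in> S. orbit_of G z \<in> U}) ` \<U>))"
      by (rule openin_Union) (use PU[unfolded P_def] in blast)
    moreover have "\<Union>\<U> \<subseteq> orbit_of G ` S"
      using PU unfolding P_def by blast
    ultimately show "P (\<Union>\<U>)"
      unfolding P_def eq by blast
  qed
  then have "openin (topology P) = P"
    by (rule topology_inverse')
  moreover have "top_of (orbit_space G S) = topology P"
    unfolding orbit_space_def function_space.simps P_def[abs_def] ..
  ultimately show ?thesis
    by (simp only: P_def)
qed

lemma quotient_map_orbit_space:
  "quotient_map (top_of_set S) (top_of (orbit_space G S)) (orbit_of G)"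
proof -
  have "topspace (top_of (orbit_space G S)) = orbit_of G ` S"
  proof (rule antisym)
    show "topspace (top_of (orbit_space G S)) \<subseteq> orbit_of G ` S"
      using openin_topspace[of "top_of (orbit_space G S)"]
      unfolding openin_orbit_space by blast
    have "{z \<in> S. orbit_of G z \<in> orbit_of G ` S} = S" by auto
    then have "openin (top_of (orbit_space G S)) (orbit_of G ` S)"
      by (simp add: openin_orbit_space)
    then show "orbit_of G ` S \<subseteq> topspace (top_of (orbit_space G S))"
      by (rule openin_subset)
  qed
  then show ?thesis
    by (auto simp: quotient_map_def openin_orbit_space)
qed

definition stratum ::
    "'a::euclidean_space set \<Rightarrow> 'a set set \<Rightarrow> ('a \<Rightarrow> 'a) set \<Rightarrow> 'a set \<Rightarrow>
      ('a \<times> 'a) set function_space"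
  where "stratum E \<H> K L =
    (let G = extended_group E \<H> K
     in orbit_space G (\<Union>g\<in>G. complex_act g ` complexify L))"


section \<open>Codimension\<close>

text \<open>
  The dimension of a subset \<open>Z\<close> of \<open>Y\<close> is the largest dimension of a complex submanifold
  contained in \<open>Z\<close>. The spaces of interest are irreducible, so the codimension is the
  difference of dimensions. The definition makes sense, and gives the dimension of the closure, also for
  analytically constructible subsets, such as the set of points at which \<open>Y\<close> is not
  unibranch, which need not be closed. The empty set has dimension \<open>-\<infinity>\<close>.

  A submanifold is the image of a holomorphic map \<open>\<phi>\<close> to \<open>Y\<close> from a nonempty open subset
  \<open>D\<close> of a complex vector space such that the coordinates on \<open>D\<close> are pullbacks of regular
  functions; locally, every submanifold is of this form. The complexified subspaces
  \<open>M \<times> M\<close> serve as the spaces \<open>\<complex>\<^sup>k\<close>, \<open>k = dim M\<close>, since the type does not allow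
  \<open>k\<close> as a parameter; larger \<open>k\<close> are not needed, because \<open>dim Y\<close> is at most \<open>dim E\<close>.
\<close>

definition holomorphic_map_to ::
    "'x function_space \<Rightarrow> ('a::euclidean_space \<times> 'a) set \<Rightarrow> ('a \<times> 'a \<Rightarrow> 'x) \<Rightarrow> bool"
  where "holomorphic_map_to Y D \<phi> \<longleftrightarrow>
    continuous_map (top_of_set D) (top_of Y) \<phi> \<and>
    (\<forall>U f. openin (top_of Y) U \<and> f \<in> regular Y U \<longrightarrow>
       analytic_fun_on {z \<in> D. \<phi> z \<in> U} (f \<circ> \<phi>))"

definition submanifold_dims ::
    "('a::euclidean_space \<times> 'a) set function_space \<Rightarrow> ('a \<times> 'a) set set \<Rightarrow> nat set"
  where "submanifold_dims Y Z = {dim M |M :: 'a set. subspace M \<and>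
    (\<exists>D \<phi> U f. openin (top_of_set (M \<times> M)) D \<and> D \<noteq> {} \<and> openin (top_of Y) U \<and>
       \<phi> ` D \<subseteq> U \<inter> Z \<and> holomorphic_map_to Y D \<phi> \<and>
       (\<forall>b\<in>Basis. f b \<in> regular Y U \<and> (\<forall>(u, v)\<in>D. f b (\<phi> (u, v)) = Complex (u \<bullet> b) (v \<bullet> b))))}"

definition complex_dim ::
    "('a::euclidean_space \<times> 'a) set function_space \<Rightarrow> ('a \<times> 'a) set set \<Rightarrow> ereal"
  where "complex_dim Y Z = (SUP k\<in>submanifold_dims Y Z. ereal (real k))"

definition codimension ::
    "('a::euclidean_space \<times> 'a) set function_space \<Rightarrow> ('a \<times> 'a) set set \<Rightarrow> ereal"
  where "codimension Y Z = complex_dim Y (topspace (top_of Y)) - complex_dim Y Z"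

definition normal_in_codim_1 :: "('a::euclidean_space \<times> 'a) set function_space \<Rightarrow> bool"
  where "normal_in_codim_1 Y \<longleftrightarrow>
    codimension Y {x \<in> topspace (top_of Y). \<not> normal_at Y x} > 1"

definition unibranch_in_codim_1 :: "('a::euclidean_space \<times> 'a) set function_space \<Rightarrow> bool"
  where "unibranch_in_codim_1 Y \<longleftrightarrow>
    codimension Y {x \<in> topspace (top_of Y). \<not> unibranch_at Y x} > 1"

end

theory Submission
  imports Defs "HOL-Complex_Analysis.Complex_Analysis"
begin

text \<open>
  Near a point of \<open>L\<^sub>\<complex>\<close> the stratum is the quotient of finitely many translates of \<open>L\<^sub>\<complex>\<close>
  by a finite stabiliser. At points of \<open>L\<^sub>\<complex>\<close> outside the complexified induced arrangement there
  is only one branch and the local ring is integrally closed, and the intersections of two members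
  of the induced arrangement have codimension two. So only a generic point of a wall \<open>M\<close> matters.
  Let \<open>t\<close> be the coordinate of \<open>L\<close> normal to \<open>M\<close>. If the reflection of \<open>L\<close> in \<open>M\<close> lies in the image of
  the group and the stratum is unibranch, then the invariant functions on the branch \<open>L\<^sub>\<complex>\<close> are even
  in \<open>t\<close>; all of them extend to the ambient space, so the local ring is integrally closed. If the
  reflection is missing, \<open>t\<close> contributes an element of the fraction field that is integral over the
  local ring, but averaging over the fixer of \<open>M\<close> shows that no invariant function has a nonzero
  derivative in the normal direction, so the local ring is not integrally closed.
\<close>

text \<open>Regular functions on the quotient are restrictions of ambient holomorphic functions, so
  normality becomes a question of extension: a function on \<open>L\<close> complexified that is
  invariant under the stabiliser has to be continued, invariantly, to a full neighbourhood. Two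
  devices do this. Orthogonal projections onto flats commute with the isometries preserving the
  flat. Quotients and even parts are written as means over a circle in a complex line, and such
  means depend holomorphically on the remaining variables. The averaging argument rests on the
  reflections in all hyperplanes through \<open>M\<close>: they fix \<open>M\<close>, whether or not
  they stabilise \<open>L\<close>, and together they fix no nonzero vector orthogonal to
  \<open>M\<close>. Several branches in the quotient are detected by zero divisors: invariant
  polynomials, each nonzero on one orbit of branches and vanishing on the others. Upper bounds for
  dimensions come from measure theory: countably many flats of too small dimension have negligible
  image in a chart. An admissible group is assumed to preserve a chamber; that it permutes the
  hyperplanes has to be derived from the walls of that chamber.\<close>

definition cscale :: "complex \<Rightarrow> 'a::euclidean_space \<times> 'a \<Rightarrow> 'a \<times> 'a"
  where "cscale c v = Re c *\<^sub>R v + Im c *\<^sub>R times_i v"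

definition hol_in :: "('a::euclidean_space \<times> 'a) set \<Rightarrow> ('a \<times> 'a \<Rightarrow> complex) \<Rightarrow> bool"
  where "hol_in N F \<longleftrightarrow> (\<forall>w\<in>N. complex_differentiable_at F w)"

text \<open>The complex-linear extension of the real functional \<open>_ \<bullet> n\<close>; for a
  unit normal \<open>n\<close> it is the complex coordinate along \<open>n\<close>.\<close>

definition cinner :: "'a::euclidean_space \<Rightarrow> 'a \<times> 'a \<Rightarrow> complex"
  where "cinner n w = Complex (fst w \<bullet> n) (snd w \<bullet> n)"

lemma times_i_simps [simp]: "times_i (x, y) = (- y, x)"
  by (simp add: times_i_def)

lemma linear_times_i: "linear times_i"
  by (rule linearI) (auto simp: times_i_def)

lemma bounded_linear_times_i: "bounded_linear times_i"
  using linear_times_i by (simp add: linear_conv_bounded_linear)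

lemma times_i_times_i [simp]: "times_i (times_i v) = - v"
  by (cases v) simp

lemma cscale_pair: "cscale c (x, y) = (Re c *\<^sub>R x - Im c *\<^sub>R y, Re c *\<^sub>R y + Im c *\<^sub>R x)"
  by (simp add: cscale_def)

lemma cscale_simps [simp]: "cscale 0 v = 0" "cscale 1 v = v" "cscale c 0 = 0"
  by (auto simp: cscale_def times_i_def zero_prod_def)

lemma cscale_of_real: "cscale (of_real t) v = t *\<^sub>R v"
  by (simp add: cscale_def)

lemma norm_cscale: "norm (cscale c v) = norm c * norm v"
proof -
  obtain x y where v: "v = (x, y)" by (cases v)
  have "(norm (cscale c v))\<^sup>2 = (norm c * norm v)\<^sup>2"
    unfolding power_mult_distrib power2_norm_eq_inner cmod_power2 v cscale_pair inner_Pair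
    by (simp add: inner_simps algebra_simps inner_commute power2_eq_square inner_complex_def)
  then show ?thesis by simp
qed

lemma bounded_linear_cscale_left: "bounded_linear (\<lambda>c. cscale c v)"
proof -
  have "linear (\<lambda>c. cscale c v)"
    by (rule linearI) (auto simp: cscale_def algebra_simps)
  then show ?thesis by (simp add: linear_conv_bounded_linear)
qed

lemma continuous_on_cscale [continuous_intros]:
  "continuous_on S f \<Longrightarrow> continuous_on S g \<Longrightarrow> continuous_on S (\<lambda>x. cscale (f x) (g x))"
  unfolding cscale_def
  by (intro continuous_intros bounded_linear.continuous_on [OF bounded_linear_times_i])

lemma complex_linear_cscale:
  assumes "linear D" "\<And>v. D (times_i v) = \<i> * D v"
  shows "D (cscale c v) = c * D v"
proof -
  have "D (cscale c v) = Re c *\<^sub>R D v + Im c *\<^sub>R (\<i> * D v)"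
    using assms by (simp add: cscale_def linear_add linear_scale)
  also have "\<dots> = (of_real (Re c) + \<i> * of_real (Im c)) * D v"
    by (simp add: scaleR_conv_of_real algebra_simps)
  also have "of_real (Re c) + \<i> * of_real (Im c) = c" by (simp add: complex_eq_iff)
  finally show ?thesis .
qed

lemma cinner_cscale: "cinner n (cscale c v) = c * cinner n v"
  by (cases v) (simp add: cinner_def cscale_pair complex_eq_iff inner_simps)

lemma cinner_real: "cinner n (x, 0) = of_real (x \<bullet> n)"
  by (simp add: cinner_def complex_eq_iff)

lemma linear_cinner: "linear (cinner n)"
  by (rule linearI) (auto simp: cinner_def complex_eq_iff inner_simps)

lemma cinner_times_i: "cinner n (times_i v) = \<i> * cinner n v"
  by (cases v) (simp add: cinner_def complex_eq_iff)

subsection \<open>Complex differentiable functions\<close>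

lemma cd_const: "complex_differentiable_at (\<lambda>_. c) w"
  unfolding complex_differentiable_at_def by (intro exI[of _ "\<lambda>_. 0"]) auto

lemma cd_add:
  assumes "complex_differentiable_at f w" "complex_differentiable_at g w"
  shows "complex_differentiable_at (\<lambda>x. f x + g x) w"
proof -
  from assms obtain D D' where
    D: "(f has_derivative D) (at w)" "\<And>v. D (times_i v) = \<i> * D v" and
    D': "(g has_derivative D') (at w)" "\<And>v. D' (times_i v) = \<i> * D' v"
    unfolding complex_differentiable_at_def by blast
  show ?thesis unfolding complex_differentiable_at_def
    by (intro exI conjI allI, rule has_derivative_add[OF D(1) D'(1)])
       (simp add: D D' algebra_simps)
qed

lemma cd_mult:
  assumes "complex_differentiable_at f w" "complex_differentiable_at g w"
  shows "complex_differentiable_at (\<lambda>x. f x * g x) w"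
proof -
  from assms obtain D D' where
    D: "(f has_derivative D) (at w)" "\<And>v. D (times_i v) = \<i> * D v" and
    D': "(g has_derivative D') (at w)" "\<And>v. D' (times_i v) = \<i> * D' v"
    unfolding complex_differentiable_at_def by blast
  show ?thesis unfolding complex_differentiable_at_def
    by (intro exI conjI allI, rule has_derivative_mult[OF D(1) D'(1)])
       (simp add: D D' algebra_simps)
qed

lemma cd_uminus:
  "complex_differentiable_at f w \<Longrightarrow> complex_differentiable_at (\<lambda>x. - f x) w"
  using cd_mult[OF cd_const[of "-1"], of f w] by simp

lemma cd_diff:
  "complex_differentiable_at f w \<Longrightarrow> complex_differentiable_at g w \<Longrightarrow>
    complex_differentiable_at (\<lambda>x. f x - g x) w"
  using cd_add[of f w "\<lambda>x. - g x"] cd_uminus[of g w] by simp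

lemma cd_power: "complex_differentiable_at f w \<Longrightarrow> complex_differentiable_at (\<lambda>x. f x ^ n) w"
  by (induction n) (auto intro: cd_const cd_mult)

lemma cd_sum:
  "(\<And>i. i \<in> I \<Longrightarrow> complex_differentiable_at (f i) w) \<Longrightarrow>
    complex_differentiable_at (\<lambda>x. \<Sum>i\<in>I. f i x) w"
  by (induction I rule: infinite_finite_induct) (auto intro: cd_const cd_add)

lemma cd_prod:
  "(\<And>i. i \<in> I \<Longrightarrow> complex_differentiable_at (f i) w) \<Longrightarrow>
    complex_differentiable_at (\<lambda>x. \<Prod>i\<in>I. f i x) w"
  by (induction I rule: infinite_finite_induct) (auto intro: cd_const cd_mult)

lemma cd_inverse:
  assumes "complex_differentiable_at f w" "f w \<noteq> 0"
  shows "complex_differentiable_at (\<lambda>x. inverse (f x)) w"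
proof -
  from assms obtain D where
    D: "(f has_derivative D) (at w)" "\<And>v. D (times_i v) = \<i> * D v"
    unfolding complex_differentiable_at_def by blast
  show ?thesis unfolding complex_differentiable_at_def
    by (intro exI conjI allI, rule Deriv.has_derivative_inverse[OF assms(2) D(1)])
       (simp add: D algebra_simps)
qed

lemma cd_divide:
  "complex_differentiable_at f w \<Longrightarrow> complex_differentiable_at g w \<Longrightarrow> g w \<noteq> 0 \<Longrightarrow>
    complex_differentiable_at (\<lambda>x. f x / g x) w"
  unfolding divide_inverse by (intro cd_mult cd_inverse)

lemma cd_compose:
  assumes "complex_differentiable_at F (T w)" "(T has_derivative T') (at w)"
    "\<And>v. T' (times_i v) = times_i (T' v)"
  shows "complex_differentiable_at (\<lambda>x. F (T x)) w"
proof -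
  from assms(1) obtain D where
    D: "(F has_derivative D) (at (T w))" "\<And>v. D (times_i v) = \<i> * D v"
    unfolding complex_differentiable_at_def by blast
  show ?thesis unfolding complex_differentiable_at_def
    by (intro exI conjI allI, rule has_derivative_compose[OF assms(2) D(1)])
       (simp add: D assms(3))
qed

lemma cd_cinner: "complex_differentiable_at (cinner n) w"
  unfolding complex_differentiable_at_def
  by (rule exI[of _ "cinner n"])
     (auto simp: cinner_times_i linear_cinner linear_conv_bounded_linear
       intro!: bounded_linear.has_derivative[of _ "\<lambda>x. x", simplified] linear_cinner[unfolded linear_conv_bounded_linear] has_derivative_ident)

lemma cd_isCont: "complex_differentiable_at F w \<Longrightarrow> isCont F w"
  unfolding complex_differentiable_at_def using has_derivative_continuous by blast

lemma hol_in_continuous_on: "hol_in N F \<Longrightarrow> continuous_on N F"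
  unfolding hol_in_def by (meson cd_isCont continuous_at_imp_continuous_on)

lemma hol_in_subset: "hol_in N F \<Longrightarrow> M \<subseteq> N \<Longrightarrow> hol_in M F"
  unfolding hol_in_def by blast

text \<open>Restriction to a complex line gives a function of one variable. All facts about several
  variables below are reduced to such lines.\<close>

lemma slice_derivative:
  assumes "(F has_derivative D) (at (w + cscale \<zeta> v))" "\<And>v. D (times_i v) = \<i> * D v"
  shows "((\<lambda>\<zeta>. F (w + cscale \<zeta> v)) has_field_derivative D v) (at \<zeta>)"
proof -
  have "((\<lambda>\<zeta>. w + cscale \<zeta> v) has_derivative (\<lambda>h. cscale h v)) (at \<zeta>)"
    by (auto intro!: derivative_eq_intros bounded_linear.has_derivative[OF bounded_linear_cscale_left])
  from has_derivative_compose[OF this assms(1)]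
  moreover have "(\<lambda>h. D (cscale h v)) = (*) (D v)"
    using complex_linear_cscale[OF has_derivative_linear[OF assms(1)] assms(2)] by (simp add: fun_eq_iff)
  ultimately show ?thesis unfolding has_field_derivative_def by simp
qed

lemma hol_in_slice:
  assumes "hol_in N F" "\<And>\<zeta>. \<zeta> \<in> S \<Longrightarrow> w + cscale \<zeta> v \<in> N"
  shows "(\<lambda>\<zeta>. F (w + cscale \<zeta> v)) holomorphic_on S"
proof -
  have "(\<lambda>\<zeta>. F (w + cscale \<zeta> v)) field_differentiable (at \<zeta>)" if "\<zeta> \<in> S" for \<zeta>
    using assms that slice_derivative unfolding hol_in_def complex_differentiable_at_def
      field_differentiable_def by blast
  then show ?thesis
    by (simp add: field_differentiable_at_within holomorphic_on_def)
qed

subsection \<open>Cauchy integrals\<close>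

lemma norm_circlepath: "norm (circlepath 0 \<rho> s) = \<bar>\<rho>\<bar>"
  by (simp add: circlepath norm_mult)

text \<open>The derivative of a circle about 0 is 2\<pi>i times the circle itself, so Cauchy's
  formulas become ordinary means over the unit interval, to which theorems on parameter integrals
  apply.\<close>

lemma circlepath_integral:
  "contour_integral (circlepath 0 \<rho>) f =
    2 * of_real pi * \<i> * integral {0..1} (\<lambda>s. f (circlepath 0 \<rho> s) * circlepath 0 \<rho> s)"
proof -
  have "contour_integral (circlepath 0 \<rho>) f =
      integral {0..1} (\<lambda>s. (2 * of_real pi * \<i>) * (f (circlepath 0 \<rho> s) * circlepath 0 \<rho> s))"
    unfolding contour_integral_integral
    by (rule integral_cong) (simp add: vector_derivative_circlepath, simp add: circlepath)
  also have "\<dots> = 2 * of_real pi * \<i> * integral {0..1} (\<lambda>s. f (circlepath 0 \<rho> s) * circlepath 0 \<rho> s)"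
    by (rule integral_mult_right)
  finally show ?thesis .
qed

lemma Cauchy_mean:
  assumes "g holomorphic_on ball 0 R" "0 < \<rho>" "\<rho> < R" "norm t < \<rho>"
  shows "g t = integral {0..1} (\<lambda>s. g (circlepath 0 \<rho> s) * circlepath 0 \<rho> s / (circlepath 0 \<rho> s - t))"
proof -
  have sub: "cball 0 \<rho> \<subseteq> ball 0 R" using assms by auto
  have "((\<lambda>u. g u/(u-t)) has_contour_integral (2 * of_real pi * \<i> * g t)) (circlepath 0 \<rho>)"
    using assms sub
    by (intro Cauchy_integral_circlepath)
       (auto intro: holomorphic_on_subset holomorphic_on_imp_continuous_on)
  then have "2 * of_real pi * \<i> * g t = contour_integral (circlepath 0 \<rho>) (\<lambda>u. g u/(u-t))"
    by (simp add: contour_integral_unique)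
  then show ?thesis by (simp add: circlepath_integral)
qed

lemma Cauchy_mean_deriv:
  assumes "g holomorphic_on ball 0 R" "0 < \<rho>" "\<rho> < R" "(g has_field_derivative g') (at 0)"
  shows "g' = integral {0..1} (\<lambda>s. g (circlepath 0 \<rho> s) / circlepath 0 \<rho> s)"
proof -
  have sub: "cball 0 \<rho> \<subseteq> ball 0 R" using assms by auto
  have "(g has_field_derivative (1 / (2 * of_real pi * \<i>) * contour_integral (circlepath 0 \<rho>) (\<lambda>u. g u / (u-0)^2))) (at 0)"
    using assms sub
    by (intro Cauchy_derivative_integral_circlepath(2))
       (auto intro: holomorphic_on_subset holomorphic_on_imp_continuous_on)
  with assms(4) have "g' = 1 / (2 * of_real pi * \<i>) * contour_integral (circlepath 0 \<rho>) (\<lambda>u. g u / (u-0)^2)"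
    by (rule DERIV_unique)
  also have "\<dots> = integral {0..1} (\<lambda>s. g (circlepath 0 \<rho> s) / (circlepath 0 \<rho> s)^2 * circlepath 0 \<rho> s)"
    by (simp add: circlepath_integral)
  also have "\<dots> = integral {0..1} (\<lambda>s. g (circlepath 0 \<rho> s) / circlepath 0 \<rho> s)"
    by (rule integral_cong) (simp add: power2_eq_square)
  finally show ?thesis .
qed

lemma continuous_on_circlepath [continuous_intros]:
  "continuous_on S f \<Longrightarrow> continuous_on S (\<lambda>x. circlepath z \<rho> (f x))"
  unfolding circlepath by (intro continuous_intros)

text \<open>Cauchy's formula makes the derivative of the integrand continuous, as needed for the Leibniz rule.\<close>

lemma hol_in_integral:
  fixes k :: "'a::euclidean_space \<times> 'a \<Rightarrow> real \<Rightarrow> complex"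
  assumes N: "open N"
    and cont: "continuous_on (N \<times> {0..1}) (\<lambda>(w, t). k w t)"
    and hol: "\<And>t. t \<in> {0..1} \<Longrightarrow> hol_in N (\<lambda>w. k w t)"
  shows "hol_in N (\<lambda>w. integral {0..1} (k w))"
  unfolding hol_in_def
proof
  fix w0 assume "w0 \<in> N"
  then obtain r where r: "r > 0" "ball w0 r \<subseteq> N" using N openE by blast
  \<comment> \<open>Half the radius leaves room for a circle of radius \<open>r/4\<close> around
    every point of \<open>U\<close>, in any unit direction.\<close>
  define U where "U = ball w0 (r/2)"
  have "\<exists>D. ((\<lambda>w. k w t) has_derivative D) (at w) \<and> (\<forall>v. D (times_i v) = \<i> * D v)"
    if "w \<in> U" "t \<in> {0..1}" for w t
  proof -
    have "w \<in> ball w0 r" using that(1) r by (simp add: U_def)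
    then show ?thesis
      using hol[OF that(2)] r unfolding hol_in_def complex_differentiable_at_def by blast
  qed
  then obtain D where D: "\<And>w t. w \<in> U \<Longrightarrow> t \<in> {0..1} \<Longrightarrow> ((\<lambda>w. k w t) has_derivative D w t) (at w)"
    and Di: "\<And>w t v. w \<in> U \<Longrightarrow> t \<in> {0..1} \<Longrightarrow> D w t (times_i v) = \<i> * D w t v"
    by metis
  define fx where "fx w t = Blinfun (D w t)" for w t
  have fx: "blinfun_apply (fx w t) = D w t" if "w \<in> U" "t \<in> {0..1}" for w t
    unfolding fx_def using D[OF that] bounded_linear_Blinfun_apply has_derivative_bounded_linear by blast
  have sub: "w + cscale \<zeta> v \<in> ball w0 r" if "w \<in> U" "norm v = 1" "norm \<zeta> < r/2" for w \<zeta> v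
    using that norm_triangle_ineq[of "w - w0" "cscale \<zeta> v"]
    by (auto simp: U_def dist_norm norm_cscale norm_minus_commute algebra_simps)
  \<comment> \<open>Cauchy's formula expresses the derivative by values of \<open>k\<close>, whose
    joint continuity is known.\<close>
  have Dint: "D w t v = integral {0..1} (\<lambda>s. k (w + cscale (circlepath 0 (r/4) s) v) t / circlepath 0 (r/4) s)"
    if w: "w \<in> U" and t: "t \<in> {0..1}" and v: "norm v = 1" for w t v
  proof (rule Cauchy_mean_deriv[where g = "\<lambda>\<zeta>. k (w + cscale \<zeta> v) t"])
    show "(\<lambda>\<zeta>. k (w + cscale \<zeta> v) t) holomorphic_on ball 0 (r/2)"
      by (rule hol_in_slice[OF hol[OF t]]) (use sub[OF w v] r in \<open>simp add: subset_iff del: split_paired_All\<close>)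
    show "((\<lambda>\<zeta>. k (w + cscale \<zeta> v) t) has_field_derivative D w t v) (at 0)"
      by (rule slice_derivative) (use D[OF w t] Di[OF w t] in auto)
  qed (use r in auto)
  have contfx: "continuous_on (U \<times> cbox 0 1) (\<lambda>(w, t). fx w t)"
  \<comment> \<open>Continuity of an operator-valued map may be tested on basis vectors; these have
    norm 1, as \<open>Dint\<close> requires.\<close>
  proof (rule continuous_on_blinfun_componentwise)
    fix v :: "'a \<times> 'a" assume "v \<in> Basis"
    then have v: "norm v = 1" by simp
    have cont2: "continuous_on ((U \<times> {0..1}) \<times> {0..1})
       (\<lambda>x. k (fst (fst x) + cscale (circlepath 0 (r/4) (snd x)) v) (snd (fst x)))"
    proof -
      have "continuous_on ((U \<times> {0..1}) \<times> {0..1})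
         (\<lambda>x. (\<lambda>(w, t). k w t) (fst (fst x) + cscale (circlepath 0 (r/4) (snd x)) v, snd (fst x)))"
      proof (rule continuous_on_compose2[OF cont])
        show "continuous_on ((U \<times> {0..1::real}) \<times> {0..1::real})
           (\<lambda>x. (fst (fst x) + cscale (circlepath 0 (r/4) (snd x)) v, snd (fst x)))"
          by (intro continuous_intros)
        show "(\<lambda>x. (fst (fst x) + cscale (circlepath 0 (r/4) (snd x)) v, snd (fst x))) ` ((U \<times> {0..1}) \<times> {0..1}) \<subseteq> N \<times> {0..1}"
          using sub[OF _ v, of _ "circlepath 0 (r/4) _"] r by (fastforce simp: norm_circlepath)
      qed
      then show ?thesis by simp
    qed
    have nz: "circlepath 0 (r/4) s \<noteq> 0" for s using norm_circlepath[of "r/4" s] r by auto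
    have "continuous_on (U \<times> cbox 0 1) (\<lambda>x. integral (cbox 0 1) (\<lambda>s. k (fst x + cscale (circlepath 0 (r/4) s) v) (snd x) / circlepath 0 (r/4) s))"
      by (rule integral_continuous_on_param)
         (use cont2 nz in \<open>auto simp: case_prod_beta intro!: continuous_intros\<close>)
    then show "continuous_on (U \<times> cbox 0 1) (\<lambda>x. blinfun_apply (case x of (w, t) \<Rightarrow> fx w t) v)"
      by (rule continuous_on_eq) (auto simp: fx Dint v)
  qed
  have "((\<lambda>w. integral (cbox 0 1) (k w)) has_derivative blinfun_apply (integral (cbox 0 1) (fx w0))) (at w0 within U)"
  proof (rule leibniz_rule[OF _ _ contfx])
    show "((\<lambda>w. k w t) has_derivative blinfun_apply (fx w t)) (at w within U)" if "w \<in> U" "t \<in> cbox 0 1" for w t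
      using that has_derivative_at_withinI[OF D[of w t]] fx[of w t] by simp
    show "k w integrable_on cbox 0 1" if "w \<in> U" for w
    proof (rule integrable_continuous)
      have "w \<in> N" using that r by (auto simp: U_def)
      then have "continuous_on {0..1} (\<lambda>t. (\<lambda>(w, t). k w t) (w, t))"
        by (intro continuous_on_compose2[OF cont]) (auto intro!: continuous_intros)
      then show "continuous_on (cbox 0 1) (k w)" by simp
    qed
    show "w0 \<in> U" using r by (simp add: U_def)
    show "convex U" by (simp add: U_def)
  qed
  moreover have "at w0 within U = at w0"
    using r by (intro at_within_open) (auto simp: U_def)
  ultimately have der: "((\<lambda>w. integral {0..1} (k w)) has_derivative blinfun_apply (integral {0..1} (fx w0))) (at w0)"
    by simp
  have w0U: "w0 \<in> U" using r by (simp add: U_def)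
  have int: "fx w0 integrable_on {0..1}"
  proof -
    have "continuous_on {0..1} (\<lambda>t. (\<lambda>(w, t). fx w t) (w0, t))"
      by (intro continuous_on_compose2[OF contfx]) (use w0U in \<open>auto intro!: continuous_intros\<close>)
    then show ?thesis using integrable_continuous_interval by simp
  qed
  have "blinfun_apply (integral {0..1} (fx w0)) (times_i v) = \<i> * blinfun_apply (integral {0..1} (fx w0)) v" for v
  proof -
    have "blinfun_apply (integral {0..1} (fx w0)) (times_i v) = integral {0..1} (\<lambda>t. \<i> * fx w0 t v)"
      unfolding blinfun_apply_integral[OF int]
      by (rule integral_cong) (simp add: fx[OF w0U] Di[OF w0U])
    also have "\<dots> = \<i> * integral {0..1} (\<lambda>t. fx w0 t v)"
      by (rule integral_mult_right)
    finally show ?thesis by (simp add: blinfun_apply_integral[OF int])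
  qed
  then show "complex_differentiable_at (\<lambda>w. integral {0..1} (k w)) w0"
    unfolding complex_differentiable_at_def using der by blast
qed

subsection \<open>Identity theorem\<close>

text \<open>The complex line through \<open>w0\<close> and \<open>w\<close> meets the ball in a
  convex, hence connected, set, and on it the identity theorem in one variable applies.\<close>

lemma hol_in_identity:
  assumes hol: "hol_in (ball z r) F" and w0: "w0 \<in> ball z r"
    and \<delta>: "\<delta> > 0" "\<And>w. w \<in> ball w0 \<delta> \<Longrightarrow> F w = 0" and w: "w \<in> ball z r"
  shows "F w = 0"
proof (cases "w = w0")
  case False
  define v where "v = w - w0"
  have v: "norm v > 0" using False by (simp add: v_def)
  define S where "S = (\<lambda>\<zeta>. w0 + cscale \<zeta> v) -` ball z r"
  have cont: "continuous_on UNIV (\<lambda>\<zeta>. w0 + cscale \<zeta> v)" by (intro continuous_intros)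
  have opS: "open S" unfolding S_def by (rule open_vimage[OF _ cont]) simp
  have "convex ((\<lambda>\<zeta>. cscale \<zeta> v) -` ball (z - w0) r)"
    by (rule convex_linear_vimage[OF bounded_linear.linear[OF bounded_linear_cscale_left] convex_ball])
  also have "(\<lambda>\<zeta>. cscale \<zeta> v) -` ball (z - w0) r = S"
    by (auto simp: S_def dist_norm algebra_simps)
  finally have conS: "connected S" by (rule convex_connected)
  have hols: "(\<lambda>\<zeta>. F (w0 + cscale \<zeta> v)) holomorphic_on S"
    by (rule hol_in_slice[OF hol]) (auto simp: S_def)
  have "F (w0 + cscale 1 v) = 0"
  proof (rule analytic_continuation_open[of "S \<inter> ball 0 (\<delta> / norm v)" S "\<lambda>\<zeta>. F (w0 + cscale \<zeta> v)" "\<lambda>_. 0" 1])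
    show "S \<inter> ball 0 (\<delta> / norm v) \<noteq> {}"
    proof -
      have "0 \<in> S \<inter> ball 0 (\<delta> / norm v)" using w0 v \<delta> by (simp add: S_def)
      then show ?thesis by blast
    qed
    show "F (w0 + cscale z' v) = 0" if "z' \<in> S \<inter> ball 0 (\<delta> / norm v)" for z'
      using that v by (intro \<delta>(2)) (auto simp: dist_norm norm_cscale field_simps)
    show "1 \<in> S" using w by (simp add: S_def v_def)
  qed (use opS conS hols in \<open>auto intro!: open_Int\<close>)
  then show ?thesis by (simp add: v_def)
qed (use \<delta> in auto)

text \<open>\<open>F\<close> has no zero near \<open>w1\<close>, so \<open>G\<close> vanishes on a
  small ball there and hence everywhere. This yields both that stalks are domains and that a
  quotient of invariants is invariant.\<close>

lemma hol_in_mult_zero: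
  assumes "hol_in (ball z r) F" "hol_in (ball z r) G" "\<And>w. w \<in> ball z r \<Longrightarrow> F w * G w = 0"
    and w1: "w1 \<in> ball z r" "F w1 \<noteq> 0" and w: "w \<in> ball z r"
  shows "G w = 0"
proof -
  have "isCont F w1" using assms cd_isCont unfolding hol_in_def by blast
  then obtain \<delta> where \<delta>: "\<delta> > 0" "\<And>x. dist x w1 < \<delta> \<Longrightarrow> F x \<noteq> 0"
    using w1(2) continuous_at_avoid[of w1 F 0] by (auto simp: dist_commute)
  obtain \<epsilon> where \<epsilon>: "\<epsilon> > 0" "ball w1 \<epsilon> \<subseteq> ball z r"
    using w1 by (meson openE open_ball)
  show ?thesis
  proof (rule hol_in_identity[OF assms(2) w1(1), of "min \<delta> \<epsilon>"])
    show "G x = 0" if "x \<in> ball w1 (min \<delta> \<epsilon>)" for x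
    proof -
      have "x \<in> ball z r" "F x \<noteq> 0" using that \<delta> \<epsilon> by (auto simp: dist_commute)
      then show ?thesis using assms(3)[of x] by simp
    qed
  qed (use \<delta> \<epsilon> w in auto)
qed


subsection \<open>Division by a coordinate\<close>

lemma holomorphic_isCont:
  "f holomorphic_on ball x r \<Longrightarrow> y \<in> ball x r \<Longrightarrow> isCont f y"
  using holomorphic_on_imp_differentiable_at field_differentiable_imp_continuous_at open_ball by blast

text \<open>Riemann's theorem on removable singularities: the zeros of \<open>b\<close> are isolated
  and the quotient is bounded near them. The gain is that the value at the centre is expressed by
  values on a circle free of zeros of \<open>b\<close>.\<close>

lemma bounded_quotient_mean:
  assumes a: "a holomorphic_on ball 0 R" and b: "b holomorphic_on ball 0 R" and \<rho>: "0 < \<rho>" "\<rho> < R"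
    and nz: "\<And>\<zeta>. norm \<zeta> = \<rho> \<Longrightarrow> b \<zeta> \<noteq> 0"
    and bd: "\<And>\<zeta>. \<zeta> \<in> ball 0 R \<Longrightarrow> b \<zeta> \<noteq> 0 \<Longrightarrow> norm (a \<zeta> / b \<zeta>) \<le> C \<zeta>"
    and C: "continuous_on (ball 0 R) C"
  shows "a 0 = integral {0..1} (\<lambda>s. a (circlepath 0 \<rho> s) / b (circlepath 0 \<rho> s)) * b 0"
proof -
  \<comment> \<open>At a zero of \<open>b\<close> the quotient gets its limit, which exists by the
    removable singularity theorem.\<close>
  define h where "h \<zeta> = (if b \<zeta> = 0 then Lim (at \<zeta>) (\<lambda>x. a x / b x) else a \<zeta> / b \<zeta>)" for \<zeta>
  have loc: "h field_differentiable (at \<zeta>) \<and> a \<zeta> = h \<zeta> * b \<zeta>" if \<zeta>: "\<zeta> \<in> ball 0 R" for \<zeta>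
  proof (cases "b \<zeta> = 0")
    case False
    have "isCont b \<zeta>"
      using holomorphic_on_imp_differentiable_at[OF b open_ball \<zeta>] field_differentiable_imp_continuous_at by blast
    then obtain \<delta> where \<delta>: "\<delta> > 0" "\<And>x. dist \<zeta> x < \<delta> \<Longrightarrow> b x \<noteq> 0"
      using False continuous_at_avoid[of \<zeta> b 0] by auto
    have "(\<lambda>x. a x / b x) field_differentiable (at \<zeta>)"
      using a b \<zeta> False by (auto intro!: field_differentiable_divide simp: holomorphic_on_imp_differentiable_at)
    then have "h field_differentiable (at \<zeta>)"
      by (rule field_differentiable_transform_within[OF \<delta>(1), rotated 2])
         (use \<delta> in \<open>auto simp: h_def dist_commute\<close>)
    then show ?thesis using False by (simp add: h_def)
  next
    case True
    obtain r0 where r0: "r0 > 0" "ball \<zeta> r0 \<subseteq> ball 0 R" "\<And>x. x \<in> ball \<zeta> r0 - {\<zeta>} \<Longrightarrow> b x \<noteq> 0"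
    proof -
      \<comment> \<open>A point of the zero-free circle shows that \<open>b\<close> is not
        identically zero, so its zeros are isolated.\<close>
      have nz\<rho>: "b (of_real \<rho>) \<noteq> 0" using nz \<rho> by simp
      show thesis
        by (rule isolated_zeros[OF b open_ball connected_ball \<zeta> True, of "of_real \<rho>"])
           (use \<rho> nz\<rho> in \<open>auto intro: that\<close>)
    qed
    obtain r where r: "0 < r" "r < r0" by (meson r0(1) dense)
    define Q where "Q x = a x / b x" for x
    have holQ: "Q holomorphic_on ball \<zeta> r0 - {\<zeta>}"
      unfolding Q_def using a b r0 by (intro holomorphic_intros) (auto intro: holomorphic_on_subset)
    have "continuous_on (cball \<zeta> r) C"
      using r r0(2) by (intro continuous_on_subset[OF C]) auto
    then have "bounded (C ` cball \<zeta> r)"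
      by (intro compact_imp_bounded compact_continuous_image) auto
    then obtain B where B: "\<And>x. x \<in> cball \<zeta> r \<Longrightarrow> \<bar>C x\<bar> \<le> B"
      unfolding bounded_iff by (metis imageI real_norm_def)
    have "eventually (\<lambda>x. norm (Q x) \<le> B) (at \<zeta>)"
      unfolding eventually_at
    proof (intro exI[of _ r] conjI ballI impI)
      fix x assume "x \<noteq> \<zeta> \<and> dist x \<zeta> < r"
      then have "x \<in> ball \<zeta> r0 - {\<zeta>}" "x \<in> cball \<zeta> r" using r by (auto simp: dist_commute)
      then show "norm (Q x) \<le> B" using bd[of x] r0 B[of x] by (force simp: Q_def)
    qed (use r in auto)
    moreover have "\<zeta> \<in> interior (ball \<zeta> r0)" using r0 by simp
    ultimately obtain g where g: "g holomorphic_on ball \<zeta> r0" "\<And>x. x \<in> ball \<zeta> r0 - {\<zeta>} \<Longrightarrow> g x = Q x"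
      using holomorphic_on_extend_bounded[OF holQ] by blast
    have "g \<midarrow>\<zeta>\<rightarrow> g \<zeta>"
      using holomorphic_isCont[OF g(1)] r0(1) by (simp add: isCont_def)
    then have lim: "Q \<midarrow>\<zeta>\<rightarrow> g \<zeta>"
      by (rule Lim_transform_within[OF _ r0(1)]) (use g(2) in \<open>auto simp: dist_commute\<close>)
    have "h \<zeta> = Lim (at \<zeta>) Q" using True by (simp add: h_def Q_def[abs_def])
    then have h\<zeta>: "h \<zeta> = g \<zeta>" using lim by (simp add: tendsto_Lim)
    have hg: "h x = g x" if "x \<in> ball \<zeta> r0" for x
      using that h\<zeta> g(2)[of x] r0(3)[of x] by (cases "x = \<zeta>") (auto simp: h_def Q_def)
    have 1: "h field_differentiable (at \<zeta>)"
      using holomorphic_transform[OF g(1), of h] hg r0(1)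
      by (intro holomorphic_on_imp_differentiable_at[of _ "ball \<zeta> r0"]) auto
    have "(\<lambda>x. g x * b x) \<midarrow>\<zeta>\<rightarrow> g \<zeta> * b \<zeta>"
      using \<open>g \<midarrow>\<zeta>\<rightarrow> g \<zeta>\<close> holomorphic_isCont[OF b \<zeta>] by (auto intro: tendsto_mult simp: isCont_def)
    then have "a \<midarrow>\<zeta>\<rightarrow> g \<zeta> * b \<zeta>"
      by (rule Lim_transform_within[OF _ r0(1)]) (use g(2) r0(3) in \<open>auto simp: dist_commute Q_def\<close>)
    moreover have "a \<midarrow>\<zeta>\<rightarrow> a \<zeta>"
      using holomorphic_isCont[OF a \<zeta>] by (simp add: isCont_def)
    ultimately have "a \<zeta> = g \<zeta> * b \<zeta>" by (rule LIM_unique[rotated])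
    with 1 h\<zeta> show ?thesis by simp
  qed
  have "h holomorphic_on ball 0 R"
    using loc by (simp add: field_differentiable_at_within holomorphic_on_def)
  from Cauchy_mean[OF this \<rho>, of 0] have "h 0 = integral {0..1} (\<lambda>s. h (circlepath 0 \<rho> s) * circlepath 0 \<rho> s / (circlepath 0 \<rho> s - 0))"
    using \<rho> by simp
  also have "\<dots> = integral {0..1} (\<lambda>s. a (circlepath 0 \<rho> s) / b (circlepath 0 \<rho> s))"
  proof (rule integral_cong)
    fix s
    have "norm (circlepath 0 \<rho> s) = \<rho>" using \<rho> by (simp add: norm_circlepath)
    then show "h (circlepath 0 \<rho> s) * circlepath 0 \<rho> s / (circlepath 0 \<rho> s - 0) = a (circlepath 0 \<rho> s) / b (circlepath 0 \<rho> s)"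
      using nz[of "circlepath 0 \<rho> s"] \<rho> by (auto simp: h_def)
  qed
  finally show ?thesis using loc[of 0] \<rho> by simp
qed

text \<open>Riemann extension in several variables. On the complex line from \<open>z\<close>
  towards \<open>w0\<close> the denominator is not identically zero, so some circle around
  \<open>z\<close> avoids its zeros. The same circle, translated, serves for all \<open>w\<close>
  near \<open>z\<close>, and the mean of \<open>A / B\<close> over it is holomorphic in
  \<open>w\<close>.\<close>

lemma hol_in_division:
  assumes A: "hol_in (ball z r) A" and B: "hol_in (ball z r) B"
    and w0: "w0 \<in> ball z r" "B w0 \<noteq> 0"
    and bd: "\<And>w. w \<in> ball z r \<Longrightarrow> B w \<noteq> 0 \<Longrightarrow> norm (A w / B w) \<le> C w"
    and C: "continuous_on (ball z r) C"
  obtains r' H where "0 < r'" "r' \<le> r" "hol_in (ball z r') H" "\<And>w. w \<in> ball z r' \<Longrightarrow> A w = H w * B w"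
proof -
  have r: "r > 0" using w0 by (metis ball_eq_empty empty_iff linorder_not_le)
  show thesis
  proof (cases "w0 = z")
    case True
    then have "isCont B z" using B w0 cd_isCont unfolding hol_in_def by blast
    then obtain \<delta> where \<delta>: "\<delta> > 0" "\<And>x. dist z x < \<delta> \<Longrightarrow> B x \<noteq> 0"
      using w0 True continuous_at_avoid[of z B 0] by auto
    show thesis
    proof (rule that[of "min r \<delta>" "\<lambda>w. A w / B w"])
      show "hol_in (ball z (min r \<delta>)) (\<lambda>w. A w / B w)"
        using A B \<delta> unfolding hol_in_def by (auto intro!: cd_divide)
    qed (use r \<delta> in auto)
  next
    case False
    define v where "v = w0 - z"
    have v: "0 < norm v" "norm v < r" using False w0 by (auto simp: v_def dist_norm norm_minus_commute)
    define R where "R = r / norm v"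
    have R: "R > 1" using v by (simp add: R_def)
    have holb: "(\<lambda>\<zeta>. B (z + cscale \<zeta> v)) holomorphic_on ball 0 R"
      by (rule hol_in_slice[OF B]) (use v in \<open>simp add: dist_norm norm_cscale R_def field_simps\<close>)
    \<comment> \<open>If \<open>B\<close> vanishes at \<open>z\<close>, the zero is isolated on the
      line, since the parameter 1 gives \<open>w0\<close>, where \<open>B\<close> is
      nonzero.\<close>
    have "\<exists>\<rho>. 0 < \<rho> \<and> \<rho> < 1 \<and> (\<forall>\<zeta>. norm \<zeta> = \<rho> \<longrightarrow> B (z + cscale \<zeta> v) \<noteq> 0)"
    proof (cases "B z = 0")
      case True
      obtain r0 where r0: "r0 > 0" "\<And>x. x \<in> ball 0 r0 - {0} \<Longrightarrow> B (z + cscale x v) \<noteq> 0"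
      proof -
        have nz1: "B (z + cscale 1 v) \<noteq> 0" using w0 by (simp add: v_def)
        show thesis
          by (rule isolated_zeros[OF holb open_ball connected_ball, of 0 1])
             (use R True nz1 in \<open>auto intro: that\<close>)
      qed
      then show ?thesis
      proof (intro exI[of _ "min (1/2) (r0/2)"] conjI allI impI r0(2))
        fix \<zeta> :: complex assume "norm \<zeta> = min (1/2) (r0/2)"
        then show "\<zeta> \<in> ball 0 r0 - {0}" using r0(1) by (auto simp: min_def split: if_splits)
      qed (use r0 in auto)
    next
      case False
      have "isCont B z" using B r cd_isCont[of B z] unfolding hol_in_def by simp
      then obtain \<delta> where \<delta>: "\<delta> > 0" "\<And>x. dist z x < \<delta> \<Longrightarrow> B x \<noteq> 0"
        using False continuous_at_avoid[of z B 0] by auto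
      show ?thesis
        by (intro exI[of _ "min (1/2) (\<delta>/(2 * norm v))"])
           (use \<delta> v in \<open>auto simp: dist_norm norm_cscale min_def field_simps\<close>)
    qed
    then obtain \<rho> where \<rho>: "0 < \<rho>" "\<rho> < 1" "\<And>\<zeta>. norm \<zeta> = \<rho> \<Longrightarrow> B (z + cscale \<zeta> v) \<noteq> 0"
      by blast
    define P where "P = {w \<in> ball z r. B w \<noteq> 0}"
    have opP: "open P"
    proof -
      have "P = ball z r \<inter> B -` (- {0})" by (auto simp: P_def)
      then show ?thesis
        using continuous_open_preimage[OF hol_in_continuous_on[OF B] open_ball, of "-{0}"] by auto
    qed
    \<comment> \<open>By compactness a whole neighbourhood of the circle is free of zeros of
      \<open>B\<close>.\<close>
    have comp: "compact ((\<lambda>\<zeta>. z + cscale \<zeta> v) ` sphere 0 \<rho>)"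
      by (intro compact_continuous_image continuous_intros) auto
    have subP: "(\<lambda>\<zeta>. z + cscale \<zeta> v) ` sphere 0 \<rho> \<subseteq> P"
    proof -
      have "\<rho> * norm v < norm v" using v \<rho> by simp
      then have "norm v * \<rho> < r" using v(2) by (metis mult.commute order_less_trans)
      then show ?thesis using \<rho> by (auto simp: P_def dist_norm norm_cscale mult.commute)
    qed
    obtain \<epsilon> where \<epsilon>: "\<epsilon> > 0" "(\<Union>x\<in>(\<lambda>\<zeta>. z + cscale \<zeta> v) ` sphere 0 \<rho>. ball x \<epsilon>) \<subseteq> P"
      using compact_subset_open_imp_ball_epsilon_subset[OF comp opP subP] by blast
    \<comment> \<open>The bound \<open>\<epsilon>\<close> keeps translated circles off the zeros of
      \<open>B\<close>; the bound \<open>r - norm v\<close> keeps the discs inside the ball.\<close>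
    define r' where "r' = min \<epsilon> (r - norm v)"
    have r': "r' > 0" "r' \<le> r" "r' \<le> r - norm v" "r' \<le> \<epsilon>"
      unfolding r'_def using \<epsilon>(1) v by linarith+
    have inP: "w + cscale (circlepath 0 \<rho> s) v \<in> P" if "w \<in> ball z r'" for w s
    proof -
      have "circlepath 0 \<rho> s \<in> sphere 0 \<rho>" using norm_circlepath[of \<rho> s] \<rho> by simp
      moreover have "w + cscale (circlepath 0 \<rho> s) v \<in> ball (z + cscale (circlepath 0 \<rho> s) v) \<epsilon>"
        using that r' by (simp add: dist_norm)
      ultimately show ?thesis using \<epsilon>(2) by blast
    qed
    define H where "H w = integral {0..1} (\<lambda>s. A (w + cscale (circlepath 0 \<rho> s) v) / B (w + cscale (circlepath 0 \<rho> s) v))" for w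
    show thesis
    proof (rule that[of r' H])
      show "hol_in (ball z r') H"
        unfolding H_def
      proof (rule hol_in_integral)
        have cont: "continuous_on P (\<lambda>x. A x / B x)"
          using hol_in_continuous_on[OF A] hol_in_continuous_on[OF B]
          by (intro continuous_intros) (auto simp: P_def intro: continuous_on_subset)
        have "continuous_on (ball z r' \<times> {0..1}) (\<lambda>x. (\<lambda>x. A x / B x) (fst x + cscale (circlepath 0 \<rho> (snd x)) v))"
          by (rule continuous_on_compose2[OF cont]) (use inP in \<open>auto intro!: continuous_intros\<close>)
        then show "continuous_on (ball z r' \<times> {0..1}) (\<lambda>(w, s). A (w + cscale (circlepath 0 \<rho> s) v) / B (w + cscale (circlepath 0 \<rho> s) v))"
          by (simp add: case_prod_beta)
      next
        fix s :: real
        have tr: "complex_differentiable_at (\<lambda>w. F (w + c)) w" if "complex_differentiable_at F (w + c)"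
          for F and c w :: "'a \<times> 'a"
          by (rule cd_compose[where T = "\<lambda>w. w + c" and T' = "\<lambda>v. v", OF that]) (auto intro!: derivative_eq_intros)
        show "hol_in (ball z r') (\<lambda>w. A (w + cscale (circlepath 0 \<rho> s) v) / B (w + cscale (circlepath 0 \<rho> s) v))"
          unfolding hol_in_def
        proof
          fix w assume "w \<in> ball z r'"
          from inP[OF this, of s] show "complex_differentiable_at (\<lambda>w. A (w + cscale (circlepath 0 \<rho> s) v) / B (w + cscale (circlepath 0 \<rho> s) v)) w"
            using A B unfolding P_def hol_in_def by (intro cd_divide tr) auto
        qed
      qed auto
    next
      fix w assume w: "w \<in> ball z r'"
      \<comment> \<open>The radius of the disc through \<open>w\<close> that surely stays in the
        ball; by the choice of \<open>r'\<close> it exceeds 1, hence \<open>\<rho>\<close>.\<close>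
      define R' where "R' = (r - norm (w - z)) / norm v"
      have nw: "norm (w - z) < r - norm v" using w r' by (simp add: dist_norm norm_minus_commute)
      have "\<rho> * norm v < norm v" using v \<rho> by simp
      then have R': "\<rho> < R'" unfolding R'_def using v(1) nw by (subst pos_less_divide_eq) linarith+
      have sub: "w + cscale \<zeta> v \<in> ball z r" if "\<zeta> \<in> ball 0 R'" for \<zeta>
      proof -
        have "norm \<zeta> * norm v < r - norm (w - z)" using that v by (simp add: R'_def field_simps)
        then show ?thesis using norm_triangle_ineq[of "w - z" "cscale \<zeta> v"]
          by (simp add: dist_norm norm_cscale norm_minus_commute[of z] algebra_simps)
      qed
      have "A (w + cscale 0 v) = integral {0..1} (\<lambda>s. A (w + cscale (circlepath 0 \<rho> s) v) / B (w + cscale (circlepath 0 \<rho> s) v)) * B (w + cscale 0 v)"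
      proof (rule bounded_quotient_mean[where a = "\<lambda>\<zeta>. A (w + cscale \<zeta> v)" and b = "\<lambda>\<zeta>. B (w + cscale \<zeta> v)"])
        show "(\<lambda>\<zeta>. A (w + cscale \<zeta> v)) holomorphic_on ball 0 R'" by (rule hol_in_slice[OF A sub])
        show "(\<lambda>\<zeta>. B (w + cscale \<zeta> v)) holomorphic_on ball 0 R'" by (rule hol_in_slice[OF B sub])
        show "B (w + cscale \<zeta> v) \<noteq> 0" if "norm \<zeta> = \<rho>" for \<zeta>
        proof -
          have "w + cscale \<zeta> v \<in> ball (z + cscale \<zeta> v) \<epsilon>" using w r' by (simp add: dist_norm)
          moreover have "\<zeta> \<in> sphere 0 \<rho>" using that by simp
          ultimately show ?thesis using \<epsilon>(2) unfolding P_def by blast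
        qed
        show "norm (A (w + cscale \<zeta> v) / B (w + cscale \<zeta> v)) \<le> C (w + cscale \<zeta> v)"
          if "\<zeta> \<in> ball 0 R'" "B (w + cscale \<zeta> v) \<noteq> 0" for \<zeta>
          using bd[OF sub[OF that(1)] that(2)] .
        show "continuous_on (ball 0 R') (\<lambda>\<zeta>. C (w + cscale \<zeta> v))"
          by (rule continuous_on_compose2[OF C]) (use sub in \<open>auto intro!: continuous_intros\<close>)
      qed (use \<rho> R' in auto)
      then show "A w = H w * B w" by (simp add: H_def)
    qed (use r' in auto)
  qed
qed


section \<open>Even parts along a normal direction\<close>

text \<open>The two Cauchy kernels for \<open>t\<close> and \<open>-t\<close> add up to an
  expression in \<open>t^2\<close> alone. Replacing \<open>t^2\<close> by \<open>q w\<close> gives a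
  function defined on a full neighbourhood, without a choice of square root. Later \<open>q\<close>
  is the squared normal coordinate and \<open>\<pi>\<close> the projection to the wall.\<close>

lemma hol_in_even_part:
  fixes z :: "'a::euclidean_space \<times> 'a"
  assumes h: "hol_in (ball z r) h" and r: "r > 0"
    and \<pi>: "\<And>w. (\<pi> has_derivative \<pi>') (at w)" "\<And>v. \<pi>' (times_i v) = times_i (\<pi>' v)" "\<pi> z = z"
    and q: "hol_in UNIV q" "q z = 0" and v: "norm v = 1"
  obtains r' G where "0 < r'" "hol_in (ball z r') G"
    "\<And>w t. w \<in> ball z r' \<Longrightarrow> q w = t\<^sup>2 \<Longrightarrow> G w = (h (\<pi> w + cscale t v) + h (\<pi> w + cscale (- t) v)) / 2"
proof -
  define \<rho> where "\<rho> = r / 4"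
  have \<rho>: "\<rho> > 0" "\<rho> < r/2" using r by (auto simp: \<rho>_def)
  define \<gamma> where "\<gamma> s = circlepath 0 \<rho> s" for s
  have n\<gamma>: "norm (\<gamma> s) = \<rho>" for s using norm_circlepath[of \<rho> s] \<rho> by (simp add: \<gamma>_def)
  have cont\<gamma>: "continuous_on S f \<Longrightarrow> continuous_on S (\<lambda>x. \<gamma> (f x))" for S :: "'b::topological_space set" and f
    unfolding \<gamma>_def by (intro continuous_intros)
  have con\<pi>: "isCont \<pi> w" for w using \<pi>(1) has_derivative_continuous by blast
  have conq: "isCont q w" for w using q(1) cd_isCont unfolding hol_in_def by blast
  obtain d1 where d1: "d1 > 0" "\<And>w. dist w z < d1 \<Longrightarrow> dist (\<pi> w) z < r/2"
  proof -
    have "\<exists>d>0. \<forall>w. dist w z < d \<longrightarrow> dist (\<pi> w) (\<pi> z) < r/2"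
      using con\<pi>[of z] half_gt_zero[OF r] unfolding continuous_at_eps_delta by blast
    then show thesis using that \<pi>(3) by metis
  qed
  obtain d2 where d2: "d2 > 0" "\<And>w. dist w z < d2 \<Longrightarrow> norm (q w) < \<rho>\<^sup>2"
  proof -
    have "\<exists>d>0. \<forall>w. dist w z < d \<longrightarrow> dist (q w) (q z) < \<rho>\<^sup>2"
      using conq[of z] zero_less_power[OF \<rho>(1)] unfolding continuous_at_eps_delta by blast
    then show thesis using that q(2) by (metis dist_norm diff_zero)
  qed
  define r' where "r' = min d1 d2"
  have in_ball: "\<pi> w + cscale \<zeta> v \<in> ball z r" if "w \<in> ball z r'" "norm \<zeta> < r/2" for w \<zeta>
  proof -
    have "dist (\<pi> w) z < r/2" using that d1(2)[of w] by (simp add: r'_def dist_commute)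
    then show ?thesis using norm_triangle_ineq[of "\<pi> w - z" "cscale \<zeta> v"] that v
      by (simp add: dist_norm norm_cscale norm_minus_commute[of z] algebra_simps)
  qed
  have qne: "(\<gamma> s)\<^sup>2 - q w \<noteq> 0" if "w \<in> ball z r'" for w s
  proof
    assume "(\<gamma> s)\<^sup>2 - q w = 0"
    then have "norm (q w) = \<rho>\<^sup>2" using n\<gamma>[of s] by (metis eq_iff_diff_eq_0 norm_power)
    then show False using d2(2)[of w] that by (simp add: r'_def dist_commute)
  qed
  define G where "G w = integral {0..1} (\<lambda>s. h (\<pi> w + cscale (\<gamma> s) v) * (\<gamma> s)\<^sup>2 / ((\<gamma> s)\<^sup>2 - q w))" for w
  show thesis
  proof (rule that[of r' G])
    show "r' > 0" using d1 d2 by (simp add: r'_def)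
    show "hol_in (ball z r') G" unfolding G_def
    proof (rule hol_in_integral)
      have "continuous_on (ball z r' \<times> {0..1}) (\<lambda>x. h (\<pi> (fst x) + cscale (\<gamma> (snd x)) v))"
      proof (rule continuous_on_compose2[OF hol_in_continuous_on[OF h]])
        show "continuous_on (ball z r' \<times> {0..1}) (\<lambda>x. \<pi> (fst x) + cscale (\<gamma> (snd x)) v)"
        proof -
          have "continuous_on UNIV \<pi>" using con\<pi> by (simp add: continuous_on_eq_continuous_at)
          then have "continuous_on (ball z r' \<times> {0..1::real}) (\<lambda>x. \<pi> (fst x))"
            by (rule continuous_on_compose2) (auto intro: continuous_on_fst continuous_on_id)
          then show ?thesis
            by (intro continuous_on_add continuous_on_cscale cont\<gamma> continuous_on_snd continuous_on_id continuous_on_const)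
        qed
        show "(\<lambda>x. \<pi> (fst x) + cscale (\<gamma> (snd x)) v) ` (ball z r' \<times> {0..1}) \<subseteq> ball z r"
        proof (rule image_subsetI)
          fix x assume "x \<in> ball z r' \<times> {0..1::real}"
          then have "fst x \<in> ball z r'" by (simp add: mem_Times_iff)
          from in_ball[OF this, of "\<gamma> (snd x)"] show "\<pi> (fst x) + cscale (\<gamma> (snd x)) v \<in> ball z r"
            using n\<gamma> \<rho> by simp
        qed
      qed
      moreover have "continuous_on (ball z r' \<times> {0..1::real}) (\<lambda>x. q (fst x))"
        by (rule continuous_on_compose2[of UNIV q])
           (auto intro: continuous_on_fst continuous_on_id simp: conq continuous_on_eq_continuous_at)
      moreover have fst_in: "fst p \<in> ball z r'" if "p \<in> ball z r' \<times> {0..1::real}" for p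
        using that by (cases p) (simp del: mem_ball)
      ultimately show "continuous_on (ball z r' \<times> {0..1}) (\<lambda>(w, s). h (\<pi> w + cscale (\<gamma> s) v) * (\<gamma> s)\<^sup>2 / ((\<gamma> s)\<^sup>2 - q w))"
        unfolding case_prod_beta
        by (intro continuous_on_divide continuous_on_mult continuous_on_diff continuous_on_power cont\<gamma> continuous_on_snd continuous_on_id ballI qne fst_in)
    next
      fix s :: real
      show "hol_in (ball z r') (\<lambda>w. h (\<pi> w + cscale (\<gamma> s) v) * (\<gamma> s)\<^sup>2 / ((\<gamma> s)\<^sup>2 - q w))"
        unfolding hol_in_def
      proof
        fix w assume w: "w \<in> ball z r'"
        have "\<pi> w + cscale (\<gamma> s) v \<in> ball z r" using in_ball[OF w] n\<gamma> \<rho> by simp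
        then have "complex_differentiable_at h (\<pi> w + cscale (\<gamma> s) v)" using h unfolding hol_in_def by blast
        then have "complex_differentiable_at (\<lambda>w. h (\<pi> w + cscale (\<gamma> s) v)) w"
          by (rule cd_compose[where T' = \<pi>']) (auto intro!: derivative_eq_intros \<pi>(1) simp: \<pi>(2))
        moreover have "complex_differentiable_at q w" using q(1) unfolding hol_in_def by blast
        ultimately show "complex_differentiable_at (\<lambda>w. h (\<pi> w + cscale (\<gamma> s) v) * (\<gamma> s)\<^sup>2 / ((\<gamma> s)\<^sup>2 - q w)) w"
          using qne[OF w] by (intro cd_divide cd_mult cd_const cd_diff)
      qed
    qed simp
  next
    fix w t assume w: "w \<in> ball z r'" and t: "q w = t\<^sup>2"
    define g where "g \<zeta> = h (\<pi> w + cscale \<zeta> v)" for \<zeta>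
    have holg: "g holomorphic_on ball 0 (r/2)" unfolding g_def
      by (rule hol_in_slice[OF h]) (use in_ball[OF w] in auto)
    have nt: "norm t < \<rho>"
    proof -
      have "dist w z < d2" using w by (simp add: r'_def dist_commute)
      then have "norm (t\<^sup>2) < \<rho>\<^sup>2" unfolding t[symmetric] by (rule d2(2))
      then have "(norm t)\<^sup>2 < \<rho>\<^sup>2" unfolding norm_power .
      then show ?thesis using \<rho>(1) by (meson less_imp_le power2_less_imp_less)
    qed
    have ne: "\<gamma> s - t \<noteq> 0" "\<gamma> s + t \<noteq> 0" for s
      using n\<gamma>[of s] nt by (auto simp: add_eq_0_iff2)
    have contg: "continuous_on {0..1} (\<lambda>s. g (\<gamma> s))"
      by (rule continuous_on_compose2[OF holomorphic_on_imp_continuous_on[OF holg]])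
         (use n\<gamma> \<rho> in \<open>auto intro!: cont\<gamma> continuous_intros\<close>)
    have int: "(\<lambda>s. g (\<gamma> s) * \<gamma> s / (\<gamma> s - t)) integrable_on {0..1}" "(\<lambda>s. g (\<gamma> s) * \<gamma> s / (\<gamma> s + t)) integrable_on {0..1}"
      by (intro integrable_continuous_interval continuous_on_divide continuous_on_mult continuous_on_diff continuous_on_add
          cont\<gamma> contg continuous_on_id continuous_on_const ballI ne)+
    have "g t + g (- t) = integral {0..1} (\<lambda>s. g (\<gamma> s) * \<gamma> s / (\<gamma> s - t)) + integral {0..1} (\<lambda>s. g (\<gamma> s) * \<gamma> s / (\<gamma> s + t))"
      using Cauchy_mean[OF holg \<rho>, of t] Cauchy_mean[OF holg \<rho>, of "-t"] nt by (simp add: \<gamma>_def)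
    also have "\<dots> = integral {0..1} (\<lambda>s. g (\<gamma> s) * \<gamma> s / (\<gamma> s - t) + g (\<gamma> s) * \<gamma> s / (\<gamma> s + t))"
      by (rule integral_add[symmetric, OF int])
    also have "\<dots> = integral {0..1} (\<lambda>s. 2 * (g (\<gamma> s) * (\<gamma> s)\<^sup>2 / ((\<gamma> s)\<^sup>2 - q w)))"
    proof (rule integral_cong)
      fix s
      have "(\<gamma> s)\<^sup>2 - q w = (\<gamma> s - t) * (\<gamma> s + t)" by (simp add: t power2_eq_square algebra_simps)
      moreover have "g (\<gamma> s) * \<gamma> s / (\<gamma> s - t) + g (\<gamma> s) * \<gamma> s / (\<gamma> s + t) =
          (g (\<gamma> s) * \<gamma> s * (\<gamma> s + t) + g (\<gamma> s) * \<gamma> s * (\<gamma> s - t)) / ((\<gamma> s - t) * (\<gamma> s + t))"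
        by (rule add_frac_eq[OF ne])
      moreover have "g (\<gamma> s) * \<gamma> s * (\<gamma> s + t) + g (\<gamma> s) * \<gamma> s * (\<gamma> s - t) = 2 * (g (\<gamma> s) * (\<gamma> s)\<^sup>2)"
        by (simp add: algebra_simps power2_eq_square)
      ultimately show "g (\<gamma> s) * \<gamma> s / (\<gamma> s - t) + g (\<gamma> s) * \<gamma> s / (\<gamma> s + t) = 2 * (g (\<gamma> s) * (\<gamma> s)\<^sup>2 / ((\<gamma> s)\<^sup>2 - q w))"
        by simp
    qed
    also have "\<dots> = 2 * G w" unfolding G_def g_def by (rule integral_mult_right)
    finally show "G w = (h (\<pi> w + cscale t v) + h (\<pi> w + cscale (- t) v)) / 2"
      by (simp add: g_def)
  qed
qed

subsection \<open>Integral closure in the fraction field\<close>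

context domain
begin

lemma fraction_eq_set:
  assumes "a \<in> carrier R" "b \<in> carrier R - {\<zero>}"
  shows "fraction R a b = {(c, d). c \<in> carrier R \<and> d \<in> carrier R - {\<zero>} \<and> a \<otimes> d = c \<otimes> b}"
  using assms by (auto simp: fraction_def frac_rel_def)

lemma frac_trans:
  assumes "a \<in> carrier R" "b \<in> carrier R - {\<zero>}" "c \<in> carrier R" "d \<in> carrier R - {\<zero>}"
    "e \<in> carrier R" "f \<in> carrier R - {\<zero>}" "a \<otimes> d = c \<otimes> b" "c \<otimes> f = e \<otimes> d"
  shows "a \<otimes> f = e \<otimes> b"
proof -
  have cc: "a \<in> carrier R" "b \<in> carrier R" "c \<in> carrier R" "d \<in> carrier R" "e \<in> carrier R" "f \<in> carrier R"
    using assms by auto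
  have "d \<otimes> (a \<otimes> f) = (a \<otimes> d) \<otimes> f" using cc by (simp add: m_ac)
  also have "\<dots> = (c \<otimes> f) \<otimes> b" unfolding assms(7) using cc by (simp add: m_ac)
  also have "\<dots> = d \<otimes> (e \<otimes> b)" unfolding assms(8) using cc by (simp add: m_ac)
  finally show ?thesis using assms m_lcancel[of d "a \<otimes> f" "e \<otimes> b"] by simp
qed

lemma fraction_eq_iff:
  assumes "a \<in> carrier R" "b \<in> carrier R - {\<zero>}" "c \<in> carrier R" "d \<in> carrier R - {\<zero>}"
  shows "fraction R a b = fraction R c d \<longleftrightarrow> a \<otimes> d = c \<otimes> b"
proof
  assume "fraction R a b = fraction R c d"
  moreover have "(c, d) \<in> fraction R c d" using assms by (simp add: fraction_eq_set)
  ultimately have "(c, d) \<in> fraction R a b" by simp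
  then show "a \<otimes> d = c \<otimes> b" using assms by (simp add: fraction_eq_set)
next
  assume eq: "a \<otimes> d = c \<otimes> b"
  have "a \<otimes> y = x \<otimes> b \<longleftrightarrow> c \<otimes> y = x \<otimes> d" if "x \<in> carrier R" "y \<in> carrier R - {\<zero>}" for x y
    using frac_trans[OF assms(3,4,1,2) that eq[symmetric]] frac_trans[OF assms(1-4) that eq] by blast
  then show "fraction R a b = fraction R c d"
    unfolding fraction_eq_set[OF assms(1,2)] fraction_eq_set[OF assms(3,4)] by blast
qed

lemma fraction_self: "a \<in> carrier R \<Longrightarrow> b \<in> carrier R - {\<zero>} \<Longrightarrow> (a, b) \<in> fraction R a b"
  by (simp add: fraction_eq_set)

text \<open>\<open>fraction_field\<close> multiplies classes by a union over all pairs of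
  representatives. The point is that all members of this union coincide; the same holds for
  addition.\<close>

lemma fraction_mult:
  assumes "a \<in> carrier R" "b \<in> carrier R - {\<zero>}" "c \<in> carrier R" "d \<in> carrier R - {\<zero>}"
  shows "fraction R a b \<otimes>\<^bsub>fraction_field R\<^esub> fraction R c d = fraction R (a \<otimes> c) (b \<otimes> d)"
proof -
  have eq: "fraction R (p \<otimes> r) (q \<otimes> s) = fraction R (a \<otimes> c) (b \<otimes> d)"
    if "(p, q) \<in> fraction R a b" "(r, s) \<in> fraction R c d" for p q r s
  proof -
    note 1 = that[unfolded fraction_eq_set[OF assms(1,2)] fraction_eq_set[OF assms(3,4)]]
    have cc: "a \<in> carrier R" "b \<in> carrier R" "c \<in> carrier R" "d \<in> carrier R"
      "p \<in> carrier R" "q \<in> carrier R" "r \<in> carrier R" "s \<in> carrier R" using 1 assms by auto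
    have "p \<otimes> r \<otimes> (b \<otimes> d) = (p \<otimes> b) \<otimes> (r \<otimes> d)" using cc by (simp add: m_ac)
    also have "\<dots> = (a \<otimes> q) \<otimes> (c \<otimes> s)" using 1 by simp
    also have "\<dots> = a \<otimes> c \<otimes> (q \<otimes> s)" using cc by (simp add: m_ac)
    finally show ?thesis using 1 assms by (subst fraction_eq_iff) (auto simp: integral_iff)
  qed
  have "fraction R a b \<otimes>\<^bsub>fraction_field R\<^esub> fraction R c d =
     (\<Union>(p, q)\<in>fraction R a b. \<Union>(r, s)\<in>fraction R c d. fraction R (a \<otimes> c) (b \<otimes> d))"
    unfolding fraction_field_def by (auto intro!: SUP_cong dest: eq)
  then show ?thesis using fraction_self assms by auto
qed

lemma fraction_add:
  assumes "a \<in> carrier R" "b \<in> carrier R - {\<zero>}" "c \<in> carrier R" "d \<in> carrier R - {\<zero>}"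
  shows "fraction R a b \<oplus>\<^bsub>fraction_field R\<^esub> fraction R c d = fraction R (a \<otimes> d \<oplus> c \<otimes> b) (b \<otimes> d)"
proof -
  have eq: "fraction R (p \<otimes> s \<oplus> r \<otimes> q) (q \<otimes> s) = fraction R (a \<otimes> d \<oplus> c \<otimes> b) (b \<otimes> d)"
    if "(p, q) \<in> fraction R a b" "(r, s) \<in> fraction R c d" for p q r s
  proof -
    note 1 = that[unfolded fraction_eq_set[OF assms(1,2)] fraction_eq_set[OF assms(3,4)]]
    have cc: "a \<in> carrier R" "b \<in> carrier R" "c \<in> carrier R" "d \<in> carrier R"
      "p \<in> carrier R" "q \<in> carrier R" "r \<in> carrier R" "s \<in> carrier R" using 1 assms by auto
    have "(p \<otimes> s \<oplus> r \<otimes> q) \<otimes> (b \<otimes> d) = (p \<otimes> b) \<otimes> (s \<otimes> d) \<oplus> (r \<otimes> d) \<otimes> (q \<otimes> b)"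
      using cc by (simp add: m_ac l_distr r_distr)
    also have "\<dots> = (a \<otimes> q) \<otimes> (s \<otimes> d) \<oplus> (c \<otimes> s) \<otimes> (q \<otimes> b)" using 1 by simp
    also have "\<dots> = (a \<otimes> d \<oplus> c \<otimes> b) \<otimes> (q \<otimes> s)" using cc by (simp add: m_ac l_distr r_distr)
    finally show ?thesis using 1 assms by (subst fraction_eq_iff) (auto simp: integral_iff)
  qed
  have "fraction R a b \<oplus>\<^bsub>fraction_field R\<^esub> fraction R c d =
     (\<Union>(p, q)\<in>fraction R a b. \<Union>(r, s)\<in>fraction R c d. fraction R (a \<otimes> d \<oplus> c \<otimes> b) (b \<otimes> d))"
    unfolding fraction_field_def by (auto intro!: SUP_cong dest: eq)
  then show ?thesis using fraction_self assms by auto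
qed

lemma fraction_in [intro]:
  "a \<in> carrier R \<Longrightarrow> b \<in> carrier R - {\<zero>} \<Longrightarrow> fraction R a b \<in> carrier (fraction_field R)"
  by (auto simp: fraction_field_def)

lemma fraction_cases:
  assumes "x \<in> carrier (fraction_field R)"
  obtains a b where "a \<in> carrier R" "b \<in> carrier R - {\<zero>}" "x = fraction R a b"
  using assms by (auto simp: fraction_field_def)

lemma fraction_field_one: "\<one>\<^bsub>fraction_field R\<^esub> = fraction R \<one> \<one>"
  and fraction_field_zero: "\<zero>\<^bsub>fraction_field R\<^esub> = fraction R \<zero> \<one>"
  by (simp_all add: fraction_field_def)

lemma prod_nonzero: "b \<in> carrier R - {\<zero>} \<Longrightarrow> d \<in> carrier R - {\<zero>} \<Longrightarrow> b \<otimes> d \<in> carrier R - {\<zero>}"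
  using integral by blast

lemma one_nonzero: "\<one> \<in> carrier R - {\<zero>}"
  by simp

lemma fraction_field_cring: "cring (fraction_field R)"
proof (rule cringI)
  let ?F = "fraction_field R"
  note sm = fraction_mult fraction_add fraction_field_one fraction_field_zero
  show "abelian_group ?F"
  proof (rule abelian_groupI)
    fix x y z assume x: "x \<in> carrier ?F" and y: "y \<in> carrier ?F" and z: "z \<in> carrier ?F"
    obtain a b c d e f where xyz: "a \<in> carrier R" "b \<in> carrier R - {\<zero>}" "x = fraction R a b"
      "c \<in> carrier R" "d \<in> carrier R - {\<zero>}" "y = fraction R c d"
      "e \<in> carrier R" "f \<in> carrier R - {\<zero>}" "z = fraction R e f"
      using x y z by (metis fraction_cases)
    have c: "a \<in> carrier R" "b \<in> carrier R" "c \<in> carrier R" "d \<in> carrier R" "e \<in> carrier R" "f \<in> carrier R"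
      using xyz by auto
    show "(x \<oplus>\<^bsub>?F\<^esub> y) \<oplus>\<^bsub>?F\<^esub> z = x \<oplus>\<^bsub>?F\<^esub> (y \<oplus>\<^bsub>?F\<^esub> z)"
    proof -
      have "(x \<oplus>\<^bsub>?F\<^esub> y) \<oplus>\<^bsub>?F\<^esub> z = fraction R ((a \<otimes> d \<oplus> c \<otimes> b) \<otimes> f \<oplus> e \<otimes> (b \<otimes> d)) (b \<otimes> d \<otimes> f)"
        using xyz prod_nonzero by (simp add: fraction_add)
      also have "\<dots> = fraction R (a \<otimes> (d \<otimes> f) \<oplus> (c \<otimes> f \<oplus> e \<otimes> d) \<otimes> b) (b \<otimes> (d \<otimes> f))"
        using c by (simp add: l_distr r_distr m_ac a_ac)
      also have "\<dots> = x \<oplus>\<^bsub>?F\<^esub> (y \<oplus>\<^bsub>?F\<^esub> z)"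
        using xyz prod_nonzero by (simp add: fraction_add)
      finally show ?thesis .
    qed
  next
    fix x y assume x: "x \<in> carrier ?F" and y: "y \<in> carrier ?F"
    obtain a b c d where xyz: "a \<in> carrier R" "b \<in> carrier R - {\<zero>}" "x = fraction R a b"
      "c \<in> carrier R" "d \<in> carrier R - {\<zero>}" "y = fraction R c d"
      using x y by (metis fraction_cases)
    show "x \<oplus>\<^bsub>?F\<^esub> y = y \<oplus>\<^bsub>?F\<^esub> x"
      using xyz by (simp add: fraction_add m_comm a_comm)
    show "x \<oplus>\<^bsub>?F\<^esub> y \<in> carrier ?F"
      using xyz prod_nonzero by (simp add: fraction_add) blast
  next
    show "\<zero>\<^bsub>?F\<^esub> \<in> carrier ?F" using one_nonzero by (auto simp: fraction_field_zero)
  next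
    fix x assume x: "x \<in> carrier ?F"
    obtain a b where xyz: "a \<in> carrier R" "b \<in> carrier R - {\<zero>}" "x = fraction R a b"
      using x by (metis fraction_cases)
    show "\<zero>\<^bsub>?F\<^esub> \<oplus>\<^bsub>?F\<^esub> x = x"
      using xyz one_nonzero by (simp add: fraction_add fraction_field_zero)
    have "fraction R (\<ominus> a) b \<oplus>\<^bsub>?F\<^esub> x = \<zero>\<^bsub>?F\<^esub>"
    proof -
      have "\<ominus> a \<otimes> b \<oplus> a \<otimes> b = \<zero>" using xyz by (simp add: l_minus l_neg)
      then show ?thesis using xyz one_nonzero prod_nonzero
        by (simp add: fraction_add fraction_field_zero fraction_eq_iff)
    qed
    then show "\<exists>y\<in>carrier ?F. y \<oplus>\<^bsub>?F\<^esub> x = \<zero>\<^bsub>?F\<^esub>"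
      using xyz by (intro bexI[of _ "fraction R (\<ominus> a) b"]) auto
  qed
  show "comm_monoid ?F"
  proof (rule comm_monoidI)
    fix x y z assume x: "x \<in> carrier ?F" and y: "y \<in> carrier ?F" and z: "z \<in> carrier ?F"
    obtain a b c d e f where xyz: "a \<in> carrier R" "b \<in> carrier R - {\<zero>}" "x = fraction R a b"
      "c \<in> carrier R" "d \<in> carrier R - {\<zero>}" "y = fraction R c d"
      "e \<in> carrier R" "f \<in> carrier R - {\<zero>}" "z = fraction R e f"
      using x y z by (metis fraction_cases)
    show "x \<otimes>\<^bsub>?F\<^esub> y \<otimes>\<^bsub>?F\<^esub> z = x \<otimes>\<^bsub>?F\<^esub> (y \<otimes>\<^bsub>?F\<^esub> z)"
      using xyz prod_nonzero by (simp add: fraction_mult m_assoc)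
  next
    fix x y assume x: "x \<in> carrier ?F" and y: "y \<in> carrier ?F"
    obtain a b c d where xyz: "a \<in> carrier R" "b \<in> carrier R - {\<zero>}" "x = fraction R a b"
      "c \<in> carrier R" "d \<in> carrier R - {\<zero>}" "y = fraction R c d"
      using x y by (metis fraction_cases)
    show "x \<otimes>\<^bsub>?F\<^esub> y = y \<otimes>\<^bsub>?F\<^esub> x"
      using xyz by (simp add: fraction_mult m_comm)
    show "x \<otimes>\<^bsub>?F\<^esub> y \<in> carrier ?F"
      using xyz prod_nonzero by (simp add: fraction_mult) blast
  next
    show "\<one>\<^bsub>?F\<^esub> \<in> carrier ?F" using one_nonzero by (auto simp: fraction_field_one)
  next
    fix x assume x: "x \<in> carrier ?F"
    then show "\<one>\<^bsub>?F\<^esub> \<otimes>\<^bsub>?F\<^esub> x = x"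
      using one_nonzero by (elim fraction_cases) (simp add: fraction_mult fraction_field_one)
  qed
  fix x y z assume x: "x \<in> carrier ?F" and y: "y \<in> carrier ?F" and z: "z \<in> carrier ?F"
  obtain a b c d e f where xyz: "a \<in> carrier R" "b \<in> carrier R - {\<zero>}" "x = fraction R a b"
    "c \<in> carrier R" "d \<in> carrier R - {\<zero>}" "y = fraction R c d"
    "e \<in> carrier R" "f \<in> carrier R - {\<zero>}" "z = fraction R e f"
    using x y z by (metis fraction_cases)
  have c: "a \<in> carrier R" "b \<in> carrier R" "c \<in> carrier R" "d \<in> carrier R" "e \<in> carrier R" "f \<in> carrier R"
    using xyz by auto
  have "(x \<oplus>\<^bsub>?F\<^esub> y) \<otimes>\<^bsub>?F\<^esub> z = fraction R ((a \<otimes> d \<oplus> c \<otimes> b) \<otimes> e) (b \<otimes> d \<otimes> f)"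
    using xyz prod_nonzero by (simp add: fraction_add fraction_mult)
  also have "\<dots> = fraction R (a \<otimes> e \<otimes> (d \<otimes> f) \<oplus> c \<otimes> e \<otimes> (b \<otimes> f)) (b \<otimes> f \<otimes> (d \<otimes> f))"
    using xyz prod_nonzero c by (subst fraction_eq_iff) (auto simp: l_distr r_distr m_ac)
  also have "\<dots> = x \<otimes>\<^bsub>?F\<^esub> z \<oplus>\<^bsub>?F\<^esub> y \<otimes>\<^bsub>?F\<^esub> z"
    using xyz prod_nonzero by (simp add: fraction_add fraction_mult)
  finally show "(x \<oplus>\<^bsub>?F\<^esub> y) \<otimes>\<^bsub>?F\<^esub> z = x \<otimes>\<^bsub>?F\<^esub> z \<oplus>\<^bsub>?F\<^esub> y \<otimes>\<^bsub>?F\<^esub> z" .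
qed

text \<open>The numerator over \<open>b ^ length cs\<close> of the value at \<open>a / b\<close> of the polynomial with
  coefficients \<open>cs\<close>.\<close>

fun homog :: "'a \<Rightarrow> 'a \<Rightarrow> 'a list \<Rightarrow> 'a"
  where "homog a b [] = \<zero>"
  | "homog a b (c # cs) = b \<otimes> (c \<otimes> a [^] length cs \<oplus> homog a b cs)"

lemma homog_closed:
  "a \<in> carrier R \<Longrightarrow> b \<in> carrier R \<Longrightarrow> set cs \<subseteq> carrier R \<Longrightarrow> homog a b cs \<in> carrier R"
  by (induction cs) auto

lemma nat_pow_nonzero: "b \<in> carrier R - {\<zero>} \<Longrightarrow> b [^] (n::nat) \<in> carrier R - {\<zero>}"
  by (induction n) (auto simp: integral_iff)

lemma fraction_pow:
  assumes "a \<in> carrier R" "b \<in> carrier R - {\<zero>}"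
  shows "fraction R a b [^]\<^bsub>fraction_field R\<^esub> (n::nat) = fraction R (a [^] n) (b [^] n)"
proof -
  interpret F: cring "fraction_field R" by (rule fraction_field_cring)
  show ?thesis
    using assms nat_pow_nonzero[OF assms(2)] by (induction n) (auto simp: fraction_field_one fraction_mult)
qed

lemma fraction_cancel:
  assumes "a \<in> carrier R" "b \<in> carrier R - {\<zero>}" "c \<in> carrier R - {\<zero>}"
  shows "fraction R (c \<otimes> a) (c \<otimes> b) = fraction R a b"
  using assms prod_nonzero by (subst fraction_eq_iff) (auto simp: m_ac)

text \<open>Denominators are cleared, so that integrality over \<open>R\<close> becomes an equation
  between elements of \<open>R\<close>.\<close>

lemma eval_fraction:
  assumes a: "a \<in> carrier R" and b: "b \<in> carrier R - {\<zero>}" and cs: "set cs \<subseteq> carrier R"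
  shows "ring.eval (fraction_field R) (map (\<lambda>c. fraction R c \<one>) cs) (fraction R a b) =
    fraction R (homog a b cs) (b [^] length cs)"
proof -
  interpret F: cring "fraction_field R" by (rule fraction_field_cring)
  show ?thesis
    using cs
  proof (induction cs)
    case Nil
    then show ?case by (simp add: fraction_field_zero)
  next
    case (Cons c cs)
    let ?n = "length cs" let ?N = "homog a b cs"
    have bn: "b [^] ?n \<in> carrier R - {\<zero>}" "b [^] ?n \<in> carrier R" "b \<in> carrier R"
      using nat_pow_nonzero[OF b] b by auto
    have N: "?N \<in> carrier R" using Cons.prems a b by (simp add: homog_closed)
    have c: "c \<in> carrier R" using Cons.prems by simp
    have "ring.eval (fraction_field R) (map (\<lambda>c. fraction R c \<one>) (c # cs)) (fraction R a b) =
        fraction R c \<one> \<otimes>\<^bsub>fraction_field R\<^esub> fraction R (a [^] ?n) (b [^] ?n) \<oplus>\<^bsub>fraction_field R\<^esub> fraction R ?N (b [^] ?n)"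
      using Cons.IH Cons.prems fraction_pow[OF a b] by simp
    also have "\<dots> = fraction R (b [^] ?n \<otimes> (c \<otimes> a [^] ?n \<oplus> ?N)) (b [^] ?n \<otimes> b [^] ?n)"
      using a c N bn one_nonzero by (simp add: fraction_mult fraction_add r_distr m_comm)
    also have "\<dots> = fraction R (c \<otimes> a [^] ?n \<oplus> ?N) (b [^] ?n)"
      using a c N bn by (intro fraction_cancel) auto
    also have "\<dots> = fraction R (b \<otimes> (c \<otimes> a [^] ?n \<oplus> ?N)) (b \<otimes> b [^] ?n)"
      using a b c N bn by (intro fraction_cancel[symmetric]) auto
    finally show ?case using bn by (simp add: m_comm)
  qed
qed

lemma fraction_zero: "b \<in> carrier R - {\<zero>} \<Longrightarrow> fraction R \<zero> b = fraction R \<zero> \<one>"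
  using one_nonzero by (subst fraction_eq_iff) auto

lemma integral_closureI:
  assumes "x \<in> carrier (fraction_field R)" "set cs \<subseteq> carrier R"
    "ring.eval (fraction_field R) (map (\<lambda>c. fraction R c \<one>) (\<one> # cs)) x = \<zero>\<^bsub>fraction_field R\<^esub>"
  shows "x \<in> integral_closure R"
proof -
  let ?p = "map (\<lambda>c. fraction R c \<one>) (\<one> # cs)"
  have "fraction R \<one> \<one> \<noteq> fraction R \<zero> \<one>"
    using one_nonzero by (subst fraction_eq_iff) auto
  then have "hd ?p \<noteq> \<zero>\<^bsub>fraction_field R\<^esub>" by (simp add: fraction_field_zero)
  moreover have "set ?p \<subseteq> embedded R" using assms(2) by (auto simp: embedded_def)
  ultimately have "polynomial\<^bsub>fraction_field R\<^esub> (embedded R) ?p"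
    unfolding polynomial_def by blast
  moreover have "?p \<noteq> []" "hd ?p = \<one>\<^bsub>fraction_field R\<^esub>" by (simp_all add: fraction_field_one)
  ultimately show ?thesis using assms unfolding integral_closure_def by blast
qed

text \<open>The equation in the hypothesis is the monic equation of degree \<open>length cs\<close>
  for \<open>a / b\<close>, multiplied by \<open>b [^] length cs\<close>. The numerator of
  \<open>\<one> # cs\<close> carries one more factor \<open>b\<close>, which is cancelled.\<close>

lemma integrally_closed_domainI:
  assumes "\<And>a b cs. a \<in> carrier R \<Longrightarrow> b \<in> carrier R - {\<zero>} \<Longrightarrow> set cs \<subseteq> carrier R \<Longrightarrow>
    a [^] length cs \<oplus> homog a b cs = \<zero> \<Longrightarrow> \<exists>h\<in>carrier R. a = h \<otimes> b"
  shows "integrally_closed_domain R"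
  unfolding integrally_closed_domain_def
proof (intro conjI equalityI subsetI)
  interpret F: cring "fraction_field R" by (rule fraction_field_cring)
  show "domain R" by (rule domain_axioms)
  {
    fix x assume "x \<in> integral_closure R"
    then obtain p where x: "x \<in> carrier (fraction_field R)"
      and p: "polynomial\<^bsub>fraction_field R\<^esub> (embedded R) p" "p \<noteq> []"
        "hd p = \<one>\<^bsub>fraction_field R\<^esub>" "ring.eval (fraction_field R) p x = \<zero>\<^bsub>fraction_field R\<^esub>"
      unfolding integral_closure_def by auto
    obtain a b where ab: "a \<in> carrier R" "b \<in> carrier R - {\<zero>}" "x = fraction R a b"
      using x by (rule fraction_cases)
    have "set (tl p) \<subseteq> embedded R" using p(1,2) by (cases p) (auto simp: polynomial_def)
    then obtain cs where cs: "set cs \<subseteq> carrier R" "tl p = map (\<lambda>c. fraction R c \<one>) cs"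
    proof -
      have "tl p \<in> lists ((\<lambda>c. fraction R c \<one>) ` carrier R)"
        using \<open>set (tl p) \<subseteq> embedded R\<close> by (auto simp: embedded_def in_lists_conv_set)
      then show thesis using that unfolding lists_image by (auto simp: in_lists_conv_set subset_iff)
    qed
    \<comment> \<open>Coefficient lists start with the leading coefficient, so a monic polynomial
      has the form \<open>\<one> # cs\<close>.\<close>
    have p_eq: "p = map (\<lambda>c. fraction R c \<one>) (\<one> # cs)"
      using p(2,3) cs(2) by (cases p) (auto simp: fraction_field_one)
    have s: "set (\<one> # cs) \<subseteq> carrier R" using cs(1) by simp
    have H: "homog a b (\<one> # cs) \<in> carrier R" using ab s homog_closed by blast
    have "fraction R (homog a b (\<one> # cs)) (b [^] length (\<one> # cs)) = fraction R \<zero> \<one>"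
      using p(4) eval_fraction[OF ab(1,2) s] by (simp only: p_eq ab(3) fraction_field_zero)
    then have "homog a b (\<one> # cs) \<otimes> \<one> = \<zero> \<otimes> b [^] length (\<one> # cs)"
      using fraction_eq_iff[OF H nat_pow_nonzero[OF ab(2)] zero_closed one_nonzero] by blast
    then have "homog a b (\<one> # cs) = \<zero>"
      using H nat_pow_nonzero[OF ab(2), of "length (\<one> # cs)"] by (simp only: r_one l_null DiffD1)
    then have "a [^] length cs \<oplus> homog a b cs = \<zero>"
      using ab homog_closed[OF ab(1) _ cs(1), of b] by (simp add: integral_iff)
    then obtain h where h: "h \<in> carrier R" "a = h \<otimes> b"
      using assms[OF ab(1,2) cs(1)] by blast
    then have "x = fraction R h \<one>"
      using ab one_nonzero by (simp add: fraction_eq_iff)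
    then show "x \<in> embedded R" using h by (auto simp: embedded_def)
  }
  fix x assume "x \<in> embedded R"
  then obtain c where c: "c \<in> carrier R" "x = fraction R c \<one>" by (auto simp: embedded_def)
  let ?p = "map (\<lambda>c. fraction R c \<one>) [\<one>, \<ominus> c]"
  have ne: "fraction R \<one> \<one> \<noteq> fraction R \<zero> \<one>"
    using one_nonzero by (subst fraction_eq_iff) auto
  have "ring.eval (fraction_field R) ?p x = fraction R (homog c \<one> [\<one>, \<ominus> c]) (\<one> [^] length [\<one>, \<ominus> c])"
    unfolding c(2) using c one_nonzero by (intro eval_fraction) auto
  also have "\<dots> = \<zero>\<^bsub>fraction_field R\<^esub>"
    using c by (simp add: fraction_field_zero r_neg)
  finally show "x \<in> integral_closure R"
    using c one_nonzero by (intro integral_closureI[of _ "[\<ominus> c]"]) (auto simp: c(2))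
qed

text \<open>\<open>a / b\<close> is a root of the monic polynomial \<open>X^2 - q\<close>. This
  instance of integrality detects a missing reflection.\<close>

lemma integrally_closed_square:
  assumes ic: "integrally_closed_domain R" and a: "a \<in> carrier R" and b: "b \<in> carrier R - {\<zero>}"
    and q: "q \<in> carrier R" and eq: "a \<otimes> a = q \<otimes> (b \<otimes> b)"
  shows "\<exists>h\<in>carrier R. a = h \<otimes> b"
proof -
  let ?x = "fraction R a b"
  let ?p = "map (\<lambda>c. fraction R c \<one>) [\<one>, \<zero>, \<ominus> q]"
  have ne: "fraction R \<one> \<one> \<noteq> fraction R \<zero> \<one>"
    using one_nonzero by (subst fraction_eq_iff) auto
  have "homog a b [\<one>, \<zero>, \<ominus> q] = b \<otimes> (a \<otimes> a \<oplus> b \<otimes> (b \<otimes> (\<ominus> q)))"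
    using a b q by (simp add: numeral_2_eq_2)
  also have "a \<otimes> a \<oplus> b \<otimes> (b \<otimes> (\<ominus> q)) = \<zero>"
    unfolding eq using b q by (simp add: m_ac r_minus l_minus r_neg)
  finally have h0: "homog a b [\<one>, \<zero>, \<ominus> q] = \<zero>" using b by simp
  have "ring.eval (fraction_field R) ?p ?x = fraction R (homog a b [\<one>, \<zero>, \<ominus> q]) (b [^] length [\<one>, \<zero>, \<ominus> q])"
    using a b q by (intro eval_fraction) auto
  also have "\<dots> = \<zero>\<^bsub>fraction_field R\<^esub>"
    unfolding h0 fraction_field_zero by (rule fraction_zero[OF nat_pow_nonzero[OF b]])
  finally have "?x \<in> integral_closure R"
    using a b q by (intro integral_closureI[of _ "[\<zero>, \<ominus> q]"]) auto
  then have "?x \<in> embedded R" using ic by (simp add: integrally_closed_domain_def)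
  then obtain h where h: "h \<in> carrier R" "?x = fraction R h \<one>" by (auto simp: embedded_def)
  then have "a = h \<otimes> b" using a b one_nonzero by (simp add: fraction_eq_iff)
  then show ?thesis using h by blast
qed

text \<open>The integral closure is the embedded copy of \<open>R\<close>. A proper ideal of it
  contains no unit, so it lies in the image of \<open>I\<close>, which is therefore the unique
  maximal ideal.\<close>

lemma integrally_closed_unibranch:
  assumes ic: "integrally_closed_domain R" and I: "ideal I R" and "\<one> \<notin> I"
    and units: "\<And>a. a \<in> carrier R - I \<Longrightarrow> \<exists>b\<in>carrier R. b \<otimes> a = \<one>"
  shows "unibranch_ring R"
proof -
  let ?\<phi> = "\<lambda>a. fraction R a \<one>"
  define S where "S = (fraction_field R)\<lparr>carrier := integral_closure R\<rparr>"
  have carr: "carrier S = ?\<phi> ` carrier R"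
    using ic by (simp add: S_def integrally_closed_domain_def embedded_def)
  have inj: "?\<phi> a = ?\<phi> b \<longleftrightarrow> a = b" if "a \<in> carrier R" "b \<in> carrier R" for a b
    using that one_nonzero by (simp add: fraction_eq_iff)
  have ops: "?\<phi> a \<otimes>\<^bsub>S\<^esub> ?\<phi> b = ?\<phi> (a \<otimes> b)" "?\<phi> a \<oplus>\<^bsub>S\<^esub> ?\<phi> b = ?\<phi> (a \<oplus> b)"
    if "a \<in> carrier R" "b \<in> carrier R" for a b
    using that one_nonzero by (simp_all add: S_def fraction_mult fraction_add)
  have oneS: "\<one>\<^bsub>S\<^esub> = ?\<phi> \<one>" by (simp add: S_def fraction_field_one)
  have hom: "?\<phi> \<in> ring_hom R S"
    by (rule ring_hom_memI) (simp_all add: carr ops oneS)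
  have iso: "?\<phi> \<in> ring_iso R S"
    using hom by (auto simp: ring_iso_def bij_betw_def inj_on_def inj carr)
  have zeroS: "\<zero>\<^bsub>S\<^esub> = ?\<phi> \<zero>" by (simp add: S_def fraction_field_zero)
  have ringS: "ring S"
  proof -
    have "S\<lparr>ring.zero := ?\<phi> \<zero>\<rparr> = S" unfolding zeroS[symmetric] by simp
    then show ?thesis using ring_iso_imp_img_ring[OF iso] oneS by (simp add: S_def)
  qed
  interpret S: ring S by (rule ringS)
  interpret h: ring_hom_ring R S ?\<phi>
    using hom ringS ring_axioms by (intro ring_hom_ringI2)
  interpret I: ideal I R by (rule I)
  have Isub: "I \<subseteq> carrier R" by (rule I.a_subset)
  have top: "J = carrier S" if J: "ideal J S" and a: "a \<in> carrier R - I" "?\<phi> a \<in> J" for J a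
  proof -
    interpret J: ideal J S by (rule J)
    obtain b where b: "b \<in> carrier R" "b \<otimes> a = \<one>" using units a by blast
    have "?\<phi> b \<otimes>\<^bsub>S\<^esub> ?\<phi> a \<in> J" using J.I_l_closed a b carr by blast
    moreover have "a \<in> carrier R" using a by blast
    ultimately have "\<one>\<^bsub>S\<^esub> \<in> J" using b by (simp only: ops oneS)
    then show ?thesis by (rule J.one_imp_carrier)
  qed
  have sub: "J \<subseteq> ?\<phi> ` I" if J: "ideal J S" "J \<noteq> carrier S" for J
  proof
    fix x assume x: "x \<in> J"
    interpret J: ideal J S by (rule J)
    obtain a where a: "a \<in> carrier R" "x = ?\<phi> a" using x J.a_subset carr by blast
    then show "x \<in> ?\<phi> ` I" using top[OF J(1), of a] J(2) x by blast
  qed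
  have idI: "ideal (?\<phi> ` I) S"
  proof (rule idealI[OF ringS])
    show "subgroup (?\<phi> ` I) (add_monoid S)"
    proof -
      show ?thesis
        by (rule group_hom.subgroup_img_is_subgroup[OF h.a_group_hom I.a_subgroup])
    qed
  next
    fix x y assume "x \<in> ?\<phi> ` I" "y \<in> carrier S"
    then obtain a b where "a \<in> I" "x = ?\<phi> a" "b \<in> carrier R" "y = ?\<phi> b" using carr by auto
    then show "y \<otimes>\<^bsub>S\<^esub> x \<in> ?\<phi> ` I" "x \<otimes>\<^bsub>S\<^esub> y \<in> ?\<phi> ` I"
      using Isub I.I_l_closed I.I_r_closed by (simp_all only: ops subsetD) (rule imageI[where f = ?\<phi>], blast)+
  qed
  have notS: "?\<phi> ` I \<noteq> carrier S"
  proof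
    assume "?\<phi> ` I = carrier S"
    moreover have "?\<phi> \<one> \<in> ?\<phi> ` carrier R" by (rule imageI[where f = ?\<phi>]) (rule one_closed)
    ultimately have "?\<phi> \<one> \<in> ?\<phi> ` I" using carr by (simp only:)
    then obtain a where "a \<in> I" "?\<phi> \<one> = ?\<phi> a" by blast
    then show False using \<open>\<one> \<notin> I\<close> Isub inj[of \<one> a] by auto
  qed
  have "maximalideal (?\<phi> ` I) S"
  proof (rule maximalidealI[OF idI])
    show "carrier S \<noteq> ?\<phi> ` I" using notS by simp
    show "J = ?\<phi> ` I \<or> J = carrier S" if "ideal J S" "?\<phi> ` I \<subseteq> J" for J
      using sub[OF that(1)] that(2) by blast
  qed
  moreover have "M = ?\<phi> ` I" if "maximalideal M S" for M
  proof -
    interpret M: maximalideal M S by (rule that)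
    have "M \<subseteq> ?\<phi> ` I" using sub[OF M.is_ideal] M.I_notcarr by simp
    moreover have "?\<phi> ` I \<subseteq> carrier S" using Isub carr by (simp add: image_mono)
    ultimately show ?thesis using M.I_maximal[OF idI] notS by simp
  qed
  ultimately show ?thesis
    unfolding unibranch_ring_def S_def[symmetric] using domain_axioms by (intro conjI ex1I) simp_all
qed

end

subsection \<open>Directions\<close>

lemma direction_iff:
  assumes "affine A" "a \<in> A"
  shows "v \<in> direction A \<longleftrightarrow> a + v \<in> A"
proof
  assume "v \<in> direction A"
  then obtain x y where xy: "x \<in> A" "y \<in> A" "v = x - y" by (auto simp: direction_def)
  have "a + v = 1 *\<^sub>R a + 1 *\<^sub>R x + (-1) *\<^sub>R y" using xy by simp
  also have "\<dots> \<in> A"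
    using mem_affine_3[OF assms(1,2) xy(1,2), of 1 1 "-1"] by simp
  finally show "a + v \<in> A" .
next
  assume "a + v \<in> A"
  then show "v \<in> direction A" using assms(2)
    unfolding direction_def by (intro CollectI exI[of _ "a + v"] exI[of _ a]) simp
qed

lemma direction_diff: "x \<in> A \<Longrightarrow> y \<in> A \<Longrightarrow> x - y \<in> direction A"
  by (auto simp: direction_def)

lemma affine_plus_direction: "affine A \<Longrightarrow> a \<in> A \<Longrightarrow> v \<in> direction A \<Longrightarrow> a + v \<in> A"
  by (simp add: direction_iff)

lemma affine_eq_translate: "affine A \<Longrightarrow> a \<in> A \<Longrightarrow> A = (+) a ` direction A"
proof -
  assume A: "affine A" "a \<in> A"
  have "x \<in> (+) a ` direction A" if "x \<in> A" for x
    using that A by (intro image_eqI[of _ _ "x - a"]) (auto simp: direction_diff)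
  then show "A = (+) a ` direction A" using A affine_plus_direction by fastforce
qed

lemma subspace_direction:
  assumes "affine A" "A \<noteq> {}"
  shows "subspace (direction A)"
proof -
  obtain a where a: "a \<in> A" using assms by blast
  show ?thesis
  proof (rule subspaceI)
    show "0 \<in> direction A" using a direction_diff[OF a a] by simp
    fix x y assume x: "x \<in> direction A" and y: "y \<in> direction A"
    have "a + x \<in> A" using x a assms direction_iff by blast
    then have "a + x + y \<in> A" using y assms direction_iff by blast
    then show "x + y \<in> direction A" using direction_iff[OF assms(1) a, of "x + y"] by (simp add: add.assoc)
  next
    fix c x assume x: "x \<in> direction A"
    have "a + x \<in> A" using x a assms direction_iff by blast
    then have "(1 - c) *\<^sub>R a + c *\<^sub>R (a + x) \<in> A"
      using mem_affine[OF assms(1) a, of "a + x" "1 - c" c] by simp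
    moreover have "(1 - c) *\<^sub>R a + c *\<^sub>R (a + x) = a + c *\<^sub>R x" by (simp add: algebra_simps)
    ultimately show "c *\<^sub>R x \<in> direction A" using direction_iff[OF assms(1) a, of "c *\<^sub>R x"] by simp
  qed
qed

lemma direction_mono: "A \<subseteq> B \<Longrightarrow> direction A \<subseteq> direction B"
  by (auto simp: direction_def)

lemma direction_Inter:
  assumes "\<And>A. A \<in> \<F> \<Longrightarrow> affine A" "x \<in> \<Inter>\<F>" "\<F> \<noteq> {}"
  shows "direction (\<Inter>\<F>) = (\<Inter>A\<in>\<F>. direction A)"
proof -
  have "affine (\<Inter>\<F>)" using assms by (simp add: affine_Inter)
  have 1: "v \<in> direction (\<Inter>\<F>) \<longleftrightarrow> x + v \<in> \<Inter>\<F>" for v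
    by (rule direction_iff[OF \<open>affine (\<Inter>\<F>)\<close> assms(2)])
  have 2: "v \<in> direction A \<longleftrightarrow> x + v \<in> A" if "A \<in> \<F>" for v A
    using direction_iff[OF assms(1)[OF that], of x v] assms(2) that by blast
  show ?thesis unfolding set_eq_iff 1 using 2 by simp
qed

lemma direction_Int:
  assumes "affine A" "affine B" "x \<in> A \<inter> B"
  shows "direction (A \<inter> B) = direction A \<inter> direction B"
  using direction_Inter[of "{A, B}" x] assms by auto

lemma affine_subset_direction_eq:
  assumes "affine A" "affine B" "A \<subseteq> B" "A \<noteq> {}" "direction A = direction B"
  shows "A = B"
proof -
  obtain a where "a \<in> A" using assms by blast
  then show ?thesis using affine_eq_translate[of A a] affine_eq_translate[of B a] assms by auto
qed

lemma aff_dim_direction: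
  assumes "affine A" "A \<noteq> {}"
  shows "aff_dim A = int (dim (direction A))"
proof -
  obtain a where "a \<in> A" using assms by blast
  then have "aff_dim A = aff_dim (direction A)"
    using affine_eq_translate[OF assms(1)] aff_dim_translation_eq by metis
  then show ?thesis using aff_dim_subspace[OF subspace_direction[OF assms]] by simp
qed

subsection \<open>Orthogonal projections\<close>

text \<open>The variational inequality for the closest point holds for both \<open>v\<close> and
  \<open>- v\<close>, which forces equality.\<close>

lemma closest_point_orthogonal:
  assumes "affine A" "A \<noteq> {}" "v \<in> direction A"
  shows "(x - closest_point A x) \<bullet> v = 0"
proof -
  have cl: "closed A" "convex A" using assms by (auto simp: affine_closed affine_imp_convex)
  let ?p = "closest_point A x"
  have p: "?p \<in> A" using cl assms by (simp add: closest_point_in_set)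
  have "?p + v \<in> A" "?p + (- v) \<in> A"
    using assms p subspace_neg[OF subspace_direction[OF assms(1,2)]] affine_plus_direction by blast+
  then have "(x - ?p) \<bullet> (?p + v - ?p) \<le> 0" "(x - ?p) \<bullet> (?p + (- v) - ?p) \<le> 0"
    using closest_point_dot cl by blast+
  then show ?thesis by simp
qed

lemma closest_point_affine_in:
  fixes A :: "'a::euclidean_space set"
  shows "affine A \<Longrightarrow> A \<noteq> {} \<Longrightarrow> closest_point A x \<in> A"
  by (simp add: closest_point_in_set affine_closed)

lemma closest_point_affineI:
  assumes "affine A" "y \<in> A" "\<And>v. v \<in> direction A \<Longrightarrow> (x - y) \<bullet> v = 0"
  shows "closest_point A x = y"
proof (rule closest_point_unique[symmetric])
  show "\<forall>z\<in>A. dist x y \<le> dist x z"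
  proof
    fix z assume z: "z \<in> A"
    have "(x - y) \<bullet> (y - z) = 0" using assms z direction_diff by blast
    then have "(norm (x - z))\<^sup>2 = (norm (x - y))\<^sup>2 + (norm (y - z))\<^sup>2"
      using norm_add_Pythagorean[of "x - y" "y - z"] by (simp add: orthogonal_def)
    then show "dist x y \<le> dist x z"
      unfolding dist_norm by (metis le_add_same_cancel1 norm_ge_zero power2_le_imp_le zero_le_power2)
  qed
qed (use assms in \<open>auto simp: affine_closed affine_imp_convex\<close>)

subsection \<open>Affine maps\<close>

text \<open>The linear part of an affine map, read off at the origin of the ambient space. All maps
  are defined on the whole type, also when they come from isometries of a subspace.\<close>

definition lin :: "('a::euclidean_space \<Rightarrow> 'a) \<Rightarrow> 'a \<Rightarrow> 'a"
  where "lin T v = T v - T 0"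

definition clin :: "('a::euclidean_space \<Rightarrow> 'a) \<Rightarrow> 'a \<times> 'a \<Rightarrow> 'a \<times> 'a"
  where "clin T = (\<lambda>(x, y). (lin T x, lin T y))"

definition affmap :: "('a::euclidean_space \<Rightarrow> 'a) \<Rightarrow> bool"
  where "affmap T \<longleftrightarrow> linear (lin T)"

lemma affmapI:
  assumes "linear f" "\<And>x. T x = f x + c"
  shows "affmap T" "lin T = f"
proof -
  show "lin T = f" using assms linear_0[OF assms(1)] by (auto simp: lin_def fun_eq_iff)
  then show "affmap T" using assms by (simp add: affmap_def)
qed

lemma affmap_add: "affmap T \<Longrightarrow> T (x + v) = T x + lin T v"
  unfolding affmap_def using linear_add[of "lin T" x v] by (simp add: lin_def algebra_simps)

lemma affmap_diff: "affmap T \<Longrightarrow> lin T (x - y) = T x - T y"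
  using affmap_add[of T y "x - y"] by simp

lemma affmap_continuous: "affmap T \<Longrightarrow> continuous_on S T"
proof -
  assume "affmap T"
  then have "continuous_on S (\<lambda>x. lin T x + T 0)"
    unfolding affmap_def by (intro continuous_intros linear_continuous_on linear_conv_bounded_linear[THEN iffD1])
  then show ?thesis by (simp add: lin_def)
qed

lemma affmap_compose:
  assumes "affmap S" "affmap T"
  shows "affmap (S \<circ> T)" "lin (S \<circ> T) = lin S \<circ> lin T"
proof -
  have "(S \<circ> T) x = (lin S \<circ> lin T) x + (S \<circ> T) 0" for x
    using affmap_add[OF assms(1), of "T 0" "T x - T 0"] by (simp add: lin_def)
  moreover have "linear (lin S \<circ> lin T)" using assms unfolding affmap_def by (rule linear_compose[rotated])
  ultimately show "affmap (S \<circ> T)" "lin (S \<circ> T) = lin S \<circ> lin T"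
    using affmapI[of "lin S \<circ> lin T" "S \<circ> T" "(S \<circ> T) 0"] by blast+
qed

lemma affmap_id: "affmap (\<lambda>x. x)" "lin (\<lambda>x. x) = (\<lambda>v. v)"
  using affmapI[of "\<lambda>x. x" "\<lambda>x. x" 0] by (auto simp: linear_id[unfolded id_def])

lemma complex_act_affmap: "affmap T \<Longrightarrow> complex_act T (x, y) = (T x, lin T y)"
  by (simp add: complex_act_def affmap_add)

lemma complex_act_compose:
  assumes "affmap S" "affmap T"
  shows "complex_act (S \<circ> T) w = complex_act S (complex_act T w)"
  using assms affmap_compose[OF assms] by (cases w) (simp add: complex_act_affmap)

lemma complex_act_id [simp]: "complex_act (\<lambda>x. x) w = w"
  by (cases w) (simp add: complex_act_def)

lemma complex_act_add:
  assumes "affmap T"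
  shows "complex_act T (w + v) = complex_act T w + clin T v"
  using assms linear_add[of "lin T"] unfolding affmap_def
  by (cases w; cases v) (simp add: complex_act_affmap assms affmap_add clin_def)

lemma linear_clin:
  assumes "affmap T"
  shows "linear (clin T)"
  using assms unfolding affmap_def clin_def
  by (intro linearI) (auto simp: linear_add linear_scale)

lemma clin_times_i: "affmap T \<Longrightarrow> clin T (times_i v) = times_i (clin T v)"
  using linear_neg[of "lin T"] by (cases v) (simp add: clin_def affmap_def)

lemma clin_cscale: "affmap T \<Longrightarrow> clin T (cscale c v) = cscale c (clin T v)"
  using linear_clin[of T] by (simp add: cscale_def linear_add linear_scale clin_times_i)

lemma complex_act_has_derivative:
  assumes "affmap T"
  shows "(complex_act T has_derivative clin T) (at w)"
proof -
  have eq: "complex_act T = (\<lambda>w. complex_act T 0 + clin T w)"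
  proof
    show "complex_act T w = complex_act T 0 + clin T w" for w
      using complex_act_add[OF assms, of 0 w] by simp
  qed
  have "bounded_linear (clin T)"
    using linear_clin[OF assms] by (simp add: linear_conv_bounded_linear)
  from bounded_linear.has_derivative[OF this has_derivative_ident]
  have "((\<lambda>w. complex_act T 0 + clin T w) has_derivative (\<lambda>v. 0 + clin T v)) (at w)"
    by (rule has_derivative_add[OF has_derivative_const])
  then show ?thesis by (simp add: eq[symmetric])
qed

lemma complex_act_continuous: "affmap T \<Longrightarrow> continuous_on S (complex_act T)"
  by (intro continuous_at_imp_continuous_on ballI has_derivative_continuous[OF complex_act_has_derivative])

lemma cd_complex_act:
  "affmap T \<Longrightarrow> complex_differentiable_at F (complex_act T w) \<Longrightarrow>
    complex_differentiable_at (\<lambda>w. F (complex_act T w)) w"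
  by (rule cd_compose[of F "complex_act T" w "clin T"]) (auto simp: complex_act_has_derivative clin_times_i)

text \<open>The points predicted by linearity lie in \<open>A\<close> and satisfy the orthogonality
  that characterises closest points.\<close>

lemma closest_point_affmap:
  assumes "affine A" "A \<noteq> {}"
  shows "affmap (closest_point A)"
proof -
  let ?\<pi> = "closest_point A"
  have sub: "subspace (direction A)" using assms by (rule subspace_direction)
  have 1: "?\<pi> x - ?\<pi> 0 \<in> direction A" for x using assms by (simp add: closest_point_affine_in direction_diff)
  note o = closest_point_orthogonal[OF assms]
  have a0: "?\<pi> 0 \<in> A" using assms by (simp add: closest_point_affine_in)
  have add: "?\<pi> (x + y) = ?\<pi> 0 + (lin ?\<pi> x + lin ?\<pi> y)" for x y
  proof (rule closest_point_affineI[OF assms(1)])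
    show "?\<pi> 0 + (lin ?\<pi> x + lin ?\<pi> y) \<in> A"
      using 1 sub a0 by (intro affine_plus_direction assms subspace_add) (auto simp: lin_def)
    fix v assume v: "v \<in> direction A"
    have "x + y - (?\<pi> 0 + (lin ?\<pi> x + lin ?\<pi> y)) = (x - ?\<pi> x) + (y - ?\<pi> y) - (0 - ?\<pi> 0)"
      by (simp add: lin_def)
    then show "(x + y - (?\<pi> 0 + (lin ?\<pi> x + lin ?\<pi> y))) \<bullet> v = 0"
      using o[OF v, of x] o[OF v, of y] o[OF v, of 0] by (simp only: inner_add_left inner_diff_left)
  qed
  have scale: "?\<pi> (c *\<^sub>R x) = ?\<pi> 0 + c *\<^sub>R lin ?\<pi> x" for c x
  proof (rule closest_point_affineI[OF assms(1)])
    show "?\<pi> 0 + c *\<^sub>R lin ?\<pi> x \<in> A"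
      using 1 sub a0 by (intro affine_plus_direction assms subspace_scale) (auto simp: lin_def)
    fix v assume v: "v \<in> direction A"
    have "c *\<^sub>R x - (?\<pi> 0 + c *\<^sub>R lin ?\<pi> x) = c *\<^sub>R (x - ?\<pi> x) + (1 - c) *\<^sub>R (0 - ?\<pi> 0)"
      by (simp add: lin_def algebra_simps)
    then show "(c *\<^sub>R x - (?\<pi> 0 + c *\<^sub>R lin ?\<pi> x)) \<bullet> v = 0"
      using o[OF v, of x] o[OF v, of 0] by (simp only: inner_add_left inner_scaleR_left)
  qed
  show ?thesis unfolding affmap_def
    by (rule linearI) (simp_all add: lin_def[of _ "_ + _"] lin_def[of _ "_ *\<^sub>R _"] add scale)
qed

lemma lin_closest_point_in:
  "affine A \<Longrightarrow> A \<noteq> {} \<Longrightarrow> lin (closest_point A) v \<in> direction A"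
  by (simp add: lin_def closest_point_affine_in direction_diff)

lemma lin_closest_point_self:
  assumes "affine A" "A \<noteq> {}" "v \<in> direction A"
  shows "lin (closest_point A) v = v"
proof -
  obtain a where a: "a \<in> A" using assms by blast
  then have "a + v \<in> A" using assms affine_plus_direction by blast
  then have "closest_point A (a + v) = a + v" "closest_point A a = a"
    using a closest_point_self by blast+
  then show ?thesis using affmap_add[OF closest_point_affmap[OF assms(1,2)], of a v] by simp
qed

lemma lin_closest_point_orthogonal:
  assumes "affine A" "A \<noteq> {}" "v \<in> direction A"
  shows "(x - lin (closest_point A) x) \<bullet> v = 0"
  using closest_point_orthogonal[OF assms, of x] closest_point_orthogonal[OF assms, of 0]
  by (simp add: lin_def inner_diff_left inner_add_left)

lemma lin_closest_point_zero:
  assumes "affine A" "A \<noteq> {}" "\<And>v. v \<in> direction A \<Longrightarrow> x \<bullet> v = 0"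
  shows "lin (closest_point A) x = 0"
proof -
  let ?u = "lin (closest_point A) x"
  have u: "?u \<in> direction A" using assms lin_closest_point_in by blast
  have "(x - ?u) \<bullet> ?u = 0" by (rule lin_closest_point_orthogonal[OF assms(1,2) u])
  then show ?thesis using assms(3)[OF u] by (simp add: inner_diff_left)
qed

lemma norm_lin_closest_point:
  assumes "affine A" "A \<noteq> {}"
  shows "norm (lin (closest_point A) v) \<le> norm v"
  using closest_point_lipschitz[of A v 0] assms
  by (simp add: lin_def dist_norm affine_closed affine_imp_convex)

text \<open>Projections therefore map a ball centred at a point of \<open>complexify A\<close> into
  itself, so that radii survive composition with a projection.\<close>

lemma dist_complex_act_closest_point:
  assumes "affine A" "A \<noteq> {}"
  shows "dist (complex_act (closest_point A) w) (complex_act (closest_point A) z) \<le> dist w z"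
proof -
  let ?\<pi> = "closest_point A"
  have aff: "affmap ?\<pi>" using assms by (rule closest_point_affmap)
  obtain x y u v where wz: "w = (x, y)" "z = (u, v)" by fastforce
  have 1: "dist (?\<pi> x) (?\<pi> u) \<le> dist x u"
    using norm_lin_closest_point[OF assms, of "x - u"] affmap_diff[OF aff] by (simp add: dist_norm)
  have "lin ?\<pi> y - lin ?\<pi> v = lin ?\<pi> (y - v)"
    using aff by (simp add: affmap_def linear_diff)
  then have 2: "dist (lin ?\<pi> y) (lin ?\<pi> v) \<le> dist y v"
    using norm_lin_closest_point[OF assms, of "y - v"] by (simp add: dist_norm)
  show ?thesis
    unfolding wz complex_act_affmap[OF aff] dist_Pair_Pair
    by (intro real_sqrt_le_mono add_mono power_mono 1 2) auto
qed

subsection \<open>Complexification\<close>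

lemma complexify_iff: "(x, y) \<in> complexify A \<longleftrightarrow> x \<in> A \<and> y \<in> direction A"
  by (simp add: complexify_def)

lemma complexify_iff': "w \<in> complexify A \<longleftrightarrow> fst w \<in> A \<and> snd w \<in> direction A"
  by (simp add: complexify_def mem_Times_iff)

lemma complexify_mono: "A \<subseteq> B \<Longrightarrow> complexify A \<subseteq> complexify B"
  using direction_mono[of A B] by (auto simp: complexify_def)

lemma complexify_translate:
  assumes "affine A" "w \<in> complexify A" "v \<in> direction A \<times> direction A"
  shows "w + v \<in> complexify A"
proof -
  have "subspace (direction A)" using assms by (intro subspace_direction) (auto simp: complexify_iff')
  then show ?thesis
    using assms by (auto simp: complexify_iff' affine_plus_direction subspace_add)
qed

lemma closed_complexify: "affine A \<Longrightarrow> closed (complexify A)"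
  unfolding complexify_def
  by (cases "A = {}") (simp, intro closed_Times affine_closed closed_subspace subspace_direction)

lemma complex_act_closest_point_in:
  assumes "affine A" "A \<noteq> {}"
  shows "complex_act (closest_point A) w \<in> complexify A"
  using assms by (cases w)
    (simp add: complex_act_affmap closest_point_affmap complexify_iff closest_point_affine_in lin_closest_point_in)

lemma complex_act_closest_point_self:
  assumes "affine A" "w \<in> complexify A"
  shows "complex_act (closest_point A) w = w"
proof -
  have "A \<noteq> {}" using assms by (auto simp: complexify_iff')
  then show ?thesis using assms by (cases w)
    (simp add: complex_act_affmap closest_point_affmap complexify_iff closest_point_self lin_closest_point_self)
qed

subsection \<open>Isometries\<close>

definition isom :: "('a::euclidean_space \<Rightarrow> 'a) \<Rightarrow> bool"
  where "isom g \<longleftrightarrow> (\<forall>x y. dist (g x) (g y) = dist x y)"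

text \<open>Subtracting the value at 0 leaves a distance-preserving map that fixes 0, and such a map
  is orthogonal.\<close>

lemma isom_lin:
  assumes "isom g"
  shows "orthogonal_transformation (lin g)"
  unfolding orthogonal_transformation_isometry
  using assms by (auto simp: isom_def lin_def dist_norm)

lemma isom_affmap: "isom g \<Longrightarrow> affmap g"
  using isom_lin by (auto simp: affmap_def orthogonal_transformation_def)

lemma isom_norm: "isom g \<Longrightarrow> norm (lin g v) = norm v"
  using isom_lin orthogonal_transformation_norm by blast

lemma isom_inner: "isom g \<Longrightarrow> lin g u \<bullet> lin g v = u \<bullet> v"
  using isom_lin orthogonal_transformation_def by blast

lemma isom_complex_act:
  assumes "isom g"
  shows "dist (complex_act g w) (complex_act g z) = dist w z"
proof -
  obtain x y u v where wz: "w = (x, y)" "z = (u, v)" by fastforce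
  have "lin g y - lin g v = lin g (y - v)"
    using isom_affmap[OF assms] by (simp add: affmap_def linear_diff)
  then have "dist (lin g y) (lin g v) = dist y v"
    using isom_norm[OF assms, of "y - v"] by (simp add: dist_norm)
  then show ?thesis
    using assms unfolding wz complex_act_affmap[OF isom_affmap[OF assms]] dist_Pair_Pair isom_def by simp
qed

lemma direction_image:
  assumes "affmap g"
  shows "direction (g ` A) = lin g ` direction A"
proof -
  have "g x - g y = lin g (x - y)" for x y using affmap_diff[OF assms] by simp
  then show ?thesis by (auto simp: direction_def image_iff) metis+
qed

lemma complexify_image:
  assumes "affmap g"
  shows "complexify (g ` A) = complex_act g ` complexify A"
  unfolding complexify_def direction_image[OF assms]
  by (auto simp: image_iff complex_act_affmap[OF assms])

lemma affine_image:
  assumes "affmap g" "affine A"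
  shows "affine (g ` A)"
proof -
  have "u *\<^sub>R g x + v *\<^sub>R g y = g (u *\<^sub>R x + v *\<^sub>R y)" if "u + v = 1" for u v x y
  proof -
    have l: "linear (lin g)" using assms(1) by (simp add: affmap_def)
    have g: "g z = lin g z + g 0" for z by (simp add: lin_def)
    have "u *\<^sub>R g x + v *\<^sub>R g y = (u *\<^sub>R lin g x + v *\<^sub>R lin g y) + (u + v) *\<^sub>R g 0"
      by (simp add: g[of x] g[of y] algebra_simps)
    also have "\<dots> = g (u *\<^sub>R x + v *\<^sub>R y)"
      using that by (simp add: g[of "u *\<^sub>R x + v *\<^sub>R y"] linear_add[OF l] linear_scale[OF l])
    finally show ?thesis .
  qed
  then show ?thesis using assms(2) unfolding affine_def by (auto simp: image_iff)
qed

text \<open>Germs are added and multiplied through a union over all representatives; this collapses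
  the union once its members agree.\<close>

lemma UN2_const:
  "a \<in> A \<Longrightarrow> b \<in> B \<Longrightarrow> (\<And>x y. x \<in> A \<Longrightarrow> y \<in> B \<Longrightarrow> H x y = C) \<Longrightarrow> (\<Union>x\<in>A. \<Union>y\<in>B. H x y) = C"
  by auto

section \<open>Orbit spaces of discrete groups of isometries\<close>

text \<open>The group acts on the whole ambient type, not just on \<open>E\<close>, so that its
  elements move balls and can be composed with ambient holomorphic functions. \<open>proper\<close>
  states discreteness through displacements.\<close>

locale isometry_action =
  fixes G :: "('a::euclidean_space \<Rightarrow> 'a) set" and L :: "'a set"
  assumes isom: "g \<in> G \<Longrightarrow> isom g"
    and id_in: "(\<lambda>x. x) \<in> G"
    and comp_in: "g \<in> G \<Longrightarrow> h \<in> G \<Longrightarrow> g \<circ> h \<in> G"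
    and inv_ex: "g \<in> G \<Longrightarrow> \<exists>h\<in>G. h \<circ> g = (\<lambda>x. x) \<and> g \<circ> h = (\<lambda>x. x)"
    and proper: "finite {g \<in> G. dist (g x) x \<le> r}"
    and affL: "affine L" and Lne: "L \<noteq> {}"
begin

definition S :: "('a \<times> 'a) set"
  where "S = (\<Union>g\<in>G. complex_act g ` complexify L)"

definition Y :: "('a \<times> 'a) set function_space"
  where "Y = orbit_space G S"

abbreviation orb :: "'a \<times> 'a \<Rightarrow> ('a \<times> 'a) set"
  where "orb \<equiv> orbit_of G"

lemma aff: "g \<in> G \<Longrightarrow> affmap g"
  using isom isom_affmap by blast

lemma act_comp: "g \<in> G \<Longrightarrow> h \<in> G \<Longrightarrow> complex_act (g \<circ> h) w = complex_act g (complex_act h w)"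
  by (simp add: complex_act_compose aff)

lemma inverseE:
  assumes "g \<in> G"
  obtains h where "h \<in> G" "\<And>x. h (g x) = x" "\<And>x. g (h x) = x"
    "\<And>w. complex_act h (complex_act g w) = w" "\<And>w. complex_act g (complex_act h w) = w"
proof -
  obtain h where h: "h \<in> G" "h \<circ> g = (\<lambda>x. x)" "g \<circ> h = (\<lambda>x. x)" using inv_ex[OF assms] by blast
  show thesis
  proof (rule that[of h])
    show "h (g x) = x" "g (h x) = x" for x using h(2,3) by (metis comp_apply)+
    show "complex_act h (complex_act g w) = w" for w
      unfolding act_comp[OF h(1) assms, symmetric] h(2) by simp
    show "complex_act g (complex_act h w) = w" for w
      unfolding act_comp[OF assms h(1), symmetric] h(3) by simp
  qed (rule h(1))
qed

lemma dist_act: "g \<in> G \<Longrightarrow> dist (complex_act g w) (complex_act g z) = dist w z"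
  by (simp add: isom isom_complex_act)

lemma orb_eq_iff: "orb w = orb w' \<longleftrightarrow> (\<exists>g\<in>G. w' = complex_act g w)"
proof
  assume "orb w = orb w'"
  moreover have "w' \<in> orb w'" unfolding orbit_of_def using id_in by (intro image_eqI[of _ _ "\<lambda>x. x"]) auto
  ultimately show "\<exists>g\<in>G. w' = complex_act g w" by (auto simp: orbit_of_def)
next
  assume "\<exists>g\<in>G. w' = complex_act g w"
  then obtain g where g: "g \<in> G" "w' = complex_act g w" by blast
  obtain h where h: "h \<in> G" "\<And>w. complex_act h (complex_act g w) = w"
    using inverseE[OF g(1)] by metis
  show "orb w = orb w'"
    unfolding orbit_of_def
  proof (intro equalityI subsetI)
    fix x assume "x \<in> (\<lambda>g. complex_act g w) ` G"
    then obtain k where "k \<in> G" "x = complex_act k w" by blast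
    then show "x \<in> (\<lambda>g. complex_act g w') ` G"
      using h g by (intro image_eqI[of _ _ "k \<circ> h"]) (auto simp: comp_in act_comp)
  next
    fix x assume "x \<in> (\<lambda>g. complex_act g w') ` G"
    then obtain k where "k \<in> G" "x = complex_act k w'" by blast
    then show "x \<in> (\<lambda>g. complex_act g w) ` G"
      using g by (intro image_eqI[of _ _ "k \<circ> g"]) (auto simp: comp_in act_comp)
  qed
qed

lemma orb_act [simp]: "g \<in> G \<Longrightarrow> orb (complex_act g w) = orb w"
  using orb_eq_iff by metis

lemma S_iff: "w \<in> S \<longleftrightarrow> (\<exists>g\<in>G. \<exists>v\<in>complexify L. w = complex_act g v)"
  by (auto simp: S_def)

lemma complexify_sub_S: "complexify L \<subseteq> S"
  using id_in by (force simp: S_iff)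

lemma S_act: "w \<in> S \<Longrightarrow> g \<in> G \<Longrightarrow> complex_act g w \<in> S"
  unfolding S_iff using comp_in act_comp by metis

lemma topspace_Y: "topspace (top_of Y) = orb ` S"
  using quotient_map_orbit_space[of S G] quotient_imp_surjective_map unfolding Y_def by force

lemma openin_Y: "openin (top_of Y) U \<longleftrightarrow> U \<subseteq> orb ` S \<and> openin (top_of_set S) {z \<in> S. orb z \<in> U}"
  unfolding Y_def by (rule openin_orbit_space)

lemma regular_Y: "f \<in> regular Y U \<longleftrightarrow> analytic_fun_on {z \<in> S. orb z \<in> U} (\<lambda>w. f (orb w))"
  by (simp add: Y_def orbit_space_def comp_def)

lemma mem_orb_image: "orb w \<in> orb ` (S \<inter> N) \<longleftrightarrow> (\<exists>g\<in>G. complex_act g w \<in> S \<inter> N)"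
  by (auto simp: image_iff orb_eq_iff)

lemma openin_orb_image:
  assumes "open N"
  shows "openin (top_of Y) (orb ` (S \<inter> N))"
proof -
  have "{w \<in> S. orb w \<in> orb ` (S \<inter> N)} = S \<inter> (\<Union>g\<in>G. complex_act g -` N)"
  proof -
    have "w \<in> S \<and> (\<exists>g\<in>G. complex_act g w \<in> S \<inter> N) \<longleftrightarrow> w \<in> S \<and> (\<exists>g\<in>G. complex_act g w \<in> N)" for w
      using S_act by blast
    then show ?thesis unfolding mem_orb_image by blast
  qed
  moreover have "open (\<Union>g\<in>G. complex_act g -` N)"
    using assms aff complex_act_continuous by (intro open_UN ballI open_vimage) auto
  ultimately show ?thesis
    unfolding openin_Y by (auto intro: openin_open_Int)
qed

text \<open>The group acts on \<open>S\<close> by homeomorphisms, so the image of a small ball is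
  open in the quotient. Germs at an orbit can thus be tested near a single representative.\<close>

lemma eventually_Y:
  assumes "z \<in> S"
  shows "(\<forall>\<^sub>F y in nhdsin (top_of Y) (orb z). P y) \<longleftrightarrow> (\<exists>\<epsilon>>0. \<forall>w\<in>S \<inter> ball z \<epsilon>. P (orb w))"
proof
  assume "\<forall>\<^sub>F y in nhdsin (top_of Y) (orb z). P y"
  then obtain U where U: "openin (top_of Y) U" "orb z \<in> U" "\<And>y. y \<in> U \<Longrightarrow> P y"
    using assms by (auto simp: eventually_nhdsin topspace_Y)
  then have "openin (top_of_set S) {z \<in> S. orb z \<in> U}" "z \<in> {z \<in> S. orb z \<in> U}"
    using assms by (auto simp: openin_Y)
  then obtain \<epsilon> where "\<epsilon> > 0" "ball z \<epsilon> \<inter> S \<subseteq> {z \<in> S. orb z \<in> U}"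
    unfolding openin_contains_ball by blast
  then show "\<exists>\<epsilon>>0. \<forall>w\<in>S \<inter> ball z \<epsilon>. P (orb w)"
    using U(3) by blast
next
  assume "\<exists>\<epsilon>>0. \<forall>w\<in>S \<inter> ball z \<epsilon>. P (orb w)"
  then obtain \<epsilon> where e: "\<epsilon> > 0" "\<forall>w\<in>S \<inter> ball z \<epsilon>. P (orb w)" by blast
  show "\<forall>\<^sub>F y in nhdsin (top_of Y) (orb z). P y"
    unfolding eventually_nhdsin
    using openin_orb_image[OF open_ball, of z \<epsilon>] e assms
    by (intro disjI2 exI[of _ "orb ` (S \<inter> ball z \<epsilon>)"]) auto
qed

text \<open>Regularity near one representative \<open>z\<close>; \<open>regular_orb_image\<close>
  transports it to the rest of the orbit.\<close>

definition local_fun :: "'a \<times> 'a \<Rightarrow> (('a \<times> 'a) set \<Rightarrow> complex) \<Rightarrow> bool"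
  where "local_fun z f \<longleftrightarrow> (\<exists>\<epsilon>>0. \<exists>F. hol_in (ball z \<epsilon>) F \<and> (\<forall>w\<in>S \<inter> ball z \<epsilon>. f (orb w) = F w))"

text \<open>At another point of the saturated set, the extension is \<open>F\<close> composed with a
  group element carrying that point into \<open>N\<close>.\<close>

lemma regular_orb_image:
  assumes N: "open N" and F: "hol_in N F" "\<And>w. w \<in> S \<inter> N \<Longrightarrow> f (orb w) = F w"
  shows "f \<in> regular Y (orb ` (S \<inter> N))"
  unfolding regular_Y analytic_fun_on_def
proof
  fix w assume "w \<in> {w \<in> S. orb w \<in> orb ` (S \<inter> N)}"
  then obtain g where g: "g \<in> G" "complex_act g w \<in> S \<inter> N"
    unfolding mem_orb_image by auto
  show "\<exists>M F. open M \<and> w \<in> M \<and> (\<forall>w\<in>M. complex_differentiable_at F w) \<and>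
     (\<forall>w\<in>M \<inter> {z \<in> S. orb z \<in> orb ` (S \<inter> N)}. f (orb w) = F w)"
  proof (intro exI[of _ "complex_act g -` N"] exI[of _ "\<lambda>w. F (complex_act g w)"] conjI ballI)
    show "open (complex_act g -` N)"
      using N aff[OF g(1)] complex_act_continuous by (intro open_vimage) auto
    show "w \<in> complex_act g -` N" using g by simp
    show "complex_differentiable_at (\<lambda>w. F (complex_act g w)) v" if "v \<in> complex_act g -` N" for v
      using that F(1) aff[OF g(1)] unfolding hol_in_def by (intro cd_complex_act) auto
    show "f (orb v) = F (complex_act g v)"
      if "v \<in> complex_act g -` N \<inter> {z \<in> S. orb z \<in> orb ` (S \<inter> N)}" for v
      using that F(2)[of "complex_act g v"] g(1) S_act by simp
  qed
qed

lemma regular_local_fun: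
  assumes "z \<in> S" "f \<in> regular Y U" "openin (top_of Y) U" "orb z \<in> U"
  shows "local_fun z f"
proof -
  have "z \<in> {z \<in> S. orb z \<in> U}" using assms by blast
  then obtain N F where N: "open N" "z \<in> N" "\<forall>w\<in>N. complex_differentiable_at F w"
    "\<forall>w\<in>N \<inter> {z \<in> S. orb z \<in> U}. f (orb w) = F w"
    using assms(2) unfolding regular_Y analytic_fun_on_def by meson
  have "\<forall>\<^sub>F y in nhdsin (top_of Y) (orb z). y \<in> U"
    using assms by (auto simp: eventually_nhdsin)
  then obtain \<epsilon>1 where e1: "\<epsilon>1 > 0" "\<forall>w\<in>S \<inter> ball z \<epsilon>1. orb w \<in> U"
    unfolding eventually_Y[OF assms(1)] by blast
  obtain \<epsilon>2 where e2: "\<epsilon>2 > 0" "ball z \<epsilon>2 \<subseteq> N" using N openE by blast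
  show ?thesis unfolding local_fun_def hol_in_def
  proof (intro exI[of _ "min \<epsilon>1 \<epsilon>2"] exI[of _ F] conjI ballI)
    fix w assume w: "w \<in> S \<inter> ball z (min \<epsilon>1 \<epsilon>2)"
    then have "w \<in> N" "orb w \<in> U" "w \<in> S" using e1 e2 by auto
    then show "f (orb w) = F w" using N(4) by blast
  next
    fix w assume "w \<in> ball z (min \<epsilon>1 \<epsilon>2)"
    then have "w \<in> ball z \<epsilon>2" by simp
    then have "w \<in> N" using e2 by blast
    then show "complex_differentiable_at F w" using N(3) by blast
  qed (use e1 e2 in auto)
qed

text \<open>By properness only finitely many elements move \<open>z\<close> by less than 1. Half of
  the least positive displacement works, since an element relating two points of the ball moves
  \<open>z\<close> by less than twice the radius.\<close>

lemma separation:
  obtains \<rho> where "\<rho> > 0" "\<And>g w. g \<in> G \<Longrightarrow> w \<in> ball z \<rho> \<Longrightarrow> complex_act g w \<in> ball z \<rho> \<Longrightarrow> complex_act g z = z"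
proof -
  define B where "B = {g \<in> G. dist (complex_act g z) z < 1}"
  obtain x y where z: "z = (x, y)" by fastforce
  have "dist (g x) x \<le> dist (complex_act g z) z" if "g \<in> G" for g
    unfolding z complex_act_affmap[OF aff[OF that]] dist_Pair_Pair by (simp add: real_le_rsqrt)
  then have "B \<subseteq> {g \<in> G. dist (g x) x \<le> 1}" unfolding B_def by force
  then have fin: "finite B" using proper finite_subset by blast
  \<comment> \<open>The 1 accounts for the elements outside \<open>B\<close> and keeps the set
    nonempty.\<close>
  define D where "D = insert 1 ((\<lambda>g. dist (complex_act g z) z) ` {g \<in> B. complex_act g z \<noteq> z})"
  have finD: "finite D" "D \<noteq> {}" using fin by (auto simp: D_def)
  have pos: "d > 0" if "d \<in> D" for d using that by (auto simp: D_def)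
  define \<rho> where "\<rho> = Min D / 2"
  have "Min D > 0" using finD pos Min_in by blast
  show thesis
  proof (rule that[of \<rho>])
    show "\<rho> > 0" using \<open>Min D > 0\<close> by (simp add: \<rho>_def)
    fix g w assume g: "g \<in> G" "w \<in> ball z \<rho>" "complex_act g w \<in> ball z \<rho>"
    have "dist (complex_act g z) z \<le> dist (complex_act g z) (complex_act g w) + dist (complex_act g w) z"
      by (rule dist_triangle)
    also have "\<dots> = dist z w + dist z (complex_act g w)" using dist_act[OF g(1)] by (simp add: dist_commute)
    also have "\<dots> < Min D" using g(2,3) by (simp add: \<rho>_def)
    finally have less: "dist (complex_act g z) z < Min D" .
    show "complex_act g z = z"
    proof (rule ccontr)
      assume ne: "complex_act g z \<noteq> z"
      have "Min D \<le> 1" using finD by (simp add: D_def)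
      then have "g \<in> B" using less g(1) by (simp add: B_def)
      then have "dist (complex_act g z) z \<in> D" using ne by (simp add: D_def)
      then show False using less finD by (meson Min_le linorder_not_le)
    qed
  qed
qed

text \<open>Two points of the ball in one orbit are related by an element fixing \<open>z\<close>,
  so invariance under the stabiliser of \<open>z\<close> makes \<open>F\<close> constant on orbits
  within the ball.\<close>

lemma local_fun_exists:
  assumes F: "hol_in (ball z \<epsilon>) F" and e: "\<epsilon> > 0"
    and sep: "\<And>g w. g \<in> G \<Longrightarrow> w \<in> ball z \<epsilon> \<Longrightarrow> complex_act g w \<in> ball z \<epsilon> \<Longrightarrow> complex_act g z = z"
    and inv: "\<And>g w. g \<in> G \<Longrightarrow> complex_act g z = z \<Longrightarrow> w \<in> S \<inter> ball z \<epsilon> \<Longrightarrow> F (complex_act g w) = F w"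
  shows "\<exists>f. (\<forall>w\<in>S \<inter> ball z \<epsilon>. f (orb w) = F w) \<and> local_fun z f"
proof -
  \<comment> \<open>Any representative in the ball may be chosen; the value does not depend on
    it.\<close>
  define f where "f y = F (SOME w. w \<in> S \<inter> ball z \<epsilon> \<and> orb w = y)" for y
  have *: "f (orb w) = F w" if w: "w \<in> S \<inter> ball z \<epsilon>" for w
  proof -
    define v where "v = (SOME v. v \<in> S \<inter> ball z \<epsilon> \<and> orb v = orb w)"
    have v: "v \<in> S \<inter> ball z \<epsilon> \<and> orb v = orb w"
      unfolding v_def by (rule someI[of _ w]) (use w in simp)
    then obtain g where g: "g \<in> G" "w = complex_act g v" using orb_eq_iff by blast
    then have "F w = F v" using inv[OF g(1) _ conjunct1[OF v]] sep[OF g(1), of v] v w by simp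
    then show ?thesis by (simp add: f_def v_def)
  qed
  moreover have "local_fun z f" unfolding local_fun_def using F e * by blast
  ultimately show ?thesis by blast
qed

subsection \<open>Stalks\<close>

abbreviation gm :: "'a \<times> 'a \<Rightarrow> (('a \<times> 'a) set \<Rightarrow> complex) \<Rightarrow> (('a \<times> 'a) set \<Rightarrow> complex) set"
  where "gm z f \<equiv> germ Y (orb z) f"

abbreviation R :: "'a \<times> 'a \<Rightarrow> (('a \<times> 'a) set \<Rightarrow> complex) set ring"
  where "R z \<equiv> stalk Y (orb z)"

lemma gm_mem: "h \<in> gm z f \<longleftrightarrow> (\<forall>\<^sub>F y in nhdsin (top_of Y) (orb z). h y = f y)"
  by (simp add: germ_def)

lemma gm_eqI: "\<forall>\<^sub>F y in nhdsin (top_of Y) (orb z). f y = g y \<Longrightarrow> gm z f = gm z g"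
  unfolding germ_def by (auto elim: eventually_elim2)

lemma gm_eq_ev: "gm z f = gm z g \<longleftrightarrow> (\<forall>\<^sub>F y in nhdsin (top_of Y) (orb z). f y = g y)"
proof
  assume "gm z f = gm z g"
  moreover have "f \<in> gm z f" by (simp add: gm_mem)
  ultimately show "\<forall>\<^sub>F y in nhdsin (top_of Y) (orb z). f y = g y" using gm_mem by blast
qed (rule gm_eqI)

lemma gm_eq_iff:
  "z \<in> S \<Longrightarrow> gm z f = gm z g \<longleftrightarrow> (\<exists>\<epsilon>>0. \<forall>w\<in>S \<inter> ball z \<epsilon>. f (orb w) = g (orb w))"
  by (simp add: gm_eq_ev eventually_Y)

lemma gm_mult: "gm z f \<otimes>\<^bsub>R z\<^esub> gm z g = gm z (\<lambda>y. f y * g y)"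
proof -
  have 1: "gm z (\<lambda>y. f' y * g' y) = gm z (\<lambda>y. f y * g y)" if "f' \<in> gm z f" "g' \<in> gm z g" for f' g'
  proof (rule gm_eqI)
    show "\<forall>\<^sub>F y in nhdsin (top_of Y) (orb z). f' y * g' y = f y * g y"
      using that unfolding gm_mem by eventually_elim simp
  qed
  have 2: "f \<in> gm z f" "g \<in> gm z g" by (simp_all add: gm_mem)
  show ?thesis unfolding stalk_def ring.simps monoid.simps by (rule UN2_const[OF 2 1])
qed

lemma gm_add: "gm z f \<oplus>\<^bsub>R z\<^esub> gm z g = gm z (\<lambda>y. f y + g y)"
proof -
  have 1: "gm z (\<lambda>y. f' y + g' y) = gm z (\<lambda>y. f y + g y)" if "f' \<in> gm z f" "g' \<in> gm z g" for f' g'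
  proof (rule gm_eqI)
    show "\<forall>\<^sub>F y in nhdsin (top_of Y) (orb z). f' y + g' y = f y + g y"
      using that unfolding gm_mem by eventually_elim simp
  qed
  have 2: "f \<in> gm z f" "g \<in> gm z g" by (simp_all add: gm_mem)
  show ?thesis unfolding stalk_def ring.simps monoid.simps by (rule UN2_const[OF 2 1])
qed

lemma gm_one: "\<one>\<^bsub>R z\<^esub> = gm z (\<lambda>_. 1)" and gm_zero: "\<zero>\<^bsub>R z\<^esub> = gm z (\<lambda>_. 0)"
  by (simp_all add: stalk_def)

lemma carrier_R:
  assumes "z \<in> S"
  shows "carrier (R z) = gm z ` {f. local_fun z f}"
proof (intro equalityI subsetI)
  fix a assume "a \<in> carrier (R z)"
  then show "a \<in> gm z ` {f. local_fun z f}"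
    unfolding stalk_def using regular_local_fun[OF assms] by auto
next
  fix a assume "a \<in> gm z ` {f. local_fun z f}"
  then obtain f \<epsilon> F where f: "a = gm z f" "\<epsilon> > 0" "hol_in (ball z \<epsilon>) F" "\<forall>w\<in>S \<inter> ball z \<epsilon>. f (orb w) = F w"
    unfolding local_fun_def by blast
  have "f \<in> regular Y (orb ` (S \<inter> ball z \<epsilon>))" using f by (intro regular_orb_image) auto
  moreover have "openin (top_of Y) (orb ` (S \<inter> ball z \<epsilon>))" by (rule openin_orb_image) simp
  moreover have "orb z \<in> orb ` (S \<inter> ball z \<epsilon>)" using assms f(2) by simp
  ultimately show "a \<in> carrier (R z)" unfolding stalk_def f(1) by auto
qed

lemma local_fun_const: "local_fun z (\<lambda>_. c)"
  unfolding local_fun_def hol_in_def by (auto intro!: exI[of _ 1] exI[of _ "\<lambda>_. c"] cd_const)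

lemma local_fun_add: "local_fun z f \<Longrightarrow> local_fun z g \<Longrightarrow> local_fun z (\<lambda>y. f y + g y)"
  and local_fun_mult: "local_fun z f \<Longrightarrow> local_fun z g \<Longrightarrow> local_fun z (\<lambda>y. f y * g y)"
proof -
  assume "local_fun z f" "local_fun z g"
  then obtain d e F H where FH: "d > 0" "hol_in (ball z d) F" "\<forall>w\<in>S \<inter> ball z d. f (orb w) = F w"
    "e > 0" "hol_in (ball z e) H" "\<forall>w\<in>S \<inter> ball z e. g (orb w) = H w"
    unfolding local_fun_def by blast
  have "hol_in (ball z (min d e)) (\<lambda>w. F w + H w)" "hol_in (ball z (min d e)) (\<lambda>w. F w * H w)"
    using FH unfolding hol_in_def by (simp_all add: cd_add cd_mult del: split_paired_All)
  moreover have "min d e > 0" using FH by simp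
  moreover have "\<forall>w\<in>S \<inter> ball z (min d e). f (orb w) + g (orb w) = F w + H w"
    "\<forall>w\<in>S \<inter> ball z (min d e). f (orb w) * g (orb w) = F w * H w" using FH by simp_all
  ultimately show "local_fun z (\<lambda>y. f y + g y)" "local_fun z (\<lambda>y. f y * g y)"
    unfolding local_fun_def by blast+
qed

lemma gm_in: "z \<in> S \<Longrightarrow> local_fun z f \<Longrightarrow> gm z f \<in> carrier (R z)"
  by (simp add: carrier_R)

lemma gm_cases:
  assumes "z \<in> S" "a \<in> carrier (R z)"
  obtains f where "local_fun z f" "a = gm z f"
  using assms by (auto simp: carrier_R)

lemma cring_R:
  assumes z: "z \<in> S"
  shows "cring (R z)"
proof (rule cringI)
  note rules = gm_add gm_mult gm_zero gm_one
  show "abelian_group (R z)"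
  proof (rule abelian_groupI)
    fix a assume "a \<in> carrier (R z)"
    then obtain f where f: "local_fun z f" "a = gm z f" by (rule gm_cases[OF z])
    then have "gm z (\<lambda>y. (- 1) * f y) \<in> carrier (R z)"
      using local_fun_mult[OF local_fun_const] by (intro gm_in[OF z]) blast
    moreover have "gm z (\<lambda>y. (- 1) * f y) \<oplus>\<^bsub>R z\<^esub> a = \<zero>\<^bsub>R z\<^esub>"
      by (simp add: f rules)
    ultimately show "\<exists>b\<in>carrier (R z). b \<oplus>\<^bsub>R z\<^esub> a = \<zero>\<^bsub>R z\<^esub>" by blast
  next
    fix a b c assume "a \<in> carrier (R z)" "b \<in> carrier (R z)" "c \<in> carrier (R z)"
    then show "a \<oplus>\<^bsub>R z\<^esub> b \<oplus>\<^bsub>R z\<^esub> c = a \<oplus>\<^bsub>R z\<^esub> (b \<oplus>\<^bsub>R z\<^esub> c)"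
      by (elim gm_cases[OF z]) (simp add: rules add.assoc)
  next
    fix a b assume ab: "a \<in> carrier (R z)" "b \<in> carrier (R z)"
    then show "a \<oplus>\<^bsub>R z\<^esub> b = b \<oplus>\<^bsub>R z\<^esub> a"
      by (elim gm_cases[OF z]) (simp add: rules add.commute)
    show "a \<oplus>\<^bsub>R z\<^esub> b \<in> carrier (R z)"
      using ab by (elim gm_cases[OF z]) (simp add: rules gm_in[OF z] local_fun_add)
  next
    show "\<zero>\<^bsub>R z\<^esub> \<in> carrier (R z)" by (simp add: rules gm_in[OF z] local_fun_const)
    show "\<zero>\<^bsub>R z\<^esub> \<oplus>\<^bsub>R z\<^esub> a = a" if "a \<in> carrier (R z)" for a
      using that by (elim gm_cases[OF z]) (simp add: rules)
  qed
  show "comm_monoid (R z)"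
  proof (rule comm_monoidI)
    fix a b c assume "a \<in> carrier (R z)" "b \<in> carrier (R z)" "c \<in> carrier (R z)"
    then show "a \<otimes>\<^bsub>R z\<^esub> b \<otimes>\<^bsub>R z\<^esub> c = a \<otimes>\<^bsub>R z\<^esub> (b \<otimes>\<^bsub>R z\<^esub> c)"
      by (elim gm_cases[OF z]) (simp add: rules mult.assoc)
  next
    fix a b assume ab: "a \<in> carrier (R z)" "b \<in> carrier (R z)"
    then show "a \<otimes>\<^bsub>R z\<^esub> b = b \<otimes>\<^bsub>R z\<^esub> a"
      by (elim gm_cases[OF z]) (simp add: rules mult.commute)
    show "a \<otimes>\<^bsub>R z\<^esub> b \<in> carrier (R z)"
      using ab by (elim gm_cases[OF z]) (simp add: rules gm_in[OF z] local_fun_mult)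
  next
    show "\<one>\<^bsub>R z\<^esub> \<in> carrier (R z)" by (simp add: rules gm_in[OF z] local_fun_const)
    show "\<one>\<^bsub>R z\<^esub> \<otimes>\<^bsub>R z\<^esub> a = a" if "a \<in> carrier (R z)" for a
      using that by (elim gm_cases[OF z]) (simp add: rules)
  qed
  fix a b c assume "a \<in> carrier (R z)" "b \<in> carrier (R z)" "c \<in> carrier (R z)"
  then show "(a \<oplus>\<^bsub>R z\<^esub> b) \<otimes>\<^bsub>R z\<^esub> c = a \<otimes>\<^bsub>R z\<^esub> c \<oplus>\<^bsub>R z\<^esub> b \<otimes>\<^bsub>R z\<^esub> c"
    by (elim gm_cases[OF z]) (simp add: rules distrib_right)
qed

lemma gm_value: "z \<in> S \<Longrightarrow> gm z f = gm z g \<Longrightarrow> f (orb z) = g (orb z)"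
  by (auto simp: gm_eq_iff)

lemma local_fun_inverse:
  assumes z: "z \<in> S" and f: "local_fun z f" "f (orb z) \<noteq> 0"
  obtains g where "local_fun z g" "gm z g \<otimes>\<^bsub>R z\<^esub> gm z f = \<one>\<^bsub>R z\<^esub>"
proof -
  obtain d F where F: "d > 0" "hol_in (ball z d) F" "\<forall>w\<in>S \<inter> ball z d. f (orb w) = F w"
    using f(1) unfolding local_fun_def by blast
  have "isCont F z" using F(1,2) cd_isCont[of F z] unfolding hol_in_def by simp
  moreover have "F z \<noteq> 0" using f(2) F z by simp
  ultimately obtain e where e: "e > 0" "\<And>x. dist z x < e \<Longrightarrow> F x \<noteq> 0"
    using continuous_at_avoid[of z F 0] by auto
  have hol: "hol_in (ball z (min d e)) (\<lambda>w. inverse (F w))"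
    using F(2) e(2) unfolding hol_in_def by (simp add: cd_inverse del: split_paired_All)
  show thesis
  proof (rule that[of "\<lambda>y. inverse (f y)"])
    show "local_fun z (\<lambda>y. inverse (f y))"
      unfolding local_fun_def
      by (intro exI[of _ "min d e"] exI[of _ "\<lambda>w. inverse (F w)"] conjI hol) (use F e in auto)
    show "gm z (\<lambda>y. inverse (f y)) \<otimes>\<^bsub>R z\<^esub> gm z f = \<one>\<^bsub>R z\<^esub>"
      unfolding gm_mult gm_one gm_eq_iff[OF z]
      by (intro exI[of _ "min d e"] conjI) (use F e in auto)
  qed
qed

text \<open>The germs vanishing at the point form an ideal, and all other germs are units. Hence the
  stalk is local, and it equals its integral closure.\<close>

lemma normal_imp_unibranch:
  assumes z: "z \<in> S" and n: "normal_at Y (orb z)"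
  shows "unibranch_at Y (orb z)"
proof -
  have ic: "integrally_closed_domain (R z)" using n by (simp add: normal_at_def)
  then interpret domain "R z" by (simp add: integrally_closed_domain_def)
  define I where "I = {a \<in> carrier (R z). \<exists>f. local_fun z f \<and> a = gm z f \<and> f (orb z) = 0}"
  have memI: "gm z f \<in> I \<longleftrightarrow> f (orb z) = 0" if "local_fun z f" for f
  proof
    assume "gm z f \<in> I"
    then obtain h where "gm z f = gm z h" "h (orb z) = 0" unfolding I_def by blast
    then show "f (orb z) = 0" using gm_value[OF z, of f h] by simp
  qed (use that gm_in[OF z that] in \<open>auto simp: I_def\<close>)
  have neg: "\<ominus>\<^bsub>R z\<^esub> gm z f = gm z (\<lambda>y. - f y)" if "local_fun z f" for f
  proof (rule minus_equality)
    show "gm z (\<lambda>y. - f y) \<oplus>\<^bsub>R z\<^esub> gm z f = \<zero>\<^bsub>R z\<^esub>" by (simp add: gm_add gm_zero)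
    show "gm z f \<in> carrier (R z)" "gm z (\<lambda>y. - f y) \<in> carrier (R z)"
      using gm_in[OF z] that local_fun_mult[OF local_fun_const[of z "-1"] that] by auto
  qed
  have "ideal I (R z)"
  proof (rule idealI[OF ring_axioms])
    show "subgroup I (add_monoid (R z))"
    proof (rule group.subgroupI)
      show "Group.group (add_monoid (R z))" by (rule a_group)
      show "I \<subseteq> carrier (add_monoid (R z))" by (auto simp: I_def)
      show "I \<noteq> {}" using memI[OF local_fun_const[of z 0]] by auto
      show "inv\<^bsub>add_monoid (R z)\<^esub> a \<in> I" if a: "a \<in> I" for a
      proof -
        obtain f where f: "local_fun z f" "a = gm z f" "f (orb z) = 0" using a by (auto simp: I_def)
        have "\<ominus>\<^bsub>R z\<^esub> a \<in> I"
          using neg[OF f(1)] memI[OF local_fun_mult[OF local_fun_const[of z "-1"] f(1)]] f by simp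
        then show ?thesis by (simp add: a_inv_def)
      qed
      show "a \<otimes>\<^bsub>add_monoid (R z)\<^esub> b \<in> I" if "a \<in> I" "b \<in> I" for a b
      proof -
        obtain f where f: "local_fun z f" "a = gm z f" "f (orb z) = 0" using \<open>a \<in> I\<close> unfolding I_def by blast
        obtain g where g: "local_fun z g" "b = gm z g" "g (orb z) = 0" using \<open>b \<in> I\<close> unfolding I_def by blast
        show ?thesis using memI[OF local_fun_add[OF f(1) g(1)]] f g by (simp add: gm_add)
      qed
    qed
  next
    fix a x assume ax: "a \<in> I" "x \<in> carrier (R z)"
    obtain f where f: "local_fun z f" "a = gm z f" "f (orb z) = 0" using ax by (auto simp: I_def)
    obtain g where g: "local_fun z g" "x = gm z g" using gm_cases[OF z ax(2)] by blast
    show "x \<otimes>\<^bsub>R z\<^esub> a \<in> I" using memI[OF local_fun_mult[OF g(1) f(1)]] f g by (simp add: gm_mult)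
    show "a \<otimes>\<^bsub>R z\<^esub> x \<in> I" using memI[OF local_fun_mult[OF f(1) g(1)]] f g by (simp add: gm_mult)
  qed
  moreover have "\<one>\<^bsub>R z\<^esub> \<notin> I" using memI[OF local_fun_const[of z 1]] by (simp add: gm_one)
  moreover have "\<exists>b\<in>carrier (R z). b \<otimes>\<^bsub>R z\<^esub> a = \<one>\<^bsub>R z\<^esub>" if a: "a \<in> carrier (R z) - I" for a
  proof -
    obtain f where f: "local_fun z f" "a = gm z f" using gm_cases[OF z] a by blast
    then have "f (orb z) \<noteq> 0" using a memI by blast
    then show ?thesis using local_fun_inverse[OF z f(1)] f gm_in[OF z] by metis
  qed
  ultimately show ?thesis
    unfolding unibranch_at_def by (intro integrally_closed_unibranch[OF ic])
qed

end

section \<open>A criterion for normality\<close>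

text \<open>The value of \<open>homog\<close> at a point, for germs represented by complex
  functions.\<close>

fun hom_val :: "complex \<Rightarrow> complex \<Rightarrow> complex list \<Rightarrow> complex"
  where "hom_val a b [] = 0"
  | "hom_val a b (c # cs) = b * (c * a ^ length cs + hom_val a b cs)"

fun poly_val :: "complex \<Rightarrow> complex list \<Rightarrow> complex"
  where "poly_val x [] = 0"
  | "poly_val x (c # cs) = c * x ^ length cs + poly_val x cs"

lemma hom_val_eq: "b \<noteq> 0 \<Longrightarrow> hom_val a b cs = b ^ length cs * poly_val (a / b) cs"
  by (induction cs) (simp_all add: power_divide field_simps)

lemma poly_val_bound:
  assumes "norm x \<ge> 1"
  shows "norm (poly_val x cs) * norm x \<le> (\<Sum>c\<leftarrow>cs. norm c) * norm x ^ length cs"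
proof (induction cs)
  case (Cons c cs)
  have "norm (poly_val x (c # cs)) * norm x \<le> (norm c * norm x ^ length cs + norm (poly_val x cs)) * norm x"
    by (intro mult_right_mono) (auto simp: norm_mult norm_power intro: norm_triangle_le)
  also have "\<dots> \<le> norm c * norm x ^ length cs * norm x + (\<Sum>c\<leftarrow>cs. norm c) * norm x ^ length cs"
    using Cons by (simp add: distrib_right)
  also have "(\<Sum>c\<leftarrow>cs. norm c) * norm x ^ length cs \<le> (\<Sum>c\<leftarrow>cs. norm c) * norm x ^ length cs * norm x"
  proof -
    have "0 \<le> (\<Sum>c\<leftarrow>cs. norm c) * norm x ^ length cs"
      by (intro mult_nonneg_nonneg sum_list_nonneg) auto
    from mult_left_mono[OF assms this] show ?thesis by simp
  qed
  finally show ?case by (simp add: algebra_simps)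
qed simp

text \<open>Cauchy's bound for the roots of a monic polynomial. It makes a quotient that is integral
  over the stalk locally bounded, as \<open>hol_in_division\<close> demands.\<close>

lemma integral_quotient_bound:
  assumes "a ^ length cs + hom_val a b cs = 0" "b \<noteq> 0"
  shows "norm (a / b) \<le> 1 + (\<Sum>c\<leftarrow>cs. norm c)"
proof (cases "norm (a / b) \<ge> 1")
  case True
  let ?x = "a / b"
  have "b ^ length cs * (?x ^ length cs + poly_val ?x cs) = 0"
    using assms by (simp add: hom_val_eq power_divide distrib_left)
  then have "?x ^ length cs = - poly_val ?x cs"
    using assms(2) by (simp add: eq_neg_iff_add_eq_0)
  then have "norm ?x ^ length cs * norm ?x \<le> (\<Sum>c\<leftarrow>cs. norm c) * norm ?x ^ length cs"
    using poly_val_bound[OF True, of cs] by (metis norm_minus_cancel norm_power)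
  then have "norm ?x \<le> (\<Sum>c\<leftarrow>cs. norm c)"
  proof -
    assume le: "norm ?x ^ length cs * norm ?x \<le> (\<Sum>c\<leftarrow>cs. norm c) * norm ?x ^ length cs"
    have "0 < norm ?x" using True by linarith
    then have "0 < norm ?x ^ length cs" by (rule zero_less_power)
    then show ?thesis using le by (metis mult.commute mult_le_cancel_right_pos)
  qed
  then show ?thesis by simp
next
  case False
  have "0 \<le> (\<Sum>c\<leftarrow>cs. norm c)" by (rule sum_list_nonneg) auto
  then show ?thesis using False by linarith
qed

context isometry_action
begin

lemma complexify_act: "g \<in> G \<Longrightarrow> complexify (g ` A) = complex_act g ` complexify A"
  by (simp add: complexify_image aff)

lemma in_branch: "w \<in> S \<longleftrightarrow> (\<exists>g\<in>G. w \<in> complexify (g ` L))"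
  unfolding S_def using complexify_act by auto

lemma dist_fix: "g \<in> G \<Longrightarrow> complex_act g z = z \<Longrightarrow> dist z (complex_act g w) = dist z w"
  using dist_act[of g z w] by simp

lemma gm_pow:
  assumes z: "z \<in> S" and f: "local_fun z f"
  shows "gm z f [^]\<^bsub>R z\<^esub> (n::nat) = gm z (\<lambda>y. f y ^ n)" "local_fun z (\<lambda>y. f y ^ n)"
proof -
  interpret cring "R z" by (rule cring_R[OF z])
  show "gm z f [^]\<^bsub>R z\<^esub> (n::nat) = gm z (\<lambda>y. f y ^ n)"
    by (induction n) (simp_all add: gm_one gm_mult mult.commute)
  show "local_fun z (\<lambda>y. f y ^ n)"
    by (induction n) (simp_all add: local_fun_const local_fun_mult f)
qed

lemma local_fun_common:
  assumes "finite \<Phi>" "\<And>f. f \<in> \<Phi> \<Longrightarrow> local_fun z f"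
  shows "\<exists>d>0. \<forall>f\<in>\<Phi>. \<exists>F. hol_in (ball z d) F \<and> (\<forall>w\<in>S \<inter> ball z d. f (orb w) = F w)"
  using assms
proof (induction \<Phi>)
  case empty
  then show ?case by (auto intro: exI[of _ 1])
next
  case (insert f \<Phi>)
  obtain d where d: "d > 0" "\<forall>f\<in>\<Phi>. \<exists>F. hol_in (ball z d) F \<and> (\<forall>w\<in>S \<inter> ball z d. f (orb w) = F w)"
    using insert.IH insert.prems by auto
  have "local_fun z f" using insert.prems by simp
  then obtain e F where F: "e > 0" "hol_in (ball z e) F" "\<forall>w\<in>S \<inter> ball z e. f (orb w) = F w"
    unfolding local_fun_def by blast
  have sub: "ball z (min d e) \<subseteq> ball z d" "ball z (min d e) \<subseteq> ball z e" by auto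
  show ?case
  proof (intro exI[of _ "min d e"] conjI ballI)
    fix h assume "h \<in> insert f \<Phi>"
    then consider "h = f" | "h \<in> \<Phi>" by blast
    then show "\<exists>F. hol_in (ball z (min d e)) F \<and> (\<forall>w\<in>S \<inter> ball z (min d e). h (orb w) = F w)"
    proof cases
      case 1
      then show ?thesis using F sub(2) hol_in_subset[OF F(2) sub(2)] by (intro exI[of _ F]) auto
    next
      case 2
      then obtain H where H: "hol_in (ball z d) H" "\<forall>w\<in>S \<inter> ball z d. h (orb w) = H w" using d by blast
      then show ?thesis using sub(1) hol_in_subset[OF H(1) sub(1)] by (intro exI[of _ H]) auto
    qed
  qed (use d F in simp)
qed

text \<open>A retraction of the ambient space onto \<open>complexify L\<close>. Composing with it
  turns functions on \<open>complexify L\<close> into functions on balls, where the identity theorem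
  and division are available.\<close>

definition proj :: "'a \<times> 'a \<Rightarrow> 'a \<times> 'a"
  where "proj = complex_act (closest_point L)"

lemma proj_in: "proj w \<in> complexify L"
  unfolding proj_def by (rule complex_act_closest_point_in[OF affL Lne])

lemma proj_self: "w \<in> complexify L \<Longrightarrow> proj w = w"
  unfolding proj_def by (rule complex_act_closest_point_self[OF affL])

lemma proj_ball: "z \<in> complexify L \<Longrightarrow> w \<in> ball z r \<Longrightarrow> proj w \<in> ball z r"
  using dist_complex_act_closest_point[OF affL Lne, of z w] proj_self[of z] unfolding proj_def by simp

lemma hol_in_proj:
  assumes "z \<in> complexify L" "hol_in (ball z r) F"
  shows "hol_in (ball z r) (\<lambda>w. F (proj w))"
  using assms proj_ball unfolding hol_in_def proj_def
  by (intro ballI cd_complex_act closest_point_affmap affL Lne) blast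

text \<open>The two hypotheses: the \<open>G\<close>-translates of \<open>L\<close> through \<open>z\<close> are permuted transitively by the
  stabiliser of \<open>z\<close>, and every function on \<open>L\<close> near \<open>z\<close> invariant under the stabiliser extends to
  an ambient function that is invariant on their union.\<close>

lemma normal_criterion:
  assumes zL: "z \<in> complexify L" and e0: "\<epsilon>0 > 0"
    and br: "\<And>w. w \<in> S \<inter> ball z \<epsilon>0 \<Longrightarrow> \<exists>g\<in>G. complex_act g z = z \<and> complex_act g w \<in> complexify L"
    and ext: "\<And>\<epsilon> H. 0 < \<epsilon> \<Longrightarrow> \<epsilon> \<le> \<epsilon>0 \<Longrightarrow> hol_in (ball z \<epsilon>) H \<Longrightarrow>
      (\<And>g w. g \<in> G \<Longrightarrow> complex_act g z = z \<Longrightarrow> g ` L = L \<Longrightarrow> w \<in> complexify L \<inter> ball z \<epsilon> \<Longrightarrow> H (complex_act g w) = H w) \<Longrightarrow>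
      \<exists>\<epsilon>'>0. \<exists>F. \<epsilon>' \<le> \<epsilon> \<and> hol_in (ball z \<epsilon>') F \<and>
        (\<forall>g\<in>G. complex_act g z = z \<longrightarrow> (\<forall>w\<in>complexify L \<inter> ball z \<epsilon>'. F (complex_act g w) = H w))"
  shows "normal_at Y (orb z)"
proof -
  have z: "z \<in> S" using zL complexify_sub_S by blast
  \<comment> \<open>The element moving \<open>w\<close> into \<open>complexify L\<close> fixes
    \<open>z\<close>, so it keeps the distance to \<open>z\<close> and preserves the orbit of
    \<open>w\<close>.\<close>
  have to_L: "\<exists>w1\<in>complexify L \<inter> ball z d. \<exists>h\<in>G. complex_act h z = z \<and> w = complex_act h w1 \<and> orb w = orb w1"
    if w: "w \<in> S \<inter> ball z d" and d: "d \<le> \<epsilon>0" for w d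
  proof -
    obtain g where g: "g \<in> G" "complex_act g z = z" "complex_act g w \<in> complexify L"
      using br[of w] w d by auto
    obtain h where h: "h \<in> G" "\<And>w. complex_act h (complex_act g w) = w" using inverseE[OF g(1)] by metis
    have "complex_act g w \<in> ball z d" using w dist_fix[OF g(1,2)] by simp
    moreover have "complex_act h z = z" using h(2)[of z] g(2) by simp
    moreover have "w = complex_act h (complex_act g w)" using h(2) by simp
    moreover have "orb w = orb (complex_act g w)" using g(1) by simp
    ultimately show ?thesis using g(3) h(1) by blast
  qed
  \<comment> \<open>By \<open>to_L\<close> a function on the quotient that vanishes on
    \<open>complexify L\<close> near \<open>z\<close> vanishes on every branch.\<close>
  have zero: "gm z f = \<zero>\<^bsub>R z\<^esub>"
    if "d > 0" "\<forall>w\<in>S \<inter> ball z d. f (orb w) = F w" "\<And>w. w \<in> ball z d' \<Longrightarrow> F (proj w) = 0" "d' > 0" for f F d d'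
    unfolding gm_zero gm_eq_iff[OF z]
  proof (intro exI[of _ "min (min d d') \<epsilon>0"] conjI ballI)
    fix w assume "w \<in> S \<inter> ball z (min (min d d') \<epsilon>0)"
    from to_L[OF this] obtain w1 where w1: "w1 \<in> complexify L" "w1 \<in> ball z (min (min d d') \<epsilon>0)" "orb w = orb w1"
      by auto
    then have "w1 \<in> S \<inter> ball z d" "w1 \<in> ball z d'" using complexify_sub_S by auto
    then have "f (orb w1) = F w1" "F (proj w1) = 0" using that(2,3) by blast+
    then show "f (orb w) = 0" using w1 proj_self by simp
  qed (use that e0 in simp)
  have dom: "domain (R z)"
  proof (intro domain.intro domain_axioms.intro cring_R[OF z])
    show "\<one>\<^bsub>R z\<^esub> \<noteq> \<zero>\<^bsub>R z\<^esub>" using gm_value[OF z, of "\<lambda>_. 1" "\<lambda>_. 0"] by (auto simp: gm_one gm_zero)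
    fix a b assume ab: "a \<otimes>\<^bsub>R z\<^esub> b = \<zero>\<^bsub>R z\<^esub>" "a \<in> carrier (R z)" "b \<in> carrier (R z)"
    obtain f where f: "local_fun z f" "a = gm z f" using gm_cases[OF z ab(2)] by blast
    obtain h where h: "local_fun z h" "b = gm z h" using gm_cases[OF z ab(3)] by blast
    obtain d1 F where F: "d1 > 0" "hol_in (ball z d1) F" "\<forall>w\<in>S \<inter> ball z d1. f (orb w) = F w"
      using f(1) unfolding local_fun_def by blast
    obtain d2 H where H: "d2 > 0" "hol_in (ball z d2) H" "\<forall>w\<in>S \<inter> ball z d2. h (orb w) = H w"
      using h(1) unfolding local_fun_def by blast
    obtain d3 where d3: "d3 > 0" "\<forall>w\<in>S \<inter> ball z d3. f (orb w) * h (orb w) = 0"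
      using ab(1) unfolding f(2) h(2) gm_mult gm_zero gm_eq_iff[OF z] by blast
    define d where "d = min (min d1 d2) d3"
    have d: "d > 0" "ball z d \<subseteq> ball z d1" "ball z d \<subseteq> ball z d2" "ball z d \<subseteq> ball z d3"
      using F H d3 by (auto simp: d_def)
    \<comment> \<open>After composition with the projection the product vanishes on a full ball, so
      one factor does.\<close>
    have FH: "F (proj w) * H (proj w) = 0" if "w \<in> ball z d" for w
    proof -
      have "proj w \<in> S" "proj w \<in> ball z d"
        using subsetD[OF complexify_sub_S proj_in] proj_ball[OF zL that] by blast+
      then have "f (orb (proj w)) = F (proj w)" "h (orb (proj w)) = H (proj w)" "f (orb (proj w)) * h (orb (proj w)) = 0"
        using F(3) H(3) d3(2) d by blast+
      then show ?thesis by simp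
    qed
    show "a = \<zero>\<^bsub>R z\<^esub> \<or> b = \<zero>\<^bsub>R z\<^esub>"
    proof (cases "\<exists>w1\<in>ball z d. F (proj w1) \<noteq> 0")
      case True
      then obtain w1 where w1: "w1 \<in> ball z d" "F (proj w1) \<noteq> 0" by blast
      have "H (proj w) = 0" if "w \<in> ball z d" for w
        by (rule hol_in_mult_zero[where F = "\<lambda>w. F (proj w)" and G = "\<lambda>w. H (proj w)", OF _ _ FH w1 that])
           (use hol_in_proj[OF zL] hol_in_subset[OF F(2) d(2)] hol_in_subset[OF H(2) d(3)] in blast)+
      then have "b = \<zero>\<^bsub>R z\<^esub>" unfolding h(2) by (rule zero[OF H(1,3) _ d(1)])
      then show ?thesis ..
    next
      case False
      then have "F (proj w) = 0" if "w \<in> ball z d" for w using that by blast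
      then have "a = \<zero>\<^bsub>R z\<^esub>" unfolding f(2) by (rule zero[OF F(1,3) _ d(1)])
      then show ?thesis ..
    qed
  qed
  interpret D: domain "R z" by (rule dom)
  have hom_gm: "D.homog (gm z fa) (gm z fb) (map (gm z) fs) = gm z (\<lambda>y. hom_val (fa y) (fb y) (map (\<lambda>f. f y) fs))"
    if "local_fun z fa" for fa fb fs
    by (induction fs) (simp_all add: gm_zero gm_pow[OF z that] gm_mult gm_add)
  have "integrally_closed_domain (R z)"
  proof (rule D.integrally_closed_domainI)
    fix a b cs assume ab: "a \<in> carrier (R z)" "b \<in> carrier (R z) - {\<zero>\<^bsub>R z\<^esub>}" and cs: "set cs \<subseteq> carrier (R z)"
      and eq: "a [^]\<^bsub>R z\<^esub> length cs \<oplus>\<^bsub>R z\<^esub> D.homog a b cs = \<zero>\<^bsub>R z\<^esub>"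
    obtain fa where fa: "local_fun z fa" "a = gm z fa" using gm_cases[OF z ab(1)] by blast
    obtain fb where fb: "local_fun z fb" "b = gm z fb" using gm_cases[OF z] ab(2) by blast
    obtain fs where fs: "set fs \<subseteq> {f. local_fun z f}" "cs = map (gm z) fs"
    proof -
      have "cs \<in> lists (gm z ` {f. local_fun z f})" using cs carrier_R[OF z] by (auto simp: in_lists_conv_set)
      then show thesis using that unfolding lists_image by (auto simp: in_lists_conv_set subset_iff)
    qed
    have "gm z (\<lambda>y. fa y ^ length fs + hom_val (fa y) (fb y) (map (\<lambda>f. f y) fs)) = gm z (\<lambda>_. 0)"
      using eq unfolding fa(2) fb(2) fs(2) hom_gm[OF fa(1)] by (simp add: gm_pow[OF z fa(1)] gm_add gm_zero)
    then obtain d1 where d1: "d1 > 0" "\<forall>w\<in>S \<inter> ball z d1. fa (orb w) ^ length fs + hom_val (fa (orb w)) (fb (orb w)) (map (\<lambda>f. f (orb w)) fs) = 0"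
      unfolding gm_eq_iff[OF z] by blast
    have "\<exists>d>0. \<forall>f\<in>insert fa (insert fb (set fs)). \<exists>F. hol_in (ball z d) F \<and> (\<forall>w\<in>S \<inter> ball z d. f (orb w) = F w)"
      using fa(1) fb(1) fs(1) by (intro local_fun_common) auto
    then obtain d2 where d2: "d2 > 0" "\<And>f. f \<in> insert fa (insert fb (set fs)) \<Longrightarrow> \<exists>F. hol_in (ball z d2) F \<and> (\<forall>w\<in>S \<inter> ball z d2. f (orb w) = F w)"
      by blast
    then obtain CF where CF0: "\<And>f. f \<in> insert fa (insert fb (set fs)) \<Longrightarrow> hol_in (ball z d2) (CF f)"
      "\<And>f w. f \<in> insert fa (insert fb (set fs)) \<Longrightarrow> w \<in> S \<inter> ball z d2 \<Longrightarrow> f (orb w) = CF f w"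
      by metis
    define d where "d = min (min d1 d2) \<epsilon>0"
    have d: "d > 0" "ball z d \<subseteq> ball z d1" "ball z d \<subseteq> ball z d2" "d \<le> \<epsilon>0" using d1 d2 e0 by (auto simp: d_def)
    have CF: "hol_in (ball z d) (CF f)" "\<And>w. w \<in> S \<inter> ball z d \<Longrightarrow> f (orb w) = CF f w"
      if "f \<in> insert fa (insert fb (set fs))" for f
      using CF0[OF that] hol_in_subset d(3) by blast+
    define A where "A = CF fa" define B where "B = CF fb"
    have holA: "hol_in (ball z d) (\<lambda>w. A (proj w))" and holB: "hol_in (ball z d) (\<lambda>w. B (proj w))"
      using hol_in_proj[OF zL] CF(1) by (auto simp: A_def B_def)
    have fA: "fa (orb w) = A w" and fB: "fb (orb w) = B w" if "w \<in> S \<inter> ball z d" for w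
      using CF(2)[OF _ that] by (auto simp: A_def B_def)
    \<comment> \<open>The denominator is a nonzero germ, hence not identically zero on
      \<open>complexify L\<close> in any ball around \<open>z\<close>.\<close>
    have Bne: "\<exists>w\<in>ball z d'. B (proj w) \<noteq> 0" if "d' > 0" for d'
    proof (rule ccontr)
      assume "\<not> (\<exists>w\<in>ball z d'. B (proj w) \<noteq> 0)"
      then have "gm z fb = \<zero>\<^bsub>R z\<^esub>" using fB by (intro zero[OF d(1) _ _ that, of fb B]) blast+
      then show False using ab(2) fb(2) by simp
    qed
    have inS: "proj w \<in> S \<inter> ball z r" if "w \<in> ball z r" for w r
      by (rule IntI[OF subsetD[OF complexify_sub_S proj_in] proj_ball[OF zL that]])
    obtain w0 where w0: "w0 \<in> ball z d" "B (proj w0) \<noteq> 0" using Bne[OF d(1)] by blast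
    \<comment> \<open>The coefficients evaluated at the point bound the quotient, and they vary
      continuously.\<close>
    have bound: "norm (A (proj w) / B (proj w)) \<le> 1 + (\<Sum>f\<leftarrow>fs. norm (CF f (proj w)))"
      if w: "w \<in> ball z d" "B (proj w) \<noteq> 0" for w
    proof -
      have p: "proj w \<in> S \<inter> ball z d" "proj w \<in> S \<inter> ball z d1" using inS[OF w(1)] d by auto
      have map_eq: "map (\<lambda>f. f (orb (proj w))) fs = map (\<lambda>f. CF f (proj w)) fs"
        using CF(2)[OF _ p(1)] by (intro map_cong) auto
      have "A (proj w) ^ length (map (\<lambda>f. CF f (proj w)) fs) + hom_val (A (proj w)) (B (proj w)) (map (\<lambda>f. CF f (proj w)) fs) = 0"
        using d1(2) p(2) fA[OF p(1)] fB[OF p(1)] map_eq by (metis length_map)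
      from integral_quotient_bound[OF this w(2)] show ?thesis by (simp add: comp_def)
    qed
    have contC: "continuous_on (ball z d) (\<lambda>w. 1 + (\<Sum>f\<leftarrow>fs. norm (CF f (proj w))))"
    proof -
      have "continuous_on (ball z d) (\<lambda>w. \<Sum>f\<leftarrow>gs. norm (CF f (proj w)))" if "set gs \<subseteq> set fs" for gs
        using that
      proof (induction gs)
        case (Cons f gs)
        then have "hol_in (ball z d) (\<lambda>w. CF f (proj w))" by (intro hol_in_proj[OF zL] CF(1)) auto
        then have "continuous_on (ball z d) (\<lambda>w. norm (CF f (proj w)))"
          by (intro continuous_on_norm hol_in_continuous_on)
        then show ?case using Cons by (auto intro!: continuous_on_add)
      qed simp
      then show ?thesis by (intro continuous_on_add continuous_on_const) blast
    qed
    obtain r H where r: "0 < r" "r \<le> d" and H: "hol_in (ball z r) H" "\<And>w. w \<in> ball z r \<Longrightarrow> A (proj w) = H w * B (proj w)"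
      using hol_in_division[OF holA holB w0 bound contC] by blast
    \<comment> \<open>The quotient on \<open>complexify L\<close>, made constant along the fibres of
      the projection.\<close>
    define K where "K w = H (proj w)" for w
    have holK: "hol_in (ball z r) K" unfolding K_def by (rule hol_in_proj[OF zL H(1)])
    have K: "A w = K w * B w" if "w \<in> complexify L \<inter> ball z r" for w
      using H(2)[of w] that proj_self[of w] by (simp add: K_def)
    have Kinv: "K (complex_act g w) = K w"
      if g: "g \<in> G" "complex_act g z = z" "g ` L = L" and w: "w \<in> complexify L \<inter> ball z r" for g w
    proof -
      \<comment> \<open>Numerator and denominator are invariant, so the denominator times this
        difference vanishes; the denominator is then cancelled by the identity theorem.\<close>
      define \<Delta> where "\<Delta> v = K (complex_act g (proj v)) - K (proj v)" for v
      have gL: "complex_act g v \<in> complexify L" if "v \<in> complexify L" for v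
        using complexify_act[OF g(1), of L] g(3) that by auto
      have gb: "complex_act g v \<in> ball z r" if "v \<in> ball z r" for v
        using that dist_fix[OF g(1,2)] by simp
      have "hol_in (ball z r) (\<lambda>v. K (complex_act g v))"
        using holK gb aff[OF g(1)] unfolding hol_in_def by (intro ballI cd_complex_act) blast+
      then have h\<Delta>: "hol_in (ball z r) \<Delta>"
        using hol_in_proj[OF zL, of r "\<lambda>v. K (complex_act g v)"] hol_in_proj[OF zL holK]
        unfolding \<Delta>_def hol_in_def by (intro ballI cd_diff) blast+
      have hB: "hol_in (ball z r) (\<lambda>w. B (proj w))" by (rule hol_in_subset[OF holB subset_ball[OF r(2)]])
      have B\<Delta>: "B (proj v) * \<Delta> v = 0" if v: "v \<in> ball z r" for v
      proof -
        let ?p = "proj v"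
        have p: "?p \<in> complexify L \<inter> ball z r" using proj_in proj_ball[OF zL v] by blast
        have gp: "complex_act g ?p \<in> complexify L \<inter> ball z r" using gL gb p by blast
        have inSd: "?p \<in> S \<inter> ball z d" "complex_act g ?p \<in> S \<inter> ball z d" using p gp r(2) complexify_sub_S by auto
        have "A (complex_act g ?p) = A ?p" "B (complex_act g ?p) = B ?p"
          using fA[OF inSd(1)] fA[OF inSd(2)] fB[OF inSd(1)] fB[OF inSd(2)] g(1) by simp_all
        then show ?thesis using K[OF p] K[OF gp] proj_self[of ?p] p by (simp add: \<Delta>_def algebra_simps)
      qed
      obtain w1 where w1: "w1 \<in> ball z r" "B (proj w1) \<noteq> 0" using Bne[OF r(1)] by blast
      have wb: "w \<in> ball z r" using w by blast
      have "\<Delta> w = 0" by (rule hol_in_mult_zero[OF hB h\<Delta> B\<Delta> w1 wb])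
      then show ?thesis using proj_self[of w] w by (simp add: \<Delta>_def)
    qed
    obtain \<epsilon>' F where F: "\<epsilon>' > 0" "\<epsilon>' \<le> r" "hol_in (ball z \<epsilon>') F"
      "\<And>g w. g \<in> G \<Longrightarrow> complex_act g z = z \<Longrightarrow> w \<in> complexify L \<inter> ball z \<epsilon>' \<Longrightarrow> F (complex_act g w) = K w"
    proof -
      have "r \<le> \<epsilon>0" using r(2) d(4) by linarith
      from ext[OF r(1) this holK Kinv] obtain \<epsilon>' F where "\<epsilon>' > 0" "\<epsilon>' \<le> r" "hol_in (ball z \<epsilon>') F"
        "\<forall>g\<in>G. complex_act g z = z \<longrightarrow> (\<forall>w\<in>complexify L \<inter> ball z \<epsilon>'. F (complex_act g w) = K w)"
        by blast
      then show thesis by (intro that[of \<epsilon>' F]) blast+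
    qed
    obtain \<rho> where \<rho>: "\<rho> > 0" "\<And>g w. g \<in> G \<Longrightarrow> w \<in> ball z \<rho> \<Longrightarrow> complex_act g w \<in> ball z \<rho> \<Longrightarrow> complex_act g z = z"
      using separation[of z] by blast
    \<comment> \<open>Within \<open>\<epsilon>'\<close> the extension is available, and within
      \<open>\<rho>\<close> only elements fixing \<open>z\<close> relate points, so the extension
      descends to the quotient.\<close>
    define \<epsilon> where "\<epsilon> = min \<epsilon>' \<rho>"
    have e: "\<epsilon> > 0" "ball z \<epsilon> \<subseteq> ball z \<epsilon>'" "ball z \<epsilon> \<subseteq> ball z \<rho>" "\<epsilon> \<le> \<epsilon>0" "ball z \<epsilon> \<subseteq> ball z r" "ball z \<epsilon> \<subseteq> ball z d"
      using F \<rho> r d by (auto simp: \<epsilon>_def)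
    have FK: "F (complex_act g w) = K w1"
      if "g \<in> G" "complex_act g z = z" "w1 \<in> complexify L \<inter> ball z \<epsilon>" "h \<in> G" "complex_act h z = z" "w = complex_act h w1" for g h w w1
      using F(4)[OF comp_in[OF that(1,4)], of w1] act_comp[OF that(1,4)] that e(2) by auto
    have sep: "complex_act g z = z" if "g \<in> G" "w \<in> ball z \<epsilon>" "complex_act g w \<in> ball z \<epsilon>" for g w
      using \<rho>(2)[OF that(1)] that e(3) by blast
    have Finv: "F (complex_act g w) = F w" if g: "g \<in> G" "complex_act g z = z" and w: "w \<in> S \<inter> ball z \<epsilon>" for g w
    proof -
      obtain w1 h where w1: "w1 \<in> complexify L \<inter> ball z \<epsilon>" "h \<in> G" "complex_act h z = z" "w = complex_act h w1"
        using to_L[OF w e(4)] by blast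
      show ?thesis using FK[OF g w1] FK[OF id_in _ w1] by simp
    qed
    have "\<exists>f. (\<forall>w\<in>S \<inter> ball z \<epsilon>. f (orb w) = F w) \<and> local_fun z f"
      by (rule local_fun_exists[OF hol_in_subset[OF F(3) e(2)] e(1)]) (fact sep, fact Finv)
    then obtain f where f: "\<And>w. w \<in> S \<inter> ball z \<epsilon> \<Longrightarrow> f (orb w) = F w" "local_fun z f" by blast
    have "a = gm z f \<otimes>\<^bsub>R z\<^esub> b"
      unfolding fa(2) fb(2) gm_mult gm_eq_iff[OF z]
    proof (intro exI[of _ \<epsilon>] conjI ballI e(1))
      fix w assume w: "w \<in> S \<inter> ball z \<epsilon>"
      obtain w1 h where w1: "w1 \<in> complexify L \<inter> ball z \<epsilon>" "h \<in> G" "complex_act h z = z" "w = complex_act h w1" and o: "orb w = orb w1"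
        using to_L[OF w e(4)] by blast
      have w1': "w1 \<in> S \<inter> ball z d" "w1 \<in> complexify L \<inter> ball z r" using w1(1) e complexify_sub_S by auto
      have "f (orb w) = K w1" using f(1)[OF w] FK[OF id_in _ w1] by simp
      then show "fa (orb w) = f (orb w) * fb (orb w)"
        using o K[OF w1'(2)] fA[OF w1'(1)] fB[OF w1'(1)] by simp
    qed
    then show "\<exists>h\<in>carrier (R z). a = h \<otimes>\<^bsub>R z\<^esub> b" using gm_in[OF z f(2)] by blast
  qed
  then show ?thesis by (simp add: normal_at_def)
qed

end

section \<open>Unit normals and normal coordinates\<close>

lemma unit_normal_exists:
  fixes U W :: "'a::euclidean_space set"
  assumes "subspace U" "subspace W" "U \<subseteq> W" "dim W = dim U + 1"
  obtains e where "e \<in> W" "norm e = 1" "\<And>u. u \<in> U \<Longrightarrow> e \<bullet> u = 0" "\<And>w. w \<in> W \<Longrightarrow> \<exists>t. w - t *\<^sub>R e \<in> U"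
proof -
  have sp: "span U = U" "span W = W" using assms span_eq_iff by blast+
  have "U \<noteq> W" using assms(4) by auto
  then have "span U \<subset> span W" unfolding sp using assms(3) by blast
  then obtain x where x: "x \<noteq> 0" "x \<in> W" "\<And>y. y \<in> U \<Longrightarrow> orthogonal x y"
    using orthogonal_to_subspace_exists_gen[of U W] sp by auto
  define e where "e = x /\<^sub>R norm x"
  have e: "e \<in> W" "norm e = 1" "\<And>u. u \<in> U \<Longrightarrow> e \<bullet> u = 0"
    using x assms(2) by (auto simp: e_def subspace_scale orthogonal_def)
  have "e \<notin> U" using e(2,3) by (metis inner_eq_zero_iff norm_zero zero_neq_one)
  then have "e \<notin> span U" unfolding sp(1) .
  then have "dim (insert e U) = dim U + 1" by (simp add: dim_insert)
  moreover have "span (insert e U) \<subseteq> W" using assms(2,3) e(1) by (intro span_minimal) auto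
  ultimately have eq: "span (insert e U) = W"
    using assms(2,4) by (intro subspace_dim_equal) auto
  have "\<exists>t. w - t *\<^sub>R e \<in> U" if "w \<in> W" for w
  proof -
    have "w \<in> span (insert e U)" unfolding eq by (rule that)
    then show ?thesis unfolding span_breakdown_eq sp(1) .
  qed
  then show thesis using that e by blast
qed

text \<open>The complex-bilinear extension of the squared norm. It is holomorphic, invariant under
  linear parts of isometries, and equals \<open>t^2\<close> at \<open>t\<close> times a real unit
  vector.\<close>

definition cq :: "'a::euclidean_space \<times> 'a \<Rightarrow> complex"
  where "cq v = (\<Sum>b\<in>Basis. (cinner b v)\<^sup>2)"

lemma cq_eq: "cq (x, y) = Complex (x \<bullet> x - y \<bullet> y) (2 * (x \<bullet> y))"
  unfolding cq_def cinner_def complex_eq_iff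
  by (simp add: power2_eq_square sum_subtractf euclidean_inner[of x x] euclidean_inner[of y y]
      euclidean_inner[of x y] sum_distrib_left algebra_simps)

lemma cq_clin: "isom g \<Longrightarrow> cq (clin g v) = cq v"
  by (cases v) (simp add: clin_def cq_eq isom_inner)

lemma cq_cscale: "norm e = 1 \<Longrightarrow> cq (cscale t (e, 0)) = t\<^sup>2"
  using cq_eq[of "Re t *\<^sub>R e" "Im t *\<^sub>R e"]
  by (simp add: cscale_pair dot_square_norm complex_eq_iff power2_eq_square)

lemma hol_in_cq: "hol_in UNIV cq"
  unfolding hol_in_def cq_def by (intro ballI cd_sum cd_power cd_cinner)

lemma clin_real: "affmap g \<Longrightarrow> clin g (cscale t (s, 0)) = cscale t (lin g s, 0)"
  by (simp add: clin_cscale) (simp add: clin_def lin_def)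

lemma cinner_cscale_real: "cinner n (cscale t (s, 0)) = t * of_real (s \<bullet> n)"
  by (simp add: cinner_cscale cinner_real)

lemma clin_diff: "affmap T \<Longrightarrow> clin T (w - v) = complex_act T w - complex_act T v"
  using complex_act_add[of T v "w - v"] by simp

lemma closest_point_commute:
  assumes "isom g" "affine M" "M \<noteq> {}" "g ` M = M"
  shows "closest_point M (g x) = g (closest_point M x)"
proof (rule closest_point_affineI[OF assms(2)])
  show "g (closest_point M x) \<in> M" using assms closest_point_affine_in by blast
  fix v assume "v \<in> direction M"
  moreover have "direction M = lin g ` direction M"
    using direction_image[OF isom_affmap[OF assms(1)], of M] unfolding assms(4) .
  ultimately obtain u where u: "u \<in> direction M" "v = lin g u" by blast
  have "g x - g (closest_point M x) = lin g (x - closest_point M x)"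
    using affmap_diff[OF isom_affmap[OF assms(1)]] by simp
  then show "(g x - g (closest_point M x)) \<bullet> v = 0"
    using closest_point_orthogonal[OF assms(2,3) u(1)] by (simp add: u isom_inner[OF assms(1)])
qed

lemma complex_act_closest_point_commute:
  assumes "isom g" "affine M" "M \<noteq> {}" "g ` M = M"
  shows "complex_act (closest_point M) (complex_act g w) = complex_act g (complex_act (closest_point M) w)"
proof -
  have "closest_point M \<circ> g = g \<circ> closest_point M"
    using closest_point_commute[OF assms] by auto
  then show ?thesis
    using complex_act_compose[of "closest_point M" g w] complex_act_compose[of g "closest_point M" w]
      isom_affmap[OF assms(1)] closest_point_affmap[OF assms(2,3)] by simp
qed

text \<open>\<open>M\<close> is a hyperplane of \<open>B\<close> with unit normal \<open>e\<close>;
  the last clause says that the codimension is one. Used both for hyperplanes of \<open>E\<close>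
  and for walls in translates of \<open>L\<close>.\<close>

definition extends_by :: "'a::euclidean_space set \<Rightarrow> 'a set \<Rightarrow> 'a \<Rightarrow> bool"
  where "extends_by M B e \<longleftrightarrow> affine M \<and> M \<noteq> {} \<and> affine B \<and> M \<subseteq> B \<and> e \<in> direction B \<and> norm e = 1 \<and>
    (\<forall>m\<in>direction M. e \<bullet> m = 0) \<and> (\<forall>v\<in>direction B. \<exists>t. v - t *\<^sub>R e \<in> direction M)"

lemma extends_by_exists:
  assumes "affine M" "M \<noteq> {}" "affine B" "M \<subseteq> B" "dim (direction B) = dim (direction M) + 1"
  shows "\<exists>e. extends_by M B e"
proof -
  have "B \<noteq> {}" using assms by blast
  then obtain e where "e \<in> direction B" "norm e = 1" "\<And>u. u \<in> direction M \<Longrightarrow> e \<bullet> u = 0"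
    "\<And>w. w \<in> direction B \<Longrightarrow> \<exists>t. w - t *\<^sub>R e \<in> direction M"
    using unit_normal_exists[OF subspace_direction[OF assms(1,2)] subspace_direction[OF assms(3)]
        direction_mono[OF assms(4)] assms(5)] by blast
  then show ?thesis using assms unfolding extends_by_def by blast
qed

lemma extends_by_normal:
  assumes "extends_by M B e" "v \<in> direction B" "\<And>m. m \<in> direction M \<Longrightarrow> v \<bullet> m = 0"
  shows "v = (v \<bullet> e) *\<^sub>R e"
proof -
  obtain t where t: "v - t *\<^sub>R e \<in> direction M" using assms unfolding extends_by_def by blast
  have "e \<bullet> (v - t *\<^sub>R e) = 0" "v \<bullet> (v - t *\<^sub>R e) = 0"
    using assms t unfolding extends_by_def by blast+
  then have "(v - t *\<^sub>R e) \<bullet> (v - t *\<^sub>R e) = 0" by (simp add: inner_diff_left)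
  then have v: "v = t *\<^sub>R e" by simp
  have "e \<bullet> e = 1" using assms(1) unfolding extends_by_def by (simp add: dot_square_norm)
  then show ?thesis by (simp add: v)
qed

lemma extends_by_unit:
  assumes "extends_by M B e" "v \<in> direction B" "\<And>m. m \<in> direction M \<Longrightarrow> v \<bullet> m = 0" "norm v = 1"
  shows "v = e \<or> v = - e"
proof -
  have v: "v = (v \<bullet> e) *\<^sub>R e" using extends_by_normal[OF assms(1-3)] .
  have "norm e = 1" using assms(1) unfolding extends_by_def by blast
  then have "\<bar>v \<bullet> e\<bar> = 1" using assms(4) v by (metis mult_cancel_left2 norm_scaleR mult.right_neutral)
  then show ?thesis using v by (metis abs_eq_iff' scaleR_minus1_left scaleR_one abs_1 abs_eq_iff)
qed

lemma extends_by_uminus: 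
  assumes "extends_by M B e"
  shows "extends_by M B (- e)"
proof -
  have "- e \<in> direction B"
    using assms subspace_neg[OF subspace_direction, of B] unfolding extends_by_def by blast
  moreover have "\<exists>t. v - t *\<^sub>R (- e) \<in> direction M" if v: "v \<in> direction B" for v
  proof -
    obtain t where "v - t *\<^sub>R e \<in> direction M" using assms v unfolding extends_by_def by blast
    then show ?thesis by (intro exI[of _ "-t"]) simp
  qed
  ultimately show ?thesis using assms unfolding extends_by_def by auto
qed

text \<open>\<open>B\<close> is recovered as \<open>M\<close> plus the line spanned by
  \<open>e\<close>, so a translate of \<open>L\<close> through a wall is known by its
  normal.\<close>

lemma extends_by_unique:
  assumes "extends_by M B e" "extends_by M B' e"
  shows "B = B'"
proof -
  have "B \<subseteq> B'" if 1: "extends_by M B e" and 2: "extends_by M B' e" for B B'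
  proof
    fix x assume x: "x \<in> B"
    obtain p where p: "p \<in> M" using 1 unfolding extends_by_def by blast
    have "x - p \<in> direction B" using x p 1 unfolding extends_by_def by (auto intro: direction_diff)
    then obtain t where t: "x - p - t *\<^sub>R e \<in> direction M" using 1 unfolding extends_by_def by blast
    have sub: "subspace (direction B')" using 2 p unfolding extends_by_def by (intro subspace_direction) auto
    have "x - p - t *\<^sub>R e \<in> direction B'" using t 2 direction_mono unfolding extends_by_def by blast
    moreover have "t *\<^sub>R e \<in> direction B'" using 2 sub subspace_scale unfolding extends_by_def by blast
    ultimately have "x - p - t *\<^sub>R e + t *\<^sub>R e \<in> direction B'" using sub subspace_add by blast
    then have "p + (x - p) \<in> B'" using 2 p affine_plus_direction[of B' p "x - p"] unfolding extends_by_def by auto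
    then show "x \<in> B'" by simp
  qed
  then show ?thesis using assms by blast
qed

lemma extends_by_image:
  assumes "extends_by M B e" "isom g"
  shows "extends_by (g ` M) (g ` B) (lin g e)"
proof -
  have aff: "affmap g" by (rule isom_affmap[OF assms(2)])
  have lg: "linear (lin g)" using aff by (simp add: affmap_def)
  have "\<exists>t. v - t *\<^sub>R lin g e \<in> direction (g ` M)" if "v \<in> direction (g ` B)" for v
  proof -
    obtain u where u: "u \<in> direction B" "v = lin g u" using \<open>v \<in> direction (g ` B)\<close> direction_image[OF aff] by auto
    obtain t where "u - t *\<^sub>R e \<in> direction M" using u assms unfolding extends_by_def by blast
    then have "lin g (u - t *\<^sub>R e) \<in> direction (g ` M)" using direction_image[OF aff] by auto
    then show ?thesis using u lg by (intro exI[of _ t]) (simp add: linear_diff linear_scale)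
  qed
  moreover have "\<forall>m\<in>direction (g ` M). lin g e \<bullet> m = 0"
  proof
    fix m assume "m \<in> direction (g ` M)"
    then obtain u where u: "u \<in> direction M" "m = lin g u" unfolding direction_image[OF aff] by blast
    have "e \<bullet> u = 0" using assms(1) u(1) unfolding extends_by_def by blast
    then show "lin g e \<bullet> m = 0" unfolding u(2) isom_inner[OF assms(2)] .
  qed
  moreover have "affine (g ` M)" "affine (g ` B)" "g ` M \<noteq> {}" "g ` M \<subseteq> g ` B"
    using assms(1) affine_image[OF aff] unfolding extends_by_def by (simp_all add: image_mono)
  moreover have "lin g e \<in> direction (g ` B)" "norm (lin g e) = 1"
    using assms(1) isom_norm[OF assms(2), of e] unfolding extends_by_def direction_image[OF aff] by (simp_all add: imageI)
  ultimately show ?thesis unfolding extends_by_def by simp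
qed

text \<open>The real and imaginary parts of \<open>t\<close> are the normal components of the two
  entries of \<open>w\<close>.\<close>

lemma extends_by_decomp:
  assumes "extends_by M B e" "w \<in> complexify B"
  shows "\<exists>t. w = complex_act (closest_point M) w + cscale t (e, 0)"
proof -
  have M: "affine M" "M \<noteq> {}" "affine B" "M \<subseteq> B" using assms unfolding extends_by_def by blast+
  have sub: "subspace (direction B)" using M by (intro subspace_direction) auto
  obtain x y where w: "w = (x, y)" by fastforce
  have xy: "x \<in> B" "y \<in> direction B" using assms by (auto simp: w complexify_iff)
  let ?\<pi> = "closest_point M"
  have "x - ?\<pi> x = ((x - ?\<pi> x) \<bullet> e) *\<^sub>R e"
    by (rule extends_by_normal[OF assms(1)])
      (use xy M closest_point_affine_in[OF M(1,2)] closest_point_orthogonal[OF M(1,2)] in \<open>auto intro!: direction_diff\<close>)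
  then have 1: "x = ?\<pi> x + ((x - ?\<pi> x) \<bullet> e) *\<^sub>R e" by (metis add.commute diff_add_cancel)
  have "y - lin ?\<pi> y = ((y - lin ?\<pi> y) \<bullet> e) *\<^sub>R e"
    by (rule extends_by_normal[OF assms(1)])
      (use xy M lin_closest_point_in[OF M(1,2)] lin_closest_point_orthogonal[OF M(1,2)] direction_mono[OF M(4)] sub in
        \<open>auto intro!: subspace_diff\<close>)
  then have 2: "y = lin ?\<pi> y + ((y - lin ?\<pi> y) \<bullet> e) *\<^sub>R e" by (metis add.commute diff_add_cancel)
  show ?thesis
    by (rule exI[of _ "Complex ((x - ?\<pi> x) \<bullet> e) ((y - lin ?\<pi> y) \<bullet> e)"])
       (use 1 2 in \<open>simp add: w cscale_pair complex_act_affmap[OF closest_point_affmap[OF M(1,2)]]\<close>)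
qed

lemma closest_point_plus_normal:
  assumes "affine M" "M \<noteq> {}" "m \<in> complexify M" "\<And>u. u \<in> direction M \<Longrightarrow> s \<bullet> u = 0"
  shows "complex_act (closest_point M) (m + cscale t (s, 0)) = m"
proof -
  let ?\<pi> = "closest_point M"
  have aff: "affmap ?\<pi>" using assms by (intro closest_point_affmap)
  have "lin ?\<pi> s = 0" using assms lin_closest_point_zero by blast
  then have "clin ?\<pi> (cscale t (s, 0)) = cscale t (0, 0)" using clin_real[OF aff, of t s] by simp
  then have "clin ?\<pi> (cscale t (s, 0)) = 0" by (simp add: cscale_pair zero_prod_def)
  then show ?thesis
    using complex_act_add[OF aff, of m] complex_act_closest_point_self[OF assms(1,3)] by simp
qed

section \<open>Walls and branches of the stratum\<close>

text \<open>The facts about flats that the local analysis uses, detached from \<open>E\<close>,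
  \<open>K\<close> and the reflections. \<open>fixer_sum\<close> is what remains of the reflections
  through \<open>M\<close>: the average of a normal vector over the fixer of \<open>M\<close> is
  zero.\<close>

locale stratum_geometry = isometry_action G L for G :: "('a::euclidean_space \<Rightarrow> 'a) set" and L :: "'a set" +
  fixes \<M> :: "'a set set"
  assumes M_aff: "M \<in> \<M> \<Longrightarrow> affine M \<and> M \<noteq> {} \<and> M \<subseteq> L \<and> dim (direction L) = dim (direction M) + 1"
    and M_fin: "finite {M \<in> \<M>. \<exists>x\<in>M. dist x p \<le> r}"
    and translates_fin: "finite {A. \<exists>g\<in>G. A = g ` L \<and> (\<exists>x\<in>A. dist x p \<le> r)}"
    and generic_branch: "z \<in> complexify L \<Longrightarrow> (\<And>M. M \<in> \<M> \<Longrightarrow> z \<notin> complexify M) \<Longrightarrow> g \<in> G \<Longrightarrow>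
      z \<in> complexify (g ` L) \<Longrightarrow> g ` L = L"
    and wall_branch: "M \<in> \<M> \<Longrightarrow> z \<in> complexify M \<Longrightarrow>
      (\<And>M'. M' \<in> \<M> \<Longrightarrow> z \<in> complexify M' \<Longrightarrow> M' = M) \<Longrightarrow> g \<in> G \<Longrightarrow> z \<in> complexify (g ` L) \<Longrightarrow> M \<subseteq> g ` L"
    and wall_stab: "M \<in> \<M> \<Longrightarrow> z \<in> complexify M \<Longrightarrow>
      (\<And>M'. M' \<in> \<M> \<Longrightarrow> z \<in> complexify M' \<Longrightarrow> M' = M) \<Longrightarrow> g \<in> G \<Longrightarrow> complex_act g z = z \<Longrightarrow> g ` M = M"
    and fixer_sum: "M \<in> \<M> \<Longrightarrow> e \<in> direction L \<Longrightarrow> (\<And>m. m \<in> direction M \<Longrightarrow> e \<bullet> m = 0) \<Longrightarrow>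
      (\<Sum>g\<in>{g \<in> G. \<forall>x\<in>M. g x = x}. lin g e) = 0"
begin

definition fixer :: "'a set \<Rightarrow> ('a \<Rightarrow> 'a) set"
  where "fixer A = {g \<in> G. \<forall>x\<in>A. g x = x}"

lemma fixer_in: "g \<in> fixer A \<Longrightarrow> g \<in> G"
  by (simp add: fixer_def)

lemma fixer_image: "g \<in> fixer A \<Longrightarrow> g ` A = A"
  by (force simp: fixer_def)

lemma fixer_finite: "A \<noteq> {} \<Longrightarrow> finite (fixer A)"
proof -
  assume "A \<noteq> {}"
  then obtain x where "x \<in> A" by blast
  then have "fixer A \<subseteq> {g \<in> G. dist (g x) x \<le> 0}" by (auto simp: fixer_def)
  then show ?thesis using proper finite_subset by blast
qed

lemma fixer_id: "(\<lambda>x. x) \<in> fixer A"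
  using id_in by (simp add: fixer_def)

lemma fixer_comp: "g \<in> fixer A \<Longrightarrow> h \<in> fixer A \<Longrightarrow> g \<circ> h \<in> fixer A"
  by (simp add: fixer_def comp_in)

lemma fixer_inv:
  assumes "g \<in> fixer A"
  obtains h where "h \<in> fixer A" "\<And>x. h (g x) = x" "\<And>x. g (h x) = x"
proof -
  obtain h where h: "h \<in> G" "\<And>x. h (g x) = x" "\<And>x. g (h x) = x"
    using inverseE[OF fixer_in[OF assms]] by metis
  have "h x = x" if "x \<in> A" for x using h(2)[of x] assms that by (simp add: fixer_def)
  then show thesis using that[of h] h by (simp add: fixer_def)
qed

lemma fixer_complexify:
  assumes "affine A" "g \<in> fixer A" "w \<in> complexify A"
  shows "complex_act g w = w"
proof -
  obtain x y where w: "w = (x, y)" "x \<in> A" "y \<in> direction A"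
    using assms(3) by (cases w) (auto simp: complexify_iff)
  then have "x + y \<in> A" using assms affine_plus_direction by blast
  then show ?thesis using w assms by (simp add: complex_act_def fixer_def)
qed

text \<open>Only finitely many translates of \<open>L\<close> come within distance 1 of the real
  part of \<open>z\<close>, and their complexifications are closed; those missing \<open>z\<close>
  stay at a positive distance.\<close>

lemma branch_near: "\<exists>\<epsilon>>0. \<forall>g\<in>G. complexify (g ` L) \<inter> ball z \<epsilon> \<noteq> {} \<longrightarrow> z \<in> complexify (g ` L)"
proof -
  define \<F> where "\<F> = {A. (\<exists>g\<in>G. A = g ` L) \<and> (\<exists>x\<in>A. dist x (fst z) \<le> 1) \<and> z \<notin> complexify A}"
  have "\<F> \<subseteq> {A. \<exists>g\<in>G. A = g ` L \<and> (\<exists>x\<in>A. dist x (fst z) \<le> 1)}" by (auto simp: \<F>_def)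
  then have fin: "finite \<F>" using translates_fin finite_subset by blast
  have "closed (complexify A)" if "A \<in> \<F>" for A
    using that affine_image[OF aff affL] by (intro closed_complexify) (auto simp: \<F>_def)
  then have "closed (\<Union>(complexify ` \<F>))" using fin by (intro closed_Union) auto
  moreover have "z \<notin> \<Union>(complexify ` \<F>)" by (auto simp: \<F>_def)
  ultimately obtain d where d: "d > 0" "ball z d \<inter> \<Union>(complexify ` \<F>) = {}"
    by (metis Compl_iff disjoint_eq_subset_Compl open_Compl openE)
  show ?thesis
  proof (intro exI[of _ "min d 1"] conjI ballI impI)
    fix g assume g: "g \<in> G" and "complexify (g ` L) \<inter> ball z (min d 1) \<noteq> {}"
    then obtain w where w: "w \<in> complexify (g ` L)" "w \<in> ball z d" "w \<in> ball z 1" by auto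
    have "fst w \<in> g ` L" using w(1) by (simp add: complexify_iff')
    moreover have "dist (fst w) (fst z) \<le> 1"
      using w(3) dist_fst_le[of w z] by (simp add: dist_commute)
    ultimately show "z \<in> complexify (g ` L)" using w(1,2) g d(2) unfolding \<F>_def by blast
  qed (use d in auto)
qed

text \<open>Here \<open>L\<close> is the only branch, so an invariant function on it extends by
  composition with the projection.\<close>

lemma normal_off_walls:
  assumes z: "z \<in> complexify L" and off: "\<And>M. M \<in> \<M> \<Longrightarrow> z \<notin> complexify M"
  shows "normal_at Y (orb z)"
proof -
  obtain \<epsilon>0 where e0: "\<epsilon>0 > 0" "\<And>g. g \<in> G \<Longrightarrow> complexify (g ` L) \<inter> ball z \<epsilon>0 \<noteq> {} \<Longrightarrow> z \<in> complexify (g ` L)"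
    using branch_near by blast
  show ?thesis
  proof (rule normal_criterion[OF z e0(1)])
    fix w assume w: "w \<in> S \<inter> ball z \<epsilon>0"
    then obtain g where g: "g \<in> G" "w \<in> complexify (g ` L)" using in_branch by blast
    then have "g ` L = L" using e0(2)[OF g(1)] generic_branch[OF z off g(1)] w by blast
    then show "\<exists>g\<in>G. complex_act g z = z \<and> complex_act g w \<in> complexify L"
      using g id_in by (intro bexI[of _ "\<lambda>x. x"]) auto
  next
    fix \<epsilon> H
    assume e: "0 < \<epsilon>" "\<epsilon> \<le> \<epsilon>0" "hol_in (ball z \<epsilon>) H"
      and inv: "\<And>g w. g \<in> G \<Longrightarrow> complex_act g z = z \<Longrightarrow> g ` L = L \<Longrightarrow> w \<in> complexify L \<inter> ball z \<epsilon> \<Longrightarrow> H (complex_act g w) = H w"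
    have "H (proj (complex_act g w)) = H w"
      if g: "g \<in> G" "complex_act g z = z" and w: "w \<in> complexify L \<inter> ball z \<epsilon>" for g w
    proof -
      have "z \<in> complexify (g ` L)" using complexify_act[OF g(1)] z g(2) by (metis imageI)
      then have gL: "g ` L = L" using generic_branch[OF z off g(1)] by blast
      then have "complexify L = complex_act g ` complexify L" using complexify_act[OF g(1), of L] by simp
      then have "complex_act g w \<in> complexify L" using w by blast
      then show ?thesis using inv[OF g gL w] proj_self by simp
    qed
    then show "\<exists>\<epsilon>'>0. \<exists>F. \<epsilon>' \<le> \<epsilon> \<and> hol_in (ball z \<epsilon>') F \<and>
        (\<forall>g\<in>G. complex_act g z = z \<longrightarrow> (\<forall>w\<in>complexify L \<inter> ball z \<epsilon>'. F (complex_act g w) = H w))"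
      using e hol_in_proj[OF z e(3)] by (intro exI[of _ \<epsilon>] exI[of _ "\<lambda>w. H (proj w)"] conjI) blast+
  qed
qed

definition reflects :: "'a set \<Rightarrow> bool"
  where "reflects M \<longleftrightarrow> (\<exists>\<sigma>\<in>G. \<sigma> ` L = L \<and> (\<forall>x\<in>L. \<sigma> x = 2 *\<^sub>R closest_point M x - x))"

text \<open>At a generic point of \<open>M\<close> the stabiliser is the fixer of \<open>M\<close>,
  so this says that all branches there become one branch in the quotient.\<close>

definition single_orbit :: "'a set \<Rightarrow> bool"
  where "single_orbit M \<longleftrightarrow> (\<forall>g\<in>G. M \<subseteq> g ` L \<longrightarrow> (\<exists>h\<in>fixer M. h ` L = g ` L))"

abbreviation \<pi> :: "'a set \<Rightarrow> 'a \<times> 'a \<Rightarrow> 'a \<times> 'a"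
  where "\<pi> M \<equiv> complex_act (closest_point M)"

text \<open>The reflection makes an invariant function even in the normal coordinate, hence a
  function of the projection to \<open>M\<close> and of the squared coordinate. Both make sense on
  the ambient space and are compatible with the stabiliser of \<open>z\<close>, which gives the
  extension to all branches.\<close>

lemma normal_on_wall:
  assumes M: "M \<in> \<M>" and zM: "z \<in> complexify M"
    and only: "\<And>M'. M' \<in> \<M> \<Longrightarrow> z \<in> complexify M' \<Longrightarrow> M' = M"
    and so: "single_orbit M" and refl: "reflects M"
  shows "normal_at Y (orb z)"
proof -
  have affM: "affine M" "M \<noteq> {}" "M \<subseteq> L" and dimM: "dim (direction L) = dim (direction M) + 1" using M_aff[OF M] by auto
  have z: "z \<in> complexify L" using complexify_mono[OF affM(3)] zM by blast
  obtain e where e: "extends_by M L e" using extends_by_exists[OF affM(1,2) affL affM(3) dimM] by blast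
  have ne: "norm e = 1" "e \<in> direction L" "\<And>m. m \<in> direction M \<Longrightarrow> e \<bullet> m = 0" using e unfolding extends_by_def by blast+
  obtain \<sigma> where \<sigma>: "\<sigma> \<in> G" "\<sigma> ` L = L" "\<And>x. x \<in> L \<Longrightarrow> \<sigma> x = 2 *\<^sub>R closest_point M x - x"
    using refl unfolding reflects_def by blast
  have \<sigma>M: "\<sigma> \<in> fixer M"
    unfolding fixer_def
  proof (intro CollectI conjI ballI \<sigma>(1))
    fix x assume "x \<in> M"
    then show "\<sigma> x = x" using \<sigma>(3)[of x] affM(3) closest_point_self[of x M] by (auto simp: scaleR_2)
  qed
  have \<sigma>e: "lin \<sigma> e = - e"
  proof -
    obtain p where p: "p \<in> M" using affM by blast
    have "p + e \<in> L" using affM p ne(2) affL affine_plus_direction by blast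
    moreover have "closest_point M (p + e) = p"
      by (rule closest_point_affineI[OF affM(1) p]) (simp add: ne)
    ultimately have "\<sigma> (p + e) = p - e" using \<sigma>(3) by (simp add: scaleR_2)
    moreover have "\<sigma> p = p" using \<sigma>M p by (simp add: fixer_def)
    ultimately show ?thesis using affmap_add[OF aff[OF \<sigma>(1)], of p e] by simp
  qed
  obtain \<epsilon>0 where e0: "\<epsilon>0 > 0" "\<And>g. g \<in> G \<Longrightarrow> complexify (g ` L) \<inter> ball z \<epsilon>0 \<noteq> {} \<Longrightarrow> z \<in> complexify (g ` L)"
    using branch_near by blast
  show ?thesis
  proof (rule normal_criterion[OF z e0(1)])
    fix w assume w: "w \<in> S \<inter> ball z \<epsilon>0"
    then obtain g where g: "g \<in> G" "w \<in> complexify (g ` L)" using in_branch by blast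
    then have "z \<in> complexify (g ` L)" using e0(2)[OF g(1)] w by blast
    then have "M \<subseteq> g ` L" using wall_branch[OF M zM only g(1)] by blast
    then obtain h where h: "h \<in> fixer M" "h ` L = g ` L" using so g(1) unfolding single_orbit_def by blast
    obtain k where k: "k \<in> fixer M" "\<And>x. k (h x) = x" using fixer_inv[OF h(1)] by metis
    have "k ` (g ` L) = L" unfolding h(2)[symmetric] using k(2) by (simp add: image_image)
    then have "complex_act k w \<in> complexify L" using complexify_act[OF fixer_in[OF k(1)], of "g ` L"] g(2) by auto
    moreover have "complex_act k z = z" by (rule fixer_complexify[OF affM(1) k(1) zM])
    ultimately show "\<exists>g\<in>G. complex_act g z = z \<and> complex_act g w \<in> complexify L"
      using fixer_in[OF k(1)] by blast
  next
    fix \<epsilon> H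
    assume ep: "0 < \<epsilon>" "\<epsilon> \<le> \<epsilon>0" and holH: "hol_in (ball z \<epsilon>) H"
      and inv: "\<And>g w. g \<in> G \<Longrightarrow> complex_act g z = z \<Longrightarrow> g ` L = L \<Longrightarrow> w \<in> complexify L \<inter> ball z \<epsilon> \<Longrightarrow> H (complex_act g w) = H w"
    \<comment> \<open>On every translate of \<open>L\<close> through \<open>M\<close> this is the
      square of the normal coordinate.\<close>
    define q where "q w = cq (w - \<pi> M w)" for w
    have a\<pi>: "affmap (closest_point M)" by (rule closest_point_affmap[OF affM(1,2)])
    have holq: "hol_in UNIV q"
      unfolding hol_in_def q_def
    proof
      fix w :: "'a \<times> 'a"
      show "complex_differentiable_at (\<lambda>w. cq (w - \<pi> M w)) w"
        by (rule cd_compose[where T' = "\<lambda>v. v - clin (closest_point M) v"])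
           (rule bspec[OF hol_in_cq[unfolded hol_in_def] UNIV_I],
            rule has_derivative_diff[OF has_derivative_ident complex_act_has_derivative[OF a\<pi>]],
            simp only: clin_times_i[OF a\<pi>] linear_diff[OF linear_times_i])
    qed
    have qz: "q z = 0" using complex_act_closest_point_self[OF affM(1) zM] by (simp add: q_def cq_def cinner_def flip: zero_complex.code)
    have \<pi>z: "\<pi> M z = z" by (rule complex_act_closest_point_self[OF affM(1) zM])
    obtain r F where r: "0 < r" "hol_in (ball z r) F"
      and F: "\<And>w t. w \<in> ball z r \<Longrightarrow> q w = t\<^sup>2 \<Longrightarrow>
        F w = (H (\<pi> M w + cscale t (e, 0)) + H (\<pi> M w + cscale (- t) (e, 0))) / 2"
      by (rule hol_in_even_part[OF holH ep(1) complex_act_has_derivative[OF a\<pi>] clin_times_i[OF a\<pi>] \<pi>z holq qz, of "(e, 0)"])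
         (use ne(1) in \<open>auto simp: norm_Pair\<close>)
    have main: "F (complex_act g w) = H w"
      if g: "g \<in> G" "complex_act g z = z" and w: "w \<in> complexify L \<inter> ball z (min r \<epsilon>)" for g w
    proof -
      have gM: "g ` M = M" by (rule wall_stab[OF M zM only g])
      have "M \<subseteq> g ` L" using gM affM(3) by blast
      then obtain h where h: "h \<in> fixer M" "h ` L = g ` L" using so g(1) unfolding single_orbit_def by blast
      obtain k where k: "k \<in> fixer M" "\<And>x. k (h x) = x" "\<And>x. h (k x) = x" using fixer_inv[OF h(1)] by metis
      \<comment> \<open>\<open>k\<close> brings the translate of \<open>L\<close> under
        \<open>g\<close> back to \<open>L\<close> without moving \<open>M\<close>. So
        \<open>l\<close> stabilises \<open>L\<close>, fixes \<open>z\<close> and acts on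
        \<open>M\<close> as \<open>g\<close> does.\<close>
      define l where "l = k \<circ> g"
      have l: "l \<in> G" unfolding l_def by (rule comp_in[OF fixer_in[OF k(1)] g(1)])
      have "k ` (g ` L) = L" unfolding h(2)[symmetric] using k(2) by (simp add: image_image)
      then have lL: "l ` L = L" by (simp add: l_def image_comp)
      have lM: "l ` M = M" unfolding l_def image_comp[symmetric] gM by (rule fixer_image[OF k(1)])
      have actl: "complex_act l v = complex_act k (complex_act g v)" for v
        unfolding l_def by (rule act_comp[OF fixer_in[OF k(1)] g(1)])
      have lz: "complex_act l z = z" using actl g(2) fixer_complexify[OF affM(1) k(1) zM] by simp
      obtain t where t: "w = \<pi> M w + cscale t (e, 0)" using extends_by_decomp[OF e] w by blast
      have m: "\<pi> M w \<in> complexify M" by (rule complex_act_closest_point_in[OF affM(1,2)])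
      have gm': "complex_act g (\<pi> M w) \<in> complexify M" using complexify_act[OF g(1), of M] gM m by auto
      have lm: "complex_act l (\<pi> M w) = complex_act g (\<pi> M w)"
        using actl fixer_complexify[OF affM(1) k(1) gm'] by simp
      \<comment> \<open>The sign is undetermined; the two cases are exchanged by
        \<open>\<sigma>\<close>, and the even part treats them alike.\<close>
      have "lin l e = e \<or> lin l e = - e"
      proof (rule extends_by_unit[OF e])
        have ext: "extends_by (l ` M) (l ` L) (lin l e)" by (rule extends_by_image[OF e isom[OF l]])
        show "lin l e \<in> direction L" "norm (lin l e) = 1" "\<And>m. m \<in> direction M \<Longrightarrow> lin l e \<bullet> m = 0"
          using ext unfolding lL lM extends_by_def by blast+
      qed
      moreover have lw: "complex_act l w = complex_act g (\<pi> M w) + cscale t (lin l e, 0)"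
        using complex_act_add[OF aff[OF l], of "\<pi> M w" "cscale t (e, 0)"] t lm clin_real[OF aff[OF l]] by simp
      moreover have neg: "cscale t (- e, 0) = cscale (- t) (e, 0)" "cscale (-t) (- e, 0) = cscale t (e, 0)"
        by (simp_all add: cscale_pair)
      ultimately consider "complex_act l w = complex_act g (\<pi> M w) + cscale t (e, 0)"
        | "complex_act l w = complex_act g (\<pi> M w) + cscale (- t) (e, 0)" by force
      note cases_l = this
      have lwL: "complex_act l w \<in> complexify L \<inter> ball z \<epsilon>"
        using complexify_act[OF l, of L] lL w dist_fix[OF l lz, of w] by auto
      have Hl: "H (complex_act l w) = H w" using inv[OF l lz lL] w by auto
      have \<sigma>z: "complex_act \<sigma> z = z" by (rule fixer_complexify[OF affM(1) \<sigma>M zM])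
      have H\<sigma>: "H (complex_act \<sigma> (complex_act l w)) = H w" using inv[OF \<sigma>(1) \<sigma>z \<sigma>(2) lwL] Hl by simp
      have \<sigma>act: "complex_act \<sigma> (complex_act g (\<pi> M w) + cscale u (e, 0)) = complex_act g (\<pi> M w) + cscale (- u) (e, 0)" for u
        using complex_act_add[OF aff[OF \<sigma>(1)], of "complex_act g (\<pi> M w)" "cscale u (e, 0)"]
          fixer_complexify[OF affM(1) \<sigma>M gm'] clin_real[OF aff[OF \<sigma>(1)]] \<sigma>e by (simp add: cscale_pair)
      have gw: "complex_act g w \<in> ball z r" using w dist_fix[OF g, of w] by auto
      have \<pi>g: "\<pi> M (complex_act g w) = complex_act g (\<pi> M w)"
        by (rule complex_act_closest_point_commute[OF isom[OF g(1)] affM(1,2) gM])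
      have "complex_act g w - complex_act g (\<pi> M w) = clin g (w - \<pi> M w)"
        using clin_diff[OF aff[OF g(1)]] by simp
      moreover have "w - \<pi> M w = cscale t (e, 0)" using t by (metis add_diff_cancel_left')
      ultimately have "q (complex_act g w) = t\<^sup>2"
        unfolding q_def \<pi>g using cq_clin[OF isom[OF g(1)]] cq_cscale[OF ne(1)] by simp
      from F[OF gw this] have "F (complex_act g w) = (H (complex_act g (\<pi> M w) + cscale t (e, 0)) + H (complex_act g (\<pi> M w) + cscale (- t) (e, 0))) / 2"
        unfolding \<pi>g .
      also have "\<dots> = H w"
        by (rule cases_l) (use Hl H\<sigma> \<sigma>act[of t] \<sigma>act[of "-t"] in simp_all)
      finally show ?thesis .
    qed
    show "\<exists>\<epsilon>'>0. \<exists>F. \<epsilon>' \<le> \<epsilon> \<and> hol_in (ball z \<epsilon>') F \<and>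
        (\<forall>g\<in>G. complex_act g z = z \<longrightarrow> (\<forall>w\<in>complexify L \<inter> ball z \<epsilon>'. F (complex_act g w) = H w))"
    proof (intro exI[of _ "min r \<epsilon>"] exI[of _ F] conjI ballI impI)
      show "hol_in (ball z (min r \<epsilon>)) F" by (rule hol_in_subset[OF r(2)]) auto
    qed (use main r ep in auto)
  qed
qed

end

section \<open>Invariants separating the branches at a generic point of a wall\<close>

context stratum_geometry
begin

definition normals :: "'a set \<Rightarrow> 'a set"
  where "normals M = {s. \<exists>g\<in>G. extends_by M (g ` L) s}"

text \<open>For a unit normal \<open>s\<close> other than \<open>e\<close> and \<open>- e\<close>,
  the vector \<open>e - (e \<bullet> s) *\<^sub>R s\<close> is orthogonal to \<open>s\<close> but
  not to \<open>e\<close>. Hence the product kills all normals except \<open>e\<close> and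
  \<open>- e\<close>. The squares keep it nonnegative on real vectors, and \<open>j\<close> fixes
  the parity.\<close>

definition sep_poly :: "'a set \<Rightarrow> 'a \<Rightarrow> nat \<Rightarrow> 'a \<times> 'a \<Rightarrow> complex"
  where "sep_poly M e j v = (\<Prod>s\<in>normals M - {e, - e}. (cinner (e - (e \<bullet> s) *\<^sub>R s) v)\<^sup>2) * cinner e v ^ j"

definition sep_val :: "'a set \<Rightarrow> 'a \<Rightarrow> nat \<Rightarrow> 'a \<Rightarrow> real"
  where "sep_val M e j v = (\<Prod>s\<in>normals M - {e, - e}. (v \<bullet> (e - (e \<bullet> s) *\<^sub>R s))\<^sup>2) * (v \<bullet> e) ^ j"

definition sep_deg :: "'a set \<Rightarrow> 'a \<Rightarrow> nat"
  where "sep_deg M e = card (normals M - {e, - e})"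

text \<open>The sum over the fixer of \<open>M\<close>, evaluated on the component of
  \<open>w\<close> normal to \<open>M\<close>; this makes the polynomial invariant.\<close>

definition inv_poly :: "'a set \<Rightarrow> 'a \<Rightarrow> nat \<Rightarrow> 'a \<times> 'a \<Rightarrow> complex"
  where "inv_poly M e j w = (\<Sum>g\<in>fixer M. sep_poly M e j (clin g (w - \<pi> M w)))"

definition inv_val :: "'a set \<Rightarrow> 'a \<Rightarrow> nat \<Rightarrow> 'a \<Rightarrow> real"
  where "inv_val M e j s = (\<Sum>g\<in>fixer M. sep_val M e j (lin g s))"

definition sq :: "'a set \<Rightarrow> 'a \<times> 'a \<Rightarrow> complex"
  where "sq M w = cq (w - \<pi> M w)"

text \<open>Homogeneity: each squared factor contributes degree 2 and the last factor degree
  \<open>j\<close>.\<close>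

lemma sep_poly_real: "sep_poly M e j (cscale t (s, 0)) = t ^ (2 * sep_deg M e + j) * of_real (sep_val M e j s)"
proof -
  have "(\<Prod>n\<in>N. (t * c n)\<^sup>2) = t ^ (2 * card N) * (\<Prod>n\<in>N. (c n)\<^sup>2)" for N :: "'a set" and c :: "'a \<Rightarrow> complex"
    by (induction N rule: infinite_finite_induct) (simp_all add: power_mult_distrib power_add power2_eq_square)
  then show ?thesis
    unfolding sep_poly_def sep_val_def cinner_cscale_real sep_deg_def
    by (simp add: power_mult_distrib power_add)
qed

text \<open>From here on \<open>z\<close> is generic on the single wall \<open>M\<close>: whatever
  fixes \<open>z\<close> fixes \<open>M\<close> pointwise.\<close>

context
  fixes M z
  assumes M: "M \<in> \<M>" and zM: "z \<in> complexify M"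
    and only: "\<And>M'. M' \<in> \<M> \<Longrightarrow> z \<in> complexify M' \<Longrightarrow> M' = M"
    and stab: "\<And>g. g \<in> G \<Longrightarrow> complex_act g z = z \<Longrightarrow> g \<in> fixer M"
begin

lemma affM: "affine M" "M \<noteq> {}" "M \<subseteq> L"
  and dimM: "dim (direction L) = dim (direction M) + 1"
  using M_aff[OF M] by auto

lemma zS: "z \<in> S"
  using zM complexify_mono[OF affM(3)] complexify_sub_S by blast

lemma a\<pi>: "affmap (closest_point M)"
  by (rule closest_point_affmap[OF affM(1,2)])

lemma \<pi>z: "\<pi> M z = z"
  by (rule complex_act_closest_point_self[OF affM(1) zM])

lemma finF: "finite (fixer M)"
  by (rule fixer_finite[OF affM(2)])

lemma ext_branch:
  assumes "g \<in> G" "M \<subseteq> g ` L"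
  shows "\<exists>s. extends_by M (g ` L) s"
proof -
  have "inj_on (lin g) (direction L)"
    using isom_norm[OF isom[OF assms(1)]] aff[OF assms(1)] unfolding affmap_def
    by (metis linear_inj_iff_eq_0 norm_eq_zero inj_on_subset subset_UNIV)
  then have "dim (lin g ` direction L) = dim (direction L)"
    using aff[OF assms(1)] subspace_direction[OF affL Lne] unfolding affmap_def
    by (metis dim_image_eq span_eq_iff)
  then have "dim (direction (g ` L)) = dim (direction M) + 1"
    using dimM direction_image[OF aff[OF assms(1)]] by simp
  then show ?thesis
    by (rule extends_by_exists[OF affM(1,2) affine_image[OF aff[OF assms(1)] affL] assms(2)])
qed

lemma normals_unit: "s \<in> normals M \<Longrightarrow> norm s = 1 \<and> (\<forall>m\<in>direction M. s \<bullet> m = 0)"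
  unfolding normals_def extends_by_def by blast

lemma normals_image:
  assumes "h \<in> fixer M" "s \<in> normals M"
  shows "lin h s \<in> normals M"
proof -
  obtain g where g: "g \<in> G" "extends_by M (g ` L) s" using assms(2) unfolding normals_def by blast
  have "extends_by (h ` M) (h ` g ` L) (lin h s)"
    by (rule extends_by_image[OF g(2) isom[OF fixer_in[OF assms(1)]]])
  then have "extends_by M ((h \<circ> g) ` L) (lin h s)"
    using fixer_image[OF assms(1)] by (simp add: image_comp)
  then show ?thesis unfolding normals_def using comp_in[OF fixer_in[OF assms(1)] g(1)] by blast
qed

text \<open>Finitely many translates of \<open>L\<close> pass through a point of \<open>M\<close>,
  and each contributes at most two unit normals.\<close>

lemma normals_finite: "finite (normals M)"
proof -
  obtain p where p: "p \<in> M" using affM by blast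
  define \<B> where "\<B> = {A. \<exists>g\<in>G. A = g ` L \<and> (\<exists>x\<in>A. dist x p \<le> 0)}"
  have fin: "finite \<B>" unfolding \<B>_def by (rule translates_fin)
  have "finite {s. extends_by M A s}" for A
  proof (cases "\<exists>e. extends_by M A e")
    case True
    then obtain e where e: "extends_by M A e" by blast
    have "{s. extends_by M A s} \<subseteq> {e, - e}"
    proof
      fix s assume "s \<in> {s. extends_by M A s}"
      then have "s \<in> direction A" "\<And>m. m \<in> direction M \<Longrightarrow> s \<bullet> m = 0" "norm s = 1" unfolding extends_by_def by blast+
      from extends_by_unit[OF e this] show "s \<in> {e, - e}" by blast
    qed
    then show ?thesis using finite_subset by blast
  qed simp
  then have "finite (\<Union>A\<in>\<B>. {s. extends_by M A s})" using fin by blast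
  moreover have "normals M \<subseteq> (\<Union>A\<in>\<B>. {s. extends_by M A s})"
  proof
    fix s assume "s \<in> normals M"
    then obtain g where g: "g \<in> G" "extends_by M (g ` L) s" unfolding normals_def by blast
    then have "p \<in> g ` L" using p unfolding extends_by_def by blast
    then have "g ` L \<in> \<B>" unfolding \<B>_def using g(1) by force
    then show "s \<in> (\<Union>A\<in>\<B>. {s. extends_by M A s})" using g(2) by blast
  qed
  ultimately show ?thesis using finite_subset by blast
qed

lemma hol_in_diff_\<pi>:
  assumes "hol_in UNIV F"
  shows "hol_in UNIV (\<lambda>w. F (w - \<pi> M w))"
  unfolding hol_in_def
proof
  fix w :: "'a \<times> 'a"
  show "complex_differentiable_at (\<lambda>w. F (w - \<pi> M w)) w"
    by (rule cd_compose[where T' = "\<lambda>v. v - clin (closest_point M) v"])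
       (rule bspec[OF assms[unfolded hol_in_def] UNIV_I],
        rule has_derivative_diff[OF has_derivative_ident complex_act_has_derivative[OF a\<pi>]],
        simp only: clin_times_i[OF a\<pi>] linear_diff[OF linear_times_i])
qed

lemma hol_in_sq: "hol_in UNIV (sq M)"
  unfolding sq_def[abs_def] by (rule hol_in_diff_\<pi>[OF hol_in_cq])

lemma hol_in_inv_poly: "hol_in UNIV (inv_poly M e j)"
proof -
  have "hol_in UNIV (\<lambda>v. \<Sum>g\<in>fixer M. sep_poly M e j (clin g v))"
    unfolding hol_in_def
  proof (intro ballI cd_sum)
    fix v g assume g: "g \<in> fixer M"
    have a: "affmap g" by (rule aff[OF fixer_in[OF g]])
    have "bounded_linear (clin g)" using linear_clin[OF a] by (simp add: linear_conv_bounded_linear)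
    show "complex_differentiable_at (\<lambda>v. sep_poly M e j (clin g v)) v"
    proof (rule cd_compose[OF _ bounded_linear.has_derivative[OF \<open>bounded_linear (clin g)\<close> has_derivative_ident] clin_times_i[OF a]])
      show "complex_differentiable_at (sep_poly M e j) (clin g v)"
        unfolding sep_poly_def[abs_def] by (intro cd_mult cd_prod cd_power cd_cinner)
    qed
  qed
  from hol_in_diff_\<pi>[OF this] show ?thesis unfolding inv_poly_def[abs_def] .
qed

lemma fixer_diff:
  assumes "h \<in> fixer M"
  shows "complex_act h w - \<pi> M (complex_act h w) = clin h (w - \<pi> M w)"
proof -
  have h: "isom h" "h ` M = M" using isom[OF fixer_in[OF assms]] fixer_image[OF assms] .
  show ?thesis
    unfolding complex_act_closest_point_commute[OF h(1) affM(1,2) h(2)] clin_diff[OF isom_affmap[OF h(1)]] ..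
qed

lemma sq_invariant: "h \<in> fixer M \<Longrightarrow> sq M (complex_act h w) = sq M w"
  unfolding sq_def fixer_diff by (rule cq_clin[OF isom[OF fixer_in]])

lemma clin_comp: "affmap g \<Longrightarrow> affmap h \<Longrightarrow> clin g (clin h v) = clin (g \<circ> h) v"
  using affmap_compose[of g h] by (cases v) (simp add: clin_def)

lemma fixer_reindex:
  assumes "h \<in> fixer M"
  shows "(\<Sum>g\<in>fixer M. f (g \<circ> h)) = (\<Sum>g\<in>fixer M. f g)"
proof -
  obtain k where k: "k \<in> fixer M" "\<And>x. k (h x) = x" "\<And>x. h (k x) = x" using fixer_inv[OF assms] by metis
  show ?thesis
    by (rule sum.reindex_bij_witness[of _ "\<lambda>g. g \<circ> k" "\<lambda>g. g \<circ> h"])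
       (use k assms fixer_comp in \<open>auto simp: fun_eq_iff\<close>)
qed

lemma inv_poly_invariant:
  assumes h: "h \<in> fixer M"
  shows "inv_poly M e j (complex_act h w) = inv_poly M e j w"
proof -
  have "inv_poly M e j (complex_act h w) = (\<Sum>g\<in>fixer M. sep_poly M e j (clin (g \<circ> h) (w - \<pi> M w)))"
    unfolding inv_poly_def fixer_diff[OF h]
  proof (intro sum.cong refl)
    fix g assume g: "g \<in> fixer M"
    show "sep_poly M e j (clin g (clin h (w - \<pi> M w))) = sep_poly M e j (clin (g \<circ> h) (w - \<pi> M w))"
      using clin_comp[OF aff[OF fixer_in[OF g]] aff[OF fixer_in[OF h]]] by simp
  qed
  also have "\<dots> = inv_poly M e j w"
    unfolding inv_poly_def by (rule fixer_reindex[OF h])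
  finally show ?thesis .
qed

lemma inv_val_invariant:
  assumes h: "h \<in> fixer M"
  shows "inv_val M e j (lin h s) = inv_val M e j s"
proof -
  have "inv_val M e j (lin h s) = (\<Sum>g\<in>fixer M. sep_val M e j (lin (g \<circ> h) s))"
    unfolding inv_val_def
  proof (intro sum.cong refl)
    fix g assume g: "g \<in> fixer M"
    show "sep_val M e j (lin g (lin h s)) = sep_val M e j (lin (g \<circ> h) s)"
      using affmap_compose(2)[OF aff[OF fixer_in[OF g]] aff[OF fixer_in[OF h]]] by simp
  qed
  also have "\<dots> = inv_val M e j s"
    unfolding inv_val_def by (rule fixer_reindex[OF h])
  finally show ?thesis .
qed

lemma diff_normal:
  assumes "m \<in> complexify M" "\<forall>u\<in>direction M. s \<bullet> u = 0"
  shows "(m + cscale t (s, 0)) - \<pi> M (m + cscale t (s, 0)) = cscale t (s, 0)"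
  using closest_point_plus_normal[OF affM(1,2) assms(1), of s t] assms(2) by simp

lemma inv_poly_normal:
  assumes "m \<in> complexify M" "\<forall>u\<in>direction M. s \<bullet> u = 0"
  shows "inv_poly M e j (m + cscale t (s, 0)) = t ^ (2 * sep_deg M e + j) * of_real (inv_val M e j s)"
proof -
  have "inv_poly M e j (m + cscale t (s, 0)) = (\<Sum>g\<in>fixer M. t ^ (2 * sep_deg M e + j) * of_real (sep_val M e j (lin g s)))"
    unfolding inv_poly_def
  proof (intro sum.cong refl)
    fix g assume g: "g \<in> fixer M"
    have "(m + cscale t (s, 0)) - \<pi> M (m + cscale t (s, 0)) = cscale t (s, 0)"
      by (rule diff_normal[OF assms])
    then show "sep_poly M e j (clin g (m + cscale t (s, 0) - \<pi> M (m + cscale t (s, 0)))) =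
        t ^ (2 * sep_deg M e + j) * of_real (sep_val M e j (lin g s))"
      using clin_real[OF aff[OF fixer_in[OF g]], of t s] sep_poly_real by simp
  qed
  then show ?thesis by (simp add: inv_val_def sum_distrib_left)
qed

lemma sq_normal:
  assumes "m \<in> complexify M" "s \<in> normals M"
  shows "sq M (m + cscale t (s, 0)) = t\<^sup>2"
proof -
  have s: "norm s = 1" "\<forall>u\<in>direction M. s \<bullet> u = 0" using normals_unit[OF assms(2)] by blast+
  have "(m + cscale t (s, 0)) - \<pi> M (m + cscale t (s, 0)) = cscale t (s, 0)"
    by (rule diff_normal[OF assms(1) s(2)])
  then show ?thesis unfolding sq_def using cq_cscale[OF s(1), of t] by simp
qed

lemma sep_val_zero:
  assumes "s \<in> normals M" "s \<noteq> e" "s \<noteq> - e"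
  shows "sep_val M e j s = 0"
proof -
  have "s \<bullet> s = 1" using normals_unit[OF assms(1)] by (simp add: dot_square_norm)
  then have "s \<bullet> (e - (e \<bullet> s) *\<^sub>R s) = 0" by (simp add: inner_diff_right inner_commute)
  then show ?thesis unfolding sep_val_def using assms normals_finite by (auto intro!: prod_zero bexI[of _ s])
qed

text \<open>A vanishing factor would be the equality case of the Cauchy-Schwarz inequality, so
  \<open>s\<close> would be \<open>e\<close> or \<open>- e\<close>.\<close>

lemma sep_val_pos:
  assumes "e \<in> normals M"
  shows "sep_val M e j e > 0"
proof -
  have e: "e \<bullet> e = 1" using normals_unit[OF assms] by (simp add: dot_square_norm)
  have "e \<bullet> (e - (e \<bullet> s) *\<^sub>R s) \<noteq> 0" if s: "s \<in> normals M - {e, - e}" for s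
  proof
    assume "e \<bullet> (e - (e \<bullet> s) *\<^sub>R s) = 0"
    then have 1: "(e \<bullet> s)\<^sup>2 = 1" by (simp add: inner_diff_right e power2_eq_square)
    have "s \<bullet> s = 1" using normals_unit s by (simp add: dot_square_norm)
    then have "(e - (e \<bullet> s) *\<^sub>R s) \<bullet> (e - (e \<bullet> s) *\<^sub>R s) = 0"
      using e 1 by (simp add: inner_diff_left inner_diff_right inner_commute power2_eq_square)
    then have "e = (e \<bullet> s) *\<^sub>R s" by simp
    moreover have "e \<bullet> s = 1 \<or> e \<bullet> s = -1" using 1 by (simp add: power2_eq_1_iff)
    ultimately have "e = s \<or> e = - s" by (metis scaleR_one scaleR_minus1_left)
    then show False using s by auto
  qed
  then have "(\<Prod>s\<in>normals M - {e, - e}. (e \<bullet> (e - (e \<bullet> s) *\<^sub>R s))\<^sup>2) > 0"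
    by (intro prod_pos) simp
  then show ?thesis unfolding sep_val_def e by simp
qed

lemma sep_val_uminus: "sep_val M e 0 (- e) = sep_val M e 0 e"
  unfolding sep_val_def by (simp add: inner_minus_left)

lemma sep_val_nonneg: "s \<in> normals M \<Longrightarrow> e \<in> normals M \<Longrightarrow> s \<noteq> - e \<or> j = 0 \<Longrightarrow> sep_val M e j s \<ge> 0"
  using sep_val_zero[of s e j] sep_val_pos[of e j] sep_val_uminus[of e] by (cases "s = e"; cases "s = - e") auto

text \<open>The identity contributes a positive term. A negative term needs odd \<open>j\<close> and
  an element sending \<open>e\<close> to \<open>- e\<close>, that is, a reflection of
  \<open>L\<close> in \<open>M\<close>.\<close>

lemma inv_val_pos:
  assumes e: "e \<in> normals M" and j: "j = 0 \<or> (\<forall>g\<in>fixer M. lin g e \<noteq> - e)"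
  shows "inv_val M e j e > 0"
  unfolding inv_val_def
proof (rule sum_pos2[OF finF fixer_id])
  show "0 < sep_val M e j (lin (\<lambda>x. x) e)" using sep_val_pos[OF e] by (simp add: affmap_id)
  show "0 \<le> sep_val M e j (lin g e)" if "g \<in> fixer M" for g
    using sep_val_nonneg[OF normals_image[OF that e] e] j that by blast
qed

lemma inv_val_zero:
  assumes "s \<in> normals M" "\<And>g. g \<in> fixer M \<Longrightarrow> lin g s \<noteq> e" "\<And>g. g \<in> fixer M \<Longrightarrow> lin g s \<noteq> - e"
  shows "inv_val M e j s = 0"
  unfolding inv_val_def using assms by (intro sum.neutral ballI sep_val_zero normals_image) auto

text \<open>Branches coming close to \<open>z\<close> pass through \<open>z\<close>, hence contain
  \<open>M\<close> by \<open>wall_branch\<close>, and so have normal coordinates relative to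
  \<open>M\<close>.\<close>

lemma near: "\<exists>\<epsilon>>0. \<forall>w\<in>S \<inter> ball z \<epsilon>. \<exists>m\<in>complexify M. \<exists>s\<in>normals M. \<exists>t. w = m + cscale t (s, 0)"
proof -
  obtain \<epsilon> where e: "\<epsilon> > 0" "\<And>g. g \<in> G \<Longrightarrow> complexify (g ` L) \<inter> ball z \<epsilon> \<noteq> {} \<Longrightarrow> z \<in> complexify (g ` L)"
    using branch_near by blast
  have "\<exists>m\<in>complexify M. \<exists>s\<in>normals M. \<exists>t. w = m + cscale t (s, 0)" if w: "w \<in> S \<inter> ball z \<epsilon>" for w
  proof -
    obtain g where g: "g \<in> G" "w \<in> complexify (g ` L)" using in_branch w by blast
    then have "z \<in> complexify (g ` L)" using e(2)[OF g(1)] w by blast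
    then have "M \<subseteq> g ` L" using wall_branch[OF M zM only g(1)] by blast
    then obtain s where s: "extends_by M (g ` L) s" using ext_branch[OF g(1)] by blast
    then have "s \<in> normals M" using g(1) unfolding normals_def by blast
    moreover have "\<pi> M w \<in> complexify M" by (rule complex_act_closest_point_in[OF affM(1,2)])
    ultimately show ?thesis using extends_by_decomp[OF s g(2)] by blast
  qed
  then show ?thesis using e(1) by blast
qed

lemma normal_in_S:
  assumes "s \<in> normals M"
  shows "z + cscale t (s, 0) \<in> S"
proof -
  obtain g where g: "g \<in> G" "extends_by M (g ` L) s" using assms unfolding normals_def by blast
  have 1: "affine (g ` L)" "M \<subseteq> g ` L" "s \<in> direction (g ` L)" using g unfolding extends_by_def by blast+
  have "subspace (direction (g ` L))" using 1 Lne by (intro subspace_direction) auto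
  then have c: "cscale t (s, 0) \<in> direction (g ` L) \<times> direction (g ` L)"
    using 1(3) subspace_scale[of "direction (g ` L)" s] unfolding cscale_pair by (simp only: mem_Times_iff fst_conv snd_conv scaleR_zero_right diff_zero add_0)
  have "z + cscale t (s, 0) \<in> complexify (g ` L)"
    by (rule complexify_translate[OF 1(1) subsetD[OF complexify_mono[OF 1(2)] zM] c])
  then show ?thesis using in_branch g(1) by blast
qed

lemma normal_in_ball:
  assumes "s \<in> normals M" "norm t < d"
  shows "z + cscale t (s, 0) \<in> ball z d"
  using assms normals_unit[OF assms(1)] by (simp add: dist_norm norm_cscale norm_Pair)

lemma invariant_local_fun:
  assumes "hol_in UNIV F" "\<And>h w. h \<in> fixer M \<Longrightarrow> F (complex_act h w) = F w"
  shows "\<exists>f. local_fun z f \<and> (\<exists>\<epsilon>>0. \<forall>w\<in>S \<inter> ball z \<epsilon>. f (orb w) = F w)"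
proof -
  obtain \<rho> where r: "\<rho> > 0" "\<And>g w. g \<in> G \<Longrightarrow> w \<in> ball z \<rho> \<Longrightarrow> complex_act g w \<in> ball z \<rho> \<Longrightarrow> complex_act g z = z"
    using separation[of z] by blast
  have "\<exists>f. (\<forall>w\<in>S \<inter> ball z \<rho>. f (orb w) = F w) \<and> local_fun z f"
  proof (rule local_fun_exists[OF _ r(1)])
    show "hol_in (ball z \<rho>) F" by (rule hol_in_subset[OF assms(1)]) simp
    show "complex_act g z = z" if "g \<in> G" "w \<in> ball z \<rho>" "complex_act g w \<in> ball z \<rho>" for g w
      using r(2) that by blast
    show "F (complex_act g w) = F w" if "g \<in> G" "complex_act g z = z" for g w
      using assms(2) stab that by blast
  qed
  then show ?thesis using r(1) by blast
qed

text \<open>Points on the real normal ray \<open>z + t s\<close> with small \<open>t > 0\<close> lie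
  in \<open>S\<close>, and they witness that the germ is nonzero.\<close>

lemma gm_nonzero:
  assumes f: "\<epsilon> > 0" "\<forall>w\<in>S \<inter> ball z \<epsilon>. f (orb w) = F w" and s: "s \<in> normals M"
    and F: "\<And>t. t > 0 \<Longrightarrow> F (z + cscale (of_real t) (s, 0)) \<noteq> 0"
  shows "gm z f \<noteq> \<zero>\<^bsub>R z\<^esub>"
proof
  assume "gm z f = \<zero>\<^bsub>R z\<^esub>"
  then obtain d where d: "d > 0" "\<forall>w\<in>S \<inter> ball z d. f (orb w) = 0"
    unfolding gm_zero gm_eq_iff[OF zS] by blast
  define t where "t = min \<epsilon> d / 2"
  have t: "t > 0" "t < \<epsilon>" "t < d" using f d by (auto simp: t_def)
  let ?w = "z + cscale (of_real t) (s, 0)"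
  have "?w \<in> S" "?w \<in> ball z \<epsilon>" "?w \<in> ball z d"
    by (rule normal_in_S[OF s], rule normal_in_ball[OF s], use t in simp, rule normal_in_ball[OF s], use t in simp)
  then have "f (orb ?w) = F ?w" "f (orb ?w) = 0" using f(2) d(2) by blast+
  then have "F ?w = 0" by simp
  then show False using F[OF t(1)] by simp
qed

lemma normals_L: "\<exists>e. extends_by M L e \<and> e \<in> normals M"
proof -
  obtain e where "extends_by M ((\<lambda>x. x) ` L) e" using ext_branch[OF id_in] affM by auto
  then show ?thesis unfolding normals_def using id_in by fastforce
qed

text \<open>If two branches are not related by the fixer of \<open>M\<close>, their even separating
  invariants are nonzero germs, while at each point of \<open>S\<close> near \<open>z\<close> one of
  them vanishes. So the stalk has zero divisors.\<close>

lemma domain_single_orbit: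
  assumes dom: "domain (R z)"
  shows "single_orbit M"
proof (rule ccontr)
  assume "\<not> single_orbit M"
  then obtain g where g: "g \<in> G" "M \<subseteq> g ` L" "\<And>h. h \<in> fixer M \<Longrightarrow> h ` L \<noteq> g ` L"
    unfolding single_orbit_def by blast
  obtain e where e: "extends_by M L e" "e \<in> normals M" using normals_L by blast
  obtain e' where e': "extends_by M (g ` L) e'" using ext_branch[OF g(1,2)] by blast
  then have e'N: "e' \<in> normals M" using g(1) unfolding normals_def by blast
  have ne: "lin h e \<noteq> e' \<and> lin h e \<noteq> - e'" if h: "h \<in> fixer M" for h
  proof -
    have "extends_by M (h ` L) (lin h e)"
      using extends_by_image[OF e(1) isom[OF fixer_in[OF h]]] fixer_image[OF h] by simp
    then show ?thesis using extends_by_unique[of M "h ` L" "lin h e" "g ` L"] e' extends_by_uminus[OF e'] g(3)[OF h] by metis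
  qed
  \<comment> \<open>If neither value vanished, elements of the fixer would carry \<open>s\<close> to
    \<open>e\<close> or \<open>- e\<close> and to \<open>e'\<close> or \<open>- e'\<close>;
    combining them would relate the two branches.\<close>
  have zero: "inv_val M e 0 s = 0 \<or> inv_val M e' 0 s = 0" if s: "s \<in> normals M" for s
  proof (rule ccontr)
    assume "\<not> ?thesis"
    then obtain g1 g2 where g1: "g1 \<in> fixer M" "lin g1 s = e \<or> lin g1 s = - e"
      and g2: "g2 \<in> fixer M" "lin g2 s = e' \<or> lin g2 s = - e'"
      using inv_val_zero[OF s] by metis
    obtain k where k: "k \<in> fixer M" "\<And>x. k (g1 x) = x" using fixer_inv[OF g1(1)] by metis
    have a: "affmap g1" "affmap g2" "affmap k" using aff fixer_in g1 g2 k by blast+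
    have l: "linear (lin g2)" "linear (lin k)" using a by (auto simp: affmap_def)
    have "k \<circ> g1 = (\<lambda>x. x)" using k(2) by (simp add: fun_eq_iff)
    from affmap_compose(2)[OF a(3,1), unfolded this affmap_id(2)]
    have kg: "lin k (lin g1 s) = s" by (metis comp_apply)
    have "lin k e = s \<or> lin k e = - s"
      using g1(2)
    proof
      assume "lin g1 s = - e"
      then have "- lin k e = s" using kg linear_neg[OF l(2), of e] by simp
      then have "lin k e = - s" by (metis minus_minus)
      then show ?thesis ..
    qed (use kg in simp)
    then have "lin g2 (lin k e) = e' \<or> lin g2 (lin k e) = - e'"
    proof
      assume "lin k e = - s"
      then have "lin g2 (lin k e) = - lin g2 s" using linear_neg[OF l(1), of s] by simp
      then show ?thesis using g2(2) by auto
    qed (use g2(2) in simp)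
    moreover have "lin (g2 \<circ> k) e = lin g2 (lin k e)" using affmap_compose(2)[OF a(2,3)] by simp
    ultimately show False using ne[OF fixer_comp[OF g2(1) k(1)]] by simp
  qed
  obtain f1 d1 where f1: "local_fun z f1" "d1 > 0" "\<forall>w\<in>S \<inter> ball z d1. f1 (orb w) = inv_poly M e 0 w"
    using invariant_local_fun[OF hol_in_inv_poly inv_poly_invariant] by metis
  obtain f2 d2 where f2: "local_fun z f2" "d2 > 0" "\<forall>w\<in>S \<inter> ball z d2. f2 (orb w) = inv_poly M e' 0 w"
    using invariant_local_fun[OF hol_in_inv_poly inv_poly_invariant] by metis
  obtain d3 where d3: "d3 > 0" "\<forall>w\<in>S \<inter> ball z d3. \<exists>m\<in>complexify M. \<exists>s\<in>normals M. \<exists>t. w = m + cscale t (s, 0)"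
    using near by blast
  have "gm z f1 \<otimes>\<^bsub>R z\<^esub> gm z f2 = \<zero>\<^bsub>R z\<^esub>"
    unfolding gm_mult gm_zero gm_eq_iff[OF zS]
  proof (intro exI[of _ "min (min d1 d2) d3"] conjI ballI)
    fix w assume w: "w \<in> S \<inter> ball z (min (min d1 d2) d3)"
    obtain m s t where m: "m \<in> complexify M" "s \<in> normals M" "w = m + cscale t (s, 0)"
    proof -
      have "w \<in> S \<inter> ball z d3" using w by simp
      then show thesis using d3(2) that by blast
    qed
    have s: "\<forall>u\<in>direction M. s \<bullet> u = 0" using normals_unit[OF m(2)] by blast
    have "inv_poly M e 0 w * inv_poly M e' 0 w = 0"
      unfolding m(3) inv_poly_normal[OF m(1) s] using zero[OF m(2)] by auto
    then show "f1 (orb w) * f2 (orb w) = 0" using f1(3) f2(3) w by simp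
  qed (use f1 f2 d3 in auto)
  then have "gm z f1 = \<zero>\<^bsub>R z\<^esub> \<or> gm z f2 = \<zero>\<^bsub>R z\<^esub>"
    using domain.integral[OF dom] gm_in[OF zS] f1(1) f2(1) by blast
  moreover have "gm z f1 \<noteq> \<zero>\<^bsub>R z\<^esub>"
  proof (rule gm_nonzero[OF f1(2,3) e(2)])
    fix t :: real assume "t > 0"
    then show "inv_poly M e 0 (z + cscale (of_real t) (e, 0)) \<noteq> 0"
      using inv_poly_normal[OF zM, of e] normals_unit[OF e(2)] inv_val_pos[OF e(2), of 0] by simp
  qed
  moreover have "gm z f2 \<noteq> \<zero>\<^bsub>R z\<^esub>"
  proof (rule gm_nonzero[OF f2(2,3) e'N])
    fix t :: real assume "t > 0"
    then show "inv_poly M e' 0 (z + cscale (of_real t) (e', 0)) \<noteq> 0"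
      using inv_poly_normal[OF zM, of e'] normals_unit[OF e'N] inv_val_pos[OF e'N, of 0] by simp
  qed
  ultimately show False by blast
qed

text \<open>Without the reflection, an odd invariant polynomial makes the coordinate normal to \<open>M\<close> integral
  over the stalk, but the derivative of an invariant function vanishes in the normal directions.\<close>

lemma normal_reflects:
  assumes ic: "integrally_closed_domain (R z)"
  shows "reflects M"
proof (rule ccontr)
  assume neg: "\<not> reflects M"
  interpret D: domain "R z" using ic by (simp add: integrally_closed_domain_def)
  have so: "single_orbit M" by (rule domain_single_orbit[OF D.domain_axioms])
  obtain e where e: "extends_by M L e" "e \<in> normals M" using normals_L by blast
  have e_perp: "\<And>u. u \<in> direction M \<Longrightarrow> e \<bullet> u = 0" using normals_unit[OF e(2)] by blast
  \<comment> \<open>An element of the fixer reversing \<open>e\<close> maps \<open>L\<close> to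
    itself, as \<open>L\<close> is determined by \<open>M\<close> and the normal line, and acts
    there as the reflection.\<close>
  have no: "lin g e \<noteq> - e" if g: "g \<in> fixer M" for g
  proof
    assume ge: "lin g e = - e"
    have "extends_by M (g ` L) (lin g e)"
      using extends_by_image[OF e(1) isom[OF fixer_in[OF g]]] fixer_image[OF g] by simp
    then have "extends_by M (g ` L) (- e)" unfolding ge .
    then have gL: "g ` L = L" by (rule extends_by_unique[OF _ extends_by_uminus[OF e(1)]])
    have "g x = 2 *\<^sub>R closest_point M x - x" if x: "x \<in> L" for x
    proof -
      let ?p = "closest_point M x"
      have p: "?p \<in> M" by (rule closest_point_affine_in[OF affM(1,2)])
      have "x - ?p \<in> direction L" using x p affM by (intro direction_diff) auto
      then have "x - ?p = ((x - ?p) \<bullet> e) *\<^sub>R e"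
        by (rule extends_by_normal[OF e(1)]) (rule closest_point_orthogonal[OF affM(1,2)])
      then have "lin g (x - ?p) = - (x - ?p)"
        using ge aff[OF fixer_in[OF g]] linear_scale[of "lin g"] unfolding affmap_def by (metis scaleR_minus_right)
      moreover have "lin g (x - ?p) = g x - ?p"
        using affmap_diff[OF aff[OF fixer_in[OF g]]] g p by (simp add: fixer_def)
      ultimately show ?thesis by (simp add: scaleR_2 algebra_simps)
    qed
    then show False using neg gL fixer_in[OF g] unfolding reflects_def by blast
  qed
  \<comment> \<open>The odd invariant (\<open>j = 1\<close>) at the unit normal; by
    \<open>no\<close> nothing cancels in the sum.\<close>
  define C where "C = inv_val M e 1 e"
  have C: "C > 0" unfolding C_def by (rule inv_val_pos[OF e(2)]) (use no in blast)
  define N where "N = sep_deg M e"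
  have val: "inv_poly M e 1 (m + cscale t (lin g e, 0)) = t ^ (2 * N + 1) * of_real C"
    "sq M (m + cscale t (lin g e, 0)) = t\<^sup>2"
    if "m \<in> complexify M" "g \<in> fixer M" for m g t
    using inv_poly_normal[OF that(1), of "lin g e"] normals_unit[OF normals_image[OF that(2) e(2)]]
      inv_val_invariant[OF that(2)] sq_normal[OF that(1) normals_image[OF that(2) e(2)]]
    by (simp_all add: C_def N_def)
  obtain d3 where d3: "d3 > 0" "\<forall>w\<in>S \<inter> ball z d3. \<exists>m\<in>complexify M. \<exists>s\<in>normals M. \<exists>t. w = m + cscale t (s, 0)"
    using near by blast
  \<comment> \<open>There is a single orbit of branches, so every normal is the image of
    \<open>e\<close> under the fixer, up to a sign absorbed into \<open>t\<close>.\<close>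
  have nearby: "\<exists>m\<in>complexify M. \<exists>g\<in>fixer M. \<exists>t. w = m + cscale t (lin g e, 0)" if w: "w \<in> S \<inter> ball z d3" for w
  proof -
    obtain m s t where m: "m \<in> complexify M" "s \<in> normals M" "w = m + cscale t (s, 0)"
      using d3(2) w by blast
    obtain g where g: "g \<in> G" "extends_by M (g ` L) s" using m(2) unfolding normals_def by blast
    then have "M \<subseteq> g ` L" unfolding extends_by_def by blast
    then obtain h where h: "h \<in> fixer M" "h ` L = g ` L" using so g(1) unfolding single_orbit_def by blast
    have "extends_by M (g ` L) (lin h e)"
      using extends_by_image[OF e(1) isom[OF fixer_in[OF h(1)]]] fixer_image[OF h(1)] h(2) by simp
    moreover have "s \<in> direction (g ` L)" "norm s = 1" "\<And>m. m \<in> direction M \<Longrightarrow> s \<bullet> m = 0"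
      using g(2) unfolding extends_by_def by blast+
    ultimately have "s = lin h e \<or> s = - lin h e" using extends_by_unit by blast
    moreover have "cscale t (- lin h e, 0) = cscale (- t) (lin h e, 0)" by (simp add: cscale_pair)
    ultimately show ?thesis using m h(1) by metis
  qed
  obtain f d1 where f: "local_fun z f" "d1 > 0" "\<forall>w\<in>S \<inter> ball z d1. f (orb w) = inv_poly M e 1 w"
    using invariant_local_fun[OF hol_in_inv_poly inv_poly_invariant] by metis
  obtain q d2 where q: "local_fun z q" "d2 > 0" "\<forall>w\<in>S \<inter> ball z d2. q (orb w) = sq M w"
    using invariant_local_fun[OF hol_in_sq sq_invariant] by metis
  \<comment> \<open>In normal coordinates \<open>f\<close> is \<open>C t^(2N+1)\<close> and
    \<open>q\<close> is \<open>t^2\<close>, so \<open>f / q^N\<close> is \<open>C t\<close>, with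
    square \<open>C^2 q\<close>: it is integral over the stalk.\<close>
  let ?b = "\<lambda>y. q y ^ N" and ?c = "\<lambda>y. of_real (C\<^sup>2) * q y"
  have b: "local_fun z ?b" by (rule gm_pow(2)[OF zS q(1)])
  have c: "local_fun z ?c" by (rule local_fun_mult[OF local_fun_const q(1)])
  have eq: "gm z f \<otimes>\<^bsub>R z\<^esub> gm z f = gm z ?c \<otimes>\<^bsub>R z\<^esub> (gm z ?b \<otimes>\<^bsub>R z\<^esub> gm z ?b)"
    unfolding gm_mult gm_eq_iff[OF zS]
  proof (intro exI[of _ "min (min d1 d2) d3"] conjI ballI)
    fix w assume w: "w \<in> S \<inter> ball z (min (min d1 d2) d3)"
    then have w123: "w \<in> S \<inter> ball z d1" "w \<in> S \<inter> ball z d2" "w \<in> S \<inter> ball z d3" by simp_all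
    obtain m g t where m: "m \<in> complexify M" "g \<in> fixer M" "w = m + cscale t (lin g e, 0)"
      using nearby[OF w123(3)] by blast
    have "f (orb w) = inv_poly M e 1 w" "q (orb w) = sq M w" using f(3) q(3) w123 by blast+
    then have "f (orb w) = t ^ (2 * N + 1) * of_real C" "q (orb w) = t\<^sup>2"
      using val[OF m(1,2), of t] m(3) by simp_all
    then show "f (orb w) * f (orb w) = of_real (C\<^sup>2) * q (orb w) * (q (orb w) ^ N * q (orb w) ^ N)"
      by (simp add: power_mult power2_eq_square power_mult_distrib algebra_simps)
  qed (use f q d3 in auto)
  have "gm z ?b \<noteq> \<zero>\<^bsub>R z\<^esub>"
  proof (rule gm_nonzero[OF q(2) _ e(2)])
    show "\<forall>w\<in>S \<inter> ball z d2. q (orb w) ^ N = sq M w ^ N" using q(3) by simp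
    show "sq M (z + cscale (of_real t) (e, 0)) ^ N \<noteq> 0" if "t > 0" for t
      using sq_normal[OF zM e(2)] that by simp
  qed
  then obtain h0 where h0: "h0 \<in> carrier (R z)" "gm z f = h0 \<otimes>\<^bsub>R z\<^esub> gm z ?b"
    using D.integrally_closed_square[OF ic gm_in[OF zS f(1)] _ gm_in[OF zS c] eq] gm_in[OF zS b] by blast
  obtain h where "local_fun z h" "h0 = gm z h" using gm_cases[OF zS h0(1)] by blast
  then have h: "local_fun z h" "gm z f = gm z (\<lambda>y. h y * ?b y)"
    using h0(2) gm_mult[of z h ?b] by simp_all
  obtain d4 where d4: "d4 > 0" "\<forall>w\<in>S \<inter> ball z d4. f (orb w) = h (orb w) * q (orb w) ^ N"
    using h(2) unfolding gm_eq_iff[OF zS] by blast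
  obtain d5 F where F: "d5 > 0" "hol_in (ball z d5) F" "\<forall>w\<in>S \<inter> ball z d5. h (orb w) = F w"
    using h(1) unfolding local_fun_def by blast
  define d where "d = min (min d1 d2) (min d4 d5)"
  have d: "d > 0" "d \<le> d1" "d \<le> d2" "d \<le> d4" "d \<le> d5" using f q d4 F by (auto simp: d_def)
  \<comment> \<open>On the normal rays \<open>q^N\<close> can be divided out, so the ambient
    function \<open>F\<close> representing the quotient is linear there.\<close>
  have lineF: "F (z + t *\<^sub>R (lin g e, 0)) = of_real t * of_real C" if g: "g \<in> fixer M" and t: "0 < t" "t < d" for g t
  proof -
    let ?w = "z + cscale (of_real t) (lin g e, 0)"
    have n: "lin g e \<in> normals M" by (rule normals_image[OF g e(2)])
    have w: "?w \<in> S" "?w \<in> ball z d" using normal_in_S[OF n] normal_in_ball[OF n, of "of_real t"] t by simp_all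
    then have "?w \<in> S \<inter> ball z d1" "?w \<in> S \<inter> ball z d2" "?w \<in> S \<inter> ball z d4" "?w \<in> S \<inter> ball z d5" using d by simp_all
    then have "f (orb ?w) = inv_poly M e 1 ?w" "q (orb ?w) = sq M ?w" "f (orb ?w) = h (orb ?w) * q (orb ?w) ^ N" "h (orb ?w) = F ?w"
      using f(3) q(3) d4(2) F(3) by blast+
    then have "inv_poly M e 1 ?w = F ?w * sq M ?w ^ N" by simp
    then have "of_real t ^ (2 * N + 1) * of_real C = F ?w * (of_real t ^ 2) ^ N"
      unfolding val[OF zM g] .
    then have "of_real t ^ (2 * N) * (of_real t * of_real C) = of_real t ^ (2 * N) * F ?w"
      by (simp only: power_mult[symmetric] power_add power_one_right mult_ac)
    then have "F ?w = of_real t * of_real C" using t by simp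
    then show ?thesis by (simp add: cscale_of_real)
  qed
  have "complex_differentiable_at F z" using F(1,2) unfolding hol_in_def by simp
  then obtain D where D: "(F has_derivative D) (at z)" unfolding complex_differentiable_at_def by blast
  have linD: "linear D" using D by (rule has_derivative_linear)
  \<comment> \<open>The derivative in the direction of a ray is determined by the values on the ray,
    so the right-hand derivative at 0 suffices.\<close>
  have DC: "D (lin g e, 0) = of_real C" if g: "g \<in> fixer M" for g
  proof -
    define v where "v = (lin g e, 0 :: 'a)"
    let ?F = "\<lambda>t. F (z + t *\<^sub>R v)"
    have "((\<lambda>t. z + t *\<^sub>R v) has_derivative (\<lambda>t. t *\<^sub>R v)) (at 0)"
      by (auto intro!: derivative_eq_intros)
    moreover have "(F has_derivative D) (at (z + 0 *\<^sub>R v))" using D by simp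
    ultimately have "(?F has_derivative (\<lambda>t. D (t *\<^sub>R v))) (at 0)" by (rule has_derivative_compose)
    then have "(?F has_vector_derivative D v) (at 0)"
      unfolding has_vector_derivative_def linear_scale[OF linD] .
    then have der: "(?F has_vector_derivative D v) (at_right 0)" by (rule has_vector_derivative_at_within)
    then have cont: "(?F \<longlongrightarrow> ?F 0) (at_right 0)"
      using has_vector_derivative_continuous continuous_within by blast
    have ev: "\<forall>\<^sub>F t in at_right 0. ?F t = of_real t * of_real C"
      unfolding eventually_at_right_field using d(1) lineF[OF g, folded v_def] by blast
    have "((\<lambda>t. complex_of_real t * of_real C) \<longlongrightarrow> of_real 0 * of_real C) (at_right 0)"
      by (intro tendsto_intros)
    then have "(?F \<longlongrightarrow> of_real 0 * of_real C) (at_right 0)"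
      by (rule Lim_transform_eventually) (use ev in eventually_elim, simp)
    then have F0: "?F 0 = of_real 0 * of_real C" using cont tendsto_unique[OF trivial_limit_at_right_real] by blast
    have at0: "at (0::real) within {0..} = at_right 0"
    proof -
      have "{0..} - {0::real} = {0<..} - {0}" by auto
      then show ?thesis by (simp add: at_within_def)
    qed
    have "((\<lambda>t. complex_of_real t * of_real C) has_vector_derivative of_real C) (at 0 within {0..})"
      by (auto intro!: derivative_eq_intros)
    then have "(?F has_vector_derivative of_real C) (at 0 within {0..})"
    proof (rule has_vector_derivative_transform_within[OF _ d(1)])
      fix t :: real assume t: "t \<in> {0..}" "dist t 0 < d"
      then consider "t = 0" | "0 < t" "t < d" by force
      then show "complex_of_real t * of_real C = ?F t"
        by cases (use F0 lineF[OF g, folded v_def] in simp_all)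
    qed simp
    then have "D v = of_real C"
      using der unfolding at0 by (metis vector_derivative_within trivial_limit_at_right_real)
    then show ?thesis unfolding v_def .
  qed
  \<comment> \<open>By linearity, \<open>D\<close> would take the zero vector to \<open>C\<close>
    times the order of the fixer, which is positive.\<close>
  have "(\<Sum>g\<in>fixer M. lin g e) = 0"
    unfolding fixer_def by (rule fixer_sum[OF M]) (use e(1) in \<open>auto simp: extends_by_def\<close>)
  moreover have "D (\<Sum>g\<in>fixer M. (lin g e, 0)) = of_nat (card (fixer M)) * of_real C"
    unfolding linear_sum[OF linD] using DC by simp
  moreover have "(\<Sum>g\<in>fixer M. (lin g e, 0 :: 'a)) = (\<Sum>g\<in>fixer M. lin g e, 0)"
    by (simp add: sum_prod)
  ultimately have "of_nat (card (fixer M)) * complex_of_real C = 0"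
    using linear_0[OF linD] by (simp add: zero_prod_def)
  then show False using C finF fixer_id by auto
qed

end

end

subsection \<open>Codimension\<close>

lemma direction_subspace: "subspace M \<Longrightarrow> direction M = M"
  using direction_iff[of M 0] subspace_imp_affine subspace_0 by force

text \<open>Baire's theorem, since each affine subspace not containing \<open>A\<close> is closed
  with empty interior in \<open>A\<close>. Countable families are needed because the group and the
  arrangement may be infinite.\<close>

lemma affine_avoid:
  fixes A :: "'a::euclidean_space set"
  assumes A: "affine A" "p \<in> A" and c: "countable \<B>"
    and B: "\<And>B. B \<in> \<B> \<Longrightarrow> affine B \<and> \<not> A \<subseteq> B" and \<epsilon>: "\<epsilon> > 0"
  shows "\<exists>x\<in>A. dist x p < \<epsilon> \<and> x \<notin> \<Union>\<B>"
proof -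
  let ?G = "insert A ((\<lambda>B. A - B) ` \<B>)"
  have "A \<subseteq> closure (\<Inter>?G)"
  proof (rule Baire)
    show "closed A" using A by (simp add: affine_closed)
    show "countable ?G" using c by simp
    fix T assume "T \<in> ?G"
    then consider "T = A" | B where "B \<in> \<B>" "T = A - B" by blast
    then show "openin (top_of_set A) T \<and> A \<subseteq> closure T"
    proof cases
      case 1
      then show ?thesis using closure_subset by auto
    next
      case 2
      have aB: "affine B" using B[OF 2(1)] by simp
      obtain a where a: "a \<in> A" "a \<notin> B" using B[OF 2(1)] by blast
      have "openin (top_of_set A) (A \<inter> (- B))"
        using affine_closed[OF aB] by (intro openin_open_Int) auto
      moreover have "x \<in> closure (A - B)" if x: "x \<in> A" for x
        unfolding closure_approachable
      proof (intro allI impI)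
        fix e :: real assume e: "e > 0"
        show "\<exists>y\<in>A - B. dist y x < e"
        proof (cases "x \<in> B")
          case False
          then show ?thesis using x e by (intro bexI[of _ x]) auto
        next
          case True
          then have n: "norm (a - x) > 0" using a by auto
          \<comment> \<open>Moving from \<open>x\<close> towards a point \<open>a\<close> outside
            \<open>B\<close> leaves \<open>B\<close> at once; this \<open>t\<close> makes the
            displacement \<open>e/2\<close>.\<close>
          define t where "t = e / (2 * norm (a - x))"
          have t: "t > 0" using e n by (simp add: t_def)
          let ?y = "x + t *\<^sub>R (a - x)"
          have "?y = (1 - t) *\<^sub>R x + t *\<^sub>R a" by (simp add: algebra_simps)
          then have yA: "?y \<in> A" using mem_affine[OF A(1) x a(1), of "1 - t" t] by simp
          have "?y \<notin> B"
          proof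
            assume yB: "?y \<in> B"
            have "(1 - 1/t) *\<^sub>R x + (1/t) *\<^sub>R ?y \<in> B"
              using mem_affine[OF aB True yB, of "1 - 1/t" "1/t"] by simp
            moreover have "(1 - 1/t) *\<^sub>R x + (1/t) *\<^sub>R ?y = a"
              using t by (simp add: algebra_simps)
            ultimately show False using a by simp
          qed
          moreover have "dist ?y x < e" using t n e by (simp add: dist_norm t_def)
          ultimately show ?thesis using yA by blast
        qed
      qed
      ultimately show ?thesis using 2 by (auto simp: Diff_eq)
    qed
  qed
  then have "p \<in> closure (\<Inter>?G)" using A(2) by (rule subsetD)
  then obtain x where "x \<in> \<Inter>?G" "dist x p < \<epsilon>" using \<epsilon> unfolding closure_approachable by blast
  then show ?thesis by blast
qed

lemma submanifold_dims_mono: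
  fixes Y :: "('a::euclidean_space \<times> 'a) set function_space"
  shows "Z \<subseteq> Z' \<Longrightarrow> submanifold_dims Y Z \<subseteq> submanifold_dims Y Z'"
proof
  fix k assume ZZ: "Z \<subseteq> Z'" and "k \<in> submanifold_dims Y Z"
  then obtain M :: "'a set" and D \<phi> U f where 1: "k = dim M" "subspace M" "openin (top_of_set (M \<times> M)) D" "D \<noteq> {}"
    "openin (top_of Y) U" "\<phi> ` D \<subseteq> U \<inter> Z" "holomorphic_map_to Y D \<phi>"
    "\<forall>b\<in>Basis. f b \<in> regular Y U \<and> (\<forall>(u, v)\<in>D. f b (\<phi> (u, v)) = Complex (u \<bullet> b) (v \<bullet> b))"
    unfolding submanifold_dims_def by blast
  moreover have "\<phi> ` D \<subseteq> U \<inter> Z'" using 1(6) ZZ by blast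
  ultimately show "k \<in> submanifold_dims Y Z'"
    unfolding submanifold_dims_def by (intro CollectI exI conjI)
qed

context isometry_action
begin

text \<open>The regular functions invert the chart, and this inverse is differentiable. So the part
  of the chart covered by a flat of dimension below \<open>k\<close> is the differentiable image of
  a negligible set, and countably many such parts cannot fill a nonempty open set.\<close>

lemma submanifold_dims_bound:
  assumes k: "k \<in> submanifold_dims Y Z" and c: "countable \<A>"
    and A: "\<And>A. A \<in> \<A> \<Longrightarrow> affine A \<and> A \<noteq> {} \<and> A \<subseteq> L"
    and Z: "Z \<subseteq> orb ` (\<Union>A\<in>\<A>. complexify A)"
  shows "\<exists>A\<in>\<A>. k \<le> dim (direction A)"
proof (rule ccontr)
  assume "\<not> ?thesis"
  then have less: "\<And>A. A \<in> \<A> \<Longrightarrow> dim (direction A) < k" by force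
  obtain M :: "'a set" and D \<phi> U f where M: "subspace M" "k = dim M"
    and D: "openin (top_of_set (M \<times> M)) D" "D \<noteq> {}" "openin (top_of Y) U" "\<phi> ` D \<subseteq> U \<inter> Z"
    and f0: "\<forall>b\<in>Basis. f b \<in> regular Y U \<and> (\<forall>(u, v)\<in>D. f b (\<phi> (u, v)) = Complex (u \<bullet> b) (v \<bullet> b))"
    using k unfolding submanifold_dims_def by blast
  have f: "f b \<in> regular Y U" "\<And>w. w \<in> D \<Longrightarrow> f b (\<phi> w) = Complex (fst w \<bullet> b) (snd w \<bullet> b)" if "b \<in> Basis" for b
    using f0 that by (auto simp: case_prod_beta)
  \<comment> \<open>Reads the chart coordinates off a point of the quotient; a left inverse of
    \<open>\<phi>\<close>.\<close>
  define \<psi> where "\<psi> w = (\<Sum>b\<in>Basis. (Re (f b (orb w)) *\<^sub>R b, Im (f b (orb w)) *\<^sub>R b))" for w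
  have \<psi>: "\<psi> w = v" if v: "v \<in> D" "\<phi> v = orb w" for w v
  proof -
    have "\<psi> w = (\<Sum>b\<in>Basis. ((fst v \<bullet> b) *\<^sub>R b, (snd v \<bullet> b) *\<^sub>R b))"
      unfolding \<psi>_def using f(2)[OF _ v(1)] v(2) by (intro sum.cong) auto
    also have "\<dots> = (fst v, snd v)" by (simp add: sum_prod euclidean_representation)
    finally show ?thesis by simp
  qed
  define Q where "Q = {w \<in> S. orb w \<in> U}"
  have diff\<psi>: "\<psi> differentiable (at w within Q)" if w: "w \<in> Q" for w
  proof -
    have "(\<lambda>w. f b (orb w)) differentiable (at w within Q)" if b: "b \<in> Basis" for b
    proof -
      have "analytic_fun_on Q (\<lambda>w. f b (orb w))" using f(1)[OF b] unfolding regular_Y Q_def .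
      then obtain N F where N: "open N" "w \<in> N" "\<forall>w\<in>N. complex_differentiable_at F w" "\<forall>w\<in>N \<inter> Q. f b (orb w) = F w"
        using w unfolding analytic_fun_on_def by meson
      obtain F' where "(F has_derivative F') (at w)"
        using N(2,3) unfolding complex_differentiable_at_def by blast
      then have dF: "F differentiable (at w within Q)"
        using has_derivative_at_withinI unfolding differentiable_def by blast
      obtain e where e: "e > 0" "ball w e \<subseteq> N" using N(1,2) openE by blast
      show ?thesis
      proof (rule differentiable_transform_within[OF dF e(1) w])
        fix v assume "v \<in> Q" "dist v w < e"
        then have "v \<in> N \<inter> Q" using e by (auto simp: dist_commute)
        then show "F v = f b (orb v)" using N(4) by simp
      qed
    qed
    then have "(\<lambda>w. (Re (f b (orb w)) *\<^sub>R b, Im (f b (orb w)) *\<^sub>R b)) differentiable (at w within Q)" if b: "b \<in> Basis" for b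
    proof -
      have "bounded_linear (\<lambda>c::complex. (Re c *\<^sub>R b, Im c *\<^sub>R b))"
        by (intro bounded_linear_Pair bounded_linear_scaleR_const bounded_linear_Re bounded_linear_Im)
      then show ?thesis
        using \<open>\<And>b. b \<in> Basis \<Longrightarrow> (\<lambda>w. f b (orb w)) differentiable (at w within Q)\<close>[OF b]
        unfolding differentiable_def using bounded_linear.has_derivative by blast
    qed
    then show ?thesis unfolding \<psi>_def[abs_def] by (intro differentiable_sum) auto
  qed
  define p2 where "p2 = clin (closest_point M)"
  have Mne: "M \<noteq> {}" "affine M" "direction M = M"
    using M(1) subspace_0 subspace_imp_affine direction_subspace by auto
  have aM: "affmap (closest_point M)" by (rule closest_point_affmap[OF Mne(2,1)])
  have linp2: "linear p2" unfolding p2_def by (rule linear_clin[OF aM])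
  \<comment> \<open>\<open>D\<close> is open only in \<open>M \<times> M\<close>. It is thickened in
    the orthogonal directions so that Lebesgue measure of the ambient space can be used.\<close>
  define \<Omega> where "\<Omega> = p2 -` D"
  have p2in: "p2 w \<in> M \<times> M" for w
    using lin_closest_point_in[OF Mne(2,1)] Mne(3) by (cases w) (simp add: p2_def clin_def)
  have p2D: "p2 w = w" if "w \<in> D" for w
  proof -
    have "w \<in> M \<times> M" using that D(1) openin_imp_subset by blast
    then show ?thesis using lin_closest_point_self[OF Mne(2,1)] Mne(3) by (cases w) (simp add: p2_def clin_def)
  qed
  have "open \<Omega>"
  proof -
    obtain T where T: "open T" "D = (M \<times> M) \<inter> T" using D(1) openin_open by blast
    have "\<Omega> = p2 -` T" unfolding \<Omega>_def T(2) using p2in by blast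
    moreover have "continuous_on UNIV p2" using linp2 by (simp add: linear_continuous_on linear_conv_bounded_linear)
    ultimately show ?thesis using T(1) by (simp add: open_vimage)
  qed
  moreover have "\<Omega> \<noteq> {}" using D(2) p2D unfolding \<Omega>_def by force
  moreover have "negligible \<Omega>"
  proof -
    have "\<exists>N. negligible N \<and> (\<forall>w\<in>\<Omega>. \<forall>v\<in>complexify A. \<phi> (p2 w) = orb v \<longrightarrow> w \<in> N)" if A': "A \<in> \<A>" for A
    proof -
      have aA: "affine A" "A \<noteq> {}" "A \<subseteq> L" using A[OF A'] by auto
      obtain a where a: "a \<in> A" using aA by blast
      have "dim (direction A) \<le> dim M" using less[OF A'] M(2) by simp
      from choose_subspace_of_subspace[OF this]
      \<comment> \<open>A model of the direction of \<open>A\<close> inside \<open>M\<close>. It is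
        a proper subspace, so \<open>M\<close> contains a nonzero vector \<open>n\<close> orthogonal
        to it.\<close>
      obtain M' where M': "subspace M'" "M' \<subseteq> span M" "dim M' = dim (direction A)" by blast
      have sp: "span M' = M'" "span M = M" using M(1) M'(1) span_eq_iff by blast+
      have "M' \<noteq> M" using M'(3) M(2) less[OF A'] by auto
      then have "span M' \<subset> span M" unfolding sp using M'(2)[unfolded sp] by blast
      then obtain n where n: "n \<noteq> 0" "n \<in> M" "\<And>y. y \<in> M' \<Longrightarrow> n \<bullet> y = 0"
        using orthogonal_to_subspace_exists_gen[of M' M] sp by (auto simp: orthogonal_def)
      have M'M: "M' \<subseteq> M" using M'(2) sp by simp
      obtain g where g: "linear g" "g ` M' = direction A"
        using isometries_subspaces[OF M'(1) subspace_direction[OF aA(1,2)] M'(3)] by metis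
      have M'ne: "M' \<noteq> {}" "affine M'" "direction M' = M'"
        using M'(1) subspace_0 subspace_imp_affine direction_subspace by auto
      define l where "l = lin (closest_point M')"
      have linl: "linear l" using closest_point_affmap[OF M'ne(2,1)] unfolding l_def affmap_def .
      define h where "h w = (a, 0) + (g (l (fst w)), g (l (snd w)))" for w :: "'a \<times> 'a"
      \<comment> \<open>The parameter set lies in a hyperplane, so it is negligible.
        \<open>h\<close> ignores all components orthogonal to \<open>M'\<close>, and
        \<open>\<Psi>\<close> puts the components orthogonal to \<open>M\<close> back.\<close>
      define T where "T = {w. (n, 0) \<bullet> w = 0 \<and> h w \<in> Q}"
      define \<Psi> where "\<Psi> w = \<psi> (h w) + (w - p2 w)" for w
      have "(n, 0 :: 'a) \<noteq> 0" using n(1) by (metis fst_conv fst_zero)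
      then have "negligible {w. (n, 0 :: 'a) \<bullet> w = 0}" by (intro negligible_hyperplane disjI1)
      moreover have "T \<subseteq> {w. (n, 0 :: 'a) \<bullet> w = 0}" by (rule subsetI) (simp only: T_def mem_Collect_eq)
      ultimately have negT: "negligible T" by (rule negligible_subset)
      have blgl: "bounded_linear (\<lambda>w. (g (l (fst w)), g (l (snd w))))"
      proof -
        have bg: "bounded_linear g" and bl: "bounded_linear l"
          using g(1) linl by (simp_all add: linear_conv_bounded_linear)
        show ?thesis
          by (rule bounded_linear_Pair[OF bounded_linear_compose[OF bg bounded_linear_compose[OF bl bounded_linear_fst]]
                bounded_linear_compose[OF bg bounded_linear_compose[OF bl bounded_linear_snd]]])
      qed
      have diffh: "h differentiable (at w within T)" for w
        unfolding h_def[abs_def] by (intro differentiable_add differentiable_const bounded_linear_imp_differentiable[OF blgl])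
      have "\<Psi> differentiable_on T"
        unfolding differentiable_on_def
      proof
        fix w assume w: "w \<in> T"
        have hT: "h ` T \<subseteq> Q" unfolding T_def by blast
        have hw: "h w \<in> Q" using w unfolding T_def by blast
        have "\<psi> differentiable (at (h w) within h ` T)"
          by (rule differentiable_within_subset[OF diff\<psi>[OF hw] hT])
        then have "(\<psi> \<circ> h) differentiable (at w within T)" using diffh by (intro differentiable_chain_within)
        moreover have "(\<lambda>w. w - p2 w) differentiable (at w within T)"
          using linp2 by (intro differentiable_diff differentiable_ident linear_imp_differentiable)
        ultimately show "\<Psi> differentiable (at w within T)"
          unfolding \<Psi>_def[abs_def] by (intro differentiable_add) (simp_all add: comp_def)
      qed
      then have "negligible (\<Psi> ` T)" by (rule negligible_differentiable_image_negligible[OF order_refl negT])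
      moreover have "w \<in> \<Psi> ` T" if w: "w \<in> \<Omega>" and v: "v \<in> complexify A" "\<phi> (p2 w) = orb v" for w v
      proof -
        have wD: "p2 w \<in> D" using w by (simp add: \<Omega>_def)
        obtain x y where v': "v = (x, y)" "x \<in> A" "y \<in> direction A" using v(1) by (cases v) (auto simp: complexify_iff)
        have "x - a \<in> direction A" using v'(2) a by (rule direction_diff)
        then obtain m1 m2 where m: "m1 \<in> M'" "x - a = g m1" "m2 \<in> M'" "y = g m2" using g(2) v'(3) by blast
        define c where "c = fst (w - p2 w)" define d where "d = snd (w - p2 w)"
        have cd: "c \<bullet> u = 0" "d \<bullet> u = 0" if "u \<in> M" for u
          using lin_closest_point_orthogonal[OF Mne(2,1), of u] that Mne(3)
          by (cases w; simp add: c_def d_def p2_def clin_def)+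
        have lzero: "l c = 0" "l d = 0" unfolding l_def
          using cd M'M M'ne by (auto intro!: lin_closest_point_zero)
        have pzero: "lin (closest_point M) c = 0" "lin (closest_point M) d = 0"
          using cd Mne by (auto intro!: lin_closest_point_zero)
        have lm: "l m1 = m1" "l m2 = m2" unfolding l_def using m M'ne lin_closest_point_self by metis+
        have pm: "lin (closest_point M) m1 = m1" "lin (closest_point M) m2 = m2"
          using m M'M Mne lin_closest_point_self[OF Mne(2,1)] by blast+
        have linM: "linear (lin (closest_point M))" using aM by (simp add: affmap_def)
        \<comment> \<open>The parameter of \<open>v\<close> in \<open>M'\<close> together with the
          components of \<open>w\<close> orthogonal to \<open>M\<close>; \<open>\<Psi>\<close> maps
          it to \<open>w\<close>.\<close>
        define w' where "w' = (m1 + c, m2 + d)"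
        have xa: "a + g m1 = x" using m(2)[symmetric] by simp
        have h: "h w' = v" unfolding h_def w'_def v'
          using m(4) xa lm lzero linl by (simp add: linear_add)
        have "n \<bullet> (m1 + c) = 0" using n m cd(1)[of n] by (simp add: inner_add_right inner_commute)
        moreover have "v \<in> Q"
        proof -
          have "v \<in> S" using v(1) complexify_mono[OF aA(3)] complexify_sub_S by blast
          moreover have "orb v \<in> U" using D(4) wD v(2) by auto
          ultimately show ?thesis by (simp add: Q_def)
        qed
        ultimately have "w' \<in> T" using h by (simp add: T_def w'_def)
        moreover have "\<Psi> w' = w"
        proof -
          have "p2 w' = (m1, m2)" unfolding p2_def clin_def w'_def
            using linear_add[OF linM] pzero pm by simp
          then have "w' - p2 w' = (c, d)" by (simp add: w'_def)
          also have "\<dots> = w - p2 w" unfolding c_def d_def by (rule prod.collapse)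
          finally show ?thesis unfolding \<Psi>_def h using \<psi>[OF wD v(2)] by simp
        qed
        ultimately show ?thesis by force
      qed
      ultimately show ?thesis by blast
    qed
    then obtain N where N: "\<And>A. A \<in> \<A> \<Longrightarrow> negligible (N A)"
      "\<And>A w v. A \<in> \<A> \<Longrightarrow> w \<in> \<Omega> \<Longrightarrow> v \<in> complexify A \<Longrightarrow> \<phi> (p2 w) = orb v \<Longrightarrow> w \<in> N A"
      by metis
    have "negligible (\<Union>(N ` \<A>))" using c N(1) by (intro negligible_countable_Union) auto
    moreover have "\<Omega> \<subseteq> \<Union>(N ` \<A>)"
    proof
      fix w assume w: "w \<in> \<Omega>"
      then have "\<phi> (p2 w) \<in> Z" using D(4) by (auto simp: \<Omega>_def)
      then obtain A v where "A \<in> \<A>" "v \<in> complexify A" "\<phi> (p2 w) = orb v" using Z by blast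
      then show "w \<in> \<Union>(N ` \<A>)" using N(2) w by blast
    qed
    ultimately show ?thesis by (rule negligible_subset)
  qed
  ultimately show False using open_not_negligible by blast
qed

end

context stratum_geometry
begin

text \<open>Near a generic point of \<open>A\<close> the orbit map restricted to
  \<open>complexify A\<close> is a chart. Its coordinates are those of the projection onto
  \<open>A\<close>, which are invariant under the stabiliser and therefore descend to the
  quotient.\<close>

lemma submanifold_dims_flat:
  assumes A: "affine A" "A \<subseteq> L" and z: "z \<in> complexify A"
    and stab: "\<And>g. g \<in> G \<Longrightarrow> complex_act g z = z \<Longrightarrow> g \<in> fixer A"
    and \<delta>: "\<delta> > 0" and Z: "\<And>w. w \<in> complexify A \<inter> ball z \<delta> \<Longrightarrow> orb w \<in> Z"
  shows "dim (direction A) \<in> submanifold_dims Y Z"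
proof -
  obtain p q where pq: "z = (p, q)" "p \<in> A" "q \<in> direction A" using z by (cases z) (auto simp: complexify_iff)
  have Ane: "A \<noteq> {}" using pq by blast
  have aA: "affmap (closest_point A)" by (rule closest_point_affmap[OF A(1) Ane])
  define M where "M = direction A"
  have M: "subspace M" unfolding M_def by (rule subspace_direction[OF A(1) Ane])
  obtain \<rho> where \<rho>: "\<rho> > 0" "\<And>g w. g \<in> G \<Longrightarrow> w \<in> ball z \<rho> \<Longrightarrow> complex_act g w \<in> ball z \<rho> \<Longrightarrow> complex_act g z = z"
    using separation[of z] by blast
  define \<epsilon> where "\<epsilon> = min \<delta> \<rho>"
  have e: "\<epsilon> > 0" "ball z \<epsilon> \<subseteq> ball z \<delta>" "ball z \<epsilon> \<subseteq> ball z \<rho>" using \<delta> \<rho> by (auto simp: \<epsilon>_def)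
  \<comment> \<open>Translation by a real point of \<open>A\<close> identifies
    \<open>M \<times> M\<close> with \<open>complexify A\<close>.\<close>
  define \<tau> where "\<tau> w = (p, 0) + w" for w :: "'a \<times> 'a"
  define D where "D = (M \<times> M) \<inter> \<tau> -` ball z \<epsilon>"
  define \<phi> where "\<phi> w = orb (\<tau> w)" for w
  define U where "U = orb ` (S \<inter> ball z \<epsilon>)"
  have cont\<tau>: "continuous_on T \<tau>" for T unfolding \<tau>_def by (intro continuous_intros)
  have zero0: "(p, 0) \<in> complexify A" using pq subspace_0[OF M] by (simp add: complexify_iff M_def)
  have \<tau>A: "\<tau> w \<in> complexify A" if "w \<in> M \<times> M" for w
    unfolding \<tau>_def by (rule complexify_translate[OF A(1) zero0 that[unfolded M_def]])
  have AS: "complexify A \<subseteq> S" using complexify_mono[OF A(2)] complexify_sub_S by blast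
  \<comment> \<open>The coordinate along \<open>b\<close> of the projection to \<open>A\<close>,
    measured from \<open>(p, 0)\<close>.\<close>
  define F where "F b w = cinner b (complex_act (closest_point A) w - (p, 0))" for b w
  have holF: "hol_in (ball z \<epsilon>) (F b)" for b
    unfolding hol_in_def
  proof
    fix w
    have "complex_differentiable_at (\<lambda>v. cinner b (v - (p, 0))) (complex_act (closest_point A) w)"
      by (rule cd_compose[OF cd_cinner, where T' = "\<lambda>v. v"]) (auto intro!: derivative_eq_intros)
    then show "complex_differentiable_at (F b) w"
      unfolding F_def[abs_def] by (rule cd_complex_act[OF aA])
  qed
  have "\<exists>f. (\<forall>w\<in>S \<inter> ball z \<epsilon>. f (orb w) = F b w) \<and> local_fun z f" for b
  proof (rule local_fun_exists[OF holF e(1)])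
    show "complex_act g z = z" if "g \<in> G" "w \<in> ball z \<epsilon>" "complex_act g w \<in> ball z \<epsilon>" for g w
      using \<rho>(2) that e(3) by blast
    show "F b (complex_act g w) = F b w" if g: "g \<in> G" "complex_act g z = z" for g w
    proof -
      have gf: "g \<in> fixer A" by (rule stab[OF g])
      have "complex_act (closest_point A) (complex_act g w) = complex_act g (complex_act (closest_point A) w)"
        by (rule complex_act_closest_point_commute[OF isom[OF g(1)] A(1) Ane fixer_image[OF gf]])
      also have "\<dots> = complex_act (closest_point A) w"
        by (rule fixer_complexify[OF A(1) gf complex_act_closest_point_in[OF A(1) Ane]])
      finally show ?thesis by (simp add: F_def)
    qed
  qed
  then obtain f where f: "\<And>b w. w \<in> S \<inter> ball z \<epsilon> \<Longrightarrow> f b (orb w) = F b w" by metis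
  have opU: "openin (top_of Y) U" unfolding U_def by (rule openin_orb_image) simp
  have inD: "w \<in> M \<times> M" "\<tau> w \<in> S \<inter> ball z \<epsilon>" "\<tau> w \<in> complexify A" if "w \<in> D" for w
    using that \<tau>A AS unfolding D_def by blast+
  have "openin (top_of_set (M \<times> M)) D"
    unfolding D_def by (intro openin_open_Int open_vimage cont\<tau> open_ball)
  moreover have "D \<noteq> {}"
  proof -
    have "(0, q) \<in> M \<times> M" using pq subspace_0[OF M] by (simp add: M_def)
    moreover have "\<tau> (0, q) = z" by (simp add: \<tau>_def pq)
    ultimately have "(0, q) \<in> D" using e(1) by (simp add: D_def)
    then show ?thesis by blast
  qed
  moreover have "\<phi> ` D \<subseteq> U \<inter> Z"
  proof
    fix y assume "y \<in> \<phi> ` D"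
    then obtain w where w: "w \<in> D" "y = orb (\<tau> w)" unfolding \<phi>_def by blast
    then show "y \<in> U \<inter> Z" using inD[OF w(1)] Z[of "\<tau> w"] e(2) unfolding U_def by blast
  qed
  moreover have "holomorphic_map_to Y D \<phi>"
    unfolding holomorphic_map_to_def
  proof (intro conjI allI impI)
    have "continuous_map (top_of_set D) (top_of_set S) \<tau>"
      using cont\<tau> inD(2) by (auto simp: continuous_map_in_subtopology)
    moreover have "continuous_map (top_of_set S) (top_of Y) orb"
      unfolding Y_def by (rule quotient_imp_continuous_map[OF quotient_map_orbit_space])
    ultimately have "continuous_map (top_of_set D) (top_of Y) (orb \<circ> \<tau>)" by (rule continuous_map_compose)
    moreover have "orb \<circ> \<tau> = \<phi>" by (simp add: fun_eq_iff \<phi>_def)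
    ultimately show "continuous_map (top_of_set D) (top_of Y) \<phi>" by simp
  next
    fix V h assume Vh: "openin (top_of Y) V \<and> h \<in> regular Y V"
    show "analytic_fun_on {w \<in> D. \<phi> w \<in> V} (h \<circ> \<phi>)"
      unfolding analytic_fun_on_def
    proof
      fix w assume w: "w \<in> {w \<in> D. \<phi> w \<in> V}"
      then have "\<tau> w \<in> {z \<in> S. orb z \<in> V}" using inD(2) unfolding \<phi>_def by blast
      then obtain N H where N: "open N" "\<tau> w \<in> N" "\<forall>v\<in>N. complex_differentiable_at H v"
        "\<forall>v\<in>N \<inter> {z \<in> S. orb z \<in> V}. h (orb v) = H v"
        using Vh unfolding regular_Y analytic_fun_on_def by meson
      show "\<exists>N F. open N \<and> w \<in> N \<and> (\<forall>v\<in>N. complex_differentiable_at F v) \<and> (\<forall>v\<in>N \<inter> {w \<in> D. \<phi> w \<in> V}. (h \<circ> \<phi>) v = F v)"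
      proof (intro exI[of _ "\<tau> -` N"] exI[of _ "\<lambda>v. H (\<tau> v)"] conjI ballI)
        show "open (\<tau> -` N)" by (rule open_vimage[OF N(1) cont\<tau>])
        show "w \<in> \<tau> -` N" using N(2) by simp
        show "complex_differentiable_at (\<lambda>v. H (\<tau> v)) v" if "v \<in> \<tau> -` N" for v
        proof (rule cd_compose[where T = \<tau> and T' = "\<lambda>v. v"])
          show "complex_differentiable_at H (\<tau> v)" using that N(3) by blast
          show "(\<tau> has_derivative (\<lambda>v. v)) (at v)" unfolding \<tau>_def[abs_def] by (auto intro!: derivative_eq_intros)
        qed simp
        show "(h \<circ> \<phi>) v = H (\<tau> v)" if v: "v \<in> \<tau> -` N \<inter> {w \<in> D. \<phi> w \<in> V}" for v
        proof -
          have "\<tau> v \<in> N \<inter> {z \<in> S. orb z \<in> V}" using v inD(2) unfolding \<phi>_def by blast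
          then show ?thesis using N(4) unfolding comp_def \<phi>_def by blast
        qed
      qed
    qed
  qed
  moreover have "f b \<in> regular Y U" for b
    unfolding U_def by (rule regular_orb_image[OF open_ball holF f])
  moreover have "f b (\<phi> (u, v)) = Complex (u \<bullet> b) (v \<bullet> b)" if uv: "(u, v) \<in> D" for b u v
  proof -
    have "complex_act (closest_point A) (\<tau> (u, v)) = \<tau> (u, v)"
      by (rule complex_act_closest_point_self[OF A(1) inD(3)[OF uv]])
    then show ?thesis unfolding \<phi>_def f[OF inD(2)[OF uv]] F_def by (simp add: \<tau>_def cinner_def)
  qed
  ultimately show ?thesis
    unfolding submanifold_dims_def M_def[symmetric] using M opU
    by (intro CollectI exI[of _ M] conjI refl exI[of _ D] exI[of _ \<phi>] exI[of _ U] exI[of _ f]) auto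
qed

lemma countable_G: "countable G"
proof -
  have "G = (\<Union>n::nat. {g \<in> G. dist (g 0) 0 \<le> real n})"
    using real_arch_simple by blast
  moreover have "countable (\<Union>n::nat. {g \<in> G. dist (g 0) 0 \<le> real n})"
    by (intro countable_UN countableI_type countable_finite proper)
  ultimately show ?thesis by simp
qed

lemma countable_\<M>: "countable \<M>"
proof -
  have "\<M> \<subseteq> (\<Union>n::nat. {M \<in> \<M>. \<exists>x\<in>M. dist x 0 \<le> real n})"
  proof
    fix M assume M: "M \<in> \<M>"
    then obtain x where x: "x \<in> M" using M_aff by blast
    obtain n :: nat where "dist x 0 \<le> real n" using real_arch_simple by blast
    then show "M \<in> (\<Union>n::nat. {M \<in> \<M>. \<exists>x\<in>M. dist x 0 \<le> real n})" using M x by blast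
  qed
  moreover have "countable (\<Union>n::nat. {M \<in> \<M>. \<exists>x\<in>M. dist x 0 \<le> real n})"
    by (intro countable_UN countableI_type countable_finite M_fin)
  ultimately show ?thesis by (rule countable_subset)
qed

text \<open>The fixed sets of elements outside the fixer of \<open>A\<close> are affine and do not
  contain \<open>A\<close>. With the given walls they form a countable family, which some real point
  of \<open>A\<close> avoids.\<close>

lemma generic_point:
  assumes A: "affine A" "A \<noteq> {}" and no: "\<And>M. M \<in> \<N> \<Longrightarrow> M \<in> \<M> \<and> \<not> A \<subseteq> M"
  shows "\<exists>z\<in>complexify A. (\<forall>g\<in>G. complex_act g z = z \<longrightarrow> g \<in> fixer A) \<and> (\<forall>M\<in>\<N>. z \<notin> complexify M)"
proof -
  define \<B> where "\<B> = (\<lambda>g. {x. g x = x}) ` (G - fixer A) \<union> \<N>"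
  have "countable \<B>"
    unfolding \<B>_def using countable_G countable_subset[OF _ countable_\<M>, of \<N>] no by auto
  moreover have "affine B \<and> \<not> A \<subseteq> B" if B: "B \<in> \<B>" for B
  proof -
    consider g where "g \<in> G" "g \<notin> fixer A" "B = {x. g x = x}" | "B \<in> \<N>" using B unfolding \<B>_def by blast
    then show ?thesis
    proof cases
      case 1
      have l: "linear (lin g)" using aff[OF 1(1)] by (simp add: affmap_def)
      have gx: "g x = lin g x + g 0" for x by (simp add: lin_def)
      have "affine B"
        unfolding affine_def
      proof (intro ballI allI impI)
        fix x y u v assume xy: "x \<in> B" "y \<in> B" and uv: "u + v = (1::real)"
        have "g (u *\<^sub>R x + v *\<^sub>R y) = u *\<^sub>R lin g x + v *\<^sub>R lin g y + (u + v) *\<^sub>R g 0"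
          using uv by (simp add: gx[of "u *\<^sub>R x + v *\<^sub>R y"] linear_add[OF l] linear_scale[OF l])
        also have "\<dots> = u *\<^sub>R g x + v *\<^sub>R g y" by (simp add: gx[of x] gx[of y] algebra_simps)
        finally show "u *\<^sub>R x + v *\<^sub>R y \<in> B" using xy 1(3) by simp
      qed
      moreover have "\<not> A \<subseteq> B" using 1 unfolding fixer_def by blast
      ultimately show ?thesis by blast
    next
      case 2
      then show ?thesis using no M_aff by blast
    qed
  qed
  moreover obtain p where "p \<in> A" using A(2) by blast
  ultimately have "\<exists>x\<in>A. dist x p < 1 \<and> x \<notin> \<Union>\<B>" by (intro affine_avoid[OF A(1)]) simp_all
  then obtain x where x: "x \<in> A" "x \<notin> \<Union>\<B>" by blast
  show ?thesis
  proof (intro bexI[of _ "(x, 0)"] conjI ballI impI)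
    show "(x, 0) \<in> complexify A" using x subspace_0[OF subspace_direction[OF A]] by (simp add: complexify_iff)
    show "g \<in> fixer A" if g: "g \<in> G" "complex_act g (x, 0) = (x, 0)" for g
    proof (rule ccontr)
      assume "g \<notin> fixer A"
      moreover have "g x = x" using g(2) by (simp add: complex_act_def)
      ultimately have "x \<in> {x. g x = x}" "{x. g x = x} \<in> \<B>" using g(1) unfolding \<B>_def by blast+
      then show False using x(2) by (meson UnionI)
    qed
    show "(x, 0) \<notin> complexify M" if "M \<in> \<N>" for M
    proof
      assume "(x, 0) \<in> complexify M"
      then have "x \<in> M" by (simp add: complexify_iff)
      moreover have "M \<in> \<B>" using that unfolding \<B>_def by (rule UnI2)
      ultimately show False using x(2) by (meson UnionI)
    qed
  qed
qed

lemma wall_subset_eq: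
  assumes "M \<in> \<M>" "M' \<in> \<M>" "M \<subseteq> M'"
  shows "M = M'"
proof -
  have 1: "affine M" "M \<noteq> {}" "affine M'" "dim (direction M) = dim (direction M')" "M' \<noteq> {}"
    using M_aff[OF assms(1)] M_aff[OF assms(2)] by simp_all
  then have "direction M = direction M'"
    using subspace_dim_equal[OF subspace_direction[OF 1(1,2)] subspace_direction[OF 1(3,5)] direction_mono[OF assms(3)]] 1(4) by simp
  then show ?thesis by (rule affine_subset_direction_eq[OF 1(1,3) assms(3) 1(2)])
qed

text \<open>Genericity persists near \<open>z\<close>: by \<open>separation\<close> stabilisers do
  not grow, and only finitely many walls come close. The whole neighbourhood is needed to build a
  chart inside a bad locus.\<close>

lemma generic_wall:
  assumes M: "M \<in> \<M>"
  shows "\<exists>z\<in>complexify M. \<exists>\<delta>>0. \<forall>w\<in>complexify M \<inter> ball z \<delta>.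
    (\<forall>g\<in>G. complex_act g w = w \<longrightarrow> g \<in> fixer M) \<and> (\<forall>M'\<in>\<M>. w \<in> complexify M' \<longrightarrow> M' = M)"
proof -
  have affM: "affine M" "M \<noteq> {}" using M_aff[OF M] by auto
  have no: "M' \<in> \<M> \<and> \<not> M \<subseteq> M'" if "M' \<in> \<M> - {M}" for M' using that wall_subset_eq[OF M] by blast
  have "\<exists>z\<in>complexify M. (\<forall>g\<in>G. complex_act g z = z \<longrightarrow> g \<in> fixer M) \<and> (\<forall>M'\<in>\<M> - {M}. z \<notin> complexify M')"
    by (rule generic_point[OF affM]) (rule no)
  then obtain z where z: "z \<in> complexify M" "\<And>g. g \<in> G \<Longrightarrow> complex_act g z = z \<Longrightarrow> g \<in> fixer M"
    "\<And>M'. M' \<in> \<M> - {M} \<Longrightarrow> z \<notin> complexify M'"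
    by blast
  obtain \<rho> where \<rho>: "\<rho> > 0" "\<And>g w. g \<in> G \<Longrightarrow> w \<in> ball z \<rho> \<Longrightarrow> complex_act g w \<in> ball z \<rho> \<Longrightarrow> complex_act g z = z"
    using separation[of z] by blast
  define \<F> where "\<F> = {M' \<in> \<M>. \<exists>x\<in>M'. dist x (fst z) \<le> 1} - {M}"
  have fin: "finite \<F>" unfolding \<F>_def using M_fin by blast
  have "closed (complexify A)" if "A \<in> \<F>" for A
    using that M_aff by (intro closed_complexify) (auto simp: \<F>_def)
  then have "closed (\<Union>(complexify ` \<F>))" using fin by (intro closed_Union) auto
  moreover have "z \<notin> \<Union>(complexify ` \<F>)" using z(3) unfolding \<F>_def by blast
  ultimately obtain d where d: "d > 0" "ball z d \<inter> \<Union>(complexify ` \<F>) = {}"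
    by (metis Compl_iff disjoint_eq_subset_Compl open_Compl openE)
  show ?thesis
  proof (intro bexI[OF _ z(1)] exI[of _ "min (min \<rho> d) 1"] conjI ballI impI)
    fix w g assume "w \<in> complexify M \<inter> ball z (min (min \<rho> d) 1)" and g: "g \<in> G" "complex_act g w = w"
    then have "w \<in> ball z \<rho>" by simp
    then have "complex_act g z = z" using \<rho>(2)[OF g(1), of w] g(2) by simp
    then show "g \<in> fixer M" by (rule z(2)[OF g(1)])
  next
    fix w M' assume "w \<in> complexify M \<inter> ball z (min (min \<rho> d) 1)" and M': "M' \<in> \<M>" "w \<in> complexify M'"
    then have w: "w \<in> ball z d" "w \<in> ball z 1" by simp_all
    show "M' = M"
    proof (rule ccontr)
      assume ne: "M' \<noteq> M"
      have "fst w \<in> M'" using M'(2) by (simp add: complexify_iff')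
      moreover have "dist (fst w) (fst z) \<le> 1" using w(2) dist_fst_le[of w z] by (simp add: dist_commute)
      ultimately have "M' \<in> \<F>" using M'(1) ne unfolding \<F>_def by blast
      then show False using d(2) w(1) M'(2) by blast
    qed
  next
    show "min (min \<rho> d) 1 > 0" using \<rho>(1) d(1) by simp
  qed
qed

lemma orb_image_S: "orb ` S = orb ` complexify L"
proof
  show "orb ` complexify L \<subseteq> orb ` S" by (rule image_mono[OF complexify_sub_S])
  show "orb ` S \<subseteq> orb ` complexify L"
  proof
  fix y assume "y \<in> orb ` S"
  then obtain g v where "g \<in> G" "v \<in> complexify L" "y = orb (complex_act g v)" unfolding S_def by blast
  then show "y \<in> orb ` complexify L" by simp
  qed
qed

end

section \<open>Normality in codimension one\<close>

context stratum_geometry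
begin

lemma complex_dim_Y: "complex_dim Y (topspace (top_of Y)) = ereal (real (dim (direction L)))"
proof (rule antisym)
  show "complex_dim Y (topspace (top_of Y)) \<le> ereal (real (dim (direction L)))"
    unfolding complex_dim_def
  proof (rule SUP_least)
    fix k assume k: "k \<in> submanifold_dims Y (topspace (top_of Y))"
    have "\<exists>A\<in>{L}. k \<le> dim (direction A)"
      by (rule submanifold_dims_bound[OF k]) (use affL Lne orb_image_S in \<open>auto simp: topspace_Y\<close>)
    then show "ereal (real k) \<le> ereal (real (dim (direction L)))" by simp
  qed
  have "\<exists>z\<in>complexify L. (\<forall>g\<in>G. complex_act g z = z \<longrightarrow> g \<in> fixer L) \<and> (\<forall>M\<in>{}. z \<notin> complexify M)"
    by (rule generic_point[OF affL Lne]) simp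
  then obtain z where z: "z \<in> complexify L" "\<And>g. g \<in> G \<Longrightarrow> complex_act g z = z \<Longrightarrow> g \<in> fixer L"
    by blast
  have "dim (direction L) \<in> submanifold_dims Y (topspace (top_of Y))"
  proof (rule submanifold_dims_flat[OF affL order_refl z(1) _ zero_less_one])
    show "g \<in> fixer L" if "g \<in> G" "complex_act g z = z" for g by (rule z(2)[OF that])
    show "orb w \<in> topspace (top_of Y)" if "w \<in> complexify L \<inter> ball z 1" for w
      unfolding topspace_Y using that complexify_sub_S by blast
  qed
  then show "ereal (real (dim (direction L))) \<le> complex_dim Y (topspace (top_of Y))"
    unfolding complex_dim_def by (rule SUP_upper)
qed

lemma codimension_gt_1_iff:
  "codimension Y Z > 1 \<longleftrightarrow> (\<forall>k\<in>submanifold_dims Y Z. k + 1 < dim (direction L))"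
proof -
  let ?d = "dim (direction L)" and ?K = "submanifold_dims Y Z"
  have cod: "codimension Y Z = ereal (real ?d) - (SUP k\<in>?K. ereal (real k))"
    unfolding codimension_def complex_dim_Y by (simp only: complex_dim_def)
  show ?thesis
  proof (cases "?K = {}")
    case True
    \<comment> \<open>The supremum over the empty set is -\<infinity>, so the codimension is
      \<infinity>.\<close>
    then show ?thesis unfolding cod by (simp add: bot_ereal_def)
  next
    case False
    show ?thesis
    proof
      assume gt: "codimension Y Z > 1"
      show "\<forall>k\<in>?K. k + 1 < ?d"
      proof
        fix k assume k: "k \<in> ?K"
        have "codimension Y Z \<le> ereal (real ?d) - ereal (real k)"
          unfolding cod by (intro ereal_minus_mono order_refl SUP_upper[OF k])
        then have "1 < ereal (real ?d - real k)" unfolding ereal_minus(1) by (rule less_le_trans[OF gt])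
        then show "k + 1 < ?d" by (simp add: one_ereal_def)
      qed
    next
      assume less: "\<forall>k\<in>?K. k + 1 < ?d"
      have "(SUP k\<in>?K. ereal (real k)) \<le> ereal (real ?d - 2)"
      proof (rule SUP_least)
        fix k assume "k \<in> ?K"
        then have "k + 1 < ?d" using less by blast
        then show "ereal (real k) \<le> ereal (real ?d - 2)" by simp
      qed
      then have "ereal (real ?d) - ereal (real ?d - 2) \<le> codimension Y Z"
        unfolding cod by (intro ereal_minus_mono order_refl)
      then have "2 \<le> codimension Y Z" by simp
      moreover have "(1::ereal) < 2" by simp
      ultimately show "codimension Y Z > 1" by (rule less_le_trans[rotated])
    qed
  qed
qed

text \<open>Off the walls, and at points on exactly one wall, the local results give
  normality.\<close>

lemma two_walls:
  assumes z: "z \<in> complexify L" and n: "\<not> normal_at Y (orb z)"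
    and good: "\<And>M. M \<in> \<M> \<Longrightarrow> single_orbit M \<and> reflects M"
  shows "\<exists>M\<in>\<M>. \<exists>M'\<in>\<M>. M \<noteq> M' \<and> z \<in> complexify (M \<inter> M')"
proof -
  obtain M where M: "M \<in> \<M>" "z \<in> complexify M" using normal_off_walls[OF z] n by blast
  have "\<exists>M'. M' \<in> \<M> \<and> z \<in> complexify M' \<and> M' \<noteq> M"
  proof (rule ccontr)
    assume neg: "\<not> ?thesis"
    then have only: "M' = M" if "M' \<in> \<M>" "z \<in> complexify M'" for M' using that by blast
    have "normal_at Y (orb z)"
      by (rule normal_on_wall[OF M]) (use only good[OF M(1)] in blast)+
    then show False using n by blast
  qed
  then obtain M' where M': "M' \<in> \<M>" "z \<in> complexify M'" "M' \<noteq> M" by blast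
  have aff: "affine M" "affine M'" using M_aff M M' by blast+
  have "fst z \<in> M \<inter> M'" "snd z \<in> direction M \<inter> direction M'" using M(2) M'(2) by (simp_all add: complexify_iff')
  then have "z \<in> complexify (M \<inter> M')" using direction_Int[OF aff] by (simp add: complexify_iff')
  then have MM': "M \<noteq> M' \<and> z \<in> complexify (M \<inter> M')" using M'(3) by simp
  show ?thesis
    by (rule bexI[OF _ M(1)], rule bexI[OF _ M'(1)], rule MM')
qed

text \<open>If normality fails, or branches multiply, along an open piece of a wall, the bad locus
  contains a submanifold of dimension \<open>dim (direction L) - 1\<close>. Conversely, when all
  walls are good, the non-normal locus lies over intersections of two distinct walls.\<close>

theorem normal_in_codim_1_iff:
  "normal_in_codim_1 Y \<longleftrightarrow> unibranch_in_codim_1 Y \<and> (\<forall>M\<in>\<M>. reflects M)"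
proof
  assume n: "normal_in_codim_1 Y"
  let ?N = "{x \<in> topspace (top_of Y). \<not> normal_at Y x}" and ?B = "{x \<in> topspace (top_of Y). \<not> unibranch_at Y x}"
  have n': "\<And>k. k \<in> submanifold_dims Y ?N \<Longrightarrow> k + 1 < dim (direction L)"
    by (rule bspec[OF n[unfolded normal_in_codim_1_def codimension_gt_1_iff]])
  have BN: "?B \<subseteq> ?N"
  proof
    fix x assume x: "x \<in> ?B"
    then obtain z where "z \<in> S" "x = orb z" unfolding topspace_Y by blast
    then show "x \<in> ?N" using x normal_imp_unibranch[of z] by blast
  qed
  have "unibranch_in_codim_1 Y"
    unfolding unibranch_in_codim_1_def codimension_gt_1_iff
    by (intro ballI n' subsetD[OF submanifold_dims_mono[OF BN]])
  moreover have "reflects M" if M: "M \<in> \<M>" for M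
  proof -
    have affM: "affine M" "M \<subseteq> L" "dim (direction L) = dim (direction M) + 1" using M_aff[OF M] by auto
    obtain z \<delta> where z: "z \<in> complexify M" "\<delta> > 0"
      and all: "\<forall>w\<in>complexify M \<inter> ball z \<delta>.
        (\<forall>g\<in>G. complex_act g w = w \<longrightarrow> g \<in> fixer M) \<and> (\<forall>M'\<in>\<M>. w \<in> complexify M' \<longrightarrow> M' = M)"
      using generic_wall[OF M] by (elim bexE exE conjE)
    have z3: "g \<in> fixer M" if "w \<in> complexify M \<inter> ball z \<delta>" "g \<in> G" "complex_act g w = w" for w g
      using bspec[OF all that(1)] that(2,3) by blast
    have z4: "M' = M" if "w \<in> complexify M \<inter> ball z \<delta>" "M' \<in> \<M>" "w \<in> complexify M'" for w M'
      using bspec[OF all that(1)] that(2,3) by blast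
    have zb: "z \<in> complexify M \<inter> ball z \<delta>" using z(1,2) by simp
    \<comment> \<open>Otherwise the generic piece of \<open>M\<close> would be a chart of
      codimension one inside the non-normal locus.\<close>
    have "\<exists>w\<in>complexify M \<inter> ball z \<delta>. normal_at Y (orb w)"
    proof (rule ccontr)
      assume non: "\<not> ?thesis"
      have "dim (direction M) \<in> submanifold_dims Y ?N"
      proof (rule submanifold_dims_flat[OF affM(1,2) z(1) z3[OF zb] z(2)])
        fix w assume w: "w \<in> complexify M \<inter> ball z \<delta>"
        then have "w \<in> S" using complexify_mono[OF affM(2)] complexify_sub_S by blast
        then show "orb w \<in> ?N" using non w unfolding topspace_Y by blast
      qed
      then show False using n' affM(3) by fastforce
    qed
    then obtain w where w: "w \<in> complexify M \<inter> ball z \<delta>" "normal_at Y (orb w)" by blast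
    have wM: "w \<in> complexify M" using w(1) by blast
    show ?thesis
    proof (rule normal_reflects[OF M wM])
      show "M' = M" if "M' \<in> \<M>" "w \<in> complexify M'" for M' by (rule z4[OF w(1) that])
      show "g \<in> fixer M" if "g \<in> G" "complex_act g w = w" for g by (rule z3[OF w(1) that])
      show "integrally_closed_domain (R w)" using w(2) by (simp add: normal_at_def)
    qed
  qed
  ultimately show "unibranch_in_codim_1 Y \<and> (\<forall>M\<in>\<M>. reflects M)" by blast
next
  assume u: "unibranch_in_codim_1 Y \<and> (\<forall>M\<in>\<M>. reflects M)"
  let ?N = "{x \<in> topspace (top_of Y). \<not> normal_at Y x}" and ?B = "{x \<in> topspace (top_of Y). \<not> unibranch_at Y x}"
  have u': "\<And>k. k \<in> submanifold_dims Y ?B \<Longrightarrow> k + 1 < dim (direction L)"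
    by (rule bspec[OF conjunct1[OF u, unfolded unibranch_in_codim_1_def codimension_gt_1_iff]])
  \<comment> \<open>A wall with several orbits of branches gives a piece of codimension one on which
    the stalks are not domains.\<close>
  have so: "single_orbit M" if M: "M \<in> \<M>" for M
  proof (rule ccontr)
    assume nso: "\<not> single_orbit M"
    have affM: "affine M" "M \<subseteq> L" "dim (direction L) = dim (direction M) + 1" using M_aff[OF M] by auto
    obtain z \<delta> where z: "z \<in> complexify M" "\<delta> > 0"
      and all: "\<forall>w\<in>complexify M \<inter> ball z \<delta>.
        (\<forall>g\<in>G. complex_act g w = w \<longrightarrow> g \<in> fixer M) \<and> (\<forall>M'\<in>\<M>. w \<in> complexify M' \<longrightarrow> M' = M)"
      using generic_wall[OF M] by (elim bexE exE conjE)
    have z3: "g \<in> fixer M" if "w \<in> complexify M \<inter> ball z \<delta>" "g \<in> G" "complex_act g w = w" for w g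
      using bspec[OF all that(1)] that(2,3) by blast
    have z4: "M' = M" if "w \<in> complexify M \<inter> ball z \<delta>" "M' \<in> \<M>" "w \<in> complexify M'" for w M'
      using bspec[OF all that(1)] that(2,3) by blast
    have zb: "z \<in> complexify M \<inter> ball z \<delta>" using z(1,2) by simp
    have "dim (direction M) \<in> submanifold_dims Y ?B"
    proof (rule submanifold_dims_flat[OF affM(1,2) z(1) z3[OF zb] z(2)])
      fix w assume w: "w \<in> complexify M \<inter> ball z \<delta>"
      then have wS: "w \<in> S" and wM: "w \<in> complexify M" using complexify_mono[OF affM(2)] complexify_sub_S by blast+
      have "\<not> domain (R w)"
      proof
        assume "domain (R w)"
        have "single_orbit M"
        proof (rule domain_single_orbit[OF M wM])
          show "M' = M" if "M' \<in> \<M>" "w \<in> complexify M'" for M' by (rule z4[OF w that])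
          show "g \<in> fixer M" if "g \<in> G" "complex_act g w = w" for g by (rule z3[OF w that])
        qed fact
        then show False using nso by blast
      qed
      then have "\<not> unibranch_at Y (orb w)" unfolding unibranch_at_def unibranch_ring_def by blast
      then show "orb w \<in> ?B" using wS unfolding topspace_Y by blast
    qed
    then show False using u' affM(3) by fastforce
  qed
  \<comment> \<open>Walls have equal dimension, so intersecting two distinct ones lowers the
    dimension again.\<close>
  define \<A> where "\<A> = {A. \<exists>M\<in>\<M>. \<exists>M'\<in>\<M>. M \<noteq> M' \<and> A = M \<inter> M' \<and> A \<noteq> {}}"
  have A: "affine A \<and> A \<noteq> {} \<and> A \<subseteq> L \<and> dim (direction A) + 1 < dim (direction L)" if "A \<in> \<A>" for A
  proof -
    obtain M M' where M: "M \<in> \<M>" "M' \<in> \<M>" "M \<noteq> M'" "A = M \<inter> M'" "A \<noteq> {}" using \<open>A \<in> \<A>\<close> unfolding \<A>_def by blast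
    have aff: "affine M" "affine M'" "M \<subseteq> L" "M \<noteq> {}" "dim (direction L) = dim (direction M) + 1" using M_aff M by blast+
    have aA: "affine A" using aff M(4) by (simp add: affine_Int)
    have "A \<noteq> M" using M wall_subset_eq[OF M(1,2)] by blast
    then have ne: "direction A \<noteq> direction M"
      using affine_subset_direction_eq[OF aA aff(1) _ M(5)] M(4) by blast
    have "direction A \<subseteq> direction M" using M(4) by (intro direction_mono) blast
    then have "dim (direction A) < dim (direction M)"
      using ne subspace_dim_equal[OF subspace_direction[OF aA M(5)] subspace_direction[OF aff(1,4)]] by fastforce
    then show ?thesis using aA M(4,5) aff(3,5) by auto
  qed
  have "countable \<A>"
  proof (rule countable_subset)
    show "\<A> \<subseteq> (\<lambda>(M, M'). M \<inter> M') ` (\<M> \<times> \<M>)" unfolding \<A>_def by force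
  qed (use countable_\<M> in auto)
  moreover have "?N \<subseteq> orb ` (\<Union>A\<in>\<A>. complexify A)"
  proof
    fix x assume "x \<in> ?N"
    then obtain z where z: "z \<in> complexify L" "x = orb z" "\<not> normal_at Y (orb z)"
      unfolding topspace_Y orb_image_S by blast
    obtain M M' where "M \<in> \<M>" "M' \<in> \<M>" "M \<noteq> M'" "z \<in> complexify (M \<inter> M')"
      using two_walls[OF z(1,3)] so u by blast
    moreover have "M \<inter> M' \<noteq> {}" using \<open>z \<in> complexify (M \<inter> M')\<close> by (auto simp: complexify_iff')
    ultimately show "x \<in> orb ` (\<Union>A\<in>\<A>. complexify A)" using z(2) unfolding \<A>_def by blast
  qed
  ultimately have "\<exists>A\<in>\<A>. k \<le> dim (direction A)" if "k \<in> submanifold_dims Y ?N" for k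
    using submanifold_dims_bound[OF that] A by blast
  then have "\<forall>k\<in>submanifold_dims Y ?N. k + 1 < dim (direction L)" using A by fastforce
  then show "normal_in_codim_1 Y" unfolding normal_in_codim_1_def codimension_gt_1_iff .
qed

end

subsection \<open>Hyperplanes and reflections\<close>

lemma affine_subset_eq:
  assumes "affine A" "affine B" "A \<noteq> {}" "A \<subseteq> B" "aff_dim A = aff_dim B"
  shows "A = B"
proof (rule ccontr)
  assume "A \<noteq> B"
  then have "affine hull A \<subset> affine hull B" using assms(1,2,4) by (simp add: affine_hull_eq[THEN iffD2] psubset_eq)
  then have "aff_dim A < aff_dim B" by (rule aff_dim_psubset)
  then show False using assms(5) by simp
qed

lemma aff_dim_isom_image:
  assumes "isom g" "affine A" "A \<noteq> {}"
  shows "aff_dim (g ` A) = aff_dim A"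
proof -
  have af: "affmap g" by (rule isom_affmap[OF assms(1)])
  have "dim (direction (g ` A)) = dim (direction A)"
    unfolding direction_image[OF af]
    using isom_lin[OF assms(1)] orthogonal_transformation_linear orthogonal_transformation_inj
    by (intro dim_image_eq) (auto intro: inj_on_subset)
  then show ?thesis using aff_dim_direction[OF affine_image[OF af assms(2)]] aff_dim_direction[OF assms(2,3)] assms(3) by simp
qed

locale euclidean_subspace =
  fixes E :: "'a::euclidean_space set"
  assumes affE: "affine E" and Ene: "E \<noteq> {}"
begin

lemma hyperplane_normal:
  assumes "hyperplane_in E H"
  shows "\<exists>n. extends_by H E n"
proof -
  have H: "affine H" "H \<noteq> {}" "H \<subseteq> E" "aff_dim H = aff_dim E - 1" using assms unfolding hyperplane_in_def by auto
  have "int (dim (direction E)) = int (dim (direction H) + 1)"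
    using aff_dim_direction[OF H(1,2)] aff_dim_direction[OF affE Ene] H(4) by simp
  then show ?thesis by (intro extends_by_exists[OF H(1,2) affE H(3)]) linarith
qed

lemma extends_by_point:
  assumes "extends_by H E n" "p \<in> H" "x \<in> E"
  shows "x - closest_point H x = ((x - p) \<bullet> n) *\<^sub>R n"
proof -
  have H: "affine H" "H \<noteq> {}" "H \<subseteq> E" "\<And>m. m \<in> direction H \<Longrightarrow> n \<bullet> m = 0" using assms unfolding extends_by_def by blast+
  have cp: "closest_point H x \<in> H" by (rule closest_point_affine_in[OF H(1,2)])
  have "x - closest_point H x \<in> direction E" using cp assms(3) H(3) by (intro direction_diff) auto
  then have 1: "x - closest_point H x = ((x - closest_point H x) \<bullet> n) *\<^sub>R n"
    by (rule extends_by_normal[OF assms(1)]) (rule closest_point_orthogonal[OF H(1,2)])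
  have "n \<bullet> (closest_point H x - p) = 0" by (rule H(4)[OF direction_diff[OF cp assms(2)]])
  then have "(x - closest_point H x) \<bullet> n = (x - p) \<bullet> n" by (simp add: inner_diff_left inner_diff_right inner_commute)
  then show ?thesis using 1 by simp
qed

lemma hyperplane_iff:
  assumes "extends_by H E n" "p \<in> H" "x \<in> E"
  shows "x \<in> H \<longleftrightarrow> (x - p) \<bullet> n = 0"
proof -
  have H: "affine H" "H \<noteq> {}" "norm n = 1" using assms unfolding extends_by_def by blast+
  have n: "n \<noteq> 0" using H(3) by auto
  show ?thesis
    using extends_by_point[OF assms] closest_point_self[of x H] closest_point_affine_in[OF H(1,2), of x] n
    by (metis eq_iff_diff_eq_0 scaleR_eq_0_iff)
qed

abbreviation rf :: "'a set \<Rightarrow> 'a \<Rightarrow> 'a"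
  where "rf \<equiv> reflection E"

lemma rf_eq: "x \<in> E \<Longrightarrow> rf H x = 2 *\<^sub>R closest_point H x - x"
  by (simp add: reflection_def)

lemma rf_normal:
  assumes "extends_by H E n" "p \<in> H" "x \<in> E"
  shows "rf H x = x - (2 * ((x - p) \<bullet> n)) *\<^sub>R n"
proof -
  have "rf H x = x - 2 *\<^sub>R (x - closest_point H x)" using assms(3) by (simp add: rf_eq scaleR_2 algebra_simps)
  then show ?thesis unfolding extends_by_point[OF assms] by simp
qed

lemma rf_in:
  assumes "hyperplane_in E H" "x \<in> E"
  shows "rf H x \<in> E"
proof -
  have H: "closest_point H x \<in> E" using assms closest_point_affine_in unfolding hyperplane_in_def by blast
  have "2 *\<^sub>R closest_point H x + (- 1) *\<^sub>R x \<in> E"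
    using mem_affine[OF affE H assms(2), of 2 "-1"] by simp
  then show ?thesis using assms(2) by (simp add: rf_eq)
qed

lemma rf_rf:
  assumes "hyperplane_in E H" "x \<in> E"
  shows "rf H (rf H x) = x"
proof -
  obtain n where n: "extends_by H E n" using hyperplane_normal[OF assms(1)] by blast
  obtain p where p: "p \<in> H" using assms(1) unfolding hyperplane_in_def by blast
  have nn: "n \<bullet> n = 1" using n unfolding extends_by_def by (simp add: dot_square_norm)
  let ?c = "(x - p) \<bullet> n"
  have "(rf H x - p) \<bullet> n = ?c - 2 * ?c * (n \<bullet> n)"
    unfolding rf_normal[OF n p assms(2)] by (simp add: inner_diff_left)
  then have "(rf H x - p) \<bullet> n = - ?c" using nn by simp
  then show ?thesis
    using rf_normal[OF n p rf_in[OF assms]] rf_normal[OF n p assms(2)] by simp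
qed

lemma rf_dist:
  assumes "hyperplane_in E H" "x \<in> E" "y \<in> E"
  shows "dist (rf H x) (rf H y) = dist x y"
proof -
  obtain n where n: "extends_by H E n" using hyperplane_normal[OF assms(1)] by blast
  obtain p where p: "p \<in> H" using assms(1) unfolding hyperplane_in_def by blast
  have nn: "n \<bullet> n = 1" using n unfolding extends_by_def by (simp add: dot_square_norm)
  let ?d = "x - y"
  have "rf H x - rf H y = ?d - (2 * (?d \<bullet> n)) *\<^sub>R n"
    unfolding rf_normal[OF n p assms(2)] rf_normal[OF n p assms(3)] by (simp add: inner_diff_left algebra_simps)
  moreover have "(?d - (2 * (?d \<bullet> n)) *\<^sub>R n) \<bullet> (?d - (2 * (?d \<bullet> n)) *\<^sub>R n) = ?d \<bullet> ?d"
    using nn by (simp add: inner_diff_left inner_diff_right inner_commute power2_eq_square)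
  ultimately have "(norm (rf H x - rf H y))\<^sup>2 = (norm ?d)\<^sup>2" by (simp only: power2_norm_eq_inner)
  then show ?thesis unfolding dist_norm by simp
qed

lemma rf_fix: "hyperplane_in E H \<Longrightarrow> x \<in> E \<Longrightarrow> rf H x = x \<longleftrightarrow> x \<in> H"
proof -
  assume H: "hyperplane_in E H" and x: "x \<in> E"
  have aH: "affine H" "H \<noteq> {}" using H unfolding hyperplane_in_def by auto
  have "rf H x = x \<longleftrightarrow> 2 *\<^sub>R closest_point H x = 2 *\<^sub>R x" using x by (auto simp: rf_eq scaleR_2 algebra_simps)
  also have "\<dots> \<longleftrightarrow> closest_point H x = x" by simp
  also have "\<dots> \<longleftrightarrow> x \<in> H" using closest_point_self[of x H] closest_point_affine_in[OF aH, of x] by metis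
  finally show ?thesis .
qed

text \<open>With \<open>c\<close> and \<open>d\<close> the signed distances of \<open>x\<close> and
  \<open>a\<close> from \<open>H\<close>, the squared distance changes by \<open>4 c d\<close>,
  which is negative when the points lie strictly on opposite sides.\<close>

lemma rf_closer:
  assumes "extends_by H E n" "p \<in> H" "x \<in> E" "((x - p) \<bullet> n) * ((a - p) \<bullet> n) < 0"
  shows "dist (rf H x) a < dist x a"
proof -
  have nn: "n \<bullet> n = 1" using assms(1) unfolding extends_by_def by (simp add: dot_square_norm)
  let ?c = "(x - p) \<bullet> n" and ?d = "(a - p) \<bullet> n"
  have cd: "(x - a) \<bullet> n = ?c - ?d" by (simp add: inner_diff_left)
  have sq: "(u - (2 * c) *\<^sub>R n) \<bullet> (u - (2 * c) *\<^sub>R n) = u \<bullet> u - 4 * c * (u \<bullet> n) + 4 * c * c" for u c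
    using nn by (simp add: inner_diff_left inner_diff_right inner_commute algebra_simps)
  have "rf H x - a = (x - a) - (2 * ?c) *\<^sub>R n" unfolding rf_normal[OF assms(1-3)] by simp
  then have "(norm (rf H x - a))\<^sup>2 = (x - a) \<bullet> (x - a) - 4 * ?c * ((x - a) \<bullet> n) + 4 * ?c * ?c"
    unfolding power2_norm_eq_inner by (simp only: sq)
  also have "\<dots> = (norm (x - a))\<^sup>2 + 4 * (?c * ?d)"
    unfolding cd power2_norm_eq_inner by (simp add: algebra_simps)
  finally have "(norm (rf H x - a))\<^sup>2 < (norm (x - a))\<^sup>2" using assms(4) by linarith
  then show ?thesis unfolding dist_norm by (rule power2_less_imp_less) simp
qed

lemma rf_Bij:
  assumes "hyperplane_in E H"
  shows "rf H \<in> Bij E"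
proof -
  have "bij_betw (rf H) E E"
    by (rule bij_betw_byWitness[of _ "rf H"]) (use rf_rf[OF assms] rf_in[OF assms] in auto)
  then show ?thesis by (simp add: Bij_def reflection_def extensional_def)
qed

lemma rf_image_image: "hyperplane_in E H \<Longrightarrow> A \<subseteq> E \<Longrightarrow> rf H ` (rf H ` A) = A"
  using rf_rf[of H] by (force simp: image_image subset_iff)

subsection \<open>Groups of bijections\<close>

lemma BijGroup_simps:
  "carrier (BijGroup E) = Bij E"
  "g \<in> Bij E \<Longrightarrow> h \<in> Bij E \<Longrightarrow> x \<in> E \<Longrightarrow> (g \<otimes>\<^bsub>BijGroup E\<^esub> h) x = g (h x)"
  "x \<in> E \<Longrightarrow> \<one>\<^bsub>BijGroup E\<^esub> x = x"
  by (simp_all add: BijGroup_def compose_def)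

lemma Bij_image: "g \<in> Bij E \<Longrightarrow> g ` E = E"
  by (simp add: Bij_def bij_betw_def)

lemma Bij_in: "g \<in> Bij E \<Longrightarrow> x \<in> E \<Longrightarrow> g x \<in> E"
  using Bij_image by blast

lemma Bij_eqI: "g \<in> Bij E \<Longrightarrow> h \<in> Bij E \<Longrightarrow> (\<And>x. x \<in> E \<Longrightarrow> g x = h x) \<Longrightarrow> g = h"
  by (auto simp: Bij_def intro: extensionalityI)

lemma Bij_mult_image:
  "g \<in> Bij E \<Longrightarrow> h \<in> Bij E \<Longrightarrow> A \<subseteq> E \<Longrightarrow> (g \<otimes>\<^bsub>BijGroup E\<^esub> h) ` A = g ` (h ` A)"
  using BijGroup_simps(2)[of g h] by (force simp: image_image subset_iff)

lemma rf_inv: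
  assumes "hyperplane_in E H"
  shows "inv\<^bsub>BijGroup E\<^esub> (rf H) = rf H"
proof -
  interpret B: group "BijGroup E" by (rule group_BijGroup)
  have s: "rf H \<in> Bij E" by (rule rf_Bij[OF assms])
  have "rf H \<otimes>\<^bsub>BijGroup E\<^esub> rf H \<in> Bij E" using B.m_closed[of "rf H" "rf H"] s by (simp add: BijGroup_simps(1))
  moreover have "\<one>\<^bsub>BijGroup E\<^esub> \<in> Bij E" using B.one_closed by (simp add: BijGroup_simps(1))
  ultimately have "rf H \<otimes>\<^bsub>BijGroup E\<^esub> rf H = \<one>\<^bsub>BijGroup E\<^esub>"
    by (rule Bij_eqI) (simp add: BijGroup_simps s rf_rf[OF assms])
  then show ?thesis using s by (intro B.inv_equality) (simp_all add: BijGroup_simps)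
qed

text \<open>An isometry of \<open>E\<close> extended to the ambient space by the identity on the normal directions.\<close>

definition amb :: "('a \<Rightarrow> 'a) \<Rightarrow> 'a \<Rightarrow> 'a"
  where "amb g x = g (closest_point E x) + (x - closest_point E x)"

lemma amb_E: "x \<in> E \<Longrightarrow> amb g x = g x"
  by (simp add: amb_def closest_point_self)

lemma amb_image: "A \<subseteq> E \<Longrightarrow> amb g ` A = g ` A"
  using amb_E by (intro image_cong) auto

lemma closest_amb:
  assumes "g \<in> Bij E"
  shows "closest_point E (amb g x) = g (closest_point E x)"
proof (rule closest_point_affineI[OF affE])
  show "g (closest_point E x) \<in> E" using Bij_in[OF assms] closest_point_affine_in[OF affE Ene] by blast
  show "(amb g x - g (closest_point E x)) \<bullet> v = 0" if "v \<in> direction E" for v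
    using closest_point_orthogonal[OF affE Ene that, of x] by (simp add: amb_def)
qed

lemma amb_mult:
  assumes "g \<in> Bij E" "h \<in> Bij E"
  shows "amb (g \<otimes>\<^bsub>BijGroup E\<^esub> h) = amb g \<circ> amb h"
proof
  fix x
  have c: "closest_point E x \<in> E" by (rule closest_point_affine_in[OF affE Ene])
  have "amb g (amb h x) = g (h (closest_point E x)) + (amb h x - h (closest_point E x))"
    unfolding amb_def[of g] closest_amb[OF assms(2)] ..
  then show "amb (g \<otimes>\<^bsub>BijGroup E\<^esub> h) x = (amb g \<circ> amb h) x"
    using BijGroup_simps(2)[OF assms c] by (simp add: amb_def)
qed

lemma amb_one: "amb \<one>\<^bsub>BijGroup E\<^esub> = (\<lambda>x. x)"
  using closest_point_affine_in[OF affE Ene] BijGroup_simps(3) by (simp add: amb_def fun_eq_iff)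

lemma amb_isom:
  assumes g: "g \<in> Bij E" and d: "\<And>x y. x \<in> E \<Longrightarrow> y \<in> E \<Longrightarrow> dist (g x) (g y) = dist x y"
  shows "isom (amb g)"
  unfolding isom_def
proof (intro allI)
  fix x y
  let ?c = "closest_point E"
  have c: "?c x \<in> E" "?c y \<in> E" using closest_point_affine_in[OF affE Ene] by blast+
  define u where "u = (x - ?c x) - (y - ?c y)"
  have u: "u \<bullet> v = 0" if "v \<in> direction E" for v
    using closest_point_orthogonal[OF affE Ene that] by (simp add: u_def inner_diff_left[of "x - ?c x"])
  have 1: "amb g x - amb g y = (g (?c x) - g (?c y)) + u" by (simp add: amb_def u_def)
  have 2: "x - y = (?c x - ?c y) + u" by (simp add: u_def)
  have "(g (?c x) - g (?c y)) \<bullet> u = 0" "(?c x - ?c y) \<bullet> u = 0"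
    using u[OF direction_diff[OF Bij_in[OF g c(1)] Bij_in[OF g c(2)]]] u[OF direction_diff[OF c]] by (simp_all add: inner_commute)
  then have "(norm (amb g x - amb g y))\<^sup>2 = (norm (g (?c x) - g (?c y)))\<^sup>2 + (norm u)\<^sup>2"
    "(norm (x - y))\<^sup>2 = (norm (?c x - ?c y))\<^sup>2 + (norm u)\<^sup>2"
    unfolding 1 2 by (auto simp: orthogonal_def intro: norm_add_Pythagorean)
  moreover have "norm (g (?c x) - g (?c y)) = norm (?c x - ?c y)" using d[OF c] by (simp add: dist_norm)
  ultimately have "(norm (amb g x - amb g y))\<^sup>2 = (norm (x - y))\<^sup>2" by simp
  then show "dist (amb g x) (amb g y) = dist x y" unfolding dist_norm by simp
qed

lemma lin_amb:
  assumes "g \<in> Bij E" "isom (amb g)" "v \<in> direction E"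
  shows "lin (amb g) v \<in> direction E"
proof -
  have "lin (amb g) ` direction E = direction (amb g ` E)" by (rule direction_image[OF isom_affmap[OF assms(2)], symmetric])
  also have "amb g ` E = E" using amb_image[of E g] Bij_image[OF assms(1)] by simp
  finally show ?thesis using assms(3) by blast
qed

end

section \<open>Admissible arrangements and local finiteness\<close>

locale arrangement = euclidean_subspace E for E :: "'a::euclidean_space set" +
  fixes \<H> :: "'a set set"
  assumes adm: "admissible_arrangement E \<H>"
begin

lemma hyp: "H \<in> \<H> \<Longrightarrow> hyperplane_in E H"
  using adm unfolding admissible_arrangement_def by blast

lemma hypD: "H \<in> \<H> \<Longrightarrow> affine H" "H \<in> \<H> \<Longrightarrow> H \<noteq> {}" "H \<in> \<H> \<Longrightarrow> H \<subseteq> E" "H \<in> \<H> \<Longrightarrow> aff_dim H = aff_dim E - 1"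
  using hyp unfolding hyperplane_in_def by blast+

definition W :: "('a \<Rightarrow> 'a) set"
  where "W = reflection_group E \<H>"

lemma W_subgroup: "subgroup W (BijGroup E)"
  unfolding W_def reflection_group_def
  using rf_Bij[OF hyp] by (intro group.generate_is_subgroup[OF group_BijGroup]) (auto simp: BijGroup_simps)

lemma rf_W: "H \<in> \<H> \<Longrightarrow> rf H \<in> W"
  unfolding W_def reflection_group_def by (intro generate.incl) blast

lemma W_Bij: "g \<in> W \<Longrightarrow> g \<in> Bij E"
  using subgroup.subset[OF W_subgroup] by (auto simp: BijGroup_simps)

lemma W_pres: "g \<in> W \<Longrightarrow> H \<in> \<H> \<Longrightarrow> g ` H \<in> \<H>"
  using adm unfolding admissible_arrangement_def W_def by blast

lemma W_induct [consumes 1, case_names one refl mult]: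
  assumes "g \<in> W" and "P \<one>\<^bsub>BijGroup E\<^esub>" and r: "\<And>H. H \<in> \<H> \<Longrightarrow> P (rf H)"
    and "\<And>g h. g \<in> W \<Longrightarrow> h \<in> W \<Longrightarrow> P g \<Longrightarrow> P h \<Longrightarrow> P (g \<otimes>\<^bsub>BijGroup E\<^esub> h)"
  shows "P g"
  using assms(1) unfolding W_def reflection_group_def
proof (induction rule: generate.induct)
  case (inv h)
  then show ?case using r rf_inv[OF hyp] by auto
next
  case (eng h1 h2)
  then show ?case using assms(4) unfolding W_def reflection_group_def by blast
qed (use assms in auto)

text \<open>The preimage of a compact product under the proper action map is compact, and its
  projection to the discrete group is compact, hence finite.\<close>

lemma W_finite: "finite {g \<in> W. \<exists>x\<in>E. dist x p \<le> r \<and> dist (g x) p \<le> r}"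
proof -
  let ?D = "discrete_topology W" and ?E = "top_of_set E"
  define C where "C = cball p r \<inter> E"
  have "compact C" unfolding C_def by (intro compact_Int_closed compact_cball affine_closed affE)
  then have "compactin ?E C" by (simp add: compactin_subtopology C_def)
  then have cc: "compactin (prod_topology ?E ?E) (C \<times> C)" unfolding compactin_Times by blast
  have pm: "proper_map (prod_topology ?D ?E) (prod_topology ?E ?E) (\<lambda>(g, x). (g x, x))"
    using adm unfolding admissible_arrangement_def acts_properly_def W_def by blast
  define K where "K = {z \<in> topspace (prod_topology ?D ?E). (\<lambda>(g, x). (g x, x)) z \<in> C \<times> C}"
  have "compactin (prod_topology ?D ?E) K"
    unfolding K_def by (rule compactin_proper_map_preimage[OF pm cc])
  then have "compactin ?D (fst ` K)"
    by (rule image_compactin[OF _ continuous_map_fst])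
  then have "finite (fst ` K)" by (simp add: compactin_discrete_topology)
  moreover have "{g \<in> W. \<exists>x\<in>E. dist x p \<le> r \<and> dist (g x) p \<le> r} \<subseteq> fst ` K"
  proof
    fix g assume "g \<in> {g \<in> W. \<exists>x\<in>E. dist x p \<le> r \<and> dist (g x) p \<le> r}"
    then obtain x where x: "g \<in> W" "x \<in> E" "dist x p \<le> r" "dist (g x) p \<le> r" by blast
    then have "(g, x) \<in> K" using Bij_in[OF W_Bij[OF x(1)] x(2)] by (simp add: K_def C_def dist_commute)
    then show "g \<in> fst ` K" by (rule rev_image_eqI) simp
  qed
  ultimately show ?thesis by (rule rev_finite_subset)
qed

text \<open>A hyperplane is the fixed set of its reflection, and a reflection in a hyperplane
  meeting the ball fixes a point of the ball.\<close>

lemma locally_finite: "finite {H \<in> \<H>. \<exists>x\<in>H. dist x p \<le> r}"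
proof (rule inj_on_finite[OF _ _ W_finite[of p r]])
  show "inj_on rf {H \<in> \<H>. \<exists>x\<in>H. dist x p \<le> r}"
  proof (rule inj_onI)
    fix H H' assume H: "H \<in> {H \<in> \<H>. \<exists>x\<in>H. dist x p \<le> r}" "H' \<in> {H \<in> \<H>. \<exists>x\<in>H. dist x p \<le> r}" and eq: "rf H = rf H'"
    have "x \<in> H \<longleftrightarrow> x \<in> H'" if "x \<in> E" for x
      using rf_fix[OF hyp that, of H] rf_fix[OF hyp that, of H'] H eq by auto
    then show "H = H'" using H hypD(3) by blast
  qed
  show "rf ` {H \<in> \<H>. \<exists>x\<in>H. dist x p \<le> r} \<subseteq> {g \<in> W. \<exists>x\<in>E. dist x p \<le> r \<and> dist (g x) p \<le> r}"
  proof
    fix g assume "g \<in> rf ` {H \<in> \<H>. \<exists>x\<in>H. dist x p \<le> r}"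
    then obtain H x where H: "H \<in> \<H>" "x \<in> H" "dist x p \<le> r" "g = rf H" by blast
    have "x \<in> E" using H hypD(3) by blast
    moreover have "rf H x = x" using rf_fix[OF hyp[OF H(1)] \<open>x \<in> E\<close>] H(2) by simp
    ultimately show "g \<in> {g \<in> W. \<exists>x\<in>E. dist x p \<le> r \<and> dist (g x) p \<le> r}" using rf_W[OF H(1)] H by auto
  qed
qed

lemma countable_\<H>: "countable \<H>"
proof -
  have "\<H> \<subseteq> (\<Union>n::nat. {H \<in> \<H>. \<exists>x\<in>H. dist x 0 \<le> real n})"
  proof
    fix H assume H: "H \<in> \<H>"
    then obtain x where x: "x \<in> H" using hypD(2) by blast
    obtain n :: nat where "dist x 0 \<le> real n" using real_arch_simple by blast
    then show "H \<in> (\<Union>n::nat. {H \<in> \<H>. \<exists>x\<in>H. dist x 0 \<le> real n})" using H x by blast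
  qed
  moreover have "countable (\<Union>n::nat. {H \<in> \<H>. \<exists>x\<in>H. dist x 0 \<le> real n})"
    by (intro countable_UN countableI_type countable_finite locally_finite)
  ultimately show ?thesis by (rule countable_subset)
qed

lemma hyperplane_subset_eq: "hyperplane_in E H \<Longrightarrow> hyperplane_in E H' \<Longrightarrow> H \<subseteq> H' \<Longrightarrow> H = H'"
proof -
  assume H: "hyperplane_in E H" "hyperplane_in E H'" "H \<subseteq> H'"
  have a: "affine H" "affine H'" "H \<noteq> {}" "aff_dim H = aff_dim H'" using H unfolding hyperplane_in_def by auto
  show "H = H'" by (rule affine_subset_eq[OF a(1-3) H(3) a(4)])
qed

lemma near_only:
  assumes "x \<in> E"
  obtains \<epsilon> where "\<epsilon> > 0" "\<And>H y. H \<in> \<H> \<Longrightarrow> y \<in> H \<Longrightarrow> dist x y < \<epsilon> \<Longrightarrow> x \<in> H"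
proof -
  define \<F> where "\<F> = {H \<in> \<H>. \<exists>y\<in>H. dist y x \<le> 1} - {H. x \<in> H}"
  have fin: "finite \<F>" unfolding \<F>_def using locally_finite by blast
  have "closed (\<Union>\<F>)" using fin hypD(1) by (intro closed_Union) (auto simp: \<F>_def affine_closed)
  moreover have "x \<notin> \<Union>\<F>" unfolding \<F>_def by blast
  ultimately obtain d where d: "d > 0" "ball x d \<inter> \<Union>\<F> = {}"
    by (metis Compl_iff disjoint_eq_subset_Compl open_Compl openE)
  show thesis
  proof (rule that[of "min d 1"])
    show "min d 1 > 0" using d(1) by simp
    fix H y assume H: "H \<in> \<H>" "y \<in> H" "dist x y < min d 1"
    show "x \<in> H"
    proof (rule ccontr)
      assume "x \<notin> H"
      moreover have "dist y x \<le> 1" using H(3) by (simp add: dist_commute)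
      ultimately have "H \<in> \<F>" using H unfolding \<F>_def by blast
      moreover have "y \<in> ball x d" using H(3) by simp
      ultimately show False using d(2) H(2) by blast
    qed
  qed
qed

end

subsection \<open>Chambers and their isometries\<close>

context euclidean_subspace
begin

definition iso :: "('a \<Rightarrow> 'a) \<Rightarrow> bool"
  where "iso g \<longleftrightarrow> g \<in> Bij E \<and> (\<forall>x\<in>E. \<forall>y\<in>E. dist (g x) (g y) = dist x y)"

lemma iso_Bij: "iso g \<Longrightarrow> g \<in> Bij E"
  by (simp add: iso_def)

lemma iso_dist: "iso g \<Longrightarrow> x \<in> E \<Longrightarrow> y \<in> E \<Longrightarrow> dist (g x) (g y) = dist x y"
  by (simp add: iso_def)

lemma iso_isom: "iso g \<Longrightarrow> isom (amb g)"
  by (rule amb_isom) (simp_all add: iso_def)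

lemma iso_rf: "hyperplane_in E H \<Longrightarrow> iso (rf H)"
  using rf_Bij rf_dist by (simp add: iso_def)

lemma iso_mult: 
  assumes "iso g" "iso h"
  shows "iso (g \<otimes>\<^bsub>BijGroup E\<^esub> h)"
proof -
  interpret B: group "BijGroup E" by (rule group_BijGroup)
  have gh: "g \<in> Bij E" "h \<in> Bij E" using assms iso_Bij by blast+
  have "g \<otimes>\<^bsub>BijGroup E\<^esub> h \<in> Bij E" using B.m_closed[of g h] gh by (simp add: BijGroup_simps(1))
  moreover have "dist ((g \<otimes>\<^bsub>BijGroup E\<^esub> h) x) ((g \<otimes>\<^bsub>BijGroup E\<^esub> h) y) = dist x y" if "x \<in> E" "y \<in> E" for x y
    using BijGroup_simps(2)[OF gh] iso_dist[OF assms(1)] iso_dist[OF assms(2)] Bij_in[OF gh(2)] that by simp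
  ultimately show ?thesis by (simp add: iso_def)
qed

lemma iso_one: "iso \<one>\<^bsub>BijGroup E\<^esub>"
proof -
  interpret B: group "BijGroup E" by (rule group_BijGroup)
  show ?thesis using B.one_closed by (simp add: iso_def BijGroup_simps)
qed

lemma iso_hyperplane:
  assumes g: "iso g" and H: "hyperplane_in E H"
  shows "hyperplane_in E (g ` H)"
proof -
  have h: "affine H" "H \<noteq> {}" "H \<subseteq> E" "aff_dim H = aff_dim E - 1" using H unfolding hyperplane_in_def by blast+
  have af: "affmap (amb g)" by (rule isom_affmap[OF iso_isom[OF g]])
  have e: "g ` H = amb g ` H" using amb_image[OF h(3)] by simp
  have gh: "affine (g ` H)" "g ` H \<noteq> {}" unfolding e using affine_image[OF af h(1)] h(2) by auto
  have "aff_dim (g ` H) = aff_dim H" unfolding e by (rule aff_dim_isom_image[OF iso_isom[OF g] h(1,2)])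
  moreover have "g ` H \<subseteq> E" using Bij_in[OF iso_Bij[OF g]] h(3) by blast
  ultimately show ?thesis using gh h(4) unfolding hyperplane_in_def by simp
qed

lemma iso_reflection:
  assumes g: "iso g" and H: "hyperplane_in E H" and x: "x \<in> E"
  shows "g (rf H x) = rf (g ` H) (g x)"
proof -
  have h: "affine H" "H \<noteq> {}" "H \<subseteq> E" using H unfolding hyperplane_in_def by blast+
  have iso: "isom (amb g)" by (rule iso_isom[OF g])
  have af: "affmap (amb g)" by (rule isom_affmap[OF iso])
  have e: "g ` H = amb g ` H" using amb_image[OF h(3)] by simp
  define c where "c = closest_point H x"
  have c: "c \<in> H" "c \<in> E" unfolding c_def using closest_point_affine_in[OF h(1,2)] h(3) by blast+
  have "closest_point (g ` H) (g x) = g c"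
  proof (rule closest_point_affineI)
    show "affine (g ` H)" unfolding e by (rule affine_image[OF af h(1)])
    show "g c \<in> g ` H" using c(1) by blast
    show "(g x - g c) \<bullet> v = 0" if "v \<in> direction (g ` H)" for v
    proof -
      obtain u where u: "u \<in> direction H" "v = lin (amb g) u"
        using \<open>v \<in> direction (g ` H)\<close> unfolding e direction_image[OF af] by blast
      have "g x - g c = lin (amb g) (x - c)" using affmap_diff[OF af, of x c] amb_E x c(2) by simp
      then have "(g x - g c) \<bullet> v = (x - c) \<bullet> u" using isom_inner[OF iso] u(2) by simp
      then show ?thesis using closest_point_orthogonal[OF h(1,2) u(1), of x] by (simp add: c_def)
    qed
  qed
  then have r: "rf (g ` H) (g x) = 2 *\<^sub>R g c - g x" using rf_eq[OF Bij_in[OF iso_Bij[OF g] x]] by simp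
  have l: "linear (lin (amb g))" using isom_lin[OF iso] by (rule orthogonal_transformation_linear)
  have "rf H x = x + 2 *\<^sub>R (c - x)" using rf_eq[OF x, of H] by (simp add: c_def scaleR_2 algebra_simps)
  then have "g (rf H x) = amb g (x + 2 *\<^sub>R (c - x))" using amb_E[OF rf_in[OF H x], of g] by simp
  also have "\<dots> = amb g x + 2 *\<^sub>R lin (amb g) (c - x)" unfolding affmap_add[OF af] linear_scale[OF l] ..
  also have "\<dots> = g x + 2 *\<^sub>R (g c - g x)" unfolding affmap_diff[OF af] using amb_E x c(2) by simp
  also have "\<dots> = 2 *\<^sub>R g c - g x" by (simp add: scaleR_2)
  finally show ?thesis using r by simp
qed

lemma iso_reflection_image:
  assumes "iso g" "hyperplane_in E H" "Z \<subseteq> E"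
  shows "g ` rf H ` Z = rf (g ` H) ` g ` Z"
  unfolding image_image by (rule image_cong) (use iso_reflection[OF assms(1,2)] assms(3) in auto)

end

locale chamber = arrangement E \<H> for E :: "'a::euclidean_space set" and \<H> +
  fixes \<A> :: "'a set"
  assumes ch: "\<A> \<in> components (E - \<Union>\<H>)"
begin

lemma ch_sub: "\<A> \<subseteq> E - \<Union>\<H>" and ch_ne: "\<A> \<noteq> {}" and ch_conn: "connected \<A>"
  using in_components_subset[OF ch] in_components_nonempty[OF ch] in_components_connected[OF ch] by auto

lemma ch_max: "connected T \<Longrightarrow> T \<subseteq> E - \<Union>\<H> \<Longrightarrow> x \<in> T \<Longrightarrow> x \<in> \<A> \<Longrightarrow> T \<subseteq> \<A>"
  using components_maximal[OF ch, of T] by blast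

lemma ball_in_complement:
  assumes "x \<in> E" "x \<notin> \<Union>\<H>"
  obtains \<epsilon> where "\<epsilon> > 0" "ball x \<epsilon> \<inter> E \<subseteq> E - \<Union>\<H>"
proof -
  obtain \<epsilon> where e: "\<epsilon> > 0" "\<And>H y. H \<in> \<H> \<Longrightarrow> y \<in> H \<Longrightarrow> dist x y < \<epsilon> \<Longrightarrow> x \<in> H" using near_only[OF assms(1)] by metis
  have "ball x \<epsilon> \<inter> E \<subseteq> E - \<Union>\<H>"
  proof
    fix y assume "y \<in> ball x \<epsilon> \<inter> E"
    then have y: "dist x y < \<epsilon>" "y \<in> E" by auto
    have "y \<notin> \<Union>\<H>" using e(2) y(1) assms(2) by blast
    then show "y \<in> E - \<Union>\<H>" using y(2) by blast
  qed
  then show thesis using that e(1) by blast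
qed

lemma connected_ball: "connected (ball x \<epsilon> \<inter> E)"
  by (intro convex_connected convex_Int convex_ball affine_imp_convex affE)

lemma chamber_closed:
  assumes "y \<in> E" "y \<notin> \<Union>\<H>" "y \<in> closure \<A>"
  shows "y \<in> \<A>"
proof -
  obtain \<epsilon> where e: "\<epsilon> > 0" "ball y \<epsilon> \<inter> E \<subseteq> E - \<Union>\<H>" by (rule ball_in_complement[OF assms(1,2)])
  obtain z where z: "z \<in> \<A>" "dist z y < \<epsilon>" using assms(3) e(1) closure_approachable by metis
  have "z \<in> ball y \<epsilon> \<inter> E" using z ch_sub by (auto simp: dist_commute)
  then have "ball y \<epsilon> \<inter> E \<subseteq> \<A>" using ch_max[OF connected_ball e(2)] z(1) by blast
  then show ?thesis using assms(1) e(1) by auto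
qed

lemma chamber_open:
  assumes "a \<in> \<A>"
  obtains \<epsilon> where "\<epsilon> > 0" "ball a \<epsilon> \<inter> E \<subseteq> \<A>"
proof -
  have a: "a \<in> E" "a \<notin> \<Union>\<H>" using assms ch_sub by blast+
  obtain \<epsilon> where e: "\<epsilon> > 0" "ball a \<epsilon> \<inter> E \<subseteq> E - \<Union>\<H>" by (rule ball_in_complement[OF a])
  have "ball a \<epsilon> \<inter> E \<subseteq> \<A>" using ch_max[OF connected_ball e(2) _ assms] a(1) e(1) by simp
  then show thesis using that e(1) by blast
qed

text \<open>A relatively open piece of the hyperplane must lie in the closure of the chamber; merely
  touching it does not count.\<close>

definition wall :: "'a set \<Rightarrow> bool"
  where "wall H \<longleftrightarrow> H \<in> \<H> \<and> (\<exists>x\<in>H. \<exists>\<epsilon>>0. H \<inter> ball x \<epsilon> \<subseteq> closure \<A>)"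

text \<open>Otherwise the countably many members of the arrangement could not cover the piece of
  \<open>H\<close> in the closure of the chamber. A point off all of them would belong to the
  chamber, which \<open>H\<close> does not meet.\<close>

lemma bounding_hyperplane_in:
  assumes H: "hyperplane_in E H" and x: "x \<in> H" and e: "\<epsilon> > 0" "H \<inter> ball x \<epsilon> \<subseteq> closure \<A>" and d: "H \<inter> \<A> = {}"
  shows "H \<in> \<H>"
proof (rule ccontr)
  assume n: "H \<notin> \<H>"
  have aH: "affine H" "H \<subseteq> E" using H unfolding hyperplane_in_def by blast+
  have "\<exists>y\<in>H. dist y x < \<epsilon> \<and> y \<notin> \<Union>\<H>"
  proof (rule affine_avoid[OF aH(1) x countable_\<H> _ e(1)])
    fix B assume B: "B \<in> \<H>"
    show "affine B \<and> \<not> H \<subseteq> B" using hyperplane_subset_eq[OF H hyp[OF B]] hypD(1)[OF B] n B by blast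
  qed
  then obtain y where y: "y \<in> H" "dist y x < \<epsilon>" "y \<notin> \<Union>\<H>" by blast
  have "y \<in> closure \<A>" using y e(2) by (auto simp: dist_commute)
  then have "y \<in> \<A>" using chamber_closed y aH(2) by blast
  then show False using d y(1) by blast
qed

lemma iso_wall:
  assumes k: "iso k" "k ` \<A> = \<A>" and w: "wall H"
  shows "k ` H \<in> \<H>"
proof -
  obtain x \<epsilon> where H: "H \<in> \<H>" and x: "x \<in> H" "\<epsilon> > 0" "H \<inter> ball x \<epsilon> \<subseteq> closure \<A>" using w unfolding wall_def by blast
  have HE: "H \<subseteq> E" by (rule hypD(3)[OF H])
  have AE: "\<A> \<subseteq> E" using ch_sub by blast
  have inj: "inj_on k E" using iso_Bij[OF k(1)] by (simp add: Bij_def bij_betw_def)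
  show ?thesis
  proof (rule bounding_hyperplane_in[OF iso_hyperplane[OF k(1) hyp[OF H]] imageI[OF x(1)] x(2)])
    show "k ` H \<inter> ball (k x) \<epsilon> \<subseteq> closure \<A>"
    proof
      fix y assume "y \<in> k ` H \<inter> ball (k x) \<epsilon>"
      then obtain h where h: "h \<in> H" "y = k h" "dist (k x) (k h) < \<epsilon>" by auto
      have hE: "h \<in> E" "x \<in> E" using h(1) x(1) HE by blast+
      then have "h \<in> closure \<A>" using h x(3) iso_dist[OF k(1) hE(2,1)] by auto
      moreover have "amb k ` closure \<A> \<subseteq> closure (amb k ` \<A>)"
        using affmap_continuous[OF isom_affmap[OF iso_isom[OF k(1)]]]
        by (rule image_closure_subset) (simp_all add: closure_subset)
      ultimately have "amb k h \<in> closure (amb k ` \<A>)" by blast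
      then show "y \<in> closure \<A>" using amb_E[OF hE(1), of k] amb_image[OF AE, of k] h(2) k(2) by simp
    qed
    have "k ` H \<inter> k ` \<A> = k ` (H \<inter> \<A>)" using inj_on_image_Int[OF inj HE AE] by simp
    also have "H \<inter> \<A> = {}" using ch_sub H by blast
    finally show "k ` H \<inter> \<A> = {}" using k(2) by simp
  qed
qed

definition W0 :: "('a \<Rightarrow> 'a) set"
  where "W0 = generate (BijGroup E) (rf ` {H. wall H})"

lemma wall_hyp: "wall H \<Longrightarrow> H \<in> \<H>"
  by (simp add: wall_def)

lemma W0_subgroup: "subgroup W0 (BijGroup E)"
  unfolding W0_def
  using rf_Bij[OF hyp[OF wall_hyp]] by (intro group.generate_is_subgroup[OF group_BijGroup]) (auto simp: BijGroup_simps)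

lemma rf_W0: "wall H \<Longrightarrow> rf H \<in> W0"
  unfolding W0_def by (intro generate.incl) blast

lemma W0_W: "W0 \<subseteq> W"
  unfolding W0_def W_def reflection_group_def
  by (intro group.mono_generate[OF group_BijGroup]) (use wall_hyp in blast)

text \<open>On a generic segment from the chamber to \<open>x\<close>, the first hyperplane met is a
  wall. It is \<open>H\<close> itself if it is first met at \<open>x\<close>; otherwise it separates
  \<open>x\<close> from \<open>a\<close>, and reflecting in it brings \<open>x\<close> closer to
  \<open>a\<close>.\<close>

lemma crossing_wall:
  assumes a: "a \<in> \<A>" and x: "x \<in> H" and H: "H \<in> \<H>" and only: "\<And>H'. H' \<in> \<H> \<Longrightarrow> x \<in> H' \<Longrightarrow> H' = H"
  shows "wall H \<or> (\<exists>H1. wall H1 \<and> dist (rf H1 x) a < dist x a)"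
proof -
  have aE: "a \<in> E" and xE: "x \<in> E" using a ch_sub x hypD(3)[OF H] by blast+
  obtain \<epsilon>0 where e0: "\<epsilon>0 > 0" "ball a \<epsilon>0 \<inter> E \<subseteq> \<A>" by (rule chamber_open[OF a])
  \<comment> \<open>The start of the segment is moved off these cones over intersections of two
    hyperplanes, so that the segment meets hyperplanes one at a time before it reaches
    \<open>x\<close>. Two distinct hyperplanes meet in codimension at least two, so the cones are
    proper.\<close>
  define \<B> where "\<B> = (\<lambda>(H1, H2). affine hull (insert x (H1 \<inter> H2))) ` {(H1, H2). H1 \<in> \<H> \<and> H2 \<in> \<H> \<and> H1 \<noteq> H2}"
  have "countable {(H1, H2). H1 \<in> \<H> \<and> H2 \<in> \<H> \<and> H1 \<noteq> H2}"
    by (rule countable_subset[OF _ countable_SIGMA[OF countable_\<H> countable_\<H>]]) auto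
  then have cB: "countable \<B>" unfolding \<B>_def by (rule countable_image)
  have "\<exists>a'\<in>E. dist a' a < \<epsilon>0 \<and> a' \<notin> \<Union>\<B>"
  proof (rule affine_avoid[OF affE aE cB _ e0(1)])
    fix B assume "B \<in> \<B>"
    then obtain H1 H2 where B: "H1 \<in> \<H>" "H2 \<in> \<H>" "H1 \<noteq> H2" "B = affine hull (insert x (H1 \<inter> H2))" unfolding \<B>_def by auto
    have "H1 \<inter> H2 \<subset> H1" using hyperplane_subset_eq[OF hyp[OF B(1)] hyp[OF B(2)]] B(3) by blast
    moreover have "affine (H1 \<inter> H2)" "affine H1" using hypD(1) B by (auto intro: affine_Int)
    ultimately have "affine hull (H1 \<inter> H2) \<subset> affine hull H1" by (simp add: affine_hull_eq[THEN iffD2])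
    then have "aff_dim (H1 \<inter> H2) < aff_dim H1" by (rule aff_dim_psubset)
    then have "aff_dim (H1 \<inter> H2) < aff_dim E - 1" using hypD(4)[OF B(1)] by simp
    then have "aff_dim (insert x (H1 \<inter> H2)) < aff_dim E" by (simp add: aff_dim_insert)
    then have "aff_dim B < aff_dim E" unfolding B(4) by simp
    then have "\<not> E \<subseteq> B" using aff_dim_subset[of E B] by linarith
    then show "affine B \<and> \<not> E \<subseteq> B" unfolding B(4) by simp
  qed
  then obtain a' where a': "a' \<in> E" "dist a' a < \<epsilon>0" "a' \<notin> \<Union>\<B>" by blast
  have a'A: "a' \<in> \<A>" using a' e0(2) by (auto simp: dist_commute)
  then have a'H: "a' \<notin> \<Union>\<H>" using ch_sub by blast
  define \<gamma> where "\<gamma> t = a' + t *\<^sub>R (x - a')" for t :: real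
  have \<gamma>0: "\<gamma> 0 = a'" and \<gamma>1: "\<gamma> 1 = x" by (simp_all add: \<gamma>_def)
  have \<gamma>E: "\<gamma> t \<in> E" for t
    using mem_affine[OF affE a'(1) xE, of "1 - t" t] by (simp add: \<gamma>_def algebra_simps)
  have \<gamma>c: "continuous_on Z \<gamma>" for Z unfolding \<gamma>_def by (intro continuous_intros)
  \<comment> \<open>The length of the segment. Only hyperplanes within this distance of
    \<open>a'\<close> can meet it; they are finitely many, so there is a first meeting
    point.\<close>
  define r where "r = norm (x - a')"
  define \<F> where "\<F> = {H \<in> \<H>. \<exists>y\<in>H. dist y a' \<le> r}"
  have fin: "finite \<F>" unfolding \<F>_def by (rule locally_finite)
  have clF: "closed (\<Union>\<F>)" using fin hypD(1) by (intro closed_Union) (auto simp: \<F>_def affine_closed)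
  have inF: "\<gamma> t \<in> \<Union>\<F>" if t: "0 \<le> t" "t \<le> 1" "\<gamma> t \<in> \<Union>\<H>" for t
  proof -
    obtain H1 where H1: "H1 \<in> \<H>" "\<gamma> t \<in> H1" using t(3) by blast
    have "dist (\<gamma> t) a' \<le> r" using t(1,2) mult_right_mono[OF t(2), of "norm (x - a')"]
      by (simp add: \<gamma>_def r_def dist_norm)
    then show ?thesis using H1 unfolding \<F>_def by blast
  qed
  define T where "T = {0..1} \<inter> \<gamma> -` \<Union>\<F>"
  have "closed T" unfolding T_def by (rule continuous_closed_preimage[OF \<gamma>c _ clF]) simp
  then have "compact T" by (simp add: compact_eq_bounded_closed T_def bounded_Int)
  moreover have "1 \<in> T" using inF[of 1] x H by (auto simp: T_def \<gamma>1)
  ultimately obtain t0 where t0: "t0 \<in> T" "\<And>t. t \<in> T \<Longrightarrow> t0 \<le> t" using compact_attains_inf[of T] by blast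
  define y where "y = \<gamma> t0"
  have t01: "0 \<le> t0" "t0 \<le> 1" and yF: "y \<in> \<Union>\<F>" using t0(1) by (auto simp: T_def y_def)
  have "t0 \<noteq> 0" using yF a'H \<gamma>0 unfolding y_def \<F>_def by auto
  then have t0pos: "t0 > 0" using t01 by simp
  have before: "\<gamma> t \<in> \<A>" if t: "0 \<le> t" "t < t0" for t
  proof -
    have "\<gamma> ` {0..t} \<subseteq> E - \<Union>\<H>"
    proof
      fix z assume "z \<in> \<gamma> ` {0..t}"
      then obtain s where s: "0 \<le> s" "s \<le> t" "z = \<gamma> s" by auto
      have "s \<notin> T" using t0(2)[of s] s t by force
      then have "z \<notin> \<Union>\<H>" using inF[of s] s t t01 by (auto simp: T_def)
      then show "z \<in> E - \<Union>\<H>" using \<gamma>E s(3) by blast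
    qed
    moreover have "connected (\<gamma> ` {0..t})" by (intro connected_continuous_image \<gamma>c) simp
    moreover have "a' \<in> \<gamma> ` {0..t}" using \<gamma>0 t(1) by (metis atLeastAtMost_iff imageI order_refl)
    ultimately have "\<gamma> ` {0..t} \<subseteq> \<A>" using ch_max a'A by blast
    then show ?thesis using t(1) by auto
  qed
  obtain H1 where H1: "H1 \<in> \<H>" "y \<in> H1" using yF unfolding \<F>_def by blast
  \<comment> \<open>If two hyperplanes met at \<open>y\<close> before \<open>x\<close>, the line
    through \<open>x\<close> and \<open>y\<close> would lie in one of the excluded subspaces, and it
    contains \<open>a'\<close>.\<close>
  have y_only: "H2 = H1" if H2: "H2 \<in> \<H>" "y \<in> H2" for H2
  proof (cases "t0 = 1")
    case True
    then have "y = x" using \<gamma>1 y_def by simp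
    then show ?thesis using only H1 H2 by metis
  next
    case False
    show ?thesis
    proof (rule ccontr)
      assume ne: "H2 \<noteq> H1"
      let ?B = "affine hull (insert x (H1 \<inter> H2))"
      have "y \<in> ?B" "x \<in> ?B" using H1 H2 by (auto intro: hull_inc)
      moreover have "1 / (1 - t0) + - (t0 / (1 - t0)) = 1" using False by (simp add: field_simps)
      ultimately have "(1 / (1 - t0)) *\<^sub>R y + (- (t0 / (1 - t0))) *\<^sub>R x \<in> ?B" by (intro mem_affine affine_affine_hull)
      moreover have "(1 / (1 - t0)) *\<^sub>R y + (- (t0 / (1 - t0))) *\<^sub>R x = a'"
      proof -
        have "(1 - t0) *\<^sub>R ((1 / (1 - t0)) *\<^sub>R y + (- (t0 / (1 - t0))) *\<^sub>R x) = y - t0 *\<^sub>R x"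
          using False by (simp add: scaleR_right_diff_distrib)
        also have "\<dots> = (1 - t0) *\<^sub>R a'" by (simp add: y_def \<gamma>_def algebra_simps)
        finally show ?thesis using False by simp
      qed
      moreover have "?B \<in> \<B>" unfolding \<B>_def using H1(1) H2(1) ne by (intro image_eqI[of _ _ "(H1, H2)"]) auto
      ultimately show False using a'(3) by auto
    qed
  qed
  obtain n where n: "extends_by H1 E n" using hyperplane_normal[OF hyp[OF H1(1)]] by blast
  define c where "c = (a' - y) \<bullet> n"
  have yE: "y \<in> E" using \<gamma>E y_def by simp
  have c0: "c \<noteq> 0" using hyperplane_iff[OF n H1(2) a'(1)] a'H H1(1) by (auto simp: c_def)
  then have cc: "c * c > 0" using not_real_square_gt_zero by blast
  have \<gamma>y: "\<gamma> t - y = ((t0 - t) / t0) *\<^sub>R (a' - y)" for t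
  proof -
    have 1: "a' - y = t0 *\<^sub>R (a' - x)" by (simp add: y_def \<gamma>_def algebra_simps)
    have "\<gamma> t - y = (t0 - t) *\<^sub>R (a' - x)" by (simp add: y_def \<gamma>_def algebra_simps)
    then show ?thesis unfolding 1 using t0pos by simp
  qed
  obtain \<epsilon> where e: "\<epsilon> > 0" "\<And>H y'. H \<in> \<H> \<Longrightarrow> y' \<in> H \<Longrightarrow> dist y y' < \<epsilon> \<Longrightarrow> y \<in> H" using near_only[OF yE] by metis
  \<comment> \<open>The half ball at \<open>y\<close> on the side of \<open>a'\<close>. It is
    convex, meets no hyperplane and contains points of the segment before \<open>y\<close>, so it
    lies in the chamber.\<close>
  define U where "U = E \<inter> (ball y \<epsilon> \<inter> {z. (c *\<^sub>R n) \<bullet> z > (c *\<^sub>R n) \<bullet> y})"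
  have U_iff: "z \<in> U \<longleftrightarrow> z \<in> E \<and> dist y z < \<epsilon> \<and> c * ((z - y) \<bullet> n) > 0" for z
    by (auto simp: U_def inner_diff_left inner_commute[of n] right_diff_distrib)
  have Uconn: "connected U" unfolding U_def
    by (intro convex_connected convex_Int convex_ball affine_imp_convex affE convex_halfspace_gt)
  have UH: "U \<subseteq> E - \<Union>\<H>"
  proof
    fix z assume z: "z \<in> U"
    have "z \<notin> H2" if H2: "H2 \<in> \<H>" for H2
    proof
      assume z2: "z \<in> H2"
      have "y \<in> H2" using e(2)[OF H2 z2] z U_iff by blast
      then have "H2 = H1" using y_only H2 by blast
      then show False using hyperplane_iff[OF n H1(2), of z] z z2 U_iff[of z] by auto
    qed
    then show "z \<in> E - \<Union>\<H>" using z U_iff by blast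
  qed
  have small: "\<exists>s. 0 < s \<and> s \<le> 1 \<and> s * norm v < \<delta>" if "\<delta> > 0" for \<delta> :: real and v :: 'a
  proof (intro exI conjI)
    let ?s = "min 1 (\<delta> / (2 * (norm v + 1)))"
    have p: "norm v + 1 > 0" by (simp add: add_nonneg_pos)
    then show "0 < ?s" using that by simp
    show "?s \<le> 1" by simp
    have "?s * norm v \<le> (\<delta> / (2 * (norm v + 1))) * (norm v + 1)" using that p by (intro mult_mono) auto
    also have "\<dots> = \<delta> / 2" using p by (simp add: field_simps)
    finally show "?s * norm v < \<delta>" using that by simp
  qed
  have UA: "U \<subseteq> \<A>"
  proof -
    obtain s where s: "0 < s" "s \<le> 1" "s * norm (a' - y) < \<epsilon>" using small[OF e(1)] by blast
    let ?t = "t0 * (1 - s)"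
    have tt: "0 \<le> ?t" "?t < t0" using s t0pos by (simp_all add: algebra_simps)
    have g: "\<gamma> ?t - y = s *\<^sub>R (a' - y)" unfolding \<gamma>y using t0pos by (simp add: algebra_simps)
    have "dist y (\<gamma> ?t) < \<epsilon>" using g s by (simp add: dist_norm norm_minus_commute[of y])
    moreover have "s * (c * c) > 0" using s(1) cc by simp
    moreover have "c * ((\<gamma> ?t - y) \<bullet> n) = s * (c * c)" unfolding g by (simp add: c_def)
    ultimately have "\<gamma> ?t \<in> U" using \<gamma>E U_iff by metis
    then show ?thesis using ch_max[OF Uconn UH] before[OF tt] by blast
  qed
  \<comment> \<open>Points of \<open>H1\<close> near \<open>y\<close> are limits of points pushed in
    the direction \<open>a' - y\<close>, which lie in \<open>U\<close>.\<close>
  have w1: "wall H1"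
    unfolding wall_def
  proof (intro conjI H1(1) bexI[OF _ H1(2)] exI[of _ \<epsilon>] e(1))
    show "H1 \<inter> ball y \<epsilon> \<subseteq> closure \<A>"
    proof
      fix z assume "z \<in> H1 \<inter> ball y \<epsilon>"
      then have z: "z \<in> H1" "dist y z < \<epsilon>" by auto
      have zE: "z \<in> E" using z(1) hypD(3)[OF H1(1)] by blast
      have zn: "(z - y) \<bullet> n = 0" using hyperplane_iff[OF n H1(2) zE] z(1) by simp
      show "z \<in> closure \<A>"
        unfolding closure_approachable
      proof (intro allI impI)
        fix d :: real assume d: "d > 0"
        obtain s where s: "0 < s" "s * norm (a' - y) < min d (\<epsilon> - dist y z)" using small[of "min d (\<epsilon> - dist y z)" "a' - y"] d z(2) by auto
        let ?z = "z + s *\<^sub>R (a' - y)"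
        have dz: "dist ?z z = s * norm (a' - y)" using s(1) by (simp add: dist_norm)
        have "dist y ?z \<le> dist y z + dist ?z z" by (metis dist_commute dist_triangle)
        then have zin: "dist y ?z < \<epsilon>" "?z \<in> E"
          using dz s(2) mem_affine_3_minus[OF affE zE a'(1) yE, of s] by simp_all
        have "(?z - y) \<bullet> n = s * c" using zn by (simp add: c_def inner_diff_left inner_add_left algebra_simps)
        moreover have "s * (c * c) > 0" using s(1) cc by simp
        ultimately have "c * ((?z - y) \<bullet> n) > 0" by (simp only: mult.left_commute)
        then have "?z \<in> \<A>" using UA U_iff zin by blast
        then show "\<exists>w\<in>\<A>. dist w z < d" using dz s(2) by (intro bexI[of _ ?z]) auto
      qed
    qed
  qed
  show ?thesis
  proof (cases "t0 = 1")
    case True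
    then have "y = x" using \<gamma>1 y_def by simp
    then show ?thesis using only H1 w1 by metis
  next
    case False
    have "x - y = ((t0 - 1) / t0) *\<^sub>R (a' - y)" using \<gamma>y[of 1] \<gamma>1 by simp
    then have xc: "(x - y) \<bullet> n = ((t0 - 1) / t0) * c" by (simp add: c_def)
    have m: "(t0 - 1) / t0 < 0" using t0pos False t01 by (simp add: divide_neg_pos)
    \<comment> \<open>\<open>a\<close> and \<open>a'\<close> lie on the same side of
      \<open>H1\<close>, because the chamber is connected and misses \<open>H1\<close>.\<close>
    have ac: "c * ((a - y) \<bullet> n) > 0"
    proof (rule ccontr)
      assume "\<not> c * ((a - y) \<bullet> n) > 0"
      then have "(c *\<^sub>R n) \<bullet> a \<le> (c *\<^sub>R n) \<bullet> y"
        by (simp add: inner_diff_left inner_commute[of n] right_diff_distrib)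
      moreover have "c * ((a' - y) \<bullet> n) > 0" using cc by (simp add: c_def[symmetric])
      then have "(c *\<^sub>R n) \<bullet> y \<le> (c *\<^sub>R n) \<bullet> a'"
        by (simp add: inner_diff_left inner_commute[of n] right_diff_distrib)
      ultimately obtain z where z: "z \<in> \<A>" "(c *\<^sub>R n) \<bullet> z = (c *\<^sub>R n) \<bullet> y"
        using connected_ivt_hyperplane[OF ch_conn a a'A] by blast
      have "(z - y) \<bullet> n = 0" using z(2) c0 by (simp add: inner_diff_left inner_commute[of n])
      then have "z \<in> H1" using hyperplane_iff[OF n H1(2), of z] z(1) ch_sub by blast
      then show False using z(1) ch_sub H1(1) by blast
    qed
    have "((x - y) \<bullet> n) * ((a - y) \<bullet> n) = ((t0 - 1) / t0) * (c * ((a - y) \<bullet> n))" unfolding xc by simp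
    also have "\<dots> < 0" by (rule mult_neg_pos[OF m ac])
    finally have "dist (rf H1 x) a < dist x a" by (rule rf_closer[OF n H1(2) xE])
    then show ?thesis using w1 by blast
  qed
qed

text \<open>Among the elements of \<open>W0\<close>, take one that brings a generic point
  \<open>x\<close> of \<open>H\<close> closest to the chamber point \<open>a\<close>. If the image
  of \<open>H\<close> were not a wall, \<open>crossing_wall\<close> would supply a wall reflection
  improving it.\<close>

lemma wall_conjugate:
  assumes H: "H \<in> \<H>"
  shows "\<exists>g\<in>W0. wall (g ` H)"
proof -
  obtain a where a: "a \<in> \<A>" using ch_ne by blast
  have aE: "a \<in> E" using a ch_sub by blast
  obtain q where q: "q \<in> H" using hypD(2)[OF H] by blast
  have "\<exists>x\<in>H. dist x q < 1 \<and> x \<notin> \<Union>(\<H> - {H})"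
  proof (rule affine_avoid[OF hypD(1)[OF H] q])
    show "countable (\<H> - {H})" using countable_\<H> by (rule countable_subset[rotated]) blast
    fix B assume B: "B \<in> \<H> - {H}"
    show "affine B \<and> \<not> H \<subseteq> B" using hyperplane_subset_eq[OF hyp[OF H] hyp, of B] hypD(1)[of B] B by blast
  qed simp
  then obtain x where x: "x \<in> H" and xo: "\<And>H'. H' \<in> \<H> \<Longrightarrow> x \<in> H' \<Longrightarrow> H' = H" by blast
  have xE: "x \<in> E" using x hypD(3)[OF H] by blast
  \<comment> \<open>Restricting to elements that do not move \<open>x\<close> farther from
    \<open>a\<close> leaves a finite set, so the minimum exists.\<close>
  define N where "N = {g \<in> W0. dist (g x) a \<le> dist x a}"
  have "finite N"
    by (rule finite_subset[OF _ W_finite[of a "dist x a"]]) (use W0_W xE in \<open>auto simp: N_def\<close>)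
  moreover have one: "\<one>\<^bsub>BijGroup E\<^esub> \<in> W0" by (rule subgroup.one_closed[OF W0_subgroup])
  then have "\<one>\<^bsub>BijGroup E\<^esub> \<in> N" using xE by (simp add: N_def BijGroup_simps)
  ultimately obtain g where g: "g \<in> N" "\<And>h. h \<in> N \<Longrightarrow> dist (g x) a \<le> dist (h x) a"
    using arg_min_if_finite(1)[of N "\<lambda>g. dist (g x) a"] arg_min_least[of N _ "\<lambda>g. dist (g x) a"] by (metis empty_iff)
  have g0: "g \<in> W0" and gx: "dist (g x) a \<le> dist x a" using g(1) by (simp_all add: N_def)
  have gW: "g \<in> W" and gB: "g \<in> Bij E" using g0 W0_W W_Bij by blast+
  have gH: "g ` H \<in> \<H>" by (rule W_pres[OF gW H])
  have gonly: "H' = g ` H" if H': "H' \<in> \<H>" "g x \<in> H'" for H'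
  proof -
    interpret B: group "BijGroup E" by (rule group_BijGroup)
    define h where "h = inv\<^bsub>BijGroup E\<^esub> g"
    have hW: "h \<in> W" unfolding h_def by (rule subgroup.m_inv_closed[OF W_subgroup gW])
    have hB: "h \<in> Bij E" by (rule W_Bij[OF hW])
    have hg: "h (g z) = z" "g (h z) = z" if "z \<in> E" for z
      using BijGroup_simps(2)[OF hB gB that] BijGroup_simps(2)[OF gB hB that] BijGroup_simps(3)[OF that]
        B.l_inv[of g] B.r_inv[of g] gB by (simp_all add: h_def BijGroup_simps(1))
    have "h ` H' = H" using xo[OF W_pres[OF hW H'(1)]] H'(2) hg(1)[OF xE] by (metis imageI)
    moreover have "g ` h ` H' = H'" using hg(2) hypD(3)[OF H'(1)] by (force simp: image_image)
    ultimately show ?thesis by simp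
  qed
  have "wall (g ` H) \<or> (\<exists>H1. wall H1 \<and> dist (rf H1 (g x)) a < dist (g x) a)"
    using crossing_wall[OF a imageI[OF x] gH gonly] by blast
  moreover have False if w: "wall H1" and l: "dist (rf H1 (g x)) a < dist (g x) a" for H1
  proof -
    let ?h = "rf H1 \<otimes>\<^bsub>BijGroup E\<^esub> g"
    have e: "?h x = rf H1 (g x)" by (rule BijGroup_simps(2)[OF rf_Bij[OF hyp[OF wall_hyp[OF w]]] gB xE])
    have "?h \<in> W0" by (rule subgroup.m_closed[OF W0_subgroup rf_W0[OF w] g0])
    then have "?h \<in> N" using l gx e by (simp add: N_def)
    then show False using g(2)[of ?h] l e by simp
  qed
  ultimately show ?thesis using g0 by blast
qed

text \<open>By \<open>iso_wall\<close> the images of walls belong to the arrangement. Every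
  hyperplane is carried to a wall by wall reflections, and \<open>k\<close> turns these into
  reflections in members of the arrangement, which preserve it.\<close>

lemma iso_preserves:
  assumes k: "iso k" "k ` \<A> = \<A>" and H: "H \<in> \<H>"
  shows "k ` H \<in> \<H>"
proof -
  obtain g where g: "g \<in> W0" "wall (g ` H)" using wall_conjugate[OF H] by blast
  have refl: "k ` Z \<in> \<H>" if w: "wall H1" and Z: "Z \<subseteq> E" and i: "k ` rf H1 ` Z \<in> \<H>" for H1 Z
  proof -
    have h: "hyperplane_in E H1" by (rule hyp[OF wall_hyp[OF w]])
    have kH: "k ` H1 \<in> \<H>" by (rule iso_wall[OF k w])
    have "rf (k ` H1) ` rf (k ` H1) ` k ` Z \<in> \<H>"
      using W_pres[OF rf_W[OF kH]] i unfolding iso_reflection_image[OF k(1) h Z] by blast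
    moreover have "k ` Z \<subseteq> E" using Bij_in[OF iso_Bij[OF k(1)]] Z by blast
    ultimately show ?thesis using rf_image_image[OF hyp[OF kH]] by simp
  qed
  \<comment> \<open>Stated for all subsets \<open>Z\<close> so that, for a product, the induction
    hypothesis applies to the image of \<open>Z\<close> under the second factor.\<close>
  have "\<forall>Z\<subseteq>E. k ` g ` Z \<in> \<H> \<longrightarrow> k ` Z \<in> \<H>"
    using g(1) unfolding W0_def
  proof (induction rule: generate.induct)
    case one
    show ?case using BijGroup_simps(3) by (simp add: image_def subset_iff cong: conj_cong bex_cong)
  next
    case (incl h)
    then show ?case using refl by blast
  next
    case (inv h)
    then obtain H1 where "wall H1" "h = rf H1" by blast
    then show ?case using refl rf_inv[OF hyp[OF wall_hyp]] by simp
  next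
    case (eng h1 h2)
    have b: "h1 \<in> Bij E" "h2 \<in> Bij E" using eng(1,2) W0_W W_Bij unfolding W0_def by blast+
    show ?case
    proof (intro allI impI)
      fix Z assume Z: "Z \<subseteq> E" "k ` (h1 \<otimes>\<^bsub>BijGroup E\<^esub> h2) ` Z \<in> \<H>"
      have "h2 ` Z \<subseteq> E" using Bij_in[OF b(2)] Z(1) by blast
      then have "k ` h2 ` Z \<in> \<H>" using eng(3) Z(2) unfolding Bij_mult_image[OF b Z(1)] by blast
      then show "k ` Z \<in> \<H>" using eng(4) Z(1) by blast
    qed
  qed
  then show ?thesis using iso_wall[OF k g(2)] hypD(3)[OF H] by blast
qed

end

subsection \<open>The group acting on the stratum\<close>

lemma subspace_common_direction: "affine E \<Longrightarrow> E \<noteq> {} \<Longrightarrow> (\<And>H. H \<in> \<H> \<Longrightarrow> affine H \<and> H \<noteq> {}) \<Longrightarrow> subspace (common_direction E \<H>)"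
  unfolding common_direction_def by (intro subspace_inter subspace_Inter) (auto intro: subspace_direction)

locale arrangement_flat = chamber E \<H> \<A> for E :: "'a::euclidean_space set" and \<H> \<A> +
  fixes K :: "('a \<Rightarrow> 'a) set" and L :: "'a set"
  assumes adK: "admissible_group E \<H> \<A> K" and fl: "is_flat E \<H> L"
begin

interpretation B: group "BijGroup E" by (rule group_BijGroup)

abbreviation mul (infixl "\<cdot>" 70)
  where "g \<cdot> h \<equiv> g \<otimes>\<^bsub>BijGroup E\<^esub> h"

definition V :: "'a set"
  where "V = common_direction E \<H>"

lemma V_sub: "subspace V"
  unfolding V_def using hypD affE Ene by (intro subspace_common_direction) auto

lemma V_E: "v \<in> V \<Longrightarrow> v \<in> direction E" and V_H: "v \<in> V \<Longrightarrow> H \<in> \<H> \<Longrightarrow> v \<in> direction H"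
  unfolding V_def common_direction_def by auto

lemma V_iff: "v \<in> V \<longleftrightarrow> v \<in> direction E \<and> (\<forall>H\<in>\<H>. v \<in> direction H)"
  unfolding V_def common_direction_def by auto

text \<open>The properties shared by \<open>W\<close> and \<open>K\<close> and inherited by
  products. The last clause, that displacements are orthogonal to \<open>V\<close>, replaces the
  choice of a base point for the essential subspace and excludes translations along
  \<open>V\<close>.\<close>

definition good :: "('a \<Rightarrow> 'a) \<Rightarrow> bool"
  where "good g \<longleftrightarrow> iso g \<and> (\<forall>H\<in>\<H>. g ` H \<in> \<H>) \<and>
    (\<forall>x\<in>E. \<forall>v\<in>V. g (x + v) = g x + v \<and> (g x - x) \<bullet> v = 0)"

lemma good_iso: "good g \<Longrightarrow> iso g"
  by (simp add: good_def)

lemma good_Bij: "good g \<Longrightarrow> g \<in> Bij E"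
  using good_iso iso_Bij by blast

lemma good_pres: "good g \<Longrightarrow> H \<in> \<H> \<Longrightarrow> g ` H \<in> \<H>"
  by (simp add: good_def)

lemma good_V: "good g \<Longrightarrow> x \<in> E \<Longrightarrow> v \<in> V \<Longrightarrow> g (x + v) = g x + v"
  "good g \<Longrightarrow> x \<in> E \<Longrightarrow> v \<in> V \<Longrightarrow> (g x - x) \<bullet> v = 0"
  by (simp_all add: good_def)

lemma good_mult:
  assumes g: "good g" and h: "good h"
  shows "good (g \<cdot> h)"
  unfolding good_def
proof (intro conjI ballI)
  note b = good_Bij[OF g] good_Bij[OF h]
  show "iso (g \<cdot> h)" using iso_mult good_iso g h by blast
  show "(g \<cdot> h) ` H \<in> \<H>" if "H \<in> \<H>" for H
    unfolding Bij_mult_image[OF b hypD(3)[OF that]] by (intro good_pres[OF g] good_pres[OF h] that)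
  fix x v assume x: "x \<in> E" and v: "v \<in> V"
  have hx: "h x \<in> E" by (rule Bij_in[OF b(2) x])
  have xv: "x + v \<in> E" by (rule affine_plus_direction[OF affE x V_E[OF v]])
  show "(g \<cdot> h) (x + v) = (g \<cdot> h) x + v"
    unfolding BijGroup_simps(2)[OF b x] BijGroup_simps(2)[OF b xv] good_V(1)[OF h x v] by (rule good_V(1)[OF g hx v])
  have "((g \<cdot> h) x - x) \<bullet> v = (g (h x) - h x) \<bullet> v + (h x - x) \<bullet> v"
    unfolding BijGroup_simps(2)[OF b x] by (simp add: inner_diff_left)
  then show "((g \<cdot> h) x - x) \<bullet> v = 0" using good_V(2)[OF g hx v] good_V(2)[OF h x v] by simp
qed

lemma good_rf:
  assumes H: "H \<in> \<H>"
  shows "good (rf H)"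
  unfolding good_def
proof (intro conjI ballI)
  show "iso (rf H)" by (rule iso_rf[OF hyp[OF H]])
  show "rf H ` H' \<in> \<H>" if "H' \<in> \<H>" for H' by (rule W_pres[OF rf_W[OF H] that])
  fix x v assume x: "x \<in> E" and v: "v \<in> V"
  have xv: "x + v \<in> E" by (rule affine_plus_direction[OF affE x V_E[OF v]])
  obtain n where n: "extends_by H E n" using hyperplane_normal[OF hyp[OF H]] by blast
  obtain p where p: "p \<in> H" using hypD(2)[OF H] by blast
  have nv: "n \<bullet> v = 0" using n V_H[OF v H] unfolding extends_by_def by blast
  then have vn: "v \<bullet> n = 0" by (simp add: inner_commute)
  show "rf H (x + v) = rf H x + v"
    unfolding rf_normal[OF n p x] rf_normal[OF n p xv] using vn by (simp add: inner_diff_left inner_add_left)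
  show "(rf H x - x) \<bullet> v = 0" unfolding rf_normal[OF n p x] using nv by simp
qed

lemma good_one: "good \<one>\<^bsub>BijGroup E\<^esub>"
  unfolding good_def
proof (intro conjI ballI)
  show "\<one>\<^bsub>BijGroup E\<^esub> ` H \<in> \<H>" if "H \<in> \<H>" for H
  proof -
    have "\<one>\<^bsub>BijGroup E\<^esub> ` H = H" using hypD(3)[OF that] BijGroup_simps(3) by (force simp: image_def)
    then show ?thesis using that by simp
  qed
  fix x v assume x: "x \<in> E" and v: "v \<in> V"
  have "x + v \<in> E" by (rule affine_plus_direction[OF affE x V_E[OF v]])
  then show "\<one>\<^bsub>BijGroup E\<^esub> (x + v) = \<one>\<^bsub>BijGroup E\<^esub> x + v" "(\<one>\<^bsub>BijGroup E\<^esub> x - x) \<bullet> v = 0"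
    using x by (simp_all add: BijGroup_simps(3))
qed (rule iso_one)

lemma good_W: "g \<in> W \<Longrightarrow> good g"
  by (induction rule: W_induct) (simp_all add: good_one good_rf good_mult)

lemma K_subgroup: "subgroup K (BijGroup E)" and K_iso: "k \<in> K \<Longrightarrow> iso k" and K_chamber: "k \<in> K \<Longrightarrow> k ` \<A> = \<A>"
proof -
  show s: "subgroup K (BijGroup E)" using adK unfolding admissible_group_def by blast
  show "k ` \<A> = \<A>" if "k \<in> K" using adK that unfolding admissible_group_def by blast
  show "iso k" if k: "k \<in> K"
  proof -
    have "k \<in> Bij E" using subgroup.subset[OF s] k by (auto simp: BijGroup_simps(1))
    moreover have "\<forall>x\<in>E. \<forall>y\<in>E. dist (k x) (k y) = dist x y" using adK k unfolding admissible_group_def by blast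
    ultimately show ?thesis unfolding iso_def by blast
  qed
qed

text \<open>Write \<open>x\<close> as a point of the essential subspace through \<open>p\<close>
  plus a vector of \<open>V\<close>; \<open>k\<close> keeps the vector and moves the point within
  the essential subspace, hence orthogonally to \<open>V\<close>.\<close>

lemma good_K:
  assumes k: "k \<in> K"
  shows "good k"
  unfolding good_def
proof (intro conjI ballI)
  show "iso k" by (rule K_iso[OF k])
  show "k ` H \<in> \<H>" if "H \<in> \<H>" for H by (rule iso_preserves[OF K_iso[OF k] K_chamber[OF k] that])
  fix x v assume x: "x \<in> E" and v: "v \<in> V"
  have "\<exists>p\<in>E. \<forall>k\<in>K. k ` (+) p ` (direction E \<inter> orthogonal_comp V) = (+) p ` (direction E \<inter> orthogonal_comp V) \<and>
      (\<forall>x\<in>E. \<forall>v\<in>V. k (x + v) = k x + v)"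
    using adK unfolding admissible_group_def Let_def V_def by (elim conjE)
  then obtain p where p: "p \<in> E" and
    kp: "\<forall>k\<in>K. k ` (+) p ` (direction E \<inter> orthogonal_comp V) = (+) p ` (direction E \<inter> orthogonal_comp V) \<and>
      (\<forall>x\<in>E. \<forall>v\<in>V. k (x + v) = k x + v)" by (rule bexE)
  note 1 = conjunct1[OF bspec[OF kp k]] and 2 = bspec[OF bspec[OF conjunct2[OF bspec[OF kp k]]]]
  show "k (x + v) = k x + v" by (rule 2[OF x v])
  have ne: "V \<noteq> {}" using v by blast
  have aV: "affine V" by (rule subspace_imp_affine[OF V_sub])
  define v' where "v' = closest_point V (x - p)"
  have v': "v' \<in> V" unfolding v'_def by (rule closest_point_affine_in[OF aV ne])
  define u where "u = x - p - v'"
  have "u \<bullet> w = 0" if "w \<in> V" for w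
    using closest_point_orthogonal[OF aV ne, of w "x - p"] that direction_subspace[OF V_sub] by (simp add: u_def v'_def)
  moreover have "u \<in> direction E"
    unfolding u_def by (rule subspace_diff[OF subspace_direction[OF affE Ene] direction_diff[OF x p] V_E[OF v']])
  ultimately have uU: "u \<in> direction E \<inter> orthogonal_comp V" by (simp add: orthogonal_comp_def orthogonal_def inner_commute)
  then have puE: "p + u \<in> E" using affine_plus_direction[OF affE p] by blast
  have "k (p + u) \<in> k ` (+) p ` (direction E \<inter> orthogonal_comp V)" using uU by (intro imageI)
  then have "k (p + u) \<in> (+) p ` (direction E \<inter> orthogonal_comp V)" unfolding 1 .
  then obtain u' where u': "u' \<in> orthogonal_comp V" "k (p + u) = p + u'" by blast
  have "x = (p + u) + v'" by (simp add: u_def)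
  then have "k x - x = u' - u" using 2[OF puE v'] u'(2) by simp
  moreover have "u' \<bullet> v = 0" "u \<bullet> v = 0"
    using u'(1) uU v by (simp_all add: orthogonal_comp_def orthogonal_def inner_commute[of u' v] inner_commute[of u v])
  ultimately show "(k x - x) \<bullet> v = 0" by (simp add: inner_diff_left)
qed

definition G :: "('a \<Rightarrow> 'a) set"
  where "G = extended_group E \<H> K"

lemma G_iff: "g \<in> G \<longleftrightarrow> (\<exists>k\<in>K. \<exists>w\<in>W. g = k \<cdot> w)"
  unfolding G_def extended_group_def set_mult_def W_def by blast

lemma good_G:
  assumes "g \<in> G"
  shows "good g"
proof -
  obtain k w where g: "k \<in> K" "w \<in> W" "g = k \<cdot> w" using assms unfolding G_iff by (elim bexE)
  show ?thesis unfolding g(3) by (rule good_mult[OF good_K[OF g(1)] good_W[OF g(2)]])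
qed

lemma good_carrier: "good g \<Longrightarrow> g \<in> carrier (BijGroup E)"
  using good_Bij BijGroup_simps(1) by blast

lemma K_carrier: "k \<in> K \<Longrightarrow> k \<in> carrier (BijGroup E)" and W_carrier: "w \<in> W \<Longrightarrow> w \<in> carrier (BijGroup E)"
  by (rule good_carrier, erule good_K good_W)+

lemma conjugate_W:
  assumes k: "k \<in> K" and w: "w \<in> W"
  shows "inv\<^bsub>BijGroup E\<^esub> k \<cdot> w \<cdot> k \<in> W"
  using w
proof (induction rule: W_induct)
  case one
  have "inv\<^bsub>BijGroup E\<^esub> k \<cdot> \<one>\<^bsub>BijGroup E\<^esub> \<cdot> k = \<one>\<^bsub>BijGroup E\<^esub>" using K_carrier[OF k] by simp
  then show ?case using subgroup.one_closed[OF W_subgroup] by simp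
next
  case (refl H)
  define h where "h = inv\<^bsub>BijGroup E\<^esub> k"
  have hK: "h \<in> K" unfolding h_def by (rule subgroup.m_inv_closed[OF K_subgroup k])
  have hB: "h \<in> Bij E" and kB: "k \<in> Bij E" and rB: "rf H \<in> Bij E"
    using good_Bij good_K hK k rf_Bij[OF hyp[OF refl]] by blast+
  have hk: "h (k x) = x" if "x \<in> E" for x
    using BijGroup_simps(2)[OF hB kB that] BijGroup_simps(3)[OF that] B.l_inv[OF K_carrier[OF k]] by (simp add: h_def)
  have hrB: "h \<cdot> rf H \<in> Bij E" using good_Bij good_mult[OF good_K[OF hK] good_rf[OF refl]] by blast
  have hH: "h ` H \<in> \<H>" by (rule good_pres[OF good_K[OF hK] refl])
  have "h \<cdot> rf H \<cdot> k = rf (h ` H)"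
  proof (rule Bij_eqI)
    show "h \<cdot> rf H \<cdot> k \<in> Bij E" by (intro good_Bij good_mult good_K good_rf hK k refl)
    show "rf (h ` H) \<in> Bij E" by (rule rf_Bij[OF hyp[OF hH]])
    fix x assume x: "x \<in> E"
    have kx: "k x \<in> E" by (rule Bij_in[OF kB x])
    show "(h \<cdot> rf H \<cdot> k) x = rf (h ` H) x"
      unfolding BijGroup_simps(2)[OF hrB kB x] BijGroup_simps(2)[OF hB rB kx]
        iso_reflection[OF K_iso[OF hK] hyp[OF refl] kx] hk[OF x] ..
  qed
  then show ?case using rf_W[OF hH] by (simp add: h_def)
next
  case (mult g h)
  note c = K_carrier[OF k] W_carrier[OF mult(1)] W_carrier[OF mult(2)]
  have "k \<cdot> (inv\<^bsub>BijGroup E\<^esub> k \<cdot> (h \<cdot> k)) = h \<cdot> k"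
    using c by (simp add: B.m_assoc[symmetric])
  then have "(inv\<^bsub>BijGroup E\<^esub> k \<cdot> g \<cdot> k) \<cdot> (inv\<^bsub>BijGroup E\<^esub> k \<cdot> h \<cdot> k) = inv\<^bsub>BijGroup E\<^esub> k \<cdot> (g \<cdot> h) \<cdot> k"
    using c by (simp add: B.m_assoc)
  then show ?case using subgroup.m_closed[OF W_subgroup mult(3,4)] by simp
qed

lemma G_mult:
  assumes "g \<in> G" "h \<in> G"
  shows "g \<cdot> h \<in> G"
proof -
  obtain k w k' w' where g: "k \<in> K" "w \<in> W" "g = k \<cdot> w" "k' \<in> K" "w' \<in> W" "h = k' \<cdot> w'" using assms unfolding G_iff by (elim bexE) (rule that)
  note c = K_carrier[OF g(1)] W_carrier[OF g(2)] K_carrier[OF g(4)] W_carrier[OF g(5)]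
  have "g \<cdot> h = (k \<cdot> k') \<cdot> ((inv\<^bsub>BijGroup E\<^esub> k' \<cdot> w \<cdot> k') \<cdot> w')"
  proof -
    have "k' \<cdot> (inv\<^bsub>BijGroup E\<^esub> k' \<cdot> (w \<cdot> (k' \<cdot> w'))) = w \<cdot> (k' \<cdot> w')"
      using c by (simp add: B.m_assoc[symmetric])
    then show ?thesis using c by (simp add: B.m_assoc g(3,6))
  qed
  moreover have "k \<cdot> k' \<in> K" by (rule subgroup.m_closed[OF K_subgroup g(1,4)])
  moreover have "(inv\<^bsub>BijGroup E\<^esub> k' \<cdot> w \<cdot> k') \<cdot> w' \<in> W"
    by (rule subgroup.m_closed[OF W_subgroup conjugate_W[OF g(4,2)] g(5)])
  ultimately show ?thesis using G_iff by blast
qed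

lemma W_G: "w \<in> W \<Longrightarrow> w \<in> G"
  unfolding G_iff
  by (intro bexI[of _ w] bexI[of _ "\<one>\<^bsub>BijGroup E\<^esub>"] subgroup.one_closed[OF K_subgroup] B.l_one[OF W_carrier, symmetric])

lemma K_G: "k \<in> K \<Longrightarrow> k \<in> G"
  unfolding G_iff
  by (intro bexI[of _ k] bexI[of _ "\<one>\<^bsub>BijGroup E\<^esub>"] subgroup.one_closed[OF W_subgroup] B.r_one[OF K_carrier, symmetric])

lemma G_one: "\<one>\<^bsub>BijGroup E\<^esub> \<in> G"
  by (rule W_G[OF subgroup.one_closed[OF W_subgroup]])

lemma G_inv:
  assumes "g \<in> G"
  shows "inv\<^bsub>BijGroup E\<^esub> g \<in> G"
proof -
  obtain k w where g: "k \<in> K" "w \<in> W" "g = k \<cdot> w"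
    using assms unfolding G_iff by (elim bexE)
  have i: "inv\<^bsub>BijGroup E\<^esub> g = inv\<^bsub>BijGroup E\<^esub> w \<cdot> inv\<^bsub>BijGroup E\<^esub> k"
    unfolding g(3) by (rule B.inv_mult_group[OF K_carrier[OF g(1)] W_carrier[OF g(2)]])
  show ?thesis unfolding i
    by (rule G_mult[OF W_G[OF subgroup.m_inv_closed[OF W_subgroup g(2)]] K_G[OF subgroup.m_inv_closed[OF K_subgroup g(1)]]])
qed

lemma G_Bij: "g \<in> G \<Longrightarrow> g \<in> Bij E"
  by (rule good_Bij[OF good_G])

lemma G_isom: "g \<in> G \<Longrightarrow> isom (amb g)"
  by (rule iso_isom[OF good_iso[OF good_G]])

lemma G_lin_V:
  assumes g: "g \<in> G" and v: "v \<in> V"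
  shows "lin (amb g) v = v"
proof -
  obtain x where x: "x \<in> E" using Ene by blast
  have xv: "x + v \<in> E" by (rule affine_plus_direction[OF affE x V_E[OF v]])
  have "lin (amb g) v = amb g (x + v) - amb g x" using affmap_diff[OF isom_affmap[OF G_isom[OF g]], of "x + v" x] by simp
  then show ?thesis using amb_E[OF x] amb_E[OF xv] good_V(1)[OF good_G[OF g] x v] by simp
qed

text \<open>A maximal independent set of normals is finite even if the arrangement is not, and a
  direction orthogonal to it is orthogonal to all normals.\<close>

lemma finite_normals:
  "\<exists>B h. finite B \<and> (\<forall>b\<in>B. h b \<in> \<H> \<and> extends_by (h b) E b) \<and>
    (\<forall>d\<in>direction E. (\<forall>b\<in>B. d \<bullet> b = 0) \<longrightarrow> d \<in> V)"
proof -
  define N where "N = {n. \<exists>H\<in>\<H>. extends_by H E n}"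
  obtain B where B: "B \<subseteq> N" "independent B" "N \<subseteq> span B" using maximal_independent_subset[of N] by metis
  have "\<forall>b\<in>B. \<exists>H. H \<in> \<H> \<and> extends_by H E b" using B(1) unfolding N_def by blast
  then obtain h where h: "\<forall>b\<in>B. h b \<in> \<H> \<and> extends_by (h b) E b" using bchoice[of B "\<lambda>b H. H \<in> \<H> \<and> extends_by H E b"] by blast
  have "d \<in> V" if d: "d \<in> direction E" "\<forall>b\<in>B. d \<bullet> b = 0" for d
    unfolding V_iff
  proof (intro conjI ballI d(1))
    fix H assume H: "H \<in> \<H>"
    obtain n where n: "extends_by H E n" using hyperplane_normal[OF hyp[OF H]] by blast
    then have "n \<in> span B" using H B(3) unfolding N_def by blast
    moreover have "subspace {x. d \<bullet> x = 0}" by (rule subspace_hyperplane)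
    then have "span B \<subseteq> {x. d \<bullet> x = 0}" using d(2) by (intro span_minimal) auto
    ultimately have dn: "d \<bullet> n = 0" by blast
    obtain q where q: "q \<in> H" using hypD(2)[OF H] by blast
    have "q + d \<in> E" using affine_plus_direction[OF affE _ d(1)] q hypD(3)[OF H] by blast
    then have "q + d \<in> H" using hyperplane_iff[OF n q] dn by simp
    then show "d \<in> direction H" using direction_iff[OF hypD(1)[OF H] q] by blast
  qed
  then show ?thesis using h independent_imp_finite[OF B(2)] by blast
qed

lemma finite_unit_normals: "finite {n. extends_by M A n}"
proof (cases "\<exists>e. extends_by M A e")
  case True
  then obtain e where e: "extends_by M A e" by blast
  have "{n. extends_by M A n} \<subseteq> {e, - e}"
  proof
    fix n assume "n \<in> {n. extends_by M A n}"
    then have n: "n \<in> direction A" "\<And>m. m \<in> direction M \<Longrightarrow> n \<bullet> m = 0" "norm n = 1" unfolding extends_by_def by blast+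
    show "n \<in> {e, - e}" using extends_by_unit[OF e n] by blast
  qed
  then show ?thesis by (rule finite_subset) simp
qed simp

text \<open>An element of \<open>G\<close> is determined by the images of finitely many hyperplanes and of
  their unit normals, and only finitely many hyperplanes are close to a given point.\<close>

lemma G_finite:
  assumes c: "c \<in> E"
  shows "finite {g \<in> G. dist (g c) c \<le> r}"
proof -
  obtain B h where fB: "finite B" and hB: "\<And>b. b \<in> B \<Longrightarrow> h b \<in> \<H>" and nB: "\<And>b. b \<in> B \<Longrightarrow> extends_by (h b) E b"
    and VB: "\<And>d. d \<in> direction E \<Longrightarrow> (\<And>b. b \<in> B \<Longrightarrow> d \<bullet> b = 0) \<Longrightarrow> d \<in> V"
    using finite_normals by metis
  have sE: "subspace (direction E)" by (rule subspace_direction[OF affE Ene])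
  \<comment> \<open>What remains of \<open>e\<close> after projection to the span is orthogonal to
    \<open>B\<close>, hence in \<open>V\<close>, and also orthogonal to \<open>V\<close>, hence
    zero.\<close>
  have span: "e \<in> span (B \<union> V)" if e: "e \<in> direction E" for e
  proof -
    have aff: "affine (span (B \<union> V))" "span (B \<union> V) \<noteq> {}" using subspace_span[of "B \<union> V"] subspace_imp_affine subspace_0 by blast+
    define s where "s = closest_point (span (B \<union> V)) e"
    have s: "s \<in> span (B \<union> V)" unfolding s_def by (rule closest_point_affine_in[OF aff])
    have o: "(e - s) \<bullet> v = 0" if "v \<in> span (B \<union> V)" for v
      using closest_point_orthogonal[OF aff, of v e] that unfolding direction_subspace[OF subspace_span] s_def by blast
    have "B \<subseteq> direction E" using nB unfolding extends_by_def by blast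
    moreover have "V \<subseteq> direction E" using V_E by blast
    ultimately have "span (B \<union> V) \<subseteq> direction E" by (intro span_minimal sE) blast
    then have "e - s \<in> direction E" using s e subspace_diff[OF sE] by blast
    then have "e - s \<in> V" by (rule VB) (rule o, simp add: span_base)
    then have "(e - s) \<bullet> (e - s) = 0" by (intro o) (simp add: span_base)
    then show ?thesis using s by simp
  qed
  define q where "q b = (SOME x. x \<in> h b)" for b
  have q: "q b \<in> h b" if "b \<in> B" for b unfolding q_def using hypD(2)[OF hB[OF that]] by (simp add: some_in_eq)
  define \<F> where "\<F> b = {H \<in> \<H>. \<exists>x\<in>H. dist x c \<le> dist (q b) c + r}" for b
  \<comment> \<open>Both components have finitely many possible values: the displacement bound
    confines the image of \<open>q b\<close> to a ball, and a hyperplane has at most two unit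
    normals.\<close>
  define \<Phi> where "\<Phi> g = (\<lambda>b\<in>B. (g ` h b, lin (amb g) b))" for g
  let ?P = "PiE B (\<lambda>b. Sigma (\<F> b) (\<lambda>H. {n. extends_by H E n}))"
  have "finite ?P"
    by (intro finite_PiE[OF fB] finite_SigmaI finite_unit_normals) (simp add: \<F>_def locally_finite)
  moreover have "\<Phi> ` {g \<in> G. dist (g c) c \<le> r} \<subseteq> ?P"
  proof
    fix \<phi> assume "\<phi> \<in> \<Phi> ` {g \<in> G. dist (g c) c \<le> r}"
    then obtain g where g: "g \<in> G" "dist (g c) c \<le> r" "\<phi> = \<Phi> g" by blast
    have "(g ` h b, lin (amb g) b) \<in> Sigma (\<F> b) (\<lambda>H. {n. extends_by H E n})" if b: "b \<in> B" for b
    proof (rule SigmaI)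
      have qE: "q b \<in> E" using q[OF b] hypD(3)[OF hB[OF b]] by blast
      have "dist (g (q b)) c \<le> dist (g (q b)) (g c) + dist (g c) c" by (rule dist_triangle)
      also have "dist (g (q b)) (g c) = dist (q b) c" by (rule iso_dist[OF good_iso[OF good_G[OF g(1)]] qE c])
      finally have "dist (g (q b)) c \<le> dist (q b) c + r" using g(2) by simp
      then show "g ` h b \<in> \<F> b" unfolding \<F>_def using good_pres[OF good_G[OF g(1)] hB[OF b]] q[OF b] by blast
      have "extends_by (amb g ` h b) (amb g ` E) (lin (amb g) b)" by (rule extends_by_image[OF nB[OF b] G_isom[OF g(1)]])
      then show "lin (amb g) b \<in> {n. extends_by (g ` h b) E n}"
        using amb_image[OF hypD(3)[OF hB[OF b]], of g] amb_image[of E g] Bij_image[OF G_Bij[OF g(1)]] by simp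
    qed
    then show "\<phi> \<in> ?P" unfolding g(3) \<Phi>_def by (intro restrict_PiE_iff[THEN iffD2] ballI)
  qed
  moreover have "inj_on \<Phi> {g \<in> G. dist (g c) c \<le> r}"
  proof (rule inj_onI)
    fix g g' assume "g \<in> {g \<in> G. dist (g c) c \<le> r}" "g' \<in> {g \<in> G. dist (g c) c \<le> r}" and eq: "\<Phi> g = \<Phi> g'"
    then have g: "g \<in> G" and g': "g' \<in> G" by blast+
    have im: "g ` h b = g' ` h b" and lb: "lin (amb g) b = lin (amb g') b" if "b \<in> B" for b
      using fun_cong[OF eq, of b] that by (simp_all add: \<Phi>_def)
    note af = isom_affmap[OF G_isom[OF g]] and af' = isom_affmap[OF G_isom[OF g']]
    have ll: "linear (lin (amb g))" "linear (lin (amb g'))" using af af' unfolding affmap_def by blast+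
    have le: "lin (amb g) e = lin (amb g') e" if e: "e \<in> direction E" for e
    proof (rule linear_eq_on_span[OF ll _ span[OF e]])
      fix x assume "x \<in> B \<union> V"
      then show "lin (amb g) x = lin (amb g') x" using lb G_lin_V[OF g] G_lin_V[OF g'] by auto
    qed
    have gx: "g x = g c + lin (amb g) (x - c)" "g' x = g' c + lin (amb g') (x - c)" if "x \<in> E" for x
      using affmap_diff[OF af, of x c] affmap_diff[OF af', of x c] amb_E[OF that] amb_E[OF c] by simp_all
    \<comment> \<open>Equal values of \<open>\<Phi>\<close> give equal linear parts, so
      \<open>g\<close> and \<open>g'\<close> differ by the translation \<open>d\<close>. It
      preserves the images of the chosen hyperplanes, so it lies in \<open>V\<close>; displacements
      are orthogonal to \<open>V\<close>, so it is zero.\<close>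
    define d where "d = g c - g' c"
    have gc: "g c \<in> E" "g' c \<in> E" using Bij_in[OF G_Bij _] g g' c by blast+
    have dE: "d \<in> direction E" unfolding d_def by (rule direction_diff[OF gc])
    have "lin (amb g) ` direction E = direction (amb g ` E)" by (rule direction_image[OF af, symmetric])
    then have "lin (amb g) ` direction E = direction E" using amb_image[of E g] Bij_image[OF G_Bij[OF g]] by simp
    then obtain d0 where d0: "d0 \<in> direction E" "d = lin (amb g) d0" using dE by blast
    have "d0 \<bullet> b = 0" if b: "b \<in> B" for b
    proof -
      have qE: "q b \<in> E" using q[OF b] hypD(3)[OF hB[OF b]] by blast
      have "g (q b) - g' (q b) = d" using gx[OF qE] le[OF direction_diff[OF qE c]] by (simp add: d_def)
      moreover have "g (q b) - g' (q b) \<in> direction (g ` h b)"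
      proof (rule direction_diff)
        show "g (q b) \<in> g ` h b" by (rule imageI[OF q[OF b]])
        show "g' (q b) \<in> g ` h b" unfolding im[OF b] by (rule imageI[OF q[OF b]])
      qed
      moreover have "extends_by (amb g ` h b) (amb g ` E) (lin (amb g) b)" by (rule extends_by_image[OF nB[OF b] G_isom[OF g]])
      then have "\<forall>m\<in>direction (g ` h b). lin (amb g) b \<bullet> m = 0"
        unfolding amb_image[OF hypD(3)[OF hB[OF b]]] extends_by_def by blast
      ultimately have "lin (amb g) b \<bullet> lin (amb g) d0 = 0" unfolding d0(2) by simp
      then show ?thesis using isom_inner[OF G_isom[OF g]] by (simp add: inner_commute)
    qed
    then have d0V: "d0 \<in> V" using VB[OF d0(1)] by blast
    then have dV: "d \<in> V" using d0(2) G_lin_V[OF g] by simp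
    have "d \<bullet> d = (g c - c) \<bullet> d - (g' c - c) \<bullet> d" by (simp add: d_def inner_diff_left)
    then have "d = 0" using good_V(2)[OF good_G[OF g] c dV] good_V(2)[OF good_G[OF g'] c dV] by simp
    then have gcc: "g c = g' c" by (simp add: d_def)
    show "g = g'"
    proof (rule Bij_eqI[OF G_Bij[OF g] G_Bij[OF g']])
      fix x assume x: "x \<in> E"
      show "g x = g' x" unfolding gx[OF x] gcc le[OF direction_diff[OF x c]] ..
    qed
  qed
  ultimately show ?thesis by (meson finite_imageD finite_subset)
qed

end

subsection \<open>The stratum\<close>

lemma analytic_fun_on_cong:
  assumes "\<And>z. z \<in> S \<Longrightarrow> f z = g z"
  shows "analytic_fun_on S f \<longleftrightarrow> analytic_fun_on S g"
  using assms by (simp add: analytic_fun_on_def)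

lemma orbit_space_cong:
  assumes "\<And>z. z \<in> S \<Longrightarrow> orbit_of G z = orbit_of G' z"
  shows "orbit_space G S = orbit_space G' S"
proof -
  have s: "{z \<in> S. orbit_of G z \<in> U} = {z \<in> S. orbit_of G' z \<in> U}" for U using assms by auto
  have i: "orbit_of G ` S = orbit_of G' ` S" using assms by (rule image_cong[OF refl])
  have a: "analytic_fun_on {z \<in> S. orbit_of G' z \<in> U} (f \<circ> orbit_of G) \<longleftrightarrow>
      analytic_fun_on {z \<in> S. orbit_of G' z \<in> U} (f \<circ> orbit_of G')" for U f
    by (rule analytic_fun_on_cong) (use assms in auto)
  show ?thesis unfolding orbit_space_def s i a ..
qed

context arrangement_flat
begin

interpretation B: group "BijGroup E" by (rule group_BijGroup)

lemma flat_affine: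
  assumes "T \<subseteq> \<H>"
  shows "affine (E \<inter> \<Inter>T)"
  using assms hypD(1) by (intro affine_Int affE affine_Inter) blast

lemma flatE:
  obtains T where "T \<subseteq> \<H>" "L = E \<inter> \<Inter>T"
  using fl unfolding is_flat_def by blast

lemma L_ne: "L \<noteq> {}" and L_aff: "affine L" and L_E: "L \<subseteq> E"
proof -
  obtain T where T: "T \<subseteq> \<H>" "L = E \<inter> \<Inter>T" by (rule flatE)
  show "L \<noteq> {}" using fl unfolding is_flat_def by blast
  show "affine L" unfolding T(2) by (rule flat_affine[OF T(1)])
  show "L \<subseteq> E" using T(2) by blast
qed

abbreviation \<M> :: "'a set set"
  where "\<M> \<equiv> induced_arrangement \<H> L"

lemma M_iff: "M \<in> \<M> \<longleftrightarrow> (\<exists>H\<in>\<H>. M = H \<inter> L \<and> M \<noteq> {} \<and> M \<noteq> L)"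
  unfolding induced_arrangement_def by blast

lemma M_hyperplane:
  assumes "M \<in> \<M>"
  shows "hyperplane_in L M"
proof -
  obtain H where H: "H \<in> \<H>" "M = H \<inter> L" "M \<noteq> {}" "M \<noteq> L" using assms M_iff by blast
  obtain p where p: "p \<in> M" using H(3) by blast
  obtain n where n: "extends_by H E n" using hyperplane_normal[OF hyp[OF H(1)]] by blast
  have pH: "p \<in> H" using p H(2) by blast
  have "x \<in> H \<longleftrightarrow> n \<bullet> x = n \<bullet> p" if "x \<in> L" for x
    using hyperplane_iff[OF n pH, of x] that L_E by (auto simp: inner_diff_left inner_commute[of n])
  then have e: "M = L \<inter> {x. n \<bullet> x = n \<bullet> p}" using H(2) by blast
  have "\<not> L \<subseteq> {x. n \<bullet> x = n \<bullet> p}" "L \<inter> {x. n \<bullet> x = n \<bullet> p} \<noteq> {}" using H(3,4) e by blast+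
  then have "aff_dim M = aff_dim L - 1" unfolding e using aff_dim_affine_Int_hyperplane[OF L_aff, of n "n \<bullet> p"] by simp
  moreover have "affine M" unfolding H(2) by (rule affine_Int[OF hypD(1)[OF H(1)] L_aff])
  ultimately show ?thesis using H(2,3) unfolding hyperplane_in_def by blast
qed

lemma M_flat:
  assumes "M \<in> \<M>"
  obtains T where "T \<subseteq> \<H>" "M = E \<inter> \<Inter>T"
proof -
  obtain H where H: "H \<in> \<H>" "M = H \<inter> L" using assms M_iff by blast
  obtain T where T: "T \<subseteq> \<H>" "L = E \<inter> \<Inter>T" by (rule flatE)
  show thesis by (rule that[of "insert H T"]) (use H T in blast)+
qed

lemma image_flat:
  assumes g: "g \<in> G" and T: "T \<subseteq> \<H>"
  shows "(`) g ` T \<subseteq> \<H>" "g ` (E \<inter> \<Inter>T) = E \<inter> \<Inter>((`) g ` T)"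
proof -
  show "(`) g ` T \<subseteq> \<H>" using good_pres[OF good_G[OF g]] T by blast
  have inj: "inj_on g E" and im: "g ` E = E" using G_Bij[OF g] by (auto simp: Bij_def bij_betw_def)
  show "g ` (E \<inter> \<Inter>T) = E \<inter> \<Inter>((`) g ` T)"
  proof
    show "g ` (E \<inter> \<Inter>T) \<subseteq> E \<inter> \<Inter>((`) g ` T)" using im by blast
    show "E \<inter> \<Inter>((`) g ` T) \<subseteq> g ` (E \<inter> \<Inter>T)"
    proof
      fix y assume y: "y \<in> E \<inter> \<Inter>((`) g ` T)"
      then obtain x where x: "x \<in> E" "y = g x" using im by blast
      have "x \<in> H" if H: "H \<in> T" for H
      proof -
        have "y \<in> g ` H" using y H by blast
        then obtain x' where x': "x' \<in> H" "y = g x'" by blast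
        have "x' \<in> E" using x'(1) H T hypD(3) by blast
        then show ?thesis using inj_onD[OF inj, of x x'] x x' by simp
      qed
      then show "y \<in> g ` (E \<inter> \<Inter>T)" using x by blast
    qed
  qed
qed

text \<open>Their intersection with \<open>E\<close> is contained in every flat whose
  complexification contains \<open>z\<close>, so it controls all branches through
  \<open>z\<close>.\<close>

definition through :: "'a \<times> 'a \<Rightarrow> 'a set set"
  where "through z = {H \<in> \<H>. z \<in> complexify H}"

lemma flat_through:
  assumes "T \<subseteq> \<H>" "z \<in> complexify (E \<inter> \<Inter>T)"
  shows "T \<subseteq> through z" "E \<inter> \<Inter>(through z) \<subseteq> E \<inter> \<Inter>T"
proof -
  have "z \<in> complexify H" if "H \<in> T" for H
    using complexify_mono[of "E \<inter> \<Inter>T" H] assms(2) that by blast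
  then show "T \<subseteq> through z" unfolding through_def using assms(1) by blast
  then show "E \<inter> \<Inter>(through z) \<subseteq> E \<inter> \<Inter>T" by blast
qed

lemma through_cases:
  assumes z: "z \<in> complexify L" and H: "H \<in> through z"
  shows "L \<subseteq> H \<or> H \<inter> L \<in> \<M> \<and> z \<in> complexify (H \<inter> L)"
proof -
  have h: "H \<in> \<H>" "z \<in> complexify H" using H unfolding through_def by blast+
  have f: "fst z \<in> H \<inter> L" using z h(2) by (simp add: complexify_iff')
  have "z \<in> complexify (H \<inter> L)"
    using z h(2) f direction_Int[OF hypD(1)[OF h(1)] L_aff f] by (simp add: complexify_iff')
  then show ?thesis using f h(1) M_iff[of "H \<inter> L"] by blast
qed

lemma amb_L: "amb g ` L = g ` L"
  by (rule amb_image[OF L_E])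

lemma L_through:
  assumes g: "g \<in> G" and z: "z \<in> complexify (amb g ` L)"
  shows "E \<inter> \<Inter>(through z) \<subseteq> amb g ` L"
proof -
  obtain T where T: "T \<subseteq> \<H>" "L = E \<inter> \<Inter>T" by (rule flatE)
  have "g ` L = E \<inter> \<Inter>((`) g ` T)" unfolding T(2) by (rule image_flat(2)[OF g T(1)])
  then show ?thesis using flat_through(2)[OF image_flat(1)[OF g T(1)]] z unfolding amb_L by simp
qed

text \<open>A hyperplane through \<open>z\<close> either contains \<open>L\<close> or cuts it in a
  wall through \<open>z\<close>, which must be \<open>M\<close>; so all of them contain
  \<open>M\<close>, and \<open>M\<close> is itself a flat.\<close>

lemma only_through:
  assumes M: "M \<in> \<M>" and z: "z \<in> complexify M" and only: "\<And>M'. M' \<in> \<M> \<Longrightarrow> z \<in> complexify M' \<Longrightarrow> M' = M"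
  shows "M = E \<inter> \<Inter>(through z)"
proof
  have M_L: "M \<subseteq> L" using M M_iff by blast
  have zL: "z \<in> complexify L" using complexify_mono[OF M_L] z by blast
  have "M \<subseteq> H" if H: "H \<in> through z" for H
  proof -
    consider "L \<subseteq> H" | "H \<inter> L \<in> \<M>" "z \<in> complexify (H \<inter> L)" using through_cases[OF zL H] by blast
    then show ?thesis
    proof cases
      case 1
      then show ?thesis using M_L by blast
    next
      case 2
      then show ?thesis using only[OF 2] by blast
    qed
  qed
  then show "M \<subseteq> E \<inter> \<Inter>(through z)" using M_L L_E by blast
  obtain T where T: "T \<subseteq> \<H>" "M = E \<inter> \<Inter>T" by (rule M_flat[OF M])
  show "E \<inter> \<Inter>(through z) \<subseteq> M" using flat_through(2)[OF T(1)] z unfolding T(2) by blast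
qed

lemma act_amb: "z \<in> complexify E \<Longrightarrow> complex_act (amb g) z = complex_act g z"
  using affine_plus_direction[OF affE] by (auto simp: complex_act_def complexify_iff' amb_E split: prod.splits)

text \<open>Composition with the reflection in a hyperplane through \<open>M\<close> permutes the
  fixer, so the sum is invariant under these reflections and lies in the direction of their common
  intersection \<open>M\<close>. It is also orthogonal to \<open>M\<close>, hence zero.\<close>

lemma fixing_M_sum:
  assumes M: "M \<in> \<M>" and e: "e \<in> direction L" and eM: "\<And>m. m \<in> direction M \<Longrightarrow> e \<bullet> m = 0"
  shows "(\<Sum>g\<in>{g \<in> amb ` G. \<forall>x\<in>M. g x = x}. lin g e) = 0"
proof -
  obtain T where T: "T \<subseteq> \<H>" "M = E \<inter> \<Inter>T" by (rule M_flat[OF M])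
  have Mh: "affine M" "M \<noteq> {}" "M \<subseteq> E" using M_hyperplane[OF M] L_E unfolding hyperplane_in_def by auto
  obtain p where p: "p \<in> M" using Mh(2) by blast
  define F where "F = {g \<in> amb ` G. \<forall>x\<in>M. g x = x}"
  define u where "u = (\<Sum>g\<in>F. lin g e)"
  have isoF: "isom g" if "g \<in> F" for g using that G_isom unfolding F_def by blast
  have uE: "u \<in> direction E"
    unfolding u_def
  proof (rule subspace_sum[OF subspace_direction[OF affE Ene]])
    fix g assume "g \<in> F"
    then obtain h where h: "h \<in> G" "g = amb h" unfolding F_def by blast
    show "lin g e \<in> direction E" unfolding h(2)
      by (rule lin_amb[OF G_Bij[OF h(1)] G_isom[OF h(1)]]) (use e direction_mono[OF L_E] in blast)
  qed
  have uM: "u \<bullet> m = 0" if m: "m \<in> direction M" for m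
  proof -
    have "lin g e \<bullet> m = 0" if g: "g \<in> F" for g
    proof -
      have "p + m \<in> M" by (rule affine_plus_direction[OF Mh(1) p m])
      then have "lin g m = m" using affmap_diff[OF isom_affmap[OF isoF[OF g]], of "p + m" p] g p unfolding F_def by simp
      then show ?thesis using isom_inner[OF isoF[OF g], of e m] eM[OF m] by simp
    qed
    then show ?thesis unfolding u_def by (simp add: inner_sum_left)
  qed
  have uH: "u \<in> direction H" if H: "H \<in> T" for H
  proof -
    have hH: "H \<in> \<H>" "M \<subseteq> H" using H T by blast+
    have rG: "rf H \<in> G" by (rule W_G[OF rf_W[OF hH(1)]])
    define \<rho> where "\<rho> = amb (rf H)"
    have r: "affmap \<rho>" unfolding \<rho>_def by (rule isom_affmap[OF G_isom[OF rG]])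
    have inv: "\<rho> \<circ> \<rho> = (\<lambda>x. x)"
    proof -
      have "rf H \<cdot> rf H = \<one>\<^bsub>BijGroup E\<^esub>" using B.r_inv[of "rf H"] rf_inv[OF hyp[OF hH(1)]] G_Bij[OF rG] by (simp add: BijGroup_simps(1))
      then show ?thesis unfolding \<rho>_def using amb_mult[OF G_Bij[OF rG] G_Bij[OF rG]] amb_one by simp
    qed
    have fix_M: "\<rho> x = x" if x: "x \<in> M" for x
    proof -
      have xE: "x \<in> E" and xH: "x \<in> H" using x hH(2) Mh(3) by blast+
      show ?thesis unfolding \<rho>_def amb_E[OF xE] using rf_fix[OF hyp[OF hH(1)] xE] xH by blast
    qed
    have FF: "\<rho> \<circ> g \<in> F" if gF: "g \<in> F" for g
    proof -
      obtain h where h: "h \<in> G" "g = amb h" and gM: "\<forall>x\<in>M. g x = x" using gF unfolding F_def by blast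
      have "\<rho> \<circ> g = amb (rf H \<cdot> h)" unfolding \<rho>_def h(2) by (rule amb_mult[OF G_Bij[OF rG] G_Bij[OF h(1)], symmetric])
      then have "\<rho> \<circ> g \<in> amb ` G" using G_mult[OF rG h(1)] by blast
      moreover have "\<forall>x\<in>M. (\<rho> \<circ> g) x = x" using gM fix_M by simp
      ultimately show ?thesis unfolding F_def by blast
    qed
    have rr: "\<rho> \<circ> (\<rho> \<circ> g) = g" for g :: "'a \<Rightarrow> 'a" using fun_cong[OF inv] by (simp add: fun_eq_iff)
    have l: "linear (lin \<rho>)" using r unfolding affmap_def by blast
    have "lin \<rho> u = (\<Sum>g\<in>F. lin \<rho> (lin g e))" unfolding u_def by (rule linear_sum[OF l])
    also have "\<dots> = (\<Sum>g\<in>F. lin (\<rho> \<circ> g) e)"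
      using affmap_compose(2)[OF r isom_affmap[OF isoF]] by (intro sum.cong) simp_all
    also have "\<dots> = u"
      unfolding u_def by (rule sum.reindex_bij_witness[of _ "\<lambda>g. \<rho> \<circ> g" "\<lambda>g. \<rho> \<circ> g"]) (simp_all only: rr FF)
    finally have lu: "lin \<rho> u = u" .
    have pE: "p \<in> E" using p Mh(3) by blast
    have puE: "p + u \<in> E" by (rule affine_plus_direction[OF affE pE uE])
    have "\<rho> (p + u) = p + u" using affmap_add[OF r, of p u] lu fix_M[OF p] by simp
    then have "rf H (p + u) = p + u" unfolding \<rho>_def amb_E[OF puE] .
    then have "p + u \<in> H" using rf_fix[OF hyp[OF hH(1)] puE] by blast
    then show ?thesis using direction_iff[OF hypD(1)[OF hH(1)]] p hH(2) by blast
  qed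
  have "p + u \<in> M"
    unfolding T(2)
  proof (intro IntI InterI)
    show "p + u \<in> E" using affine_plus_direction[OF affE _ uE] p Mh(3) by blast
    fix H assume H: "H \<in> T"
    then have "p \<in> H" "affine H" using p T hypD(1) by blast+
    then show "p + u \<in> H" using affine_plus_direction uH[OF H] by blast
  qed
  then have "u \<in> direction M" using direction_iff[OF Mh(1) p] by blast
  then have "u \<bullet> u = 0" by (rule uM)
  then show ?thesis unfolding u_def F_def by simp
qed

lemma stratum_geometry: "stratum_geometry (amb ` G) L \<M>"
proof
  show "isom g" if "g \<in> amb ` G" for g using that G_isom by blast
  show "(\<lambda>x. x) \<in> amb ` G" using G_one amb_one by (metis imageI)
  show "g \<circ> h \<in> amb ` G" if gG: "g \<in> amb ` G" and hG: "h \<in> amb ` G" for g h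
  proof -
    obtain g' h' where 1: "g' \<in> G" "g = amb g'" "h' \<in> G" "h = amb h'" using gG hG by blast
    have "amb (g' \<cdot> h') = g \<circ> h" unfolding 1(2,4) by (rule amb_mult[OF G_Bij[OF 1(1)] G_Bij[OF 1(3)]])
    then show ?thesis using G_mult[OF 1(1,3)] by (metis imageI)
  qed
  show "\<exists>h\<in>amb ` G. h \<circ> g = (\<lambda>x. x) \<and> g \<circ> h = (\<lambda>x. x)" if gG: "g \<in> amb ` G" for g
  proof -
    obtain g' where 1: "g' \<in> G" "g = amb g'" using gG by blast
    let ?h = "inv\<^bsub>BijGroup E\<^esub> g'"
    have h: "?h \<in> G" by (rule G_inv[OF 1(1)])
    have c: "g' \<in> carrier (BijGroup E)" by (rule good_carrier[OF good_G[OF 1(1)]])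
    have "amb ?h \<circ> g = (\<lambda>x. x)" "g \<circ> amb ?h = (\<lambda>x. x)"
      unfolding 1(2) amb_mult[OF G_Bij[OF h] G_Bij[OF 1(1)], symmetric] amb_mult[OF G_Bij[OF 1(1)] G_Bij[OF h], symmetric]
        B.l_inv[OF c] B.r_inv[OF c] by (rule amb_one)+
    then show ?thesis using h by blast
  qed
  show "finite {g \<in> amb ` G. dist (g x) x \<le> r}" for r x
  proof -
    define c where "c = closest_point E x"
    have c: "c \<in> E" unfolding c_def by (rule closest_point_affine_in[OF affE Ene])
    have "{g \<in> amb ` G. dist (g x) x \<le> r} \<subseteq> amb ` {g \<in> G. dist (g c) c \<le> r}"
    proof
      fix g assume "g \<in> {g \<in> amb ` G. dist (g x) x \<le> r}"
      then obtain h where h: "h \<in> G" "g = amb h" "dist (amb h x) x \<le> r" by blast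
      have "amb h x - x = h c - c" by (simp add: amb_def c_def)
      then have "dist (h c) c \<le> r" using h(3) by (simp add: dist_norm)
      then show "g \<in> amb ` {g \<in> G. dist (g c) c \<le> r}" using h by blast
    qed
    then show ?thesis by (rule finite_subset) (rule finite_imageI[OF G_finite[OF c]])
  qed
  show "affine L" by (rule L_aff)
  show "L \<noteq> {}" by (rule L_ne)
  show "affine M \<and> M \<noteq> {} \<and> M \<subseteq> L \<and> dim (direction L) = dim (direction M) + 1" if "M \<in> \<M>" for M
  proof -
    have h: "affine M" "M \<noteq> {}" "M \<subseteq> L" "aff_dim M = aff_dim L - 1" using M_hyperplane[OF that] unfolding hyperplane_in_def by blast+
    then show ?thesis using aff_dim_direction[OF h(1,2)] aff_dim_direction[OF L_aff L_ne] by linarith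
  qed
  show "finite {M \<in> \<M>. \<exists>x\<in>M. dist x p \<le> r}" for p r
  proof -
    have "{M \<in> \<M>. \<exists>x\<in>M. dist x p \<le> r} \<subseteq> (\<lambda>H. H \<inter> L) ` {H \<in> \<H>. \<exists>x\<in>H. dist x p \<le> r}"
    proof
      fix M assume "M \<in> {M \<in> \<M>. \<exists>x\<in>M. dist x p \<le> r}"
      then obtain x where x: "M \<in> \<M>" "x \<in> M" "dist x p \<le> r" by blast
      then obtain H where "H \<in> \<H>" "M = H \<inter> L" using M_iff by blast
      then show "M \<in> (\<lambda>H. H \<inter> L) ` {H \<in> \<H>. \<exists>x\<in>H. dist x p \<le> r}" using x by blast
    qed
    then show ?thesis by (rule finite_subset) (rule finite_imageI[OF locally_finite])
  qed
  show "finite {A. \<exists>g\<in>amb ` G. A = g ` L \<and> (\<exists>x\<in>A. dist x p \<le> r)}" for p r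
  proof -
    obtain T where T: "T \<subseteq> \<H>" "L = E \<inter> \<Inter>T" by (rule flatE)
    \<comment> \<open>A translate of \<open>L\<close> that meets the ball is an intersection of
      hyperplanes that meet the ball.\<close>
    have "{A. \<exists>g\<in>amb ` G. A = g ` L \<and> (\<exists>x\<in>A. dist x p \<le> r)} \<subseteq> (\<lambda>T. E \<inter> \<Inter>T) ` Pow {H \<in> \<H>. \<exists>x\<in>H. dist x p \<le> r}"
    proof
      fix A assume "A \<in> {A. \<exists>g\<in>amb ` G. A = g ` L \<and> (\<exists>x\<in>A. dist x p \<le> r)}"
      then obtain g x where g: "g \<in> G" "A = amb g ` L" "x \<in> A" "dist x p \<le> r" by blast
      have A: "A = E \<inter> \<Inter>((`) g ` T)" unfolding g(2) amb_L unfolding T(2) by (rule image_flat(2)[OF g(1) T(1)])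
      have "(`) g ` T \<subseteq> {H \<in> \<H>. \<exists>x\<in>H. dist x p \<le> r}"
      proof
        fix H assume H: "H \<in> (`) g ` T"
        then have "H \<in> \<H>" using image_flat(1)[OF g(1) T(1)] by blast
        moreover have "x \<in> H" using g(3) H unfolding A by blast
        ultimately show "H \<in> {H \<in> \<H>. \<exists>x\<in>H. dist x p \<le> r}" using g(4) by blast
      qed
      then show "A \<in> (\<lambda>T. E \<inter> \<Inter>T) ` Pow {H \<in> \<H>. \<exists>x\<in>H. dist x p \<le> r}" using A by blast
    qed
    moreover have "finite (Pow {H \<in> \<H>. \<exists>x\<in>H. dist x p \<le> r})" by (simp add: locally_finite)
    ultimately show ?thesis by (meson finite_subset finite_imageI)
  qed
  show "g ` L = L" if z: "z \<in> complexify L" and no: "\<And>M. M \<in> \<M> \<Longrightarrow> z \<notin> complexify M" and g: "g \<in> amb ` G"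
    and zg: "z \<in> complexify (g ` L)" for z g
  proof -
    obtain h where h: "h \<in> G" "g = amb h" using g by blast
    have "L \<subseteq> H" if H: "H \<in> through z" for H using through_cases[OF z H] no by blast
    then have "L \<subseteq> E \<inter> \<Inter>(through z)" using L_E by blast
    also have "\<dots> \<subseteq> g ` L" using L_through[OF h(1)] zg unfolding h(2) by blast
    finally have s: "L \<subseteq> g ` L" .
    have i: "isom g" unfolding h(2) by (rule G_isom[OF h(1)])
    show ?thesis using affine_subset_eq[OF L_aff affine_image[OF isom_affmap[OF i] L_aff] L_ne s] aff_dim_isom_image[OF i L_aff L_ne] by simp
  qed
  show "M \<subseteq> g ` L" if M: "M \<in> \<M>" and z: "z \<in> complexify M" and only: "\<And>M'. M' \<in> \<M> \<Longrightarrow> z \<in> complexify M' \<Longrightarrow> M' = M"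
    and g: "g \<in> amb ` G" and zg: "z \<in> complexify (g ` L)" for M z g
  proof -
    obtain h where h: "h \<in> G" "g = amb h" using g by blast
    have "M = E \<inter> \<Inter>(through z)" by (rule only_through[OF M z only])
    also have "\<dots> \<subseteq> g ` L" using L_through[OF h(1)] zg unfolding h(2) by blast
    finally show ?thesis .
  qed
  show "g ` M = M" if M: "M \<in> \<M>" and z: "z \<in> complexify M" and only: "\<And>M'. M' \<in> \<M> \<Longrightarrow> z \<in> complexify M' \<Longrightarrow> M' = M"
    and g: "g \<in> amb ` G" and gz: "complex_act g z = z" for M z g
  proof -
    obtain h where h: "h \<in> G" "g = amb h" using g by blast
    have i: "isom g" unfolding h(2) by (rule G_isom[OF h(1)])
    have Mh: "affine M" "M \<noteq> {}" "M \<subseteq> E" using M_hyperplane[OF M] L_E unfolding hyperplane_in_def by auto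
    have e: "M = E \<inter> \<Inter>(through z)" by (rule only_through[OF M z only])
    \<comment> \<open>An element fixing \<open>z\<close> maps hyperplanes through \<open>z\<close>
      to hyperplanes through \<open>z\<close>, so \<open>M\<close> is contained in its image; equal
      dimensions give equality.\<close>
    have th: "through z \<subseteq> \<H>" unfolding through_def by blast
    have "(`) h ` through z \<subseteq> through z"
    proof
      fix H' assume "H' \<in> (`) h ` through z"
      then obtain H where H: "H \<in> \<H>" "z \<in> complexify H" "H' = h ` H" unfolding through_def by blast
      have "z \<in> complex_act g ` complexify H" using gz H(2) by (metis imageI)
      then have "z \<in> complexify (g ` H)" unfolding complexify_image[OF isom_affmap[OF i]] .
      then show "H' \<in> through z" unfolding through_def H(3) h(2) amb_image[OF hypD(3)[OF H(1)]]
        using good_pres[OF good_G[OF h(1)] H(1)] by blast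
    qed
    then have "E \<inter> \<Inter>(through z) \<subseteq> E \<inter> \<Inter>((`) h ` through z)" by blast
    also have "\<dots> = g ` M" unfolding h(2) amb_image[OF Mh(3)] unfolding e by (rule image_flat(2)[OF h(1) th, symmetric])
    finally have s: "M \<subseteq> g ` M" using e by simp
    show ?thesis using affine_subset_eq[OF Mh(1) affine_image[OF isom_affmap[OF i] Mh(1)] Mh(2) s] aff_dim_isom_image[OF i Mh(1,2)] by simp
  qed
  show "(\<Sum>g\<in>{g \<in> amb ` G. \<forall>x\<in>M. g x = x}. lin g e) = 0" if "M \<in> \<M>" "e \<in> direction L"
    and "\<And>m. m \<in> direction M \<Longrightarrow> e \<bullet> m = 0" for M e
    by (rule fixing_M_sum[OF that])
qed

sublocale geo: stratum_geometry "amb ` G" L \<M>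
  by (rule stratum_geometry)

text \<open>Extending the group elements to the ambient space changes nothing on
  \<open>complexify E\<close>, where all orbits in question lie.\<close>

lemma stratum_eq: "stratum E \<H> K L = geo.Y"
proof -
  have cE: "complexify L \<subseteq> complexify E" by (rule complexify_mono[OF L_E])
  have S: "(\<Union>g\<in>G. complex_act g ` complexify L) = geo.S"
  proof -
    have "complex_act g ` complexify L = complex_act (amb g) ` complexify L" for g
      by (rule image_cong[OF refl]) (rule act_amb[symmetric], use cE in blast)
    then show ?thesis unfolding geo.S_def by simp
  qed
  have "orbit_space G geo.S = orbit_space (amb ` G) geo.S"
  proof (rule orbit_space_cong)
    fix z assume "z \<in> geo.S"
    then obtain g w where g: "g \<in> G" "w \<in> complexify L" "z = complex_act (amb g) w" unfolding geo.S_def by blast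
    have "z \<in> complex_act (amb g) ` complexify E" using g(2,3) cE by blast
    then have "z \<in> complexify (amb g ` E)" unfolding complexify_image[OF isom_affmap[OF G_isom[OF g(1)]]] .
    then have "z \<in> complexify E" using amb_image[of E g] Bij_image[OF G_Bij[OF g(1)]] by simp
    then show "orbit_of G z = orbit_of (amb ` G) z" unfolding orbit_of_def image_image using act_amb by simp
  qed
  then show ?thesis unfolding stratum_def Let_def G_def[symmetric] S geo.Y_def .
qed

lemma stabiliser_mult:
  assumes "g \<in> flat_stabiliser E \<H> K L" "h \<in> flat_stabiliser E \<H> K L"
  shows "g \<cdot> h \<in> flat_stabiliser E \<H> K L" "restrict (g \<cdot> h) L = restrict g L \<otimes>\<^bsub>BijGroup L\<^esub> restrict h L"
proof -
  have s: "g \<in> G" "h \<in> G" "g ` L = L" "h ` L = L" using assms unfolding flat_stabiliser_def G_def by blast+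
  note b = G_Bij[OF s(1)] G_Bij[OF s(2)]
  show "g \<cdot> h \<in> flat_stabiliser E \<H> K L"
    unfolding flat_stabiliser_def G_def[symmetric] using G_mult[OF s(1,2)] Bij_mult_image[OF b L_E] s(3,4) by simp
  interpret L: euclidean_subspace L by unfold_locales (rule L_aff L_ne)+
  interpret BL: group "BijGroup L" by (rule group_BijGroup)
  have r: "restrict f L \<in> Bij L" if f: "f \<in> Bij E" "f ` L = L" for f
  proof -
    have "inj_on f L" using f(1) inj_on_subset[of f E, OF _ L_E] by (simp add: Bij_def bij_betw_def)
    then show ?thesis using f(2) by (simp add: Bij_def bij_betw_def inj_on_restrict_eq image_restrict_eq)
  qed
  note rr = r[OF b(1) s(3)] r[OF b(2) s(4)]
  show "restrict (g \<cdot> h) L = restrict g L \<otimes>\<^bsub>BijGroup L\<^esub> restrict h L"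
  proof (rule L.Bij_eqI)
    have "(g \<cdot> h) ` L = L" using Bij_mult_image[OF b L_E] s(3,4) by simp
    then show "restrict (g \<cdot> h) L \<in> Bij L" by (rule r[OF G_Bij[OF G_mult[OF s(1,2)]]])
    show "restrict g L \<otimes>\<^bsub>BijGroup L\<^esub> restrict h L \<in> Bij L"
      using BL.m_closed[of "restrict g L" "restrict h L"] rr by (simp add: L.BijGroup_simps(1))
    fix x assume x: "x \<in> L"
    have xE: "x \<in> E" and hx: "h x \<in> L" using x L_E s(4) by blast+
    show "restrict (g \<cdot> h) L x = (restrict g L \<otimes>\<^bsub>BijGroup L\<^esub> restrict h L) x"
      unfolding L.BijGroup_simps(2)[OF rr x] using BijGroup_simps(2)[OF b xE] x hx by simp
  qed
qed

lemma reflects_iff: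
  assumes M: "M \<in> \<M>"
  shows "geo.reflects M \<longleftrightarrow> reflection L M \<in> (\<lambda>g. restrict g L) ` flat_stabiliser E \<H> K L"
proof
  assume "geo.reflects M"
  then obtain \<sigma> where "\<sigma> \<in> amb ` G" "\<sigma> ` L = L" "\<forall>x\<in>L. \<sigma> x = 2 *\<^sub>R closest_point M x - x"
    unfolding geo.reflects_def by blast
  then obtain g where g: "g \<in> G" "amb g ` L = L" "\<forall>x\<in>L. amb g x = 2 *\<^sub>R closest_point M x - x" by (elim imageE) simp
  have "g \<in> flat_stabiliser E \<H> K L" unfolding flat_stabiliser_def G_def[symmetric] using g(1,2) amb_L by simp
  moreover have "reflection L M = restrict g L"
    unfolding reflection_def
  proof (rule restrict_ext)
    fix x assume x: "x \<in> L"
    then have "amb g x = g x" using amb_E L_E by blast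
    then show "2 *\<^sub>R closest_point M x - x = g x" using bspec[OF g(3) x] by simp
  qed
  ultimately show "reflection L M \<in> (\<lambda>g. restrict g L) ` flat_stabiliser E \<H> K L" by blast
next
  assume "reflection L M \<in> (\<lambda>g. restrict g L) ` flat_stabiliser E \<H> K L"
  then obtain g where g: "g \<in> G" "g ` L = L" "reflection L M = restrict g L" unfolding flat_stabiliser_def G_def by blast
  have "amb g x = 2 *\<^sub>R closest_point M x - x" if x: "x \<in> L" for x
  proof -
    have "amb g x = g x" using x L_E amb_E by blast
    then show ?thesis using fun_cong[OF g(3), of x] x by (simp add: reflection_def)
  qed
  then show "geo.reflects M"
    unfolding geo.reflects_def using g(1,2) amb_L[of g] by (intro bexI[of _ "amb g"] conjI ballI) simp_all
qed

text \<open>Restrictions of stabilising elements are closed under products, and reflections are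
  their own inverses, so containing the generators is the same as containing the group.\<close>

lemma all_reflect_iff:
  "(\<forall>M\<in>\<M>. geo.reflects M) \<longleftrightarrow> reflection_group L \<M> \<subseteq> (\<lambda>g. restrict g L) ` flat_stabiliser E \<H> K L"
  (is "?l \<longleftrightarrow> _ \<subseteq> ?R")
proof
  assume "reflection_group L \<M> \<subseteq> ?R"
  moreover have "reflection L M \<in> reflection_group L \<M>" if "M \<in> \<M>" for M
    unfolding reflection_group_def by (rule generate.incl) (use that in blast)
  ultimately show ?l using reflects_iff by (metis subsetD)
next
  assume l: ?l
  interpret L: euclidean_subspace L by unfold_locales (rule L_aff L_ne)+
  show "reflection_group L \<M> \<subseteq> ?R"
  proof
    fix f assume "f \<in> reflection_group L \<M>"
    then show "f \<in> ?R"
      unfolding reflection_group_def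
    proof (induction rule: generate.induct)
      case one
      have o: "\<one>\<^bsub>BijGroup E\<^esub> x = x" if "x \<in> L" for x using that L_E BijGroup_simps(3) by blast
      have "\<one>\<^bsub>BijGroup E\<^esub> ` L = (\<lambda>x. x) ` L" by (rule image_cong[OF refl o])
      then have "\<one>\<^bsub>BijGroup E\<^esub> ` L = L" by simp
      then have "\<one>\<^bsub>BijGroup E\<^esub> \<in> flat_stabiliser E \<H> K L" unfolding flat_stabiliser_def G_def[symmetric] using G_one by simp
      moreover have "\<one>\<^bsub>BijGroup L\<^esub> = restrict \<one>\<^bsub>BijGroup E\<^esub> L"
      proof
        fix x
        show "\<one>\<^bsub>BijGroup L\<^esub> x = restrict \<one>\<^bsub>BijGroup E\<^esub> L x"
        proof (cases "x \<in> L")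
          case True
          then show ?thesis using o L.BijGroup_simps(3) by simp
        next
          case False
          then show ?thesis by (simp add: BijGroup_def)
        qed
      qed
      ultimately show ?case by blast
    next
      case (incl f)
      then obtain M where M: "M \<in> \<M>" "f = reflection L M" by blast
      show ?case unfolding M(2) using bspec[OF l M(1)] unfolding reflects_iff[OF M(1)] .
    next
      case (inv f)
      then obtain M where M: "M \<in> \<M>" "f = reflection L M" by blast
      have "inv\<^bsub>BijGroup L\<^esub> f = f" unfolding M(2) by (rule L.rf_inv[OF M_hyperplane[OF M(1)]])
      moreover have "f \<in> ?R" unfolding M(2) using l M(1) reflects_iff[OF M(1)] by blast
      ultimately show ?case by (simp only:)
    next
      case (eng f1 f2)
      obtain g1 g2 where g: "g1 \<in> flat_stabiliser E \<H> K L" "f1 = restrict g1 L" "g2 \<in> flat_stabiliser E \<H> K L" "f2 = restrict g2 L"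
        using eng(3,4) by blast
      show ?case unfolding g(2,4) stabiliser_mult(2)[OF g(1,3), symmetric] using stabiliser_mult(1)[OF g(1,3)] by blast
    qed
  qed
qed

end

theorem proposition5p3:
  fixes E :: "'a::euclidean_space set"
    and \<H> :: "'a set set"
    and \<A> L :: "'a set"
    and K :: "('a \<Rightarrow> 'a) set"
  assumes "affine E" and "E \<noteq> {}"
    and "admissible_arrangement E \<H>"
    and "\<A> \<in> components (E - \<Union>\<H>)"
    and "admissible_group E \<H> \<A> K"
    and "is_flat E \<H> L"
  shows "normal_in_codim_1 (stratum E \<H> K L) \<longleftrightarrow>
    unibranch_in_codim_1 (stratum E \<H> K L) \<and>
    reflection_group L (induced_arrangement \<H> L)
      \<subseteq> (\<lambda>g. restrict g L) ` flat_stabiliser E \<H> K L"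
proof -
  interpret arrangement_flat E \<H> \<A> K L
    using assms by unfold_locales
  show ?thesis
    unfolding stratum_eq all_reflect_iff[symmetric] by (rule geo.normal_in_codim_1_iff)
qed

end
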